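(* Let $\kappa$ be a nonzero real number and let $\tilde E_\kappa(2)=\mathcal L/h\mathcal L$ be the $\kappa$-contraction of $SU_\mu(2)$ described in the context, with $a_0,a_0^*,w_0,w_0^*$ the images (limits as $R=1/h\to\infty$) of $a,a^*,w,w^*$. Then $\tilde E_\kappa(2)$ is the Hopf algebra (over $\mathbb C$) generated by the elements $a_0,a_0^*,w_0,w_0^*$ subject to the relations $$[a_0^*,w_0]=-[a_0^*,w_0^*]=\frac{1}{2\kappa}\left((a_0^* )^2-I\right),\qquad [a_0,w_0]=-[a_0,w_0^*]=\frac{1}{2\kappa}\left(a_0^2-I\right),$$ $$[w_0,w_0^*]=-\frac{1}{2\kappa}(a_0+a_0^* )(w_0+w_0^* ),\qquad [a_0,a_0^*]=0,\qquad a_0^*a_0=a_0a_0^*=I,$$ with coproduct $$\Delta a_0=a_0\otimes a_0,\quad \Delta a_0^*=a_0^*\otimes a_0^*,\quad \Delta w_0=w_0\otimes a_0^*+a_0\otimes w_0,\quad \Delta w_0^*=w_0^*\otimes a_0+a_0^*\otimes w_0^*,$$ antipode $$S(a_0)=a_0^*,\quad S(a_0^* )=a_0,\quad S(w_0)=-a_0^*w_0a_0,\quad S(w_0^* )=-a_0w_0^*a_0^*,$$ and counit $$\epsilon(a_0)=\epsilon(a_0^* )=1,\qquad \epsilon(w_0)=\epsilon(w_0^* )=0.$$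
   Context: $[x,y]=xy-yx$ and $I$ is the unit. The quantum group $SU_\mu(2)$: the unital $*$-algebra generated by $\sigma,\rho$ with relations $\rho\rho^*=\rho^*\rho$, $\mu(\rho-\rho^* )\sigma=\sigma(\rho-\rho^* )$, $\mu(\rho+\rho^* )\sigma=\sigma(\rho+\rho^* )$, $\sigma\sigma^*+\mu^2\rho\rho^*=I$, $\sigma^*\sigma+\rho\rho^*=I$ (and their adjoints). It is a Hopf algebra with coproduct $\Delta g_{ij}=\sum_k g_{ik}\otimes g_{kj}$, where $g=\begin{pmatrix}\sigma&-\mu\rho^*\\ \rho&\sigma^*\end{pmatrix}$, counit $\epsilon(g_{ij})=\delta_{ij}$ and the corresponding antipode. Contraction: put $\mu=e^{1/(\kappa R)}$, where $R$ is the contraction parameter, and write $h=1/R$ (formal, $h^*=h$). Consider $SU_\mu(2)$ over the field $\mathbb C((h))$ with $\mu=e^{h/\kappa}$. Define $a=a(R)$ and $w=w(R)$ by $$a=\tfrac12(\sigma+\rho-\mu\rho^*+\sigma^* ),\qquad \tfrac{1}{R}\,w=\tfrac12(-\sigma-\rho-\mu\rho^*+\sigma^* ),$$ equivalently $$\sigma=\tfrac{1}{1+\mu}\left(\mu a+a^*+\tfrac1R(w^*-\mu w)\right),\qquad \rho=\tfrac{1}{1+\mu}\left(a-a^*-\tfrac1R(w+w^* )\right).$$ Let $\mathcal L$ be the $\mathbb C[[h]]$-subalgebra generated by $a,a^*,w,w^*$. The limit $R\to\infty$ (contraction) is $\tilde E_\kappa(2)=\mathcal L/h\mathcal L$, with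 the structure maps induced from $SU_\mu(2)$; $a_0,a_0^*,w_0,w_0^*$ denote the images of $a,a^*,w,w^*$. *)

theory Defs
  imports
    "HOL-Library.Poly_Mapping"
    "HOL-Computational_Algebra.Formal_Laurent_Series"
    "HOL-Algebra.QuotRing"
    "HOL-Algebra.Subrings"
    "HOL-Algebra.Module"
begin

section \<open>Associative algebras\<close>

text \<open>
  The locale \<^locale>\<open>algebra\<close> of the library is restricted to commutative algebras, so
  associative unital algebras are introduced here, on the same records.  The scalars always form a
  whole type.
\<close>

definition scalars :: "('k::comm_ring_1, 'k) module" where
  "scalars = \<lparr>carrier = UNIV, mult = (*), one = 1, zero = 0, add = (+), smult = (*)\<rparr>"

locale assoc_algebra = Module.module scalars A + ring A
  for A :: "('k::comm_ring_1, 'a) module" (structure) +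
  assumes smult_mult_left:
      "\<lbrakk>x \<in> carrier A; y \<in> carrier A\<rbrakk> \<Longrightarrow> (c \<odot> x) \<otimes> y = c \<odot> (x \<otimes> y)"
    and smult_mult_right:
      "\<lbrakk>x \<in> carrier A; y \<in> carrier A\<rbrakk> \<Longrightarrow> x \<otimes> (c \<odot> y) = c \<odot> (x \<otimes> y)"

definition alg_hom :: "('k, 'a) module \<Rightarrow> ('k, 'b) module \<Rightarrow> ('a \<Rightarrow> 'b) set" where
  "alg_hom A B =
    {f \<in> ring_hom A B. \<forall>c. \<forall>x \<in> carrier A. f (c \<odot>\<^bsub>A\<^esub> x) = c \<odot>\<^bsub>B\<^esub> f x}"

definition opposite :: "('k, 'a) module \<Rightarrow> ('k, 'a) module" where
  "opposite A = A\<lparr>mult := \<lambda>x y. y \<otimes>\<^bsub>A\<^esub> x\<rparr>"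

definition restrict_scalars :: "('l \<Rightarrow> 'k) \<Rightarrow> ('k, 'a) module \<Rightarrow> ('l, 'a) module" where
  "restrict_scalars \<phi> A =
    \<lparr>carrier = carrier A, mult = mult A, one = one A, zero = zero A, add = add A,
     smult = \<lambda>c. smult A (\<phi> c)\<rparr>"

definition generated_subalgebra :: "('k::comm_ring_1, 'a) module \<Rightarrow> 'a set \<Rightarrow> 'a set" where
  "generated_subalgebra A X = (\<lambda>B. subring B A \<and> submodule B scalars A) hull X"

definition quot_algebra :: "('k, 'a) module \<Rightarrow> 'a set \<Rightarrow> ('k, 'a set) module" where
  "quot_algebra A I =
    \<lparr>carrier = carrier (A Quot I), mult = mult (A Quot I), one = one (A Quot I),
     zero = zero (A Quot I), add = add (A Quot I),
     smult = \<lambda>c X. \<Union>x\<in>X. I +>\<^bsub>A\<^esub> (c \<odot>\<^bsub>A\<^esub> x)\<rparr>"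

text \<open>
  The map induced on cosets by a map \<open>\<phi>\<close> which is constant on each of them.
\<close>

definition coset_map :: "('a \<Rightarrow> 'b) \<Rightarrow> 'a set \<Rightarrow> 'b" where
  "coset_map \<phi> X = the_elem (\<phi> ` X)"

definition monoid_algebra :: "('m, 'x) monoid_scheme \<Rightarrow> ('k::comm_ring_1, 'm \<Rightarrow>\<^sub>0 'k) module" where
  "monoid_algebra M =
    \<lparr>carrier = {f. Poly_Mapping.keys f \<subseteq> carrier M},
     mult = \<lambda>f g. \<Sum>p\<in>Poly_Mapping.keys f. \<Sum>q\<in>Poly_Mapping.keys g. Poly_Mapping.single (p \<otimes>\<^bsub>M\<^esub> q) (Poly_Mapping.lookup f p * Poly_Mapping.lookup g q),
     one = Poly_Mapping.single \<one>\<^bsub>M\<^esub> 1, zero = 0, add = (+),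
     smult = \<lambda>c. Poly_Mapping.map ((*) c)\<rparr>"

definition lin_ext :: "('k::zero, 'v) module \<Rightarrow> ('m \<Rightarrow> 'v) \<Rightarrow> ('m \<Rightarrow>\<^sub>0 'k) \<Rightarrow> 'v" where
  "lin_ext V b f = (\<Oplus>\<^bsub>V\<^esub>p\<in>Poly_Mapping.keys f. Poly_Mapping.lookup f p \<odot>\<^bsub>V\<^esub> b p)"


section \<open>Generators and relations\<close>

definition free_algebra :: "('k::comm_ring_1, 'x list \<Rightarrow>\<^sub>0 'k) module" where
  "free_algebra = monoid_algebra \<lparr>carrier = UNIV, mult = (@), one = []\<rparr>"

definition gen :: "'x \<Rightarrow> 'x list \<Rightarrow>\<^sub>0 'k::comm_ring_1" where
  "gen x = Poly_Mapping.single [x] 1"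

definition free_eval :: "('k::comm_ring_1, 'a) module \<Rightarrow> ('x \<Rightarrow> 'a) \<Rightarrow> ('x list \<Rightarrow>\<^sub>0 'k) \<Rightarrow> 'a" where
  "free_eval A v = lin_ext A (\<lambda>ws. foldr (\<lambda>x y. v x \<otimes>\<^bsub>A\<^esub> y) ws \<one>\<^bsub>A\<^esub>)"

text \<open>
  \<open>A\<close> is generated by the elements \<open>v x\<close> subject to the relations \<open>r = 0\<close>, for \<open>r \<in> R\<close>.
\<close>

definition presented_by ::
  "('k::comm_ring_1, 'a) module \<Rightarrow> ('x \<Rightarrow> 'a) \<Rightarrow> ('x list \<Rightarrow>\<^sub>0 'k) set \<Rightarrow> bool" where
  "presented_by A v R \<longleftrightarrow>
     free_eval A v \<in> alg_hom free_algebra A \<and>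
     free_eval A v ` carrier free_algebra = carrier A \<and>
     a_kernel free_algebra A (free_eval A v) = Idl\<^bsub>free_algebra\<^esub> R"

definition commutator :: "('a, 'm) ring_scheme \<Rightarrow> 'a \<Rightarrow> 'a \<Rightarrow> 'a" where
  "commutator A x y = x \<otimes>\<^bsub>A\<^esub> y \<ominus>\<^bsub>A\<^esub> y \<otimes>\<^bsub>A\<^esub> x"


section \<open>Tensor products\<close>

text \<open>
  The tensor product is the free module on the pairs of elements modulo the bilinearity relations;
  as the monoid algebra of the product monoid, the free module also carries the componentwise
  product.
\<close>

definition bilinear_relations ::
  "('k::comm_ring_1, 'a) module \<Rightarrow> ('k, 'b) module \<Rightarrow> (('a \<times> 'b) \<Rightarrow>\<^sub>0 'k) set" where
  "bilinear_relations A B =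
     {Poly_Mapping.single (x \<oplus>\<^bsub>A\<^esub> x', y) 1 - Poly_Mapping.single (x, y) 1 - Poly_Mapping.single (x', y) 1 | x x' y.
        x \<in> carrier A \<and> x' \<in> carrier A \<and> y \<in> carrier B} \<union>
     {Poly_Mapping.single (x, y \<oplus>\<^bsub>B\<^esub> y') 1 - Poly_Mapping.single (x, y) 1 - Poly_Mapping.single (x, y') 1 | x y y'.
        x \<in> carrier A \<and> y \<in> carrier B \<and> y' \<in> carrier B} \<union>
     {Poly_Mapping.single (c \<odot>\<^bsub>A\<^esub> x, y) 1 - Poly_Mapping.single (x, y) c | c x y. x \<in> carrier A \<and> y \<in> carrier B} \<union>
     {Poly_Mapping.single (x, c \<odot>\<^bsub>B\<^esub> y) 1 - Poly_Mapping.single (x, y) c | c x y. x \<in> carrier A \<and> y \<in> carrier B}"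

definition tensor_null ::
  "('k::comm_ring_1, 'a) module \<Rightarrow> ('k, 'b) module \<Rightarrow> (('a \<times> 'b) \<Rightarrow>\<^sub>0 'k) set" where
  "tensor_null A B =
     (\<lambda>N. submodule N scalars (monoid_algebra (A \<times>\<times> B))) hull bilinear_relations A B"

definition tensor ::
  "('k::comm_ring_1, 'a) module \<Rightarrow> ('k, 'b) module \<Rightarrow> ('k, (('a \<times> 'b) \<Rightarrow>\<^sub>0 'k) set) module" where
  "tensor A B = quot_algebra (monoid_algebra (A \<times>\<times> B)) (tensor_null A B)"

definition pure_tensor ::
  "('k::comm_ring_1, 'a) module \<Rightarrow> ('k, 'b) module \<Rightarrow> 'a \<Rightarrow> 'b \<Rightarrow> (('a \<times> 'b) \<Rightarrow>\<^sub>0 'k) set" where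
  "pure_tensor A B x y =
     tensor_null A B +>\<^bsub>monoid_algebra (A \<times>\<times> B) :: ('k, ('a \<times> 'b) \<Rightarrow>\<^sub>0 'k) module\<^esub> Poly_Mapping.single (x, y) 1"

text \<open>
  The linear map on a tensor product that sends \<open>x \<otimes> y\<close> to \<open>\<beta> x y\<close>, for bilinear \<open>\<beta>\<close>.
\<close>

definition tensor_lift ::
  "('k::comm_ring_1, 'v) module \<Rightarrow> ('a \<Rightarrow> 'b \<Rightarrow> 'v) \<Rightarrow> (('a \<times> 'b) \<Rightarrow>\<^sub>0 'k) set \<Rightarrow> 'v" where
  "tensor_lift V \<beta> = coset_map (lin_ext V (\<lambda>(x, y). \<beta> x y))"

definition tensor_map ::
  "('k::comm_ring_1, 'c) module \<Rightarrow> ('k, 'd) module \<Rightarrow> ('a \<Rightarrow> 'c) \<Rightarrow> ('b \<Rightarrow> 'd) \<Rightarrow>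
    (('a \<times> 'b) \<Rightarrow>\<^sub>0 'k) set \<Rightarrow> (('c \<times> 'd) \<Rightarrow>\<^sub>0 'k) set" where
  "tensor_map C D f g = tensor_lift (tensor C D) (\<lambda>x y. pure_tensor C D (f x) (g y))"

definition tensor_assoc ::
  "('k::comm_ring_1, 'a) module \<Rightarrow> ('k, 'b) module \<Rightarrow> ('k, 'c) module \<Rightarrow>
    (((('a \<times> 'b) \<Rightarrow>\<^sub>0 'k) set \<times> 'c) \<Rightarrow>\<^sub>0 'k) set \<Rightarrow>
    (('a \<times> (('b \<times> 'c) \<Rightarrow>\<^sub>0 'k) set) \<Rightarrow>\<^sub>0 'k) set" where
  "tensor_assoc A B C =
     tensor_lift (tensor A (tensor B C)) (\<lambda>t z.
       tensor_lift (tensor A (tensor B C)) (\<lambda>x y.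
         pure_tensor A (tensor B C) x (pure_tensor B C y z)) t)"


section \<open>Hopf algebras\<close>

locale hopf_algebra = assoc_algebra A
  for A :: "('k::comm_ring_1, 'a) module" (structure)
    and \<Delta> :: "'a \<Rightarrow> (('a \<times> 'a) \<Rightarrow>\<^sub>0 'k) set"
    and \<epsilon> :: "'a \<Rightarrow> 'k"
    and S :: "'a \<Rightarrow> 'a" +
  assumes coproduct_hom: "\<Delta> \<in> alg_hom A (tensor A A)"
    and counit_hom: "\<epsilon> \<in> alg_hom A scalars"
    and coassociative: "x \<in> carrier A \<Longrightarrow>
      tensor_assoc A A A (tensor_map (tensor A A) A \<Delta> (\<lambda>y. y) (\<Delta> x)) =
      tensor_map A (tensor A A) (\<lambda>y. y) \<Delta> (\<Delta> x)"
    and counit_left: "x \<in> carrier A \<Longrightarrow> tensor_lift A (\<lambda>y z. \<epsilon> y \<odot> z) (\<Delta> x) = x"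
    and counit_right: "x \<in> carrier A \<Longrightarrow> tensor_lift A (\<lambda>y z. \<epsilon> z \<odot> y) (\<Delta> x) = x"
    and antipode_closed: "x \<in> carrier A \<Longrightarrow> S x \<in> carrier A"
    and antipode_add: "\<lbrakk>x \<in> carrier A; y \<in> carrier A\<rbrakk> \<Longrightarrow> S (x \<oplus> y) = S x \<oplus> S y"
    and antipode_smult: "x \<in> carrier A \<Longrightarrow> S (c \<odot> x) = c \<odot> S x"
    and antipode_left: "x \<in> carrier A \<Longrightarrow> tensor_lift A (\<lambda>y z. S y \<otimes> z) (\<Delta> x) = \<epsilon> x \<odot> \<one>"
    and antipode_right: "x \<in> carrier A \<Longrightarrow> tensor_lift A (\<lambda>y z. y \<otimes> S z) (\<Delta> x) = \<epsilon> x \<odot> \<one>"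


section \<open>The quantum group \<open>SU\<^sub>\<mu>(2)\<close> over the formal Laurent series\<close>

text \<open>
  The formal variable \<open>h = 1/R\<close> is \<^const>\<open>fls_X\<close>.
\<close>

definition mu :: "real \<Rightarrow> complex fls" where
  "mu \<kappa> = fps_to_fls (fps_exp (of_real (1 / \<kappa>)))"

text \<open>
  The involution of the scalars extends complex conjugation and fixes \<open>h\<close>.
\<close>

definition fls_cnj :: "complex fls \<Rightarrow> complex fls" where
  "fls_cnj f = Abs_fls (\<lambda>n. cnj (fls_nth f n))"

text \<open>
  The free \<open>*\<close>-algebra on \<open>\<sigma>, \<rho>\<close> is the free algebra on \<open>\<sigma>, \<sigma>\<^sup>*, \<rho>, \<rho>\<^sup>*\<close>.
\<close>

datatype su2_gen = Sigma | Sigma_star | Rho | Rho_star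

fun su2_gen_star :: "su2_gen \<Rightarrow> su2_gen" where
  "su2_gen_star Sigma = Sigma_star"
| "su2_gen_star Sigma_star = Sigma"
| "su2_gen_star Rho = Rho_star"
| "su2_gen_star Rho_star = Rho"

type_synonym su2_free = "su2_gen list \<Rightarrow>\<^sub>0 complex fls"

definition su2_free_star :: "su2_free \<Rightarrow> su2_free" where
  "su2_free_star f =
     (\<Sum>ws\<in>Poly_Mapping.keys f. Poly_Mapping.single (rev (map su2_gen_star ws)) (fls_cnj (Poly_Mapping.lookup f ws)))"

definition su2_relations :: "real \<Rightarrow> su2_free set" where
  "su2_relations \<kappa> =
    (let F = free_algebra; \<mu> = mu \<kappa>;
         s = gen Sigma; s' = gen Sigma_star; r = gen Rho; r' = gen Rho_star;
         rels =
          {r \<otimes>\<^bsub>F\<^esub> r' \<ominus>\<^bsub>F\<^esub> r' \<otimes>\<^bsub>F\<^esub> r,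
           \<mu> \<odot>\<^bsub>F\<^esub> ((r \<ominus>\<^bsub>F\<^esub> r') \<otimes>\<^bsub>F\<^esub> s) \<ominus>\<^bsub>F\<^esub> s \<otimes>\<^bsub>F\<^esub> (r \<ominus>\<^bsub>F\<^esub> r'),
           \<mu> \<odot>\<^bsub>F\<^esub> ((r \<oplus>\<^bsub>F\<^esub> r') \<otimes>\<^bsub>F\<^esub> s) \<ominus>\<^bsub>F\<^esub> s \<otimes>\<^bsub>F\<^esub> (r \<oplus>\<^bsub>F\<^esub> r'),
           (s \<otimes>\<^bsub>F\<^esub> s' \<oplus>\<^bsub>F\<^esub> \<mu>^2 \<odot>\<^bsub>F\<^esub> (r \<otimes>\<^bsub>F\<^esub> r')) \<ominus>\<^bsub>F\<^esub> \<one>\<^bsub>F\<^esub>,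
           (s' \<otimes>\<^bsub>F\<^esub> s \<oplus>\<^bsub>F\<^esub> r \<otimes>\<^bsub>F\<^esub> r') \<ominus>\<^bsub>F\<^esub> \<one>\<^bsub>F\<^esub>}
     in rels \<union> su2_free_star ` rels)"

type_synonym su2_carrier = "su2_free set"

definition su2 :: "real \<Rightarrow> (complex fls, su2_carrier) module" where
  "su2 \<kappa> = quot_algebra free_algebra (Idl\<^bsub>free_algebra\<^esub> (su2_relations \<kappa>))"

definition su2_class :: "real \<Rightarrow> su2_gen \<Rightarrow> su2_carrier" where
  "su2_class \<kappa> x =
     Idl\<^bsub>free_algebra\<^esub> (su2_relations \<kappa>)
       +>\<^bsub>free_algebra :: (complex fls, su2_free) module\<^esub> gen x"

definition su2_star :: "su2_carrier \<Rightarrow> su2_carrier" where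
  "su2_star X = su2_free_star ` X"

text \<open>
  The fundamental matrix \<open>g\<close>, with indices in \<open>{1, 2}\<close>.
\<close>

definition su2_matrix :: "real \<Rightarrow> nat \<Rightarrow> nat \<Rightarrow> su2_carrier" where
  "su2_matrix \<kappa> i j =
     (if i = 1
      then if j = 1 then su2_class \<kappa> Sigma else (- mu \<kappa>) \<odot>\<^bsub>su2 \<kappa>\<^esub> su2_class \<kappa> Rho_star
      else if j = 1 then su2_class \<kappa> Rho else su2_class \<kappa> Sigma_star)"

text \<open>
  The values on the generators of the linear map which sends \<open>g i j\<close> to \<open>G i j\<close>; note that
  \<open>\<rho>\<^sup>* = -\<mu>\<^sup>-\<^sup>1 g\<^sub>1\<^sub>2\<close>.
\<close>

fun su2_gen_value ::
  "real \<Rightarrow> (complex fls, 'v) module \<Rightarrow> (nat \<Rightarrow> nat \<Rightarrow> 'v) \<Rightarrow> su2_gen \<Rightarrow> 'v" where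
  "su2_gen_value \<kappa> V G Sigma = G 1 1"
| "su2_gen_value \<kappa> V G Rho = G 2 1"
| "su2_gen_value \<kappa> V G Sigma_star = G 2 2"
| "su2_gen_value \<kappa> V G Rho_star = (- inverse (mu \<kappa>)) \<odot>\<^bsub>V\<^esub> G 1 2"

definition su2_coproduct :: "real \<Rightarrow> su2_carrier \<Rightarrow> ((su2_carrier \<times> su2_carrier) \<Rightarrow>\<^sub>0 complex fls) set" where
  "su2_coproduct \<kappa> =
    (let T = tensor (su2 \<kappa>) (su2 \<kappa>); g = su2_matrix \<kappa> in
     coset_map (free_eval T (su2_gen_value \<kappa> T
       (\<lambda>i j. \<Oplus>\<^bsub>T\<^esub>k\<in>{1, 2}. pure_tensor (su2 \<kappa>) (su2 \<kappa>) (g i k) (g k j)))))"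

definition su2_counit :: "real \<Rightarrow> su2_carrier \<Rightarrow> complex fls" where
  "su2_counit \<kappa> =
     coset_map (free_eval scalars (su2_gen_value \<kappa> scalars (\<lambda>i j. if i = j then 1 else 0)))"

text \<open>
  The antipode is antimultiplicative and sends the matrix \<open>g\<close> to its inverse; the defining
  relations say that \<open>g\<close> is unitary, so this inverse has the entries \<open>(g\<^sub>j\<^sub>i)\<^sup>*\<close>.
\<close>

definition su2_antipode :: "real \<Rightarrow> su2_carrier \<Rightarrow> su2_carrier" where
  "su2_antipode \<kappa> =
     coset_map (free_eval (opposite (su2 \<kappa>))
       (su2_gen_value \<kappa> (su2 \<kappa>) (\<lambda>i j. su2_star (su2_matrix \<kappa> j i))))"


section \<open>The contraction\<close>

definition su2_a :: "real \<Rightarrow> su2_carrier" where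
  "su2_a \<kappa> =
    (let A = su2 \<kappa>; s = su2_class \<kappa> Sigma; s' = su2_class \<kappa> Sigma_star;
         r = su2_class \<kappa> Rho; r' = su2_class \<kappa> Rho_star
     in (1 / 2) \<odot>\<^bsub>A\<^esub> (((s \<oplus>\<^bsub>A\<^esub> r) \<ominus>\<^bsub>A\<^esub> mu \<kappa> \<odot>\<^bsub>A\<^esub> r') \<oplus>\<^bsub>A\<^esub> s'))"

definition su2_w :: "real \<Rightarrow> su2_carrier" where
  "su2_w \<kappa> =
    (let A = su2 \<kappa>; s = su2_class \<kappa> Sigma; s' = su2_class \<kappa> Sigma_star;
         r = su2_class \<kappa> Rho; r' = su2_class \<kappa> Rho_star
     in inverse fls_X \<odot>\<^bsub>A\<^esub>
          ((1 / 2) \<odot>\<^bsub>A\<^esub> (((\<ominus>\<^bsub>A\<^esub> s \<ominus>\<^bsub>A\<^esub> r) \<ominus>\<^bsub>A\<^esub> mu \<kappa> \<odot>\<^bsub>A\<^esub> r') \<oplus>\<^bsub>A\<^esub> s')))"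

definition lattice_carrier :: "real \<Rightarrow> su2_carrier set" where
  "lattice_carrier \<kappa> =
     generated_subalgebra (restrict_scalars fps_to_fls (su2 \<kappa>))
       {su2_a \<kappa>, su2_star (su2_a \<kappa>), su2_w \<kappa>, su2_star (su2_w \<kappa>)}"

definition lattice_alg :: "real \<Rightarrow> (complex fps, su2_carrier) module" where
  "lattice_alg \<kappa> = restrict_scalars fps_to_fls ((su2 \<kappa>)\<lparr>carrier := lattice_carrier \<kappa>\<rparr>)"

definition h_lattice :: "real \<Rightarrow> su2_carrier set" where
  "h_lattice \<kappa> = (\<lambda>x. fps_X \<odot>\<^bsub>lattice_alg \<kappa>\<^esub> x) ` lattice_carrier \<kappa>"

type_synonym contraction_carrier = "su2_carrier set"

definition contraction :: "real \<Rightarrow> (complex, contraction_carrier) module" where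
  "contraction \<kappa> = quot_algebra (restrict_scalars fps_const (lattice_alg \<kappa>)) (h_lattice \<kappa>)"

definition limit_class :: "real \<Rightarrow> su2_carrier \<Rightarrow> contraction_carrier" where
  "limit_class \<kappa> x = h_lattice \<kappa> +>\<^bsub>lattice_alg \<kappa>\<^esub> x"

text \<open>
  A coproduct of \<open>L/hL\<close> is induced by that of \<open>SU\<^sub>\<mu>(2)\<close> if the latter maps \<open>L\<close> into the
  image of \<open>L \<otimes> L\<close> (over \<open>\<complex>[[h]]\<close>) in \<open>SU\<^sub>\<mu>(2) \<otimes> SU\<^sub>\<mu>(2)\<close>, and reducing modulo \<open>h\<close> any
  element of \<open>L \<otimes> L\<close> over \<open>\<Delta> x\<close> gives the coproduct of the class of \<open>x\<close>.
\<close>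

definition lattice_tensor_incl ::
  "real \<Rightarrow> ((su2_carrier \<times> su2_carrier) \<Rightarrow>\<^sub>0 complex fps) set \<Rightarrow>
    ((su2_carrier \<times> su2_carrier) \<Rightarrow>\<^sub>0 complex fls) set" where
  "lattice_tensor_incl \<kappa> =
     tensor_lift (restrict_scalars fps_to_fls (tensor (su2 \<kappa>) (su2 \<kappa>)))
       (pure_tensor (su2 \<kappa>) (su2 \<kappa>))"

definition lattice_tensor_limit ::
  "real \<Rightarrow> ((su2_carrier \<times> su2_carrier) \<Rightarrow>\<^sub>0 complex fps) set \<Rightarrow>
    ((contraction_carrier \<times> contraction_carrier) \<Rightarrow>\<^sub>0 complex) set" where
  "lattice_tensor_limit \<kappa> =
    (let E = contraction \<kappa> in
     tensor_lift (restrict_scalars (\<lambda>c. fps_nth c 0) (tensor E E))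
       (\<lambda>x y. pure_tensor E E (limit_class \<kappa> x) (limit_class \<kappa> y)))"

definition induced_coproduct ::
  "real \<Rightarrow> (contraction_carrier \<Rightarrow> ((contraction_carrier \<times> contraction_carrier) \<Rightarrow>\<^sub>0 complex) set) \<Rightarrow> bool" where
  "induced_coproduct \<kappa> \<Delta> \<longleftrightarrow>
    (\<forall>x \<in> lattice_carrier \<kappa>.
      (\<exists>t \<in> carrier (tensor (lattice_alg \<kappa>) (lattice_alg \<kappa>)).
         lattice_tensor_incl \<kappa> t = su2_coproduct \<kappa> x) \<and>
      (\<forall>t \<in> carrier (tensor (lattice_alg \<kappa>) (lattice_alg \<kappa>)).
         lattice_tensor_incl \<kappa> t = su2_coproduct \<kappa> x \<longrightarrow>
         \<Delta> (limit_class \<kappa> x) = lattice_tensor_limit \<kappa> t))"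

definition induced_counit :: "real \<Rightarrow> (contraction_carrier \<Rightarrow> complex) \<Rightarrow> bool" where
  "induced_counit \<kappa> \<epsilon> \<longleftrightarrow>
    (\<forall>x \<in> lattice_carrier \<kappa>.
      \<exists>c. su2_counit \<kappa> x = fps_to_fls c \<and> \<epsilon> (limit_class \<kappa> x) = fps_nth c 0)"

definition induced_antipode :: "real \<Rightarrow> (contraction_carrier \<Rightarrow> contraction_carrier) \<Rightarrow> bool" where
  "induced_antipode \<kappa> S \<longleftrightarrow>
    (\<forall>x \<in> lattice_carrier \<kappa>.
      su2_antipode \<kappa> x \<in> lattice_carrier \<kappa> \<and>
      S (limit_class \<kappa> x) = limit_class \<kappa> (su2_antipode \<kappa> x))"


section \<open>The relations of the contracted algebra\<close>

datatype e2_gen = A0 | A0_star | W0 | W0_star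

fun e2_gen_value :: "real \<Rightarrow> e2_gen \<Rightarrow> contraction_carrier" where
  "e2_gen_value \<kappa> A0 = limit_class \<kappa> (su2_a \<kappa>)"
| "e2_gen_value \<kappa> A0_star = limit_class \<kappa> (su2_star (su2_a \<kappa>))"
| "e2_gen_value \<kappa> W0 = limit_class \<kappa> (su2_w \<kappa>)"
| "e2_gen_value \<kappa> W0_star = limit_class \<kappa> (su2_star (su2_w \<kappa>))"

definition e2_relations :: "real \<Rightarrow> (e2_gen list \<Rightarrow>\<^sub>0 complex) set" where
  "e2_relations \<kappa> =
    (let F = free_algebra; k = complex_of_real (1 / (2 * \<kappa>));
         a = gen A0; a' = gen A0_star; w = gen W0; w' = gen W0_star
     in {commutator F a' w \<ominus>\<^bsub>F\<^esub> k \<odot>\<^bsub>F\<^esub> (a' \<otimes>\<^bsub>F\<^esub> a' \<ominus>\<^bsub>F\<^esub> \<one>\<^bsub>F\<^esub>),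
         \<ominus>\<^bsub>F\<^esub> commutator F a' w' \<ominus>\<^bsub>F\<^esub> k \<odot>\<^bsub>F\<^esub> (a' \<otimes>\<^bsub>F\<^esub> a' \<ominus>\<^bsub>F\<^esub> \<one>\<^bsub>F\<^esub>),
         commutator F a w \<ominus>\<^bsub>F\<^esub> k \<odot>\<^bsub>F\<^esub> (a \<otimes>\<^bsub>F\<^esub> a \<ominus>\<^bsub>F\<^esub> \<one>\<^bsub>F\<^esub>),
         \<ominus>\<^bsub>F\<^esub> commutator F a w' \<ominus>\<^bsub>F\<^esub> k \<odot>\<^bsub>F\<^esub> (a \<otimes>\<^bsub>F\<^esub> a \<ominus>\<^bsub>F\<^esub> \<one>\<^bsub>F\<^esub>),
         commutator F w w' \<ominus>\<^bsub>F\<^esub> (- k) \<odot>\<^bsub>F\<^esub> ((a \<oplus>\<^bsub>F\<^esub> a') \<otimes>\<^bsub>F\<^esub> (w \<oplus>\<^bsub>F\<^esub> w')),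
         commutator F a a',
         a' \<otimes>\<^bsub>F\<^esub> a \<ominus>\<^bsub>F\<^esub> \<one>\<^bsub>F\<^esub>,
         a \<otimes>\<^bsub>F\<^esub> a' \<ominus>\<^bsub>F\<^esub> \<one>\<^bsub>F\<^esub>})"

end

theory Submission
  imports Defs "HOL-Library.Product_Plus"
begin

text \<open>
  Dividing the commutation relations of \<open>SU\<^sub>\<mu>(2)\<close>, written in \<open>a, a\<^sup>*, w, w\<^sup>*\<close>, by suitable powers of \<open>h\<close>
  gives the relations of the limit.  They suffice to write every word, after multiplication by a power of
  \<open>a\<close>, as a combination of the monomials \<open>a\<^sup>n (w + w\<^sup>*)\<^sup>i w\<^sup>j\<close>, so it remains to see that no further relation
  holds.  For this \<open>SU\<^sub>\<mu>(2)\<close> is represented by difference operators on power series, with two parameters,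
  in such a way that the lattice preserves the series with integral coefficients; for \<open>h = 0\<close> they become
  differential operators, under which the monomials are independent.

  The matrix coefficients of these representations separate the points of the limit, hence their products
  separate the points of its tensor square.  Therefore an element of \<open>\<L> \<otimes> \<L>\<close> that vanishes in
  \<open>SU\<^sub>\<mu>(2) \<otimes> SU\<^sub>\<mu>(2)\<close> has limit zero, and the coproduct descends to the limit.  The Hopf algebra axioms
  only need to be checked on generators.
\<close>

section \<open>Associative algebras\<close>

text \<open>The lattice is given by generators only, so \<open>h\<L>\<close> is not known
  explicitly; what excludes further relations is that an element of \<open>h\<L>\<close> acts as
  zero modulo h on integral series. The form of the operators is nearly forced. \<sigma> picks up a
  factor \<mu> when it passes \<rho> or \<rho>*, hence the dilation. As w and w* contain \<rho> +
  \<rho>* and \<sigma> - \<sigma>* divided by h, the first has to be a multiple of h, and \<sigma>,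
  \<sigma>* have to agree modulo h. The ratio of \<rho> + \<rho>* to \<rho> - \<rho>* and a
  rescaling of \<sigma> remain free; after division by h they give the parameters v and x. These
  serve as polynomial variables: v separates the powers of w + w*, the top degree in x those of w,
  while a acts by a power series that satisfies no polynomial equation. Multiplying by powers of a
  keeps its exponents nonnegative and loses nothing, since a is a unit in the limit. The relations
  of the limit are not checked on the differential operators, which inherit them from the difference
  operators. On the tensor square, matrix coefficients take the place of a flatness argument for
  \<L>.\<close>

lemma scalars_simps [simp]:
  "carrier scalars = UNIV" "mult scalars = (*)" "one scalars = 1" "zero scalars = 0"
  "add scalars = (+)" "smult scalars = (*)"
  by (simp_all add: scalars_def)

lemma cring_scalars: "cring (scalars :: ('k::comm_ring_1, 'k) module)"
  by (intro cringI abelian_groupI comm_monoidI)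
    (auto simp: algebra_simps intro: exI[of _ "- x" for x])

lemma assoc_algebraI:
  fixes A :: "('k::comm_ring_1, 'a) module" (structure)
  assumes "ring A"
    and "\<And>c x. x \<in> carrier A \<Longrightarrow> c \<odot> x \<in> carrier A"
    and "\<And>c d x. x \<in> carrier A \<Longrightarrow> (c + d) \<odot> x = c \<odot> x \<oplus> d \<odot> x"
    and "\<And>c x y. \<lbrakk>x \<in> carrier A; y \<in> carrier A\<rbrakk> \<Longrightarrow> c \<odot> (x \<oplus> y) = c \<odot> x \<oplus> c \<odot> y"
    and "\<And>c d x. x \<in> carrier A \<Longrightarrow> (c * d) \<odot> x = c \<odot> (d \<odot> x)"
    and "\<And>x. x \<in> carrier A \<Longrightarrow> 1 \<odot> x = x"
    and "\<And>c x y. \<lbrakk>x \<in> carrier A; y \<in> carrier A\<rbrakk> \<Longrightarrow> (c \<odot> x) \<otimes> y = c \<odot> (x \<otimes> y)"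
    and "\<And>c x y. \<lbrakk>x \<in> carrier A; y \<in> carrier A\<rbrakk> \<Longrightarrow> x \<otimes> (c \<odot> y) = c \<odot> (x \<otimes> y)"
  shows "assoc_algebra A"
  using assms ring.is_abelian_group[OF assms(1)] cring_scalars
  by (auto simp: assoc_algebra_def assoc_algebra_axioms_def module_def module_axioms_def)

context assoc_algebra
begin

lemma smult_in [simp, intro]: "x \<in> carrier A \<Longrightarrow> c \<odot> x \<in> carrier A"
  by (rule smult_closed) auto

lemma smult_add_l: "x \<in> carrier A \<Longrightarrow> (c + d) \<odot> x = c \<odot> x \<oplus> d \<odot> x"
  using smult_l_distr[of c d x] by simp

lemma smult_add_r: "\<lbrakk>x \<in> carrier A; y \<in> carrier A\<rbrakk> \<Longrightarrow> c \<odot> (x \<oplus> y) = c \<odot> x \<oplus> c \<odot> y"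
  using smult_r_distr[of c x y] by simp

lemma smult_assoc: "x \<in> carrier A \<Longrightarrow> (c * d) \<odot> x = c \<odot> (d \<odot> x)"
  using smult_assoc1[of c d x] by simp

lemma smult_1 [simp]: "x \<in> carrier A \<Longrightarrow> 1 \<odot> x = x"
  using smult_one[of x] by simp

lemma smult_0 [simp]: "x \<in> carrier A \<Longrightarrow> 0 \<odot> x = \<zero>"
  using smult_l_null[of x] by simp

lemma smult_zero [simp]: "c \<odot> \<zero> = \<zero>"
  using smult_r_null[of c] by simp

lemma smult_uminus: "x \<in> carrier A \<Longrightarrow> (- c) \<odot> x = \<ominus> (c \<odot> x)"
  by (rule minus_equality[symmetric]) (simp_all flip: smult_add_l)

lemma smult_neg: "x \<in> carrier A \<Longrightarrow> c \<odot> (\<ominus> x) = \<ominus> (c \<odot> x)"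
  using smult_r_minus[of c x] by simp

lemma ex_neg: "x \<in> carrier A \<Longrightarrow> \<exists>y\<in>carrier A. y \<oplus> x = \<zero>"
  using l_neg a_inv_closed by blast

lemma is_assoc_algebra: "assoc_algebra A" ..

lemma monoid_mult: "Group.monoid A" ..

lemma subspaceI:
  assumes "H \<subseteq> carrier A" "\<zero> \<in> H" "\<And>x y. \<lbrakk>x \<in> H; y \<in> H\<rbrakk> \<Longrightarrow> x \<oplus> y \<in> H"
    and sm: "\<And>c x. x \<in> H \<Longrightarrow> c \<odot> x \<in> H"
  shows "submodule H scalars A"
proof (rule submoduleI)
  fix x assume "x \<in> H"
  then show "\<ominus> x \<in> H"
    using sm[of x "- 1"] smult_uminus[of x 1] subsetD[OF assms(1)] by simp
qed (use assms in auto)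

lemma subspaceD:
  assumes "submodule H scalars A"
  shows "H \<subseteq> carrier A" "\<zero> \<in> H" "\<And>x y. \<lbrakk>x \<in> H; y \<in> H\<rbrakk> \<Longrightarrow> x \<oplus> y \<in> H"
    "\<And>c x. x \<in> H \<Longrightarrow> c \<odot> x \<in> H" "\<And>x. x \<in> H \<Longrightarrow> \<ominus> x \<in> H"
proof -
  interpret H: submodule H scalars A by fact
  show "H \<subseteq> carrier A" "\<zero> \<in> H" "\<And>x y. \<lbrakk>x \<in> H; y \<in> H\<rbrakk> \<Longrightarrow> x \<oplus> y \<in> H"
    "\<And>c x. x \<in> H \<Longrightarrow> c \<odot> x \<in> H"
    using H.subset H.one_closed H.m_closed H.smult_closed by auto
  show "\<And>x. x \<in> H \<Longrightarrow> \<ominus> x \<in> H"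
    using submoduleE(3)[OF assms] by auto
qed

lemma subspace_Inter:
  assumes "\<And>H. H \<in> \<H> \<Longrightarrow> submodule H scalars A" "\<H> \<noteq> {}"
  shows "submodule (\<Inter>\<H>) scalars A"
proof (rule subspaceI)
  from assms(2) obtain H where "H \<in> \<H>" by blast
  then show "\<Inter>\<H> \<subseteq> carrier A"
    using subspaceD(1)[OF assms(1)] by blast
qed (use subspaceD(2-4)[OF assms(1)] in auto)

lemma subspace_hull:
  assumes "X \<subseteq> carrier A"
  shows "submodule ((\<lambda>N. submodule N scalars A) hull X) scalars A"
  unfolding hull_def
  by (rule subspace_Inter) (use assms carrier_is_submodule in auto)

end

lemma assoc_algebra_scalars: "assoc_algebra (scalars :: ('k::comm_ring_1, 'k) module)"
  by (rule assoc_algebraI) (use cring_scalars in \<open>auto simp: cring_def algebra_simps\<close>)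

lemma a_inv_scalars [simp]: "\<ominus>\<^bsub>scalars\<^esub> (x :: 'k::comm_ring_1) = - x"
proof -
  interpret assoc_algebra "scalars :: ('k, 'k) module" by (rule assoc_algebra_scalars)
  show ?thesis using minus_equality[of "- x" x] by simp
qed

lemma assoc_algebra_restrict_scalars:
  fixes A :: "('k::comm_ring_1, 'a) module" and \<phi> :: "'l::comm_ring_1 \<Rightarrow> 'k"
  assumes "assoc_algebra A" "\<And>c d. \<phi> (c + d) = \<phi> c + \<phi> d" "\<And>c d. \<phi> (c * d) = \<phi> c * \<phi> d" "\<phi> 1 = 1"
  shows "assoc_algebra (restrict_scalars \<phi> A)"
proof -
  interpret assoc_algebra A by fact
  have "ring (restrict_scalars \<phi> A)"
    by (intro ringI abelian_groupI monoidI)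
      (auto simp: restrict_scalars_def a_ac l_distr r_distr m_assoc intro: ex_neg)
  then show ?thesis
    by (rule assoc_algebraI)
      (auto simp: restrict_scalars_def assms smult_add_l smult_add_r smult_assoc smult_mult_left smult_mult_right)
qed

lemma restrict_scalars_simps [simp]:
  "carrier (restrict_scalars \<phi> A) = carrier A" "mult (restrict_scalars \<phi> A) = mult A"
  "one (restrict_scalars \<phi> A) = one A" "zero (restrict_scalars \<phi> A) = zero A"
  "add (restrict_scalars \<phi> A) = add A" "smult (restrict_scalars \<phi> A) c = smult A (\<phi> c)"
  by (simp_all add: restrict_scalars_def)

lemma a_inv_cong_add:
  assumes "carrier A = carrier B" "add A = add B" "zero A = zero B"
  shows "a_inv A = a_inv B"
  using assms by (auto simp: a_inv_def m_inv_def fun_eq_iff)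

lemma a_inv_restrict_scalars [simp]: "a_inv (restrict_scalars \<phi> A) = a_inv A"
  by (rule a_inv_cong_add) auto

lemma assoc_algebra_opposite:
  assumes "assoc_algebra A"
  shows "assoc_algebra (opposite A)"
proof -
  interpret assoc_algebra A by fact
  have "ring (opposite A)"
    by (intro ringI abelian_groupI monoidI)
      (auto simp: opposite_def a_ac l_distr r_distr m_assoc intro: ex_neg)
  then show ?thesis
    by (rule assoc_algebraI)
      (auto simp: opposite_def smult_add_l smult_add_r smult_assoc smult_mult_left smult_mult_right)
qed

lemma opposite_simps [simp]:
  "carrier (opposite A) = carrier A" "mult (opposite A) x y = mult A y x"
  "one (opposite A) = one A" "zero (opposite A) = zero A"
  "add (opposite A) = add A" "smult (opposite A) = smult A"
  by (simp_all add: opposite_def)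

lemma (in assoc_algebra) assoc_algebra_subalgebra:
  assumes "subring L A" "submodule L scalars A"
  shows "assoc_algebra (A\<lparr>carrier := L\<rparr>)"
proof -
  interpret L: subring L A by fact
  have "L \<subseteq> carrier A" by (rule subspaceD) fact
  moreover have "ring (A\<lparr>carrier := L\<rparr>)" by (rule subring_is_ring) fact
  ultimately show ?thesis
    by (intro assoc_algebraI)
      (auto simp: smult_add_l smult_add_r smult_assoc smult_mult_left smult_mult_right subset_iff
        subspaceD(4)[OF assms(2)])
qed


subsection \<open>Linear maps and homomorphisms\<close>

text \<open>Matrix coefficients and the contractions with the antipode are linear without being
  multiplicative, so linearity is kept apart from \<open>alg_hom\<close>.\<close>

definition lin_map :: "('k, 'a) module \<Rightarrow> ('k, 'b) module \<Rightarrow> ('a \<Rightarrow> 'b) set" where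
  "lin_map A V = {f. f \<in> carrier A \<rightarrow> carrier V \<and>
     (\<forall>x\<in>carrier A. \<forall>y\<in>carrier A. f (x \<oplus>\<^bsub>A\<^esub> y) = f x \<oplus>\<^bsub>V\<^esub> f y) \<and>
     (\<forall>c. \<forall>x\<in>carrier A. f (c \<odot>\<^bsub>A\<^esub> x) = c \<odot>\<^bsub>V\<^esub> f x)}"

lemma lin_mapI:
  assumes "\<And>x. x \<in> carrier A \<Longrightarrow> f x \<in> carrier V"
    and "\<And>x y. \<lbrakk>x \<in> carrier A; y \<in> carrier A\<rbrakk> \<Longrightarrow> f (x \<oplus>\<^bsub>A\<^esub> y) = f x \<oplus>\<^bsub>V\<^esub> f y"
    and "\<And>c x. x \<in> carrier A \<Longrightarrow> f (c \<odot>\<^bsub>A\<^esub> x) = c \<odot>\<^bsub>V\<^esub> f x"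
  shows "f \<in> lin_map A V"
  using assms by (auto simp: lin_map_def)

lemma lin_mapD:
  assumes "f \<in> lin_map A V"
  shows "\<And>x. x \<in> carrier A \<Longrightarrow> f x \<in> carrier V"
    and "\<And>x y. \<lbrakk>x \<in> carrier A; y \<in> carrier A\<rbrakk> \<Longrightarrow> f (x \<oplus>\<^bsub>A\<^esub> y) = f x \<oplus>\<^bsub>V\<^esub> f y"
    and "\<And>c x. x \<in> carrier A \<Longrightarrow> f (c \<odot>\<^bsub>A\<^esub> x) = c \<odot>\<^bsub>V\<^esub> f x"
  using assms by (auto simp: lin_map_def)

lemma lin_map_zero:
  assumes "assoc_algebra A" "assoc_algebra V" "f \<in> lin_map A V"
  shows "f \<zero>\<^bsub>A\<^esub> = \<zero>\<^bsub>V\<^esub>"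
proof -
  interpret A: assoc_algebra A by fact
  interpret V: assoc_algebra V by fact
  show ?thesis using lin_mapD(3)[OF assms(3), of "\<zero>\<^bsub>A\<^esub>" 0] lin_mapD(1)[OF assms(3)] by simp
qed

lemma lin_map_neg:
  assumes "assoc_algebra A" "assoc_algebra V" "f \<in> lin_map A V" "x \<in> carrier A"
  shows "f (\<ominus>\<^bsub>A\<^esub> x) = \<ominus>\<^bsub>V\<^esub> f x"
proof -
  interpret A: assoc_algebra A by fact
  interpret V: assoc_algebra V by fact
  show ?thesis using lin_mapD(3)[OF assms(3), of x "- 1"] lin_mapD(1)[OF assms(3)] assms(4)
    by (simp add: A.smult_uminus V.smult_uminus)
qed

lemma lin_map_minus:
  assumes "assoc_algebra A" "assoc_algebra V" "f \<in> lin_map A V" "x \<in> carrier A" "y \<in> carrier A"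
  shows "f (x \<ominus>\<^bsub>A\<^esub> y) = f x \<ominus>\<^bsub>V\<^esub> f y"
proof -
  interpret A: assoc_algebra A by fact
  show ?thesis
    using assms by (simp add: a_minus_def lin_mapD lin_map_neg)
qed

lemma lin_map_comp:
  "f \<in> lin_map A B \<Longrightarrow> g \<in> lin_map B C \<Longrightarrow> (\<lambda>x. g (f x)) \<in> lin_map A C"
  by (auto simp: lin_map_def Pi_iff)

lemma alg_hom_iff:
  "f \<in> alg_hom A B \<longleftrightarrow> f \<in> lin_map A B \<and>
     (\<forall>x\<in>carrier A. \<forall>y\<in>carrier A. f (x \<otimes>\<^bsub>A\<^esub> y) = f x \<otimes>\<^bsub>B\<^esub> f y) \<and> f \<one>\<^bsub>A\<^esub> = \<one>\<^bsub>B\<^esub>"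
  by (auto simp: alg_hom_def lin_map_def ring_hom_def)

lemma alg_homI:
  assumes "f \<in> lin_map A B" "f \<one>\<^bsub>A\<^esub> = \<one>\<^bsub>B\<^esub>"
    and "\<And>x y. \<lbrakk>x \<in> carrier A; y \<in> carrier A\<rbrakk> \<Longrightarrow> f (x \<otimes>\<^bsub>A\<^esub> y) = f x \<otimes>\<^bsub>B\<^esub> f y"
  shows "f \<in> alg_hom A B"
  using assms by (auto simp: alg_hom_iff)

lemma alg_homD:
  assumes "f \<in> alg_hom A B"
  shows "f \<in> lin_map A B" "f \<one>\<^bsub>A\<^esub> = \<one>\<^bsub>B\<^esub>"
    "\<And>x. x \<in> carrier A \<Longrightarrow> f x \<in> carrier B"
    "\<And>x y. \<lbrakk>x \<in> carrier A; y \<in> carrier A\<rbrakk> \<Longrightarrow> f (x \<otimes>\<^bsub>A\<^esub> y) = f x \<otimes>\<^bsub>B\<^esub> f y"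
    "\<And>x y. \<lbrakk>x \<in> carrier A; y \<in> carrier A\<rbrakk> \<Longrightarrow> f (x \<oplus>\<^bsub>A\<^esub> y) = f x \<oplus>\<^bsub>B\<^esub> f y"
    "\<And>c x. x \<in> carrier A \<Longrightarrow> f (c \<odot>\<^bsub>A\<^esub> x) = c \<odot>\<^bsub>B\<^esub> f x"
  using assms by (auto simp: alg_hom_iff lin_map_def)

lemma alg_hom_comp:
  "f \<in> alg_hom A B \<Longrightarrow> g \<in> alg_hom B C \<Longrightarrow> (\<lambda>x. g (f x)) \<in> alg_hom A C"
  by (auto simp: alg_hom_iff lin_map_comp intro: alg_homD lin_mapD)

lemma alg_hom_id: "(\<lambda>x. x) \<in> alg_hom A A"
  by (auto simp: alg_hom_iff lin_map_def)


subsection \<open>Quotients\<close>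

lemma quot_algebra_simps:
  "carrier (quot_algebra A I) = a_rcosets\<^bsub>A\<^esub> I" "mult (quot_algebra A I) = rcoset_mult A I"
  "one (quot_algebra A I) = I +>\<^bsub>A\<^esub> \<one>\<^bsub>A\<^esub>" "zero (quot_algebra A I) = I" "add (quot_algebra A I) = set_add A"
  by (simp_all add: quot_algebra_def FactRing_def)

text \<open>Applied three times: to algebras given by relations, to the tensor product, and to the
  lattice modulo h.\<close>

locale algebra_ideal = assoc_algebra A + ideal I A
  for I and A :: "('k::comm_ring_1, 'a) module" (structure)
begin

abbreviation Q where "Q \<equiv> quot_algebra A I"

text \<open>An ideal of the ring is automatically a subspace, because a scalar acts as
  multiplication by \<open>c \<odot> \<one>\<close>.\<close>

lemma smult_I: "x \<in> I \<Longrightarrow> c \<odot> x \<in> I"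
  using I_l_closed[of x "c \<odot> \<one>"] a_Hcarr[of x] by (simp add: smult_mult_left)

lemma proj_eq_iff:
  "\<lbrakk>x \<in> carrier A; y \<in> carrier A\<rbrakk> \<Longrightarrow> I +> x = I +> y \<longleftrightarrow> x \<ominus> y \<in> I"
  using quotient_eq_iff_same_a_r_cos[OF is_ideal] by blast

lemma proj_self: "x \<in> carrier A \<Longrightarrow> x \<in> I +> x"
  by (rule a_rcos_self)

lemma proj_memD: "\<lbrakk>x \<in> carrier A; y \<in> I +> x\<rbrakk> \<Longrightarrow> y \<in> carrier A \<and> I +> y = I +> x"
  using a_elemrcos_carrier a_repr_independence additive_subgroup.a_subgroup is_additive_subgroup by metis

lemma proj_zero_iff: "x \<in> carrier A \<Longrightarrow> I +> x = I \<longleftrightarrow> x \<in> I"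
  by (metis a_rcos_const a_rcos_self)

lemma carrier_Q: "carrier Q = (\<lambda>x. I +> x) ` carrier A"
  by (auto simp: quot_algebra_simps A_RCOSETS_def')

text \<open>\<open>quot_algebra\<close> defines the scalar action as a union over all
  representatives. Each of them contributes the same coset, and there is at least one, so the union
  is that coset.\<close>

lemma proj_smult:
  assumes "x \<in> carrier A"
  shows "c \<odot>\<^bsub>Q\<^esub> (I +> x) = I +> c \<odot> x"
proof -
  have "I +> c \<odot> y = I +> c \<odot> x" if "y \<in> I +> x" for y
  proof -
    from that assms have y: "y \<in> carrier A" "y \<ominus> x \<in> I"
      using proj_memD[OF assms that] proj_eq_iff[of y x] by auto
    have "c \<odot> y \<ominus> c \<odot> x = c \<odot> (y \<ominus> x)"
      using y(1) assms by (simp add: a_minus_def smult_add_r smult_neg)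
    with smult_I[OF y(2), of c] have "c \<odot> y \<ominus> c \<odot> x \<in> I" by (simp only:)
    then show ?thesis
      by (simp only: proj_eq_iff[OF smult_in[OF y(1)] smult_in[OF assms]])
  qed
  then have "(\<Union>y\<in>I +> x. I +> c \<odot> y) = (\<Union>y\<in>I +> x. I +> c \<odot> x)"
    by (intro SUP_cong refl)
  moreover have "I +> x \<noteq> {}"
    using proj_self[OF assms] by blast
  ultimately show ?thesis
    by (simp add: quot_algebra_def)
qed

lemma ring_Q: "ring Q"
proof -
  interpret QQ: ring "A Quot I" by (rule quotient_is_ring)
  show ?thesis
  proof (rule ringI)
    show "abelian_group Q"
      by (rule abelian_groupI)
        (use QQ.a_ac QQ.l_neg QQ.a_inv_closed in \<open>auto simp: quot_algebra_def\<close>)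
    show "Group.monoid Q"
      by (rule monoidI) (use QQ.m_assoc in \<open>auto simp: quot_algebra_def\<close>)
  qed (use QQ.l_distr QQ.r_distr in \<open>auto simp: quot_algebra_def\<close>)
qed

lemma proj_mult: "\<lbrakk>x \<in> carrier A; y \<in> carrier A\<rbrakk> \<Longrightarrow> (I +> x) \<otimes>\<^bsub>Q\<^esub> (I +> y) = I +> x \<otimes> y"
  by (simp add: quot_algebra_simps rcoset_mult_add)

lemma proj_add: "\<lbrakk>x \<in> carrier A; y \<in> carrier A\<rbrakk> \<Longrightarrow> (I +> x) \<oplus>\<^bsub>Q\<^esub> (I +> y) = I +> (x \<oplus> y)"
  by (simp add: quot_algebra_simps a_rcos_sum)

lemma assoc_algebra_Q: "assoc_algebra Q"
  by (rule assoc_algebraI[OF ring_Q])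
    (auto simp: carrier_Q proj_smult proj_add proj_mult smult_add_l smult_add_r smult_assoc
      smult_mult_left smult_mult_right)

lemma proj_hom: "(\<lambda>x. I +> x) \<in> alg_hom A Q"
  by (intro alg_homI lin_mapI) (auto simp: carrier_Q proj_smult proj_add proj_mult quot_algebra_simps(3))

text \<open>\<open>coset_map\<close> takes \<open>the_elem\<close> of an image, which is meaningful
  only once the image is known to be a singleton.\<close>

lemma coset_map_proj:
  assumes "x \<in> carrier A" "\<And>y. \<lbrakk>y \<in> carrier A; y \<ominus> x \<in> I\<rbrakk> \<Longrightarrow> \<phi> y = \<phi> x"
  shows "coset_map \<phi> (I +> x) = \<phi> x"
proof -
  have "\<phi> y = \<phi> x" if "y \<in> I +> x" for y
    using assms proj_memD[OF assms(1) that] proj_eq_iff[of y x] by simp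
  then have "\<phi> ` (I +> x) \<subseteq> {\<phi> x}"
    by (intro image_subsetI) (simp only: singleton_iff)
  with imageI[OF proj_self[OF assms(1)], of \<phi>] have "\<phi> ` (I +> x) = {\<phi> x}"
    by (intro equalityI) simp_all
  then show ?thesis by (simp add: coset_map_def)
qed

context
  fixes V :: "('k, 'v) module" and \<phi>
  assumes V: "assoc_algebra V" and lin: "\<phi> \<in> lin_map A V" and null: "\<And>x. x \<in> I \<Longrightarrow> \<phi> x = \<zero>\<^bsub>V\<^esub>"
begin

lemma coset_map_lin:
  assumes "x \<in> carrier A"
  shows "coset_map \<phi> (I +> x) = \<phi> x"
proof (rule coset_map_proj[OF assms])
  interpret V: assoc_algebra V by (rule V)
  fix y assume y: "y \<in> carrier A" "y \<ominus> x \<in> I"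
  have "\<phi> y \<ominus>\<^bsub>V\<^esub> \<phi> x = \<zero>\<^bsub>V\<^esub>"
    using null[OF y(2)] y(1) assms by (simp add: lin_map_minus[OF is_assoc_algebra V lin])
  then show "\<phi> y = \<phi> x"
    using lin_mapD(1)[OF lin] y assms V.r_right_minus_eq by blast
qed

lemma coset_map_lin_map: "coset_map \<phi> \<in> lin_map Q V"
  by (rule lin_mapI)
    (auto simp: carrier_Q coset_map_lin proj_add proj_smult lin_mapD[OF lin])

lemma coset_map_hom: "\<phi> \<in> alg_hom A V \<Longrightarrow> coset_map \<phi> \<in> alg_hom Q V"
  by (intro alg_homI coset_map_lin_map)
    (auto simp: carrier_Q coset_map_lin proj_mult quot_algebra_simps(3) alg_homD)

end

end


subsection \<open>Monoid algebras\<close>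

abbreviation sgl where "sgl \<equiv> Poly_Mapping.single"

abbreviation lkp where "lkp \<equiv> Poly_Mapping.lookup"

abbreviation kys where "kys \<equiv> Poly_Mapping.keys"

lemma sum_sgl_kys: "(\<Sum>p\<in>kys f. sgl p (lkp f p)) = f"
  by (rule poly_mapping_eqI)
    (auto simp: lookup_sum lookup_single when_def in_keys_iff if_distrib sum.delta cong: if_cong)

text \<open>The carrier of a monoid algebra is described by supports, so the induction carries the
  bound on the support along.\<close>

lemma kys_restrict_induct [consumes 1, case_names zero add]:
  fixes f :: "'m \<Rightarrow>\<^sub>0 'k::comm_ring_1"
  assumes "kys f \<subseteq> M" "P 0"
    and step: "\<And>p c g. \<lbrakk>p \<in> M; kys g \<subseteq> M; P g\<rbrakk> \<Longrightarrow> P (sgl p c + g)"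
  shows "P f"
proof -
  have "P (\<Sum>p\<in>X. sgl p (lkp f p)) \<and> kys (\<Sum>p\<in>X. sgl p (lkp f p)) \<subseteq> M" if "X \<subseteq> kys f" for X
  proof -
    have "finite X" using finite_subset[OF that] by simp
    then show ?thesis using that
    proof (induction X)
      case (insert p X)
      then have p: "p \<in> M" using assms(1) by auto
      with insert have "kys (sgl p (lkp f p) + (\<Sum>p\<in>X. sgl p (lkp f p))) \<subseteq> M"
        using Poly_Mapping.keys_add[of "sgl p (lkp f p)" "\<Sum>p\<in>X. sgl p (lkp f p)"] by (auto split: if_splits)
      with insert p step show ?case by auto
    qed (simp add: assms(2))
  qed
  from this[of "kys f"] show ?thesis by (simp add: sum_sgl_kys)
qed

lemma pm_induct [case_names zero add]:
  fixes f :: "'m \<Rightarrow>\<^sub>0 'k::comm_ring_1"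
  assumes "P 0" "\<And>p c g. P g \<Longrightarrow> P (sgl p c + g)"
  shows "P f"
  by (rule kys_restrict_induct[of f UNIV]) (use assms in auto)

lemma lookup_map_mult: "lkp (Poly_Mapping.map ((*) (c::'k::comm_ring_1)) f) p = c * lkp f p"
  by (simp add: Poly_Mapping.map.rep_eq when_def)

lemma map_mult_add:
  "Poly_Mapping.map ((*) (c::'k::comm_ring_1)) (f + g) = Poly_Mapping.map ((*) c) f + Poly_Mapping.map ((*) c) g"
  by (rule poly_mapping_eqI) (simp add: lookup_map_mult lookup_add distrib_left)

lemma map_mult_zero [simp]: "Poly_Mapping.map ((*) (c::'k::comm_ring_1)) 0 = 0"
  by (rule poly_mapping_eqI) (simp add: lookup_map_mult)

lemma map_mult_sgl: "Poly_Mapping.map ((*) (c::'k::comm_ring_1)) (sgl p d) = sgl p (c * d)"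
  by (rule poly_mapping_eqI) (simp add: lookup_map_mult lookup_single when_def)

lemma monoid_algebra_simps:
  "carrier (monoid_algebra M) = {f. kys f \<subseteq> carrier M}"
  "one (monoid_algebra M) = sgl \<one>\<^bsub>M\<^esub> 1" "zero (monoid_algebra M) = 0"
  "add (monoid_algebra M) = (+)" "smult (monoid_algebra M) c = Poly_Mapping.map ((*) c)"
  by (simp_all add: monoid_algebra_def)

text \<open>The support of a sum can be smaller than the union of the supports. Summing over larger
  finite sets instead makes additivity in each factor a termwise statement.\<close>

lemma monoid_algebra_mult:
  fixes f g :: "'m \<Rightarrow>\<^sub>0 'k::comm_ring_1"
  assumes "finite P" "finite Q" "kys f \<subseteq> P" "kys g \<subseteq> Q"
  shows "f \<otimes>\<^bsub>monoid_algebra M\<^esub> g = (\<Sum>p\<in>P. \<Sum>q\<in>Q. sgl (p \<otimes>\<^bsub>M\<^esub> q) (lkp f p * lkp g q))"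
proof -
  have "f \<otimes>\<^bsub>monoid_algebra M\<^esub> g = (\<Sum>p\<in>kys f. \<Sum>q\<in>kys g. sgl (p \<otimes>\<^bsub>M\<^esub> q) (lkp f p * lkp g q))"
    by (simp add: monoid_algebra_def)
  also have "\<dots> = (\<Sum>p\<in>kys f. \<Sum>q\<in>Q. sgl (p \<otimes>\<^bsub>M\<^esub> q) (lkp f p * lkp g q))"
    using assms by (intro sum.cong sum.mono_neutral_left) (auto simp: in_keys_iff)
  also have "\<dots> = (\<Sum>p\<in>P. \<Sum>q\<in>Q. sgl (p \<otimes>\<^bsub>M\<^esub> q) (lkp f p * lkp g q))"
    using assms by (intro sum.mono_neutral_left) (auto simp: in_keys_iff)
  finally show ?thesis .
qed

lemma monoid_algebra_mult_add_left:
  fixes f g h :: "'m \<Rightarrow>\<^sub>0 'k::comm_ring_1"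
  shows "(f + g) \<otimes>\<^bsub>monoid_algebra M\<^esub> h = f \<otimes>\<^bsub>monoid_algebra M\<^esub> h + g \<otimes>\<^bsub>monoid_algebra M\<^esub> h"
  using Poly_Mapping.keys_add[of f g]
  by (subst (1 2 3) monoid_algebra_mult[of "kys f \<union> kys g" "kys h"])
    (auto simp: lookup_add distrib_right single_add sum.distrib)

lemma monoid_algebra_mult_add_right:
  fixes f g h :: "'m \<Rightarrow>\<^sub>0 'k::comm_ring_1"
  shows "h \<otimes>\<^bsub>monoid_algebra M\<^esub> (f + g) = h \<otimes>\<^bsub>monoid_algebra M\<^esub> f + h \<otimes>\<^bsub>monoid_algebra M\<^esub> g"
  using Poly_Mapping.keys_add[of f g]
  by (subst (1 2 3) monoid_algebra_mult[of "kys h" "kys f \<union> kys g"])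
    (auto simp: lookup_add distrib_left single_add sum.distrib)

lemma monoid_algebra_mult_sgl [simp]:
  "sgl p c \<otimes>\<^bsub>monoid_algebra M\<^esub> sgl q d = sgl (p \<otimes>\<^bsub>M\<^esub> q) (c * d :: 'k::comm_ring_1)"
  by (subst monoid_algebra_mult[of "{p}" "{q}"]) auto

lemma monoid_algebra_mult_zero [simp]:
  fixes f :: "'m \<Rightarrow>\<^sub>0 'k::comm_ring_1"
  shows "0 \<otimes>\<^bsub>monoid_algebra M\<^esub> f = 0" "f \<otimes>\<^bsub>monoid_algebra M\<^esub> 0 = 0"
  by (simp_all add: monoid_algebra_def)

lemma monoid_algebra_smult_mult_left:
  fixes f g :: "'m \<Rightarrow>\<^sub>0 'k::comm_ring_1"
  shows "Poly_Mapping.map ((*) c) f \<otimes>\<^bsub>monoid_algebra M\<^esub> g = Poly_Mapping.map ((*) c) (f \<otimes>\<^bsub>monoid_algebra M\<^esub> g)"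
proof (induction f rule: pm_induct)
  case (add p d f)
  have "Poly_Mapping.map ((*) c) (sgl p d) \<otimes>\<^bsub>monoid_algebra M\<^esub> g = Poly_Mapping.map ((*) c) (sgl p d \<otimes>\<^bsub>monoid_algebra M\<^esub> g)"
    by (induction g rule: pm_induct)
      (auto simp: map_mult_sgl monoid_algebra_mult_add_right map_mult_add mult.assoc poly_mapping_eqI lookup_map_mult)
  with add show ?case by (simp add: map_mult_add monoid_algebra_mult_add_left)
qed (auto intro: poly_mapping_eqI simp: lookup_map_mult)

lemma monoid_algebra_smult_mult_right:
  fixes f g :: "'m \<Rightarrow>\<^sub>0 'k::comm_ring_1"
  shows "f \<otimes>\<^bsub>monoid_algebra M\<^esub> Poly_Mapping.map ((*) c) g = Poly_Mapping.map ((*) c) (f \<otimes>\<^bsub>monoid_algebra M\<^esub> g)"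
proof (induction f rule: pm_induct)
  case (add p d f)
  have "sgl p d \<otimes>\<^bsub>monoid_algebra M\<^esub> Poly_Mapping.map ((*) c) g = Poly_Mapping.map ((*) c) (sgl p d \<otimes>\<^bsub>monoid_algebra M\<^esub> g)"
    by (induction g rule: pm_induct)
      (auto simp: map_mult_sgl monoid_algebra_mult_add_right map_mult_add mult.left_commute poly_mapping_eqI lookup_map_mult)
  with add show ?case by (simp add: map_mult_add monoid_algebra_mult_add_left)
qed (auto intro: poly_mapping_eqI simp: lookup_map_mult)

lemma assoc_algebra_monoid_algebra:
  assumes "Group.monoid M"
  shows "assoc_algebra (monoid_algebra M :: ('k::comm_ring_1, 'm \<Rightarrow>\<^sub>0 'k) module)" (is "assoc_algebra ?R")
proof -
  interpret Group.monoid M by fact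
  note madd = monoid_algebra_mult_add_left monoid_algebra_mult_add_right
  have carr: "carrier ?R = {f. kys f \<subseteq> carrier M}" by (simp add: monoid_algebra_simps)
  have add_in: "kys (f + g) \<subseteq> carrier M" if "kys f \<subseteq> carrier M" "kys g \<subseteq> carrier M" for f g :: "'m \<Rightarrow>\<^sub>0 'k"
    using that Poly_Mapping.keys_add[of f g] by blast
  have mult_in: "kys (f \<otimes>\<^bsub>?R\<^esub> g) \<subseteq> carrier M" if "kys f \<subseteq> carrier M" "kys g \<subseteq> carrier M" for f g :: "'m \<Rightarrow>\<^sub>0 'k"
    using that(1)
  proof (induction f rule: kys_restrict_induct)
    case (add p c f)
    have "kys (sgl p c \<otimes>\<^bsub>?R\<^esub> g) \<subseteq> carrier M"
      using that(2)
    proof (induction g rule: kys_restrict_induct)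
      case (add q d g)
      with \<open>p \<in> carrier M\<close> show ?case
        unfolding madd by (intro add_in) auto
    qed auto
    with add show ?case unfolding madd by (intro add_in) auto
  qed auto
  \<comment> \<open>Additivity reduces the claim to single terms, in one argument after the other,
    where it is associativity in the monoid and in the scalars.\<close>
  have assoc: "(f \<otimes>\<^bsub>?R\<^esub> g) \<otimes>\<^bsub>?R\<^esub> h = f \<otimes>\<^bsub>?R\<^esub> (g \<otimes>\<^bsub>?R\<^esub> h)"
    if f: "kys f \<subseteq> carrier M" and g: "kys g \<subseteq> carrier M" and h: "kys h \<subseteq> carrier M" for f g h :: "'m \<Rightarrow>\<^sub>0 'k"
    using f
  proof (induction f rule: kys_restrict_induct)
    case (add p c f)
    have "(sgl p c \<otimes>\<^bsub>?R\<^esub> g) \<otimes>\<^bsub>?R\<^esub> h = sgl p c \<otimes>\<^bsub>?R\<^esub> (g \<otimes>\<^bsub>?R\<^esub> h)"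
      using g
    proof (induction g rule: kys_restrict_induct)
      case (add q d g)
      have "(sgl p c \<otimes>\<^bsub>?R\<^esub> sgl q d) \<otimes>\<^bsub>?R\<^esub> h = sgl p c \<otimes>\<^bsub>?R\<^esub> (sgl q d \<otimes>\<^bsub>?R\<^esub> h)"
        using h
        by (induction h rule: kys_restrict_induct)
          (use \<open>p \<in> carrier M\<close> \<open>q \<in> carrier M\<close> in \<open>simp_all add: madd m_assoc mult.assoc\<close>)
      with add show ?case by (simp add: madd)
    qed auto
    with add show ?case by (simp add: madd)
  qed auto
  have one: "sgl \<one>\<^bsub>M\<^esub> 1 \<otimes>\<^bsub>?R\<^esub> f = f \<and> f \<otimes>\<^bsub>?R\<^esub> sgl \<one>\<^bsub>M\<^esub> 1 = f" if "kys f \<subseteq> carrier M" for f :: "'m \<Rightarrow>\<^sub>0 'k"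
    using that by (induction f rule: kys_restrict_induct) (simp_all add: madd)
  have map_in: "kys (Poly_Mapping.map ((*) c) f) \<subseteq> carrier M" if "kys f \<subseteq> carrier M" for c and f :: "'m \<Rightarrow>\<^sub>0 'k"
    using that by (fastforce simp: in_keys_iff lookup_map_mult)
  have neg: "\<exists>y\<in>carrier ?R. y + f = 0" if "kys f \<subseteq> carrier M" for f :: "'m \<Rightarrow>\<^sub>0 'k"
    using that by (intro bexI[of _ "- f"]) (auto simp: carr in_keys_iff subset_iff)
  have "ring ?R"
    by (intro ringI abelian_groupI monoidI)
      (use neg in \<open>auto simp: monoid_algebra_simps madd assoc one add_in[THEN subsetD] mult_in[THEN subsetD]
        add.commute add.left_commute split: if_splits\<close>)
  then show ?thesis
    by (rule assoc_algebraI)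
      (auto simp: monoid_algebra_simps map_in[THEN subsetD] map_mult_add monoid_algebra_smult_mult_left
        monoid_algebra_smult_mult_right
        intro!: poly_mapping_eqI simp: lookup_map_mult lookup_add algebra_simps)
qed

lemma a_inv_monoid_algebra:
  assumes "Group.monoid M" "kys f \<subseteq> carrier M"
  shows "\<ominus>\<^bsub>monoid_algebra M\<^esub> f = - (f :: 'm \<Rightarrow>\<^sub>0 'k::comm_ring_1)"
proof -
  interpret assoc_algebra "monoid_algebra M :: ('k, 'm \<Rightarrow>\<^sub>0 'k) module"
    by (rule assoc_algebra_monoid_algebra) fact
  show ?thesis
    using minus_equality[of "- f" f] assms(2) by (auto simp: monoid_algebra_simps in_keys_iff subset_iff)
qed


subsection \<open>Linear extension\<close>

context assoc_algebra
begin

lemma lin_ext_superset: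
  assumes "finite P" "kys f \<subseteq> P" "b \<in> P \<rightarrow> carrier A"
  shows "lin_ext A b f = (\<Oplus>p\<in>P. lkp f p \<odot> b p)"
  unfolding lin_ext_def
  using assms
  by (intro add.finprod_mono_neutral_cong_left) (auto simp: in_keys_iff Pi_iff)

lemma lin_ext_closed:
  assumes "b \<in> kys f \<rightarrow> carrier A"
  shows "lin_ext A b f \<in> carrier A"
  unfolding lin_ext_def using assms by (intro finsum_closed) auto

lemma lin_ext_add:
  assumes "b \<in> kys f \<union> kys g \<rightarrow> carrier A"
  shows "lin_ext A b (f + g) = lin_ext A b f \<oplus> lin_ext A b g"
proof -
  let ?P = "kys f \<union> kys g"
  have "lin_ext A b (f + g) = (\<Oplus>p\<in>?P. lkp (f + g) p \<odot> b p)"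
    using assms Poly_Mapping.keys_add[of f g] by (intro lin_ext_superset) auto
  also have "\<dots> = (\<Oplus>p\<in>?P. lkp f p \<odot> b p \<oplus> lkp g p \<odot> b p)"
    using assms by (intro finsum_cong') (auto simp: lookup_add smult_add_l Pi_iff)
  also have "\<dots> = (\<Oplus>p\<in>?P. lkp f p \<odot> b p) \<oplus> (\<Oplus>p\<in>?P. lkp g p \<odot> b p)"
    using assms by (intro finsum_addf) auto
  also have "\<dots> = lin_ext A b f \<oplus> lin_ext A b g"
    using assms by (auto simp: lin_ext_superset[of ?P])
  finally show ?thesis .
qed

lemma lin_ext_sgl [simp]:
  assumes "b p \<in> carrier A"
  shows "lin_ext A b (sgl p c) = c \<odot> b p"
  using assms lin_ext_superset[of "{p}" "sgl p c" b]
    add.finprod_insert[of "{}" p "\<lambda>q. lkp (sgl p c) q \<odot> b q"] by auto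

lemma lin_ext_zero [simp]: "lin_ext A b 0 = \<zero>"
  by (simp add: lin_ext_def)

lemma lin_ext_smult:
  assumes "b \<in> kys f \<rightarrow> carrier A"
  shows "lin_ext A b (Poly_Mapping.map ((*) c) f) = c \<odot> lin_ext A b f"
proof -
  have "lin_ext A b (Poly_Mapping.map ((*) c) f) = (\<Oplus>p\<in>kys f. lkp (Poly_Mapping.map ((*) c) f) p \<odot> b p)"
    using assms by (intro lin_ext_superset) (auto simp: in_keys_iff lookup_map_mult)
  also have "\<dots> = (\<Oplus>p\<in>kys f. c \<odot> (lkp f p \<odot> b p))"
    using assms by (intro finsum_cong') (auto simp: lookup_map_mult smult_assoc Pi_iff)
  also have "\<dots> = c \<odot> lin_ext A b f"
    unfolding lin_ext_def using assms by (intro finsum_smult_ldistr[symmetric]) auto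
  finally show ?thesis .
qed

lemma lin_ext_lin_map:
  assumes "b \<in> carrier M \<rightarrow> carrier A"
  shows "lin_ext A b \<in> lin_map (monoid_algebra M) A"
proof (rule lin_mapI)
qed (use assms in \<open>auto simp: monoid_algebra_simps Pi_iff subset_iff intro!: lin_ext_closed lin_ext_add lin_ext_smult\<close>)

text \<open>The universal property of a monoid algebra. Evaluation of free algebras and the
  projection \<open>theta\<close> onto a tensor square are both instances.\<close>

lemma lin_ext_hom:
  fixes M :: "('m, 'x) monoid_scheme"
  assumes "Group.monoid M" "b \<in> carrier M \<rightarrow> carrier A" "b \<one>\<^bsub>M\<^esub> = \<one>"
    and b_mult: "\<And>p q. \<lbrakk>p \<in> carrier M; q \<in> carrier M\<rbrakk> \<Longrightarrow> b (p \<otimes>\<^bsub>M\<^esub> q) = b p \<otimes> b q"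
  shows "lin_ext A b \<in> alg_hom (monoid_algebra M) A"
proof (rule alg_homI)
  let ?R = "monoid_algebra M :: ('k, 'm \<Rightarrow>\<^sub>0 'k) module"
  interpret M: Group.monoid M by fact
  interpret R: assoc_algebra ?R by (rule assoc_algebra_monoid_algebra) fact
  show lin: "lin_ext A b \<in> lin_map ?R A" by (rule lin_ext_lin_map) fact
  note L = lin_mapD[OF lin]
  have b: "b p \<in> carrier A" if "p \<in> carrier M" for p using assms(2) that by auto
  show "lin_ext A b \<one>\<^bsub>?R\<^esub> = \<one>"
    using assms(3) by (simp add: monoid_algebra_simps)
  fix f g assume f: "f \<in> carrier ?R" and g: "g \<in> carrier ?R"
  have s: "sgl p c \<in> carrier ?R" if "p \<in> carrier M" for p c
    using that by (auto simp: monoid_algebra_simps)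
  have carr: "carrier ?R = {f. kys f \<subseteq> carrier M}" by (simp add: monoid_algebra_simps)
  have add: "(+) = add ?R" and zero: "0 = zero ?R" by (simp_all add: monoid_algebra_simps)
  have "kys f \<subseteq> carrier M" using f by (simp add: monoid_algebra_simps)
  then show "lin_ext A b (f \<otimes>\<^bsub>?R\<^esub> g) = lin_ext A b f \<otimes> lin_ext A b g"
  proof (induction f rule: kys_restrict_induct)
    case zero
    then show ?case using L(1)[OF g] by simp
  next
    case (add p c f)
    have "kys g \<subseteq> carrier M" using g by (simp add: monoid_algebra_simps)
    then have "lin_ext A b (sgl p c \<otimes>\<^bsub>?R\<^esub> g) = lin_ext A b (sgl p c) \<otimes> lin_ext A b g"
    proof (induction g rule: kys_restrict_induct)
      case zero
      then show ?case using b[OF add(1)] by simp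
    next
      case (add q d g)
      then have "lin_ext A b (sgl p c \<otimes>\<^bsub>?R\<^esub> (sgl q d + g)) =
          lin_ext A b (sgl (p \<otimes>\<^bsub>M\<^esub> q) (c * d)) \<oplus> lin_ext A b (sgl p c \<otimes>\<^bsub>?R\<^esub> g)"
        using L(2)[OF s[of "p \<otimes>\<^bsub>M\<^esub> q" "c * d"] R.m_closed[OF s[of p c], of g]] \<open>p \<in> carrier M\<close>
        by (simp add: monoid_algebra_mult_add_right carr) (simp add: monoid_algebra_simps)
      also have "\<dots> = (c \<odot> b p) \<otimes> (d \<odot> b q) \<oplus> (c \<odot> b p) \<otimes> lin_ext A b g"
        using add \<open>p \<in> carrier M\<close>
        by (simp add: b b_mult smult_mult_left smult_mult_right mult.commute flip: smult_assoc)
      also have "\<dots> = (c \<odot> b p) \<otimes> (lin_ext A b (sgl q d) \<oplus> lin_ext A b g)"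
        using add \<open>p \<in> carrier M\<close> L(1)[of g] by (simp add: b r_distr carr)
      also have "lin_ext A b (sgl q d) \<oplus> lin_ext A b g = lin_ext A b (sgl q d + g)"
        using L(2)[OF s, of q g d] add by (simp add: monoid_algebra_simps)
      finally show ?case
        using \<open>p \<in> carrier M\<close> by (simp add: b)
    qed
    moreover have "lin_ext A b (sgl p c + f) = lin_ext A b (sgl p c) \<oplus> lin_ext A b f"
      using L(2)[OF s, of p f c] add by (simp add: monoid_algebra_simps)
    moreover have "lin_ext A b ((sgl p c + f) \<otimes>\<^bsub>?R\<^esub> g) =
        lin_ext A b (sgl p c \<otimes>\<^bsub>?R\<^esub> g) \<oplus> lin_ext A b (f \<otimes>\<^bsub>?R\<^esub> g)"
      using L(2)[OF R.m_closed[OF s[of p c] g] R.m_closed[of f g]] add g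
      by (simp add: monoid_algebra_mult_add_left monoid_algebra_simps)
    ultimately show ?case
      using add L(1)[OF s, of p c] L(1)[of f] L(1)[OF g] by (simp add: l_distr carr)
  qed
qed

end


section \<open>Free algebras\<close>

text \<open>With concatenation as addition of words, the convolution product that
  \<open>poly_mapping\<close> already carries is the product of the free algebra. Relations can then
  be handled by ring normalisation.\<close>

instantiation list :: (type) monoid_add
begin

definition zero_list :: "'a list" where "zero_list = []"

definition plus_list :: "'a list \<Rightarrow> 'a list \<Rightarrow> 'a list" where "plus_list = (@)"

instance by standard (simp_all add: zero_list_def plus_list_def)

end

text \<open>Used for words, where it is the free algebra, and for pairs of words with componentwise
  addition, where it is the tensor square of the free algebra.\<close>

definition pm_algebra :: "('k::comm_ring_1, 'm::monoid_add \<Rightarrow>\<^sub>0 'k) module" where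
  "pm_algebra = monoid_algebra \<lparr>carrier = UNIV, mult = (+), one = 0\<rparr>"

lemma monoid_UNIV: "Group.monoid \<lparr>carrier = UNIV, mult = (+), one = (0 :: 'm::monoid_add)\<rparr>"
  by (rule monoidI) (auto simp: add.assoc)

lemma pm_algebra_mult:
  fixes f g :: "'m::monoid_add \<Rightarrow>\<^sub>0 'k::comm_ring_1"
  shows "f \<otimes>\<^bsub>pm_algebra\<^esub> g = f * g"
proof (induction f rule: pm_induct)
  case zero
  show ?case by (simp add: pm_algebra_def)
next
  case (add p c f)
  have "sgl p c \<otimes>\<^bsub>pm_algebra\<^esub> g = sgl p c * g"
    by (induction g rule: pm_induct)
      (simp_all add: monoid_algebra_mult_add_right mult_single distrib_left pm_algebra_def)
  with add show ?case by (simp add: monoid_algebra_mult_add_left distrib_right pm_algebra_def)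
qed

text \<open>Writing scalars as elements of the algebra turns scalar multiplication into a ring
  product. The price is that constants have to be moved past generators by commutation
  rules.\<close>

definition cst :: "'k \<Rightarrow> 'm::zero \<Rightarrow>\<^sub>0 'k::comm_ring_1" where "cst c = sgl 0 c"

lemma cst_simps [simp]:
  "cst 0 = 0" "cst 1 = (1 :: 'm::monoid_add \<Rightarrow>\<^sub>0 'k::comm_ring_1)"
  by (simp_all add: cst_def)

lemma cst_hom:
  fixes c d :: "'k::comm_ring_1"
  shows "cst (c + d) = (cst c + cst d :: 'm::monoid_add \<Rightarrow>\<^sub>0 'k)" "cst (c * d) = (cst c * cst d :: 'm::monoid_add \<Rightarrow>\<^sub>0 'k)"
    "cst (c - d) = (cst c - cst d :: 'm::monoid_add \<Rightarrow>\<^sub>0 'k)" "cst (- c) = (- cst c :: 'm::monoid_add \<Rightarrow>\<^sub>0 'k)"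
    "cst (c ^ n) = (cst c ^ n :: 'm::monoid_add \<Rightarrow>\<^sub>0 'k)"
proof -
  show m: "cst (c * d) = (cst c * cst d :: 'm::monoid_add \<Rightarrow>\<^sub>0 'k)" for c d :: 'k
    by (simp add: cst_def mult_single)
  show "cst (c ^ n) = (cst c ^ n :: 'm::monoid_add \<Rightarrow>\<^sub>0 'k)"
    by (induction n) (simp_all add: m)
qed (simp_all add: cst_def single_add single_diff single_uminus)

lemma cst_commute: "f * cst c = cst c * (f :: 'm::monoid_add \<Rightarrow>\<^sub>0 'k::comm_ring_1)"
  by (induction f rule: pm_induct) (simp_all add: cst_def distrib_left distrib_right mult_single mult.commute)

lemma cst_left_commute: "f * (cst c * g) = cst c * (f * (g :: 'm::monoid_add \<Rightarrow>\<^sub>0 'k::comm_ring_1))"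
  by (metis cst_commute mult.assoc)

lemma sgl_eq_cst: "sgl p c = cst c * sgl p (1 :: 'k::comm_ring_1)" for p :: "'m::monoid_add"
  by (simp add: cst_def mult_single)

lemma pm_algebra_simps [simp]:
  "carrier (pm_algebra :: ('k::comm_ring_1, 'm::monoid_add \<Rightarrow>\<^sub>0 'k) module) = UNIV"
  "mult (pm_algebra :: ('k, 'm \<Rightarrow>\<^sub>0 'k) module) = (*)"
  "one (pm_algebra :: ('k, 'm \<Rightarrow>\<^sub>0 'k) module) = 1"
  "zero (pm_algebra :: ('k, 'm \<Rightarrow>\<^sub>0 'k) module) = 0"
  "add (pm_algebra :: ('k, 'm \<Rightarrow>\<^sub>0 'k) module) = (+)"
  "smult (pm_algebra :: ('k, 'm \<Rightarrow>\<^sub>0 'k) module) c = (*) (cst c)"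
proof -
  show "mult (pm_algebra :: ('k, 'm \<Rightarrow>\<^sub>0 'k) module) = (*)"
    by (simp add: pm_algebra_mult fun_eq_iff)
qed (simp_all add: pm_algebra_def monoid_algebra_simps fun_eq_iff mult_map_scale_conv_mult cst_def)

lemma free_algebra_eq: "free_algebra = (pm_algebra :: ('k::comm_ring_1, 'x list \<Rightarrow>\<^sub>0 'k) module)"
  by (simp add: free_algebra_def pm_algebra_def plus_list_def zero_list_def)

lemmas free_algebra_simps [simp] = pm_algebra_simps[where 'm = "'x list", folded free_algebra_eq]

lemma assoc_algebra_pm: "assoc_algebra (pm_algebra :: ('k::comm_ring_1, 'm::monoid_add \<Rightarrow>\<^sub>0 'k) module)"
  unfolding pm_algebra_def by (rule assoc_algebra_monoid_algebra[OF monoid_UNIV])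

lemma assoc_algebra_free: "assoc_algebra (free_algebra :: ('k::comm_ring_1, 'x list \<Rightarrow>\<^sub>0 'k) module)"
  unfolding free_algebra_eq by (rule assoc_algebra_pm)

interpretation free: assoc_algebra "free_algebra :: ('k::comm_ring_1, 'x list \<Rightarrow>\<^sub>0 'k) module"
  by (rule assoc_algebra_free)

lemma a_inv_free [simp]: "\<ominus>\<^bsub>free_algebra\<^esub> (x :: 'x list \<Rightarrow>\<^sub>0 'k::comm_ring_1) = - x"
  using free.minus_equality[of "- x" x] by simp

lemma a_minus_free [simp]: "x \<ominus>\<^bsub>free_algebra\<^esub> (y :: 'x list \<Rightarrow>\<^sub>0 'k::comm_ring_1) = x - y"
  by (simp add: a_minus_def)

lemma gen_cst: "gen x * cst c = cst c * gen x" "gen x * (cst c * f) = cst c * (gen x * f)"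
  by (simp_all add: cst_commute cst_left_commute)

lemma free_induct [case_names one add smult gen_mult]:
  fixes f :: "'x list \<Rightarrow>\<^sub>0 'k::comm_ring_1"
  assumes "P 1" "\<And>f g. P f \<Longrightarrow> P g \<Longrightarrow> P (f + g)" "\<And>c f. P f \<Longrightarrow> P (cst c * f)"
    "\<And>x f. P f \<Longrightarrow> P (gen x * f)"
  shows "P f"
proof (induction f rule: pm_induct)
  case zero
  show ?case using assms(3)[OF assms(1), of 0] by simp
next
  case (add p c f)
  have "P (sgl p 1)"
  proof (induction p)
    case Nil
    then show ?case using assms(1) by (simp add: zero_list_def flip: single_one)
  next
    case (Cons x p)
    then show ?case using assms(4)[of "sgl p 1" x] by (simp add: gen_def mult_single plus_list_def)
  qed
  with add assms(2,3) show ?case by (subst sgl_eq_cst) auto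
qed

context assoc_algebra
begin

context
  fixes v :: "'x \<Rightarrow> 'a"
  assumes v: "\<And>x. v x \<in> carrier A"
begin

lemma free_eval_hom: "free_eval A v \<in> alg_hom free_algebra A"
proof -
  have c: "foldr (\<lambda>x y. v x \<otimes> y) ws \<one> \<in> carrier A" for ws
    by (induction ws) (use v in auto)
  have m: "foldr (\<lambda>x y. v x \<otimes> y) (us @ ws) \<one> = foldr (\<lambda>x y. v x \<otimes> y) us \<one> \<otimes> foldr (\<lambda>x y. v x \<otimes> y) ws \<one>" for us ws
    by (induction us) (use v c in \<open>auto simp: m_assoc simp del: foldr_append\<close>)
  show ?thesis
    unfolding free_eval_def free_algebra_eq pm_algebra_def
    by (rule lin_ext_hom[OF monoid_UNIV]) (use c m in \<open>auto simp: zero_list_def plus_list_def\<close>)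
qed

lemma free_eval_closed [simp]: "free_eval A v f \<in> carrier A"
  using alg_homD(3)[OF free_eval_hom] by simp

lemma free_eval_gen [simp]: "free_eval A v (gen x) = v x"
  using v[of x] by (simp add: free_eval_def gen_def)

lemma free_eval_simps:
  "free_eval A v (f * g) = free_eval A v f \<otimes> free_eval A v g"
  "free_eval A v (f + g) = free_eval A v f \<oplus> free_eval A v g"
  "free_eval A v (f - g) = free_eval A v f \<ominus> free_eval A v g"
  "free_eval A v (- f) = \<ominus> free_eval A v f"
  "free_eval A v 0 = \<zero>" "free_eval A v 1 = \<one>"
  using alg_homD(2,4,5)[OF free_eval_hom] lin_map_zero[OF assoc_algebra_free is_assoc_algebra alg_homD(1)[OF free_eval_hom]]
    lin_map_neg[OF assoc_algebra_free is_assoc_algebra alg_homD(1)[OF free_eval_hom]]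
    lin_map_minus[OF assoc_algebra_free is_assoc_algebra alg_homD(1)[OF free_eval_hom]] by auto

lemma free_eval_smult: "free_eval A v (cst c * f) = c \<odot> free_eval A v f"
  using alg_homD(6)[OF free_eval_hom, of f c] by simp

lemma free_eval_cst: "free_eval A v (cst c) = c \<odot> \<one>"
  using free_eval_smult[of c 1] by (simp add: free_eval_simps)

lemma free_eval_unique:
  assumes "f \<in> alg_hom free_algebra A" "\<And>x. f (gen x) = v x"
  shows "f p = free_eval A v p"
proof (induction p rule: free_induct)
  case (smult c p)
  then show ?case using alg_homD(6)[OF assms(1), of p c] by (simp add: free_eval_smult)
qed (use alg_homD(2,4,5)[OF assms(1)] assms(2) in \<open>simp_all add: free_eval_simps\<close>)

text \<open>The zeros of an evaluation form a two-sided ideal, so vanishing has to be tested on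
  generators of the ideal only.\<close>

lemma free_eval_Idl:
  assumes "\<And>r. r \<in> R \<Longrightarrow> free_eval A v r = \<zero>" "f \<in> Idl\<^bsub>free_algebra\<^esub> R"
  shows "free_eval A v f = \<zero>"
proof -
  let ?K = "{f. free_eval A v f = \<zero>}"
  have "ideal ?K free_algebra"
    by (rule idealI[OF free.ring_axioms], rule free.add.subgroupI) (auto simp: free_eval_simps intro: exI[of _ 0])
  then have "Idl\<^bsub>free_algebra\<^esub> R \<subseteq> ?K"
    by (rule free.genideal_minimal) (use assms(1) in auto)
  with assms(2) show ?thesis by auto
qed

end

end

text \<open>The ideal laws in terms of the operations of the type instead of the record, since all
  explicit identities below are written with the former.\<close>

lemma Idl_free:
  fixes R :: "('x list \<Rightarrow>\<^sub>0 'k::comm_ring_1) set"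
  shows "algebra_ideal (Idl\<^bsub>free_algebra\<^esub> R) free_algebra"
    and "R \<subseteq> Idl\<^bsub>free_algebra\<^esub> R"
    and "0 \<in> Idl\<^bsub>free_algebra\<^esub> R"
    and "\<And>f g. f \<in> Idl\<^bsub>free_algebra\<^esub> R \<Longrightarrow> g \<in> Idl\<^bsub>free_algebra\<^esub> R \<Longrightarrow> f + g \<in> Idl\<^bsub>free_algebra\<^esub> R"
    and "\<And>f g. f \<in> Idl\<^bsub>free_algebra\<^esub> R \<Longrightarrow> g \<in> Idl\<^bsub>free_algebra\<^esub> R \<Longrightarrow> f - g \<in> Idl\<^bsub>free_algebra\<^esub> R"
    and "\<And>f. f \<in> Idl\<^bsub>free_algebra\<^esub> R \<Longrightarrow> - f \<in> Idl\<^bsub>free_algebra\<^esub> R"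
    and "\<And>f g. f \<in> Idl\<^bsub>free_algebra\<^esub> R \<Longrightarrow> f * g \<in> Idl\<^bsub>free_algebra\<^esub> R"
    and "\<And>f g. f \<in> Idl\<^bsub>free_algebra\<^esub> R \<Longrightarrow> g * f \<in> Idl\<^bsub>free_algebra\<^esub> R"
proof -
  have i: "ideal (Idl\<^bsub>free_algebra\<^esub> R) free_algebra" by (rule free.genideal_ideal) auto
  then show "algebra_ideal (Idl\<^bsub>free_algebra\<^esub> R) free_algebra"
    by (simp add: algebra_ideal_def assoc_algebra_free)
  interpret I: ideal "Idl\<^bsub>free_algebra\<^esub> R" free_algebra by (rule i)
  show "R \<subseteq> Idl\<^bsub>free_algebra\<^esub> R" by (rule free.genideal_self) auto
  show "0 \<in> Idl\<^bsub>free_algebra\<^esub> R" using I.zero_closed by simp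
  show add: "f + g \<in> Idl\<^bsub>free_algebra\<^esub> R" if "f \<in> Idl\<^bsub>free_algebra\<^esub> R" "g \<in> Idl\<^bsub>free_algebra\<^esub> R" for f g
    using I.a_closed[OF that] by simp
  show neg: "- f \<in> Idl\<^bsub>free_algebra\<^esub> R" if "f \<in> Idl\<^bsub>free_algebra\<^esub> R" for f
    using I.a_inv_closed[OF that] by simp
  show "f - g \<in> Idl\<^bsub>free_algebra\<^esub> R" if "f \<in> Idl\<^bsub>free_algebra\<^esub> R" "g \<in> Idl\<^bsub>free_algebra\<^esub> R" for f g
    using add[OF that(1) neg[OF that(2)]] by simp
  show "f * g \<in> Idl\<^bsub>free_algebra\<^esub> R" if "f \<in> Idl\<^bsub>free_algebra\<^esub> R" for f g
    using I.I_r_closed[OF that, of g] by simp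
  show "g * f \<in> Idl\<^bsub>free_algebra\<^esub> R" if "f \<in> Idl\<^bsub>free_algebra\<^esub> R" for f g
    using I.I_l_closed[OF that, of g] by simp
qed


section \<open>Tensor products\<close>

definition bilinear_map ::
  "('k::comm_ring_1, 'a) module \<Rightarrow> ('k, 'b) module \<Rightarrow> ('k, 'v) module \<Rightarrow> ('a \<Rightarrow> 'b \<Rightarrow> 'v) \<Rightarrow> bool" where
  "bilinear_map A B V \<beta> \<longleftrightarrow>
     (\<forall>y\<in>carrier B. (\<lambda>x. \<beta> x y) \<in> lin_map A V) \<and> (\<forall>x\<in>carrier A. \<beta> x \<in> lin_map B V)"

locale tensor_product = A: assoc_algebra A + B: assoc_algebra B
  for A :: "('k::comm_ring_1, 'a) module" and B :: "('k, 'b) module"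
begin

abbreviation FT :: "('k, ('a \<times> 'b) \<Rightarrow>\<^sub>0 'k) module" where "FT \<equiv> monoid_algebra (A \<times>\<times> B)"

abbreviation T where "T \<equiv> tensor A B"

abbreviation pure (infixl "\<otimes>\<otimes>" 70) where "x \<otimes>\<otimes> y \<equiv> pure_tensor A B x y"

lemma monoid_prod: "Group.monoid (A \<times>\<times> B)"
  by (rule DirProd_monoid[OF A.monoid_mult B.monoid_mult])

sublocale FT: assoc_algebra FT
  by (rule assoc_algebra_monoid_algebra[OF monoid_prod])

lemma sgl_FT: "\<lbrakk>x \<in> carrier A; y \<in> carrier B\<rbrakk> \<Longrightarrow> sgl (x, y) c \<in> carrier FT"
  by (auto simp: monoid_algebra_simps)

lemma FT_minus:
  assumes "f \<in> carrier FT" "g \<in> carrier FT"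
  shows "f \<ominus>\<^bsub>FT\<^esub> g = f - g" "f - g \<in> carrier FT"
proof -
  show *: "f \<ominus>\<^bsub>FT\<^esub> g = f - g"
    using assms a_inv_monoid_algebra[OF monoid_prod, of g] by (simp add: a_minus_def monoid_algebra_simps)
  show "f - g \<in> carrier FT" using FT.minus_closed[OF assms] by (simp add: *)
qed

lemma bilinear_relations_carrier: "bilinear_relations A B \<subseteq> carrier FT"
  by (auto simp: bilinear_relations_def intro!: FT_minus(2) sgl_FT)

lemma tensor_null_minimal:
  "\<lbrakk>submodule K scalars FT; bilinear_relations A B \<subseteq> K\<rbrakk> \<Longrightarrow> tensor_null A B \<subseteq> K"
  unfolding tensor_null_def by (rule hull_minimal)

lemma tensor_null_subspace: "submodule (tensor_null A B) scalars FT"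
  unfolding tensor_null_def by (rule FT.subspace_hull[OF bilinear_relations_carrier])

lemma bilinear_relations_in_null: "bilinear_relations A B \<subseteq> tensor_null A B"
  unfolding tensor_null_def by (rule hull_subset)

lemma FT_smult_sgl_diff:
  "Poly_Mapping.map ((*) (d::'k)) (f - g) = Poly_Mapping.map ((*) d) f - Poly_Mapping.map ((*) d) g"
  by (rule poly_mapping_eqI) (simp add: lookup_map_mult lookup_minus algebra_simps)

text \<open>Multiplying a bilinearity relation by a single term gives a scalar multiple of a
  bilinearity relation of the same kind.\<close>

lemma tensor_null_mult_relation:
  assumes r: "r \<in> bilinear_relations A B" and m: "p \<in> carrier A" "q \<in> carrier B"
  shows "sgl (p, q) d \<otimes>\<^bsub>FT\<^esub> r \<in> tensor_null A B \<and> r \<otimes>\<^bsub>FT\<^esub> sgl (p, q) d \<in> tensor_null A B"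
proof -
  note N = FT.subspaceD[OF tensor_null_subspace]
  have pq: "(p, q) \<in> carrier A \<times> carrier B" using m by simp
  have sc: "f - g \<in> carrier FT" if "f \<in> carrier FT" "g \<in> carrier FT" for f g using FT_minus(2)[OF that] .
  have ml: "h \<otimes>\<^bsub>FT\<^esub> (f - g) = h \<otimes>\<^bsub>FT\<^esub> f - h \<otimes>\<^bsub>FT\<^esub> g" for f g h :: "('a \<times> 'b) \<Rightarrow>\<^sub>0 'k"
    using monoid_algebra_mult_add_right[of "A \<times>\<times> B" h "f - g" g] by (simp add: algebra_simps)
  have mr: "(f - g) \<otimes>\<^bsub>FT\<^esub> h = f \<otimes>\<^bsub>FT\<^esub> h - g \<otimes>\<^bsub>FT\<^esub> h" for f g h :: "('a \<times> 'b) \<Rightarrow>\<^sub>0 'k"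
    using monoid_algebra_mult_add_left[of "A \<times>\<times> B" "f - g" g h] by (simp add: algebra_simps)
  have key: "Poly_Mapping.map ((*) d) r' \<in> tensor_null A B" if "r' \<in> bilinear_relations A B" for r'
    using N(4)[of r' d] that bilinear_relations_in_null by (auto simp: monoid_algebra_simps)
  note S = FT_smult_sgl_diff map_mult_sgl ml mr
  from r consider
    (1) x x' y where "r = sgl (x \<oplus>\<^bsub>A\<^esub> x', y) 1 - sgl (x, y) 1 - sgl (x', y) 1" "x \<in> carrier A" "x' \<in> carrier A" "y \<in> carrier B"
  | (2) x y y' where "r = sgl (x, y \<oplus>\<^bsub>B\<^esub> y') 1 - sgl (x, y) 1 - sgl (x, y') 1" "x \<in> carrier A" "y \<in> carrier B" "y' \<in> carrier B"
  | (3) c x y where "r = sgl (c \<odot>\<^bsub>A\<^esub> x, y) 1 - sgl (x, y) c" "x \<in> carrier A" "y \<in> carrier B"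
  | (4) c x y where "r = sgl (x, c \<odot>\<^bsub>B\<^esub> y) 1 - sgl (x, y) c" "x \<in> carrier A" "y \<in> carrier B"
    unfolding bilinear_relations_def by blast
  then show ?thesis
  proof cases
    case 1
    have "sgl (p \<otimes>\<^bsub>A\<^esub> x \<oplus>\<^bsub>A\<^esub> p \<otimes>\<^bsub>A\<^esub> x', q \<otimes>\<^bsub>B\<^esub> y) (1::'k) - sgl (p \<otimes>\<^bsub>A\<^esub> x, q \<otimes>\<^bsub>B\<^esub> y) 1 - sgl (p \<otimes>\<^bsub>A\<^esub> x', q \<otimes>\<^bsub>B\<^esub> y) 1 \<in> bilinear_relations A B"
      "sgl (x \<otimes>\<^bsub>A\<^esub> p \<oplus>\<^bsub>A\<^esub> x' \<otimes>\<^bsub>A\<^esub> p, y \<otimes>\<^bsub>B\<^esub> q) (1::'k) - sgl (x \<otimes>\<^bsub>A\<^esub> p, y \<otimes>\<^bsub>B\<^esub> q) 1 - sgl (x' \<otimes>\<^bsub>A\<^esub> p, y \<otimes>\<^bsub>B\<^esub> q) 1 \<in> bilinear_relations A B"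
      unfolding bilinear_relations_def using 1 m A.m_closed B.m_closed by blast+
    from key[OF this(1)] key[OF this(2)] 1 m show ?thesis
      by (simp add: S A.l_distr A.r_distr)
  next
    case 2
    have "sgl (p \<otimes>\<^bsub>A\<^esub> x, q \<otimes>\<^bsub>B\<^esub> y \<oplus>\<^bsub>B\<^esub> q \<otimes>\<^bsub>B\<^esub> y') (1::'k) - sgl (p \<otimes>\<^bsub>A\<^esub> x, q \<otimes>\<^bsub>B\<^esub> y) 1 - sgl (p \<otimes>\<^bsub>A\<^esub> x, q \<otimes>\<^bsub>B\<^esub> y') 1 \<in> bilinear_relations A B"
      "sgl (x \<otimes>\<^bsub>A\<^esub> p, y \<otimes>\<^bsub>B\<^esub> q \<oplus>\<^bsub>B\<^esub> y' \<otimes>\<^bsub>B\<^esub> q) (1::'k) - sgl (x \<otimes>\<^bsub>A\<^esub> p, y \<otimes>\<^bsub>B\<^esub> q) 1 - sgl (x \<otimes>\<^bsub>A\<^esub> p, y' \<otimes>\<^bsub>B\<^esub> q) 1 \<in> bilinear_relations A B"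
      unfolding bilinear_relations_def using 2 m A.m_closed B.m_closed by blast+
    from key[OF this(1)] key[OF this(2)] 2 m show ?thesis
      by (simp add: S B.l_distr B.r_distr)
  next
    case 3
    have "sgl (c \<odot>\<^bsub>A\<^esub> (p \<otimes>\<^bsub>A\<^esub> x), q \<otimes>\<^bsub>B\<^esub> y) (1::'k) - sgl (p \<otimes>\<^bsub>A\<^esub> x, q \<otimes>\<^bsub>B\<^esub> y) c \<in> bilinear_relations A B"
      "sgl (c \<odot>\<^bsub>A\<^esub> (x \<otimes>\<^bsub>A\<^esub> p), y \<otimes>\<^bsub>B\<^esub> q) (1::'k) - sgl (x \<otimes>\<^bsub>A\<^esub> p, y \<otimes>\<^bsub>B\<^esub> q) c \<in> bilinear_relations A B"
      unfolding bilinear_relations_def using 3 m A.m_closed B.m_closed by blast+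
    from key[OF this(1)] key[OF this(2)] 3 m show ?thesis
      by (simp add: S A.smult_mult_left A.smult_mult_right mult.commute)
  next
    case 4
    have "sgl (p \<otimes>\<^bsub>A\<^esub> x, c \<odot>\<^bsub>B\<^esub> (q \<otimes>\<^bsub>B\<^esub> y)) (1::'k) - sgl (p \<otimes>\<^bsub>A\<^esub> x, q \<otimes>\<^bsub>B\<^esub> y) c \<in> bilinear_relations A B"
      "sgl (x \<otimes>\<^bsub>A\<^esub> p, c \<odot>\<^bsub>B\<^esub> (y \<otimes>\<^bsub>B\<^esub> q)) (1::'k) - sgl (x \<otimes>\<^bsub>A\<^esub> p, y \<otimes>\<^bsub>B\<^esub> q) c \<in> bilinear_relations A B"
      unfolding bilinear_relations_def using 4 m A.m_closed B.m_closed by blast+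
    from key[OF this(1)] key[OF this(2)] 4 m show ?thesis
      by (simp add: S B.smult_mult_left B.smult_mult_right mult.commute)
  qed
qed

text \<open>\<open>tensor_null\<close> is generated as a submodule only. It is an ideal because
  multiplication by single terms preserves it on both sides, and this is what makes the tensor
  product an algebra.\<close>

lemma tensor_null_ideal: "algebra_ideal (tensor_null A B) FT"
proof -
  note N = FT.subspaceD[OF tensor_null_subspace]
  have step: "sgl m d \<otimes>\<^bsub>FT\<^esub> t \<in> tensor_null A B \<and> t \<otimes>\<^bsub>FT\<^esub> sgl m d \<in> tensor_null A B"
    if t: "t \<in> tensor_null A B" and m: "m \<in> carrier A \<times> carrier B" for m d t
  proof -
    let ?K = "{t \<in> carrier FT. sgl m d \<otimes>\<^bsub>FT\<^esub> t \<in> tensor_null A B \<and> t \<otimes>\<^bsub>FT\<^esub> sgl m d \<in> tensor_null A B}"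
    have mc: "sgl m d \<in> carrier FT" using m by (auto simp: monoid_algebra_simps)
    have "submodule ?K scalars FT"
      by (rule FT.subspaceI)
        (use N mc in \<open>auto simp: FT.l_distr FT.r_distr FT.smult_mult_left FT.smult_mult_right\<close>)
    moreover have "bilinear_relations A B \<subseteq> ?K"
      using tensor_null_mult_relation m bilinear_relations_carrier by auto
    ultimately show ?thesis
      using tensor_null_minimal t by blast
  qed
  have "f \<otimes>\<^bsub>FT\<^esub> t \<in> tensor_null A B \<and> t \<otimes>\<^bsub>FT\<^esub> f \<in> tensor_null A B"
    if t: "t \<in> tensor_null A B" and f: "f \<in> carrier FT" for t f
  proof -
    from f have "kys f \<subseteq> carrier A \<times> carrier B" by (simp add: monoid_algebra_simps)
    then show ?thesis
    proof (induction f rule: kys_restrict_induct)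
      case zero
      then show ?case using N(2) by (simp add: monoid_algebra_simps)
    next
      case (add p c g)
      then show ?case
        using N(3) step[OF t, of p c]
        by (simp add: monoid_algebra_mult_add_left monoid_algebra_mult_add_right) (simp add: monoid_algebra_simps)
    qed
  qed
  then have "ideal (tensor_null A B) FT"
    by (intro idealI[OF FT.ring_axioms] submodule.axioms(1)[OF tensor_null_subspace]) auto
  then show ?thesis
    by (simp add: algebra_ideal_def FT.is_assoc_algebra)
qed

sublocale N: algebra_ideal "tensor_null A B" FT
  by (rule tensor_null_ideal)

lemma assoc_algebra_T: "assoc_algebra T"
  unfolding tensor_def by (rule N.assoc_algebra_Q)

sublocale T: assoc_algebra T
  by (rule assoc_algebra_T)

lemma pure_eq: "x \<otimes>\<otimes> y = tensor_null A B +>\<^bsub>FT\<^esub> sgl (x, y) 1"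
  by (simp add: pure_tensor_def)

lemma pure_closed [simp]: "\<lbrakk>x \<in> carrier A; y \<in> carrier B\<rbrakk> \<Longrightarrow> x \<otimes>\<otimes> y \<in> carrier T"
  unfolding pure_eq tensor_def by (simp add: N.carrier_Q sgl_FT)

lemma proj_sgl: "\<lbrakk>x \<in> carrier A; y \<in> carrier B\<rbrakk> \<Longrightarrow> tensor_null A B +>\<^bsub>FT\<^esub> sgl (x, y) c = c \<odot>\<^bsub>T\<^esub> (x \<otimes>\<otimes> y)"
  unfolding pure_eq tensor_def by (simp add: N.proj_smult sgl_FT) (simp add: monoid_algebra_simps map_mult_sgl)

lemma pure_add_left:
  assumes "x \<in> carrier A" "x' \<in> carrier A" "y \<in> carrier B"
  shows "(x \<oplus>\<^bsub>A\<^esub> x') \<otimes>\<otimes> y = x \<otimes>\<otimes> y \<oplus>\<^bsub>T\<^esub> x' \<otimes>\<otimes> y"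
proof -
  let ?X = "sgl (x \<oplus>\<^bsub>A\<^esub> x', y) (1::'k)" and ?Y = "sgl (x, y) (1::'k)" and ?Z = "sgl (x', y) (1::'k)"
  have "?X - ?Y - ?Z \<in> bilinear_relations A B"
    using assms unfolding bilinear_relations_def by blast
  moreover have "?X \<ominus>\<^bsub>FT\<^esub> (?Y \<oplus>\<^bsub>FT\<^esub> ?Z) = ?X - (?Y \<oplus>\<^bsub>FT\<^esub> ?Z)"
    using assms by (intro FT_minus(1) FT.a_closed sgl_FT) auto
  ultimately have "?X \<ominus>\<^bsub>FT\<^esub> (?Y \<oplus>\<^bsub>FT\<^esub> ?Z) \<in> tensor_null A B"
    using bilinear_relations_in_null by (auto simp: monoid_algebra_simps(4) diff_diff_eq)
  then have "tensor_null A B +>\<^bsub>FT\<^esub> sgl (x \<oplus>\<^bsub>A\<^esub> x', y) 1 = tensor_null A B +>\<^bsub>FT\<^esub> (sgl (x, y) 1 \<oplus>\<^bsub>FT\<^esub> sgl (x', y) 1)"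
    using assms by (subst N.proj_eq_iff) (auto intro!: sgl_FT)
  then show ?thesis
    using assms unfolding pure_eq tensor_def by (simp add: N.proj_add sgl_FT)
qed

lemma pure_add_right:
  assumes "x \<in> carrier A" "y \<in> carrier B" "y' \<in> carrier B"
  shows "x \<otimes>\<otimes> (y \<oplus>\<^bsub>B\<^esub> y') = x \<otimes>\<otimes> y \<oplus>\<^bsub>T\<^esub> x \<otimes>\<otimes> y'"
proof -
  let ?X = "sgl (x, y \<oplus>\<^bsub>B\<^esub> y') (1::'k)" and ?Y = "sgl (x, y) (1::'k)" and ?Z = "sgl (x, y') (1::'k)"
  have "?X - ?Y - ?Z \<in> bilinear_relations A B"
    using assms unfolding bilinear_relations_def by blast
  moreover have "?X \<ominus>\<^bsub>FT\<^esub> (?Y \<oplus>\<^bsub>FT\<^esub> ?Z) = ?X - (?Y \<oplus>\<^bsub>FT\<^esub> ?Z)"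
    using assms by (intro FT_minus(1) FT.a_closed sgl_FT) auto
  ultimately have "?X \<ominus>\<^bsub>FT\<^esub> (?Y \<oplus>\<^bsub>FT\<^esub> ?Z) \<in> tensor_null A B"
    using bilinear_relations_in_null by (auto simp: monoid_algebra_simps(4) diff_diff_eq)
  then have "tensor_null A B +>\<^bsub>FT\<^esub> sgl (x, y \<oplus>\<^bsub>B\<^esub> y') 1 = tensor_null A B +>\<^bsub>FT\<^esub> (sgl (x, y) 1 \<oplus>\<^bsub>FT\<^esub> sgl (x, y') 1)"
    using assms by (subst N.proj_eq_iff) (auto intro!: sgl_FT)
  then show ?thesis
    using assms unfolding pure_eq tensor_def by (simp add: N.proj_add sgl_FT)
qed

lemma pure_smult:
  assumes "x \<in> carrier A" "y \<in> carrier B"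
  shows "(c \<odot>\<^bsub>A\<^esub> x) \<otimes>\<otimes> y = c \<odot>\<^bsub>T\<^esub> (x \<otimes>\<otimes> y)" "x \<otimes>\<otimes> (c \<odot>\<^bsub>B\<^esub> y) = c \<odot>\<^bsub>T\<^esub> (x \<otimes>\<otimes> y)"
proof -
  have "sgl (c \<odot>\<^bsub>A\<^esub> x, y) 1 - sgl (x, y) c \<in> bilinear_relations A B" "sgl (x, c \<odot>\<^bsub>B\<^esub> y) 1 - sgl (x, y) c \<in> bilinear_relations A B"
    using assms unfolding bilinear_relations_def by blast+
  note this[THEN subsetD[OF bilinear_relations_in_null]]
  then show "(c \<odot>\<^bsub>A\<^esub> x) \<otimes>\<otimes> y = c \<odot>\<^bsub>T\<^esub> (x \<otimes>\<otimes> y)" "x \<otimes>\<otimes> (c \<odot>\<^bsub>B\<^esub> y) = c \<odot>\<^bsub>T\<^esub> (x \<otimes>\<otimes> y)"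
    unfolding proj_sgl[OF assms, symmetric] unfolding pure_eq
    using assms by (simp_all add: N.proj_eq_iff sgl_FT FT_minus)
qed

lemma pure_mult:
  assumes "x \<in> carrier A" "x' \<in> carrier A" "y \<in> carrier B" "y' \<in> carrier B"
  shows "(x \<otimes>\<otimes> y) \<otimes>\<^bsub>T\<^esub> (x' \<otimes>\<otimes> y') = (x \<otimes>\<^bsub>A\<^esub> x') \<otimes>\<otimes> (y \<otimes>\<^bsub>B\<^esub> y')"
  using assms unfolding pure_eq tensor_def by (simp add: N.proj_mult sgl_FT)

lemma one_T: "\<one>\<^bsub>T\<^esub> = \<one>\<^bsub>A\<^esub> \<otimes>\<otimes> \<one>\<^bsub>B\<^esub>"
  unfolding pure_eq tensor_def by (simp add: quot_algebra_simps monoid_algebra_simps)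

text \<open>The coefficient of each term is absorbed into its left leg, so sums of pure tensors
  suffice.\<close>

lemma tensor_induct [consumes 1, case_names zero add]:
  assumes "t \<in> carrier T" "P \<zero>\<^bsub>T\<^esub>"
    and step: "\<And>x y t. \<lbrakk>x \<in> carrier A; y \<in> carrier B; t \<in> carrier T; P t\<rbrakk> \<Longrightarrow> P ((x \<otimes>\<otimes> y) \<oplus>\<^bsub>T\<^esub> t)"
  shows "P t"
proof -
  from assms(1) obtain f where f: "f \<in> carrier FT" "t = tensor_null A B +>\<^bsub>FT\<^esub> f"
    unfolding tensor_def N.carrier_Q by blast
  then have "kys f \<subseteq> carrier A \<times> carrier B" by (simp add: monoid_algebra_simps)
  then have "P (tensor_null A B +>\<^bsub>FT\<^esub> f)"
  proof (induction f rule: kys_restrict_induct)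
    case zero
    have "tensor_null A B +>\<^bsub>FT\<^esub> 0 = \<zero>\<^bsub>T\<^esub>"
      using N.proj_zero_iff[of 0] FT.zero_closed FT.subspaceD(2)[OF tensor_null_subspace]
      unfolding tensor_def by (simp add: quot_algebra_simps monoid_algebra_simps)
    with assms(2) show ?case by simp
  next
    case (add p c g)
    obtain x y where p: "p = (x, y)" "x \<in> carrier A" "y \<in> carrier B" using add by auto
    have g: "g \<in> carrier FT" using add by (simp add: monoid_algebra_simps)
    have "tensor_null A B +>\<^bsub>FT\<^esub> (sgl p c + g) = (c \<odot>\<^bsub>A\<^esub> x) \<otimes>\<otimes> y \<oplus>\<^bsub>T\<^esub> (tensor_null A B +>\<^bsub>FT\<^esub> g)"
      using N.proj_add[OF sgl_FT[OF p(2,3)] g, of c] p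
      by (simp add: pure_smult flip: proj_sgl) (simp add: tensor_def monoid_algebra_simps)
    moreover have "tensor_null A B +>\<^bsub>FT\<^esub> g \<in> carrier T"
      using g by (simp add: tensor_def N.carrier_Q)
    ultimately show ?case using step[of "c \<odot>\<^bsub>A\<^esub> x" y] p add by simp
  qed
  then show ?thesis by (simp add: f)
qed

context
  fixes V :: "('k, 'v) module" and \<beta>
  assumes V: "assoc_algebra V" and bil: "bilinear_map A B V \<beta>"
begin

interpretation V: assoc_algebra V by (rule V)

lemma bilinear_closed: "\<lbrakk>x \<in> carrier A; y \<in> carrier B\<rbrakk> \<Longrightarrow> \<beta> x y \<in> carrier V"
  using bil lin_mapD(1) unfolding bilinear_map_def by fast

lemma lin_ext_bilinear: "lin_ext V (\<lambda>(x, y). \<beta> x y) \<in> lin_map FT V"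
  by (rule V.lin_ext_lin_map) (auto intro: bilinear_closed)

lemma lin_ext_tensor_null:
  assumes "t \<in> tensor_null A B"
  shows "lin_ext V (\<lambda>(x, y). \<beta> x y) t = \<zero>\<^bsub>V\<^esub>"
proof -
  let ?f = "lin_ext V (\<lambda>(x, y). \<beta> x y)"
  let ?K = "{t \<in> carrier FT. ?f t = \<zero>\<^bsub>V\<^esub>}"
  note L = lin_mapD[OF lin_ext_bilinear]
  have "submodule ?K scalars FT"
    by (rule FT.subspaceI) (auto simp: L(2,3) lin_map_zero[OF FT.is_assoc_algebra V lin_ext_bilinear])
  moreover have "bilinear_relations A B \<subseteq> ?K"
  proof
    fix r assume r: "r \<in> bilinear_relations A B"
    have sub: "?f (f - g) = ?f f \<ominus>\<^bsub>V\<^esub> ?f g" if "f \<in> carrier FT" "g \<in> carrier FT" for f g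
      using lin_map_minus[OF FT.is_assoc_algebra V lin_ext_bilinear that] FT_minus[OF that] by simp
    have s: "?f (sgl (x, y) c) = c \<odot>\<^bsub>V\<^esub> \<beta> x y" if "x \<in> carrier A" "y \<in> carrier B" for x y c
      using that bilinear_closed by simp
    have bl: "\<beta> (x \<oplus>\<^bsub>A\<^esub> x') y = \<beta> x y \<oplus>\<^bsub>V\<^esub> \<beta> x' y" "\<beta> (c \<odot>\<^bsub>A\<^esub> x) y = c \<odot>\<^bsub>V\<^esub> \<beta> x y"
      if "x \<in> carrier A" "x' \<in> carrier A" "y \<in> carrier B" for x x' y c
      using bil that lin_mapD[of "\<lambda>x. \<beta> x y" A V] by (auto simp: bilinear_map_def)
    have br: "\<beta> x (y \<oplus>\<^bsub>B\<^esub> y') = \<beta> x y \<oplus>\<^bsub>V\<^esub> \<beta> x y'" "\<beta> x (c \<odot>\<^bsub>B\<^esub> y) = c \<odot>\<^bsub>V\<^esub> \<beta> x y"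
      if "x \<in> carrier A" "y \<in> carrier B" "y' \<in> carrier B" for x y y' c
      using bil that lin_mapD[of "\<beta> x" B V] by (auto simp: bilinear_map_def)
    have vv: "u \<oplus>\<^bsub>V\<^esub> u' \<oplus>\<^bsub>V\<^esub> \<ominus>\<^bsub>V\<^esub> u \<oplus>\<^bsub>V\<^esub> \<ominus>\<^bsub>V\<^esub> u' = \<zero>\<^bsub>V\<^esub>" if "u \<in> carrier V" "u' \<in> carrier V" for u u'
      using that by (simp add: a_minus_def V.a_ac V.r_neg V.r_neg1)
    have rc: "r \<in> carrier FT" using r bilinear_relations_carrier by blast
    have "?f r = \<zero>\<^bsub>V\<^esub>"
      using r unfolding bilinear_relations_def
      by (auto simp: sub sgl_FT FT_minus(2) s bl br vv bilinear_closed V.minus_eq V.r_neg) 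
    with rc show "r \<in> ?K" by simp
  qed
  ultimately show ?thesis using tensor_null_minimal assms by blast
qed

lemma tensor_lift_lin: "tensor_lift V \<beta> \<in> lin_map T V"
  unfolding tensor_lift_def tensor_def
  by (rule N.coset_map_lin_map[OF V lin_ext_bilinear lin_ext_tensor_null])

lemma tensor_lift_pure [simp]:
  assumes "x \<in> carrier A" "y \<in> carrier B"
  shows "tensor_lift V \<beta> (x \<otimes>\<otimes> y) = \<beta> x y"
  unfolding tensor_lift_def pure_eq
  using N.coset_map_lin[OF V lin_ext_bilinear lin_ext_tensor_null sgl_FT[OF assms]] bilinear_closed assms
  by simp

lemma tensor_lift_hom:
  assumes "\<beta> \<one>\<^bsub>A\<^esub> \<one>\<^bsub>B\<^esub> = \<one>\<^bsub>V\<^esub>"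
    and mult: "\<And>x x' y y'. \<lbrakk>x \<in> carrier A; x' \<in> carrier A; y \<in> carrier B; y' \<in> carrier B\<rbrakk> \<Longrightarrow>
      \<beta> (x \<otimes>\<^bsub>A\<^esub> x') (y \<otimes>\<^bsub>B\<^esub> y') = \<beta> x y \<otimes>\<^bsub>V\<^esub> \<beta> x' y'"
  shows "tensor_lift V \<beta> \<in> alg_hom T V"
proof (rule alg_homI[OF tensor_lift_lin])
  let ?f = "tensor_lift V \<beta>"
  note L = lin_mapD[OF tensor_lift_lin] and Z = lin_map_zero[OF assoc_algebra_T V tensor_lift_lin]
  show "?f \<one>\<^bsub>T\<^esub> = \<one>\<^bsub>V\<^esub>" by (simp add: one_T assms(1))
  fix s t assume "s \<in> carrier T" and t: "t \<in> carrier T"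
  then show "?f (s \<otimes>\<^bsub>T\<^esub> t) = ?f s \<otimes>\<^bsub>V\<^esub> ?f t"
  proof (induction s rule: tensor_induct)
    case zero
    then show ?case using t L(1) by (simp add: Z)
  next
    case (add x y s)
    have "?f ((x \<otimes>\<otimes> y) \<otimes>\<^bsub>T\<^esub> t) = \<beta> x y \<otimes>\<^bsub>V\<^esub> ?f t"
      using t
    proof (induction t rule: tensor_induct)
      case zero
      then show ?case using add by (simp add: Z bilinear_closed)
    next
      case (add x' y' t)
      then show ?case
        using \<open>x \<in> carrier A\<close> \<open>y \<in> carrier B\<close>
        by (simp add: T.r_distr pure_mult L V.r_distr bilinear_closed mult)
    qed
    with add t show ?case
      by (simp add: T.l_distr L V.l_distr bilinear_closed)
  qed
qed

end

end


section \<open>The quantum group\<close>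

subsection \<open>Conjugation of Laurent series\<close>

lemma fls_cnj_nth [simp]: "fls_nth (fls_cnj f) n = cnj (fls_nth f n)"
proof -
  obtain N where "\<forall>n<N. fls_nth f n = 0" by (rule fls_nth_vanishes_belowE)
  then show ?thesis
    unfolding fls_cnj_def by (intro nth_Abs_fls_lower_bound[of N]) auto
qed

lemma fls_cnj_simps [simp]:
  "fls_cnj (f + g) = fls_cnj f + fls_cnj g" "fls_cnj (f - g) = fls_cnj f - fls_cnj g"
  "fls_cnj (- f) = - fls_cnj f" "fls_cnj 0 = 0" "fls_cnj 1 = 1" "fls_cnj (fls_cnj f) = f" "fls_cnj fls_X = fls_X"
  by (auto intro!: fls_eqI)

text \<open>The coefficient formula for a product of Laurent series has the subdegrees as summation
  bounds, so conjugation has to preserve these before it can be shown multiplicative.\<close>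

lemma fls_subdegree_cnj: "fls_subdegree (fls_cnj f) = fls_subdegree f"
proof (cases "f = 0")
  case False
  then show ?thesis
    by (intro fls_subdegree_eqI) (auto simp: nth_less_subdegree_zero)
qed simp

lemma fls_cnj_mult [simp]: "fls_cnj (f * g) = fls_cnj f * fls_cnj g"
  by (rule fls_eqI) (simp add: fls_times_nth(2) fls_subdegree_cnj)

lemma fls_cnj_inverse [simp]: "fls_cnj (inverse f) = inverse (fls_cnj f)"
proof (cases "f = 0")
  case False
  then have "fls_cnj f * fls_cnj (inverse f) = 1"
    by (simp flip: fls_cnj_mult)
  then show ?thesis by (rule inverse_unique[symmetric])
qed simp

lemma fls_cnj_divide [simp]: "fls_cnj (f / g) = fls_cnj f / fls_cnj g"
  by (simp add: divide_inverse)

lemma fls_cnj_numeral [simp]: "fls_cnj (numeral n) = numeral n"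
proof -
  have "fls_cnj (of_nat m) = of_nat m" for m by (induction m) simp_all
  from this[of "numeral n"] show ?thesis by simp
qed

lemma fls_cnj_mu [simp]: "fls_cnj (mu \<kappa>) = mu \<kappa>"
  by (rule fls_eqI) (simp add: mu_def)

lemma mu_nonzero [simp]: "mu \<kappa> \<noteq> 0"
  by (simp add: mu_def fps_eq_iff exI[of _ 0])


subsection \<open>The star operation\<close>

lemma su2_free_star_superset:
  assumes "finite P" "kys f \<subseteq> P"
  shows "su2_free_star f = (\<Sum>ws\<in>P. sgl (rev (map su2_gen_star ws)) (fls_cnj (lkp f ws)))"
  unfolding su2_free_star_def using assms by (intro sum.mono_neutral_left) (auto simp: in_keys_iff)

lemma su2_free_star_add [simp]: "su2_free_star (f + g) = su2_free_star f + su2_free_star g"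
  using Poly_Mapping.keys_add[of f g]
  by (subst (1 2 3) su2_free_star_superset[of "kys f \<union> kys g"])
    (auto simp: lookup_add single_add sum.distrib)

lemma su2_free_star_sgl [simp]: "su2_free_star (sgl ws c) = sgl (rev (map su2_gen_star ws)) (fls_cnj c)"
  by (subst su2_free_star_superset[of "{ws}"]) auto

lemma su2_free_star_zero [simp]: "su2_free_star 0 = 0"
  by (simp add: su2_free_star_def)

lemma su2_free_star_minus [simp]: "su2_free_star (- f) = - su2_free_star f" "su2_free_star (f - g) = su2_free_star f - su2_free_star g"
proof -
  show *: "su2_free_star (- f) = - su2_free_star f" for f
    using su2_free_star_add[of f "- f"] by (simp add: add_eq_0_iff)
  show "su2_free_star (f - g) = su2_free_star f - su2_free_star g"
    using su2_free_star_add[of f "- g"] by (simp add: *)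
qed

lemma su2_free_star_mult [simp]: "su2_free_star (f * g) = su2_free_star g * su2_free_star f"
proof (induction f rule: pm_induct)
  case (add p c f)
  have "su2_free_star (sgl p c * g) = su2_free_star g * su2_free_star (sgl p c)"
    by (induction g rule: pm_induct) (simp_all add: distrib_left distrib_right mult_single plus_list_def mult.commute)
  with add show ?case by (simp add: distrib_left distrib_right)
qed simp

lemma su2_free_star_gen [simp]: "su2_free_star (gen x) = gen (su2_gen_star x)"
  by (simp add: gen_def)

lemma su2_free_star_cst [simp]: "su2_free_star (cst c) = cst (fls_cnj c)"
  by (simp add: cst_def zero_list_def)

lemma su2_free_star_one [simp]: "su2_free_star 1 = 1"
  using su2_free_star_cst[of 1] by simp

lemma su2_gen_star_star [simp]: "su2_gen_star (su2_gen_star x) = x"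
  by (cases x) auto

lemma su2_free_star_star [simp]: "su2_free_star (su2_free_star f) = f"
  by (induction f rule: pm_induct) (simp_all add: rev_map comp_def)


subsection \<open>The defining ideal\<close>

abbreviation gs :: su2_free where "gs \<equiv> gen Sigma"
abbreviation gq :: su2_free where "gq \<equiv> gen Sigma_star"
abbreviation gr :: su2_free where "gr \<equiv> gen Rho"
abbreviation gp :: su2_free where "gp \<equiv> gen Rho_star"
abbreviation gm :: "real \<Rightarrow> ('m::monoid_add \<Rightarrow>\<^sub>0 complex fls)" where "gm \<kappa> \<equiv> cst (mu \<kappa>)"

abbreviation su2_ideal :: "real \<Rightarrow> su2_free set" where
  "su2_ideal \<kappa> \<equiv> Idl\<^bsub>free_algebra\<^esub> (su2_relations \<kappa>)"

text \<open>An equivalent set of relations with a separate commutation rule for \<rho> and for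
  \<rho>*: half the sum and half the difference of the relations in \<rho> - \<rho>* and \<rho> +
  \<rho>*. The rules for \<sigma>* come from the adjoints.\<close>

definition su2_basic :: "real \<Rightarrow> su2_free set" where
  "su2_basic \<kappa> = {gr * gp - gp * gr, gm \<kappa> * (gr * gs) - gs * gr, gm \<kappa> * (gp * gs) - gs * gp,
     gs * gq + gm \<kappa> * (gm \<kappa> * (gr * gp)) - 1, gq * gs + gr * gp - 1,
     gm \<kappa> * (gq * gp) - gp * gq, gm \<kappa> * (gq * gr) - gr * gq}"

lemma su2_relations_eq:
  "su2_relations \<kappa> = (let rels = {gr * gp - gp * gr, gm \<kappa> * ((gr - gp) * gs) - gs * (gr - gp),
     gm \<kappa> * ((gr + gp) * gs) - gs * (gr + gp), gs * gq + gm \<kappa> * (gm \<kappa> * (gr * gp)) - 1, gq * gs + gr * gp - 1}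
     in rels \<union> su2_free_star ` rels)"
  by (simp add: su2_relations_def Let_def cst_hom power2_eq_square mult.assoc)

lemma cst_half_double: "cst (1/2 :: complex fls) * (x + x) = (x :: 'm::monoid_add \<Rightarrow>\<^sub>0 complex fls)"
proof -
  have "cst (1/2 :: complex fls) * (x + x) = cst (1/2 * 2) * x"
    unfolding cst_hom(2) by (simp add: mult.assoc flip: mult_2) (simp add: cst_def flip: single_numeral)
  then show ?thesis by simp
qed

lemma su2_basic_in_ideal: "su2_basic \<kappa> \<subseteq> su2_ideal \<kappa>"
proof -
  note I = Idl_free[where R = "su2_relations \<kappa>"]
  let ?r1 = "gm \<kappa> * ((gr - gp) * gs) - gs * (gr - gp)" and ?r2 = "gm \<kappa> * ((gr + gp) * gs) - gs * (gr + gp)"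
  have R: "?r1 \<in> su2_ideal \<kappa>" "?r2 \<in> su2_ideal \<kappa>" "su2_free_star ?r1 \<in> su2_ideal \<kappa>" "su2_free_star ?r2 \<in> su2_ideal \<kappa>"
    using I(2) by (auto simp: su2_relations_eq Let_def)
  have half: "x \<in> su2_ideal \<kappa>" if "a \<in> su2_ideal \<kappa>" "b \<in> su2_ideal \<kappa>" "x + x = a + b" for x a b
    using I(8)[OF I(4)[OF that(1,2)], of "cst (1/2)"] by (simp add: cst_half_double flip: that(3))
  have "gm \<kappa> * (gr * gs) - gs * gr \<in> su2_ideal \<kappa>"
    by (rule half[OF R(1,2)]) (simp add: algebra_simps)
  moreover have "gm \<kappa> * (gp * gs) - gs * gp \<in> su2_ideal \<kappa>"
    by (rule half[OF R(2) I(6)[OF R(1)]]) (simp add: algebra_simps)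
  moreover have "gm \<kappa> * (gq * gp) - gp * gq \<in> su2_ideal \<kappa>"
    by (rule half[OF R(4) R(3)]) (simp add: algebra_simps gen_cst)
  moreover have "gm \<kappa> * (gq * gr) - gr * gq \<in> su2_ideal \<kappa>"
    by (rule half[OF R(4) R(3)[THEN I(6)]]) (simp add: algebra_simps gen_cst)
  ultimately show ?thesis
    using I(2) by (auto simp: su2_relations_eq Let_def su2_basic_def)
qed

lemma su2_relations_in_basic: "su2_relations \<kappa> \<subseteq> Idl\<^bsub>free_algebra\<^esub> (su2_basic \<kappa>)"
proof -
  note I = Idl_free[where R = "su2_basic \<kappa>"]
  let ?I = "Idl\<^bsub>free_algebra\<^esub> (su2_basic \<kappa>)"
  have B: "gr * gp - gp * gr \<in> ?I" "gm \<kappa> * (gr * gs) - gs * gr \<in> ?I" "gm \<kappa> * (gp * gs) - gs * gp \<in> ?I"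
     "gs * gq + gm \<kappa> * (gm \<kappa> * (gr * gp)) - 1 \<in> ?I" "gq * gs + gr * gp - 1 \<in> ?I"
     "gm \<kappa> * (gq * gp) - gp * gq \<in> ?I" "gm \<kappa> * (gq * gr) - gr * gq \<in> ?I"
    using I(2) by (auto simp: su2_basic_def)
  have "gm \<kappa> * ((gr - gp) * gs) - gs * (gr - gp) \<in> ?I"
    using I(5)[OF B(2,3)] by (simp add: algebra_simps)
  moreover have "gm \<kappa> * ((gr + gp) * gs) - gs * (gr + gp) \<in> ?I"
    using I(4)[OF B(2,3)] by (simp add: algebra_simps)
  moreover have "su2_free_star (gm \<kappa> * ((gr - gp) * gs) - gs * (gr - gp)) \<in> ?I"
    using I(5)[OF B(6,7)] by (simp add: algebra_simps gen_cst)
  moreover have "su2_free_star (gm \<kappa> * ((gr + gp) * gs) - gs * (gr + gp)) \<in> ?I"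
    using I(4)[OF B(6,7)] by (simp add: algebra_simps gen_cst)
  moreover have "su2_free_star (gr * gp - gp * gr) \<in> ?I"
    using B(1) by simp
  moreover have "su2_free_star (gs * gq + gm \<kappa> * (gm \<kappa> * (gr * gp)) - 1) \<in> ?I"
    using B(4) by (simp add: gen_cst mult.assoc)
  moreover have "su2_free_star (gq * gs + gr * gp - 1) \<in> ?I"
    using B(5) by simp
  ultimately show ?thesis
    unfolding su2_relations_eq Let_def using B(1,4,5) by blast
qed

text \<open>The star reverses products, so the preimage of a two-sided ideal under it is again a
  two-sided ideal; this one contains the relations because their set is closed under the
  star.\<close>

lemma su2_ideal_star:
  assumes "f \<in> su2_ideal \<kappa>"
  shows "su2_free_star f \<in> su2_ideal \<kappa>"
proof -
  note I = Idl_free[where R = "su2_relations \<kappa>"]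
  let ?K = "{f. su2_free_star f \<in> su2_ideal \<kappa>}"
  have "ideal ?K free_algebra"
    by (rule idealI[OF free.ring_axioms], rule free.add.subgroupI) (use I in \<open>auto intro: exI[of _ 0]\<close>)
  moreover have "su2_relations \<kappa> \<subseteq> ?K"
    using I(2) unfolding su2_relations_eq Let_def by (auto simp del: su2_free_star_mult su2_free_star_minus su2_free_star_add)
  ultimately show ?thesis using free.genideal_minimal[of ?K "su2_relations \<kappa>"] assms by auto
qed


subsection \<open>Computing with classes\<close>

definition cls :: "real \<Rightarrow> su2_free \<Rightarrow> su2_carrier" where
  "cls \<kappa> f = su2_ideal \<kappa> +>\<^bsub>free_algebra :: (complex fls, su2_free) module\<^esub> f"

lemmas su2_idl = Idl_free(1)[of "su2_relations \<kappa>" for \<kappa>]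

interpretation su2: assoc_algebra "su2 \<kappa>" for \<kappa>
  unfolding su2_def by (rule algebra_ideal.assoc_algebra_Q[OF su2_idl])

lemma cls_closed [simp]: "cls \<kappa> f \<in> carrier (su2 \<kappa>)"
  by (simp add: su2_def algebra_ideal.carrier_Q[OF su2_idl] cls_def)

lemma cls_simps [simp]:
  "cls \<kappa> f \<otimes>\<^bsub>su2 \<kappa>\<^esub> cls \<kappa> g = cls \<kappa> (f * g)" "cls \<kappa> f \<oplus>\<^bsub>su2 \<kappa>\<^esub> cls \<kappa> g = cls \<kappa> (f + g)"
  "c \<odot>\<^bsub>su2 \<kappa>\<^esub> cls \<kappa> f = cls \<kappa> (cst c * f)"
  by (simp_all add: su2_def cls_def algebra_ideal.proj_mult[OF su2_idl] algebra_ideal.proj_add[OF su2_idl] algebra_ideal.proj_smult[OF su2_idl])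

lemma cls_one: "\<one>\<^bsub>su2 \<kappa>\<^esub> = cls \<kappa> 1"
  by (simp add: su2_def quot_algebra_simps cls_def)

lemma cls_eq_iff: "cls \<kappa> f = cls \<kappa> g \<longleftrightarrow> f - g \<in> su2_ideal \<kappa>"
  by (simp add: cls_def algebra_ideal.proj_eq_iff[OF su2_idl])

lemma cls_zero: "\<zero>\<^bsub>su2 \<kappa>\<^esub> = cls \<kappa> 0"
  using algebra_ideal.proj_zero_iff[OF su2_idl[of \<kappa>], of 0] Idl_free(3)[where R = "su2_relations \<kappa>"]
  by (simp add: su2_def quot_algebra_simps cls_def)

lemma cls_uminus [simp]: "\<ominus>\<^bsub>su2 \<kappa>\<^esub> cls \<kappa> f = cls \<kappa> (- f)"
  using su2.minus_equality[of \<kappa> "cls \<kappa> (- f)" "cls \<kappa> f"] by (simp add: cls_zero)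

lemma cls_minus [simp]: "cls \<kappa> f \<ominus>\<^bsub>su2 \<kappa>\<^esub> cls \<kappa> g = cls \<kappa> (f - g)"
  by (simp add: a_minus_def)

lemma su2_class_eq: "su2_class \<kappa> x = cls \<kappa> (gen x)"
  by (simp add: su2_class_def cls_def)

text \<open>The star of a class is the image of a coset. It is a full coset again because the star
  is an involution that preserves the ideal.\<close>

lemma su2_star_cls [simp]: "su2_star (cls \<kappa> f) = cls \<kappa> (su2_free_star f)"
proof -
  have mem: "g \<in> cls \<kappa> f \<longleftrightarrow> g - f \<in> su2_ideal \<kappa>" for f g
    using algebra_ideal.proj_memD[OF su2_idl[of \<kappa>], of f g] algebra_ideal.proj_self[OF su2_idl[of \<kappa>], of g] cls_eq_iff[of \<kappa> g f] unfolding cls_def by auto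
  have "g \<in> su2_free_star ` cls \<kappa> f \<longleftrightarrow> su2_free_star g \<in> cls \<kappa> f" for g
    by (metis (no_types) image_iff su2_free_star_star)
  moreover have "su2_free_star g - f \<in> su2_ideal \<kappa> \<longleftrightarrow> g - su2_free_star f \<in> su2_ideal \<kappa>" for g
    using su2_ideal_star[of "su2_free_star g - f" \<kappa>] su2_ideal_star[of "g - su2_free_star f" \<kappa>] by auto
  ultimately show ?thesis
    unfolding su2_star_def by (simp add: set_eq_iff mem)
qed

context
  fixes \<kappa> :: real and V :: "(complex fls, 'v) module" and v :: "su2_gen \<Rightarrow> 'v"
  assumes V: "assoc_algebra V" and v: "\<And>x. v x \<in> carrier V"
    and null: "\<And>r. r \<in> su2_basic \<kappa> \<Longrightarrow> free_eval V v r = \<zero>\<^bsub>V\<^esub>"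
begin

interpretation V: assoc_algebra V by (rule V)

lemma free_eval_su2_ideal: "f \<in> su2_ideal \<kappa> \<Longrightarrow> free_eval V v f = \<zero>\<^bsub>V\<^esub>"
  using V.free_eval_Idl[of v "su2_relations \<kappa>" f, OF v] V.free_eval_Idl[of v "su2_basic \<kappa>", OF v]
    null su2_relations_in_basic[of \<kappa>] by blast

lemma su2_induced_hom: "coset_map (free_eval V v) \<in> alg_hom (su2 \<kappa>) V"
  unfolding su2_def
  by (rule algebra_ideal.coset_map_hom[OF su2_idl V alg_homD(1)[OF V.free_eval_hom[of v, OF v]] free_eval_su2_ideal V.free_eval_hom[of v, OF v]])

lemma su2_induced_cls: "coset_map (free_eval V v) (cls \<kappa> f) = free_eval V v f"
  unfolding cls_def
  by (rule algebra_ideal.coset_map_lin[OF su2_idl V alg_homD(1)[OF V.free_eval_hom[of v, OF v]] free_eval_su2_ideal]) auto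

end


subsection \<open>Counit and antipode\<close>

interpretation scal: assoc_algebra "scalars :: (complex fls, complex fls) module"
  by (rule assoc_algebra_scalars)

lemma a_minus_scalars [simp]: "x \<ominus>\<^bsub>scalars\<^esub> (y :: 'k::comm_ring_1) = x - y"
  by (simp add: a_minus_def)

lemma su2_counit_hom: "su2_counit \<kappa> \<in> alg_hom (su2 \<kappa>) scalars"
  and su2_counit_cls: "su2_counit \<kappa> (cls \<kappa> f) =
    free_eval scalars (su2_gen_value \<kappa> scalars (\<lambda>i j. if i = j then 1 else 0)) f"
proof -
  have null: "free_eval scalars (su2_gen_value \<kappa> scalars (\<lambda>i j. if i = j then 1 else 0)) r = \<zero>\<^bsub>scalars\<^esub>"
    if "r \<in> su2_basic \<kappa>" for r
    using that by (auto simp: su2_basic_def scal.free_eval_simps scal.free_eval_smult)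
  show "su2_counit \<kappa> \<in> alg_hom (su2 \<kappa>) scalars"
    unfolding su2_counit_def by (rule su2_induced_hom[OF assoc_algebra_scalars _ null]) auto
  show "su2_counit \<kappa> (cls \<kappa> f) = free_eval scalars (su2_gen_value \<kappa> scalars (\<lambda>i j. if i = j then 1 else 0)) f"
    unfolding su2_counit_def by (rule su2_induced_cls[OF assoc_algebra_scalars _ null]) auto
qed

text \<open>The entries of the adjoint matrix of g, lifted to the free algebra. The factor -\<mu> in
  the entry (1, 2) of g leaves -\<mu> on \<rho> and -1/\<mu> on \<rho>*.\<close>

definition su2_antipode_value :: "real \<Rightarrow> su2_gen \<Rightarrow> su2_free" where
  "su2_antipode_value \<kappa> x = (case x of Sigma \<Rightarrow> gq | Sigma_star \<Rightarrow> gs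
     | Rho \<Rightarrow> - (gm \<kappa> * gr) | Rho_star \<Rightarrow> - (cst (inverse (mu \<kappa>)) * gp))"

lemma su2_antipode_value_simps [simp]:
  "su2_antipode_value \<kappa> Sigma = gq" "su2_antipode_value \<kappa> Sigma_star = gs"
  "su2_antipode_value \<kappa> Rho = - (gm \<kappa> * gr)" "su2_antipode_value \<kappa> Rho_star = - (cst (inverse (mu \<kappa>)) * gp)"
  by (simp_all add: su2_antipode_value_def)

lemma su2_matrix_cls: "su2_matrix \<kappa> i j = cls \<kappa> (if i = 1
      then if j = 1 then gs else - (gm \<kappa> * gp) else if j = 1 then gr else gq)"
  by (simp add: su2_matrix_def su2_class_eq cst_hom)

lemma su2_antipode_value_eq:
  "su2_gen_value \<kappa> (su2 \<kappa>) (\<lambda>i j. su2_star (su2_matrix \<kappa> j i)) x = cls \<kappa> (su2_antipode_value \<kappa> x)"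
  by (cases x) (simp_all add: su2_matrix_cls cst_hom gen_cst)

lemma assoc_algebra_su2_opposite: "assoc_algebra (opposite (su2 \<kappa>))"
  by (rule assoc_algebra_opposite) (rule su2.is_assoc_algebra)

interpretation opp: assoc_algebra "opposite (su2 \<kappa>)" for \<kappa>
  by (rule assoc_algebra_su2_opposite)

lemma a_minus_opposite [simp]: "x \<ominus>\<^bsub>opposite A\<^esub> y = x \<ominus>\<^bsub>A\<^esub> y"
  using a_inv_cong_add[of "opposite A" A] by (simp add: a_minus_def)

lemma inverse_mu_cst: "cst (inverse (mu \<kappa>)) * (gm \<kappa> * x) = (x :: su2_free)" "gm \<kappa> * (cst (inverse (mu \<kappa>)) * x) = x"
  by (simp_all flip: mult.assoc cst_hom)

text \<open>Reversing the products exchanges the commutation rules of \<sigma> with those of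
  \<sigma>*, up to scalars. The two unitarity relations are reproduced up to a multiple of the
  commutator of \<rho> and \<rho>*.\<close>

lemma su2_antipode_null:
  assumes "r \<in> su2_basic \<kappa>"
  shows "free_eval (opposite (su2 \<kappa>)) (\<lambda>x. cls \<kappa> (su2_antipode_value \<kappa> x)) r = \<zero>\<^bsub>opposite (su2 \<kappa>)\<^esub>"
proof -
  note I = Idl_free[where R = "su2_relations \<kappa>"]
  let ?ev = "free_eval (opposite (su2 \<kappa>)) (\<lambda>x. cls \<kappa> (su2_antipode_value \<kappa> x))"
  let ?n = "cst (inverse (mu \<kappa>))"
  have B: "gr * gp - gp * gr \<in> su2_ideal \<kappa>" "gm \<kappa> * (gr * gs) - gs * gr \<in> su2_ideal \<kappa>" "gm \<kappa> * (gp * gs) - gs * gp \<in> su2_ideal \<kappa>"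
     "gs * gq + gm \<kappa> * (gm \<kappa> * (gr * gp)) - 1 \<in> su2_ideal \<kappa>" "gq * gs + gr * gp - 1 \<in> su2_ideal \<kappa>"
     "gm \<kappa> * (gq * gp) - gp * gq \<in> su2_ideal \<kappa>" "gm \<kappa> * (gq * gr) - gr * gq \<in> su2_ideal \<kappa>"
    using su2_basic_in_ideal[of \<kappa>] by (auto simp: su2_basic_def)
  have ev: "?ev (gen x * f) = ?ev f \<otimes>\<^bsub>su2 \<kappa>\<^esub> cls \<kappa> (su2_antipode_value \<kappa> x)" "?ev (f - g) = ?ev f \<ominus>\<^bsub>su2 \<kappa>\<^esub> ?ev g"
    "?ev (f + g) = ?ev f \<oplus>\<^bsub>su2 \<kappa>\<^esub> ?ev g" "?ev 0 = cls \<kappa> 0" "?ev 1 = cls \<kappa> 1"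
    "?ev (gen x) = cls \<kappa> (su2_antipode_value \<kappa> x)" for f g x
    by (simp_all add: opp.free_eval_simps cls_one cls_zero)
  have ev_smult: "?ev (gm \<kappa> * f) = mu \<kappa> \<odot>\<^bsub>su2 \<kappa>\<^esub> ?ev f" for f
    by (simp add: opp.free_eval_smult)
  note S = ev(2,3,5,6) ev_smult gen_cst inverse_mu_cst cls_zero cls_eq_iff mult.assoc
  from assms show ?thesis
    unfolding su2_basic_def
  proof (elim insertE emptyE; hypsubst)
    show "?ev (gr * gp - gp * gr) = \<zero>\<^bsub>opposite (su2 \<kappa>)\<^esub>"
      using I(6)[OF B(1)] by (simp add: S ev(1)) 
    show "?ev (gm \<kappa> * (gr * gs) - gs * gr) = \<zero>\<^bsub>opposite (su2 \<kappa>)\<^esub>"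
      using I(8)[OF B(7), of "- gm \<kappa>"] by (simp add: S ev(1) algebra_simps) 
    show "?ev (gm \<kappa> * (gp * gs) - gs * gp) = \<zero>\<^bsub>opposite (su2 \<kappa>)\<^esub>"
      using I(8)[OF B(6), of "- ?n"] by (simp add: S ev(1) algebra_simps)
    show "?ev (gs * gq + gm \<kappa> * (gm \<kappa> * (gr * gp)) - 1) = \<zero>\<^bsub>opposite (su2 \<kappa>)\<^esub>"
      using I(5)[OF B(4) I(8)[OF B(1), of "gm \<kappa> * gm \<kappa>"]] by (simp add: S ev(1) algebra_simps)
    show "?ev (gq * gs + gr * gp - 1) = \<zero>\<^bsub>opposite (su2 \<kappa>)\<^esub>"
      using I(5)[OF B(5) B(1)] by (simp add: S ev(1) algebra_simps)
    show "?ev (gm \<kappa> * (gq * gp) - gp * gq) = \<zero>\<^bsub>opposite (su2 \<kappa>)\<^esub>"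
      using I(8)[OF B(3), of "- ?n"] by (simp add: S ev(1) algebra_simps)
    show "?ev (gm \<kappa> * (gq * gr) - gr * gq) = \<zero>\<^bsub>opposite (su2 \<kappa>)\<^esub>"
      using I(8)[OF B(2), of "- gm \<kappa>"] by (simp add: S ev(1) algebra_simps)
  qed
qed

lemma su2_antipode_hom: "su2_antipode \<kappa> \<in> alg_hom (su2 \<kappa>) (opposite (su2 \<kappa>))"
  unfolding su2_antipode_def su2_antipode_value_eq
  by (rule su2_induced_hom[OF assoc_algebra_su2_opposite _ su2_antipode_null]) auto

lemma su2_antipode_cls: "su2_antipode \<kappa> (cls \<kappa> f) =
    free_eval (opposite (su2 \<kappa>)) (\<lambda>x. cls \<kappa> (su2_antipode_value \<kappa> x)) f"
  unfolding su2_antipode_def su2_antipode_value_eq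
  by (rule su2_induced_cls[OF assoc_algebra_su2_opposite _ su2_antipode_null]) auto


subsection \<open>Coproduct\<close>

text \<open>\<open>inl f * inr g\<close> plays the role of the pure tensor of f and g in the tensor
  square of the free algebra.\<close>

definition inl :: "su2_free \<Rightarrow> (su2_gen list \<times> su2_gen list) \<Rightarrow>\<^sub>0 complex fls" where
  "inl = free_eval pm_algebra (\<lambda>x. sgl ([x], 0) 1)"

definition inr :: "su2_free \<Rightarrow> (su2_gen list \<times> su2_gen list) \<Rightarrow>\<^sub>0 complex fls" where
  "inr = free_eval pm_algebra (\<lambda>x. sgl (0, [x]) 1)"

interpretation pm: assoc_algebra "pm_algebra :: ('k::comm_ring_1, 'm::monoid_add \<Rightarrow>\<^sub>0 'k) module"
  by (rule assoc_algebra_pm)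

lemma a_inv_pm [simp]: "\<ominus>\<^bsub>pm_algebra\<^esub> (x :: 'm::monoid_add \<Rightarrow>\<^sub>0 'k::comm_ring_1) = - x"
  using pm.minus_equality[of "- x" x] by simp

lemma a_minus_pm [simp]: "x \<ominus>\<^bsub>pm_algebra\<^esub> (y :: 'm::monoid_add \<Rightarrow>\<^sub>0 'k::comm_ring_1) = x - y"
  by (simp add: a_minus_def)

lemma inl_hom: "inl \<in> alg_hom free_algebra pm_algebra" and inr_hom: "inr \<in> alg_hom free_algebra pm_algebra"
  unfolding inl_def inr_def by (rule pm.free_eval_hom; simp)+

lemma inlr_simps:
  "inl (f * g) = inl f * inl g" "inl (f + g) = inl f + inl g" "inl (f - g) = inl f - inl g" "inl (- f) = - inl f"
  "inl 1 = 1" "inl (cst c) = cst c"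
  "inr (f * g) = inr f * inr g" "inr (f + g) = inr f + inr g" "inr (f - g) = inr f - inr g" "inr (- f) = - inr f"
  "inr 1 = 1" "inr (cst c) = cst c"
  by (simp_all add: inl_def inr_def pm.free_eval_simps pm.free_eval_cst)

lemma inlr_gen: "inl (gen x) = sgl ([x], 0) 1" "inr (gen x) = sgl (0, [x]) 1"
  by (simp_all add: inl_def inr_def)

lemma inlr_commute:
  "inr (gen y) * inl (gen x) = inl (gen x) * inr (gen y)"
  "inr (gen y) * (inl (gen x) * z) = inl (gen x) * (inr (gen y) * z)"
  "inl (gen x) * cst c = cst c * inl (gen x)" "inr (gen x) * cst c = cst c * inr (gen x)"
  "inl (gen x) * (cst c * z) = cst c * (inl (gen x) * z)" "inr (gen x) * (cst c * z) = cst c * (inr (gen x) * z)"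
proof -
  show *: "inr (gen y) * inl (gen x) = inl (gen x) * inr (gen y)"
    by (simp add: inlr_gen mult_single)
  show "inr (gen y) * (inl (gen x) * z) = inl (gen x) * (inr (gen y) * z)"
    by (simp add: * flip: mult.assoc)
qed (simp_all add: cst_commute cst_left_commute)

text \<open>The matrix product of g with itself, read off entry by entry; for
  \<open>Rho_star\<close> the factor -\<mu> of the entry (1, 2) has been cancelled.\<close>

definition su2_D :: "real \<Rightarrow> su2_gen \<Rightarrow> (su2_gen list \<times> su2_gen list) \<Rightarrow>\<^sub>0 complex fls" where
  "su2_D \<kappa> x = (case x of Sigma \<Rightarrow> inl gs * inr gs - gm \<kappa> * (inl gp * inr gr)
     | Sigma_star \<Rightarrow> inl gq * inr gq - gm \<kappa> * (inl gr * inr gp)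
     | Rho \<Rightarrow> inl gr * inr gs + inl gq * inr gr | Rho_star \<Rightarrow> inl gs * inr gp + inl gp * inr gq)"

lemma su2_D_simps:
  "su2_D \<kappa> Sigma = inl gs * inr gs - gm \<kappa> * (inl gp * inr gr)"
  "su2_D \<kappa> Sigma_star = inl gq * inr gq - gm \<kappa> * (inl gr * inr gp)"
  "su2_D \<kappa> Rho = inl gr * inr gs + inl gq * inr gr" "su2_D \<kappa> Rho_star = inl gs * inr gp + inl gp * inr gq"
  by (simp_all add: su2_D_def)

section \<open>Compatibility of the coproduct with the relations\<close>

definition e1 :: "real \<Rightarrow> su2_free" where "e1 \<kappa> = gr * gp - gp * gr"
definition e2 :: "real \<Rightarrow> su2_free" where "e2 \<kappa> = gm \<kappa> * (gr * gs) - gs * gr"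
definition e3 :: "real \<Rightarrow> su2_free" where "e3 \<kappa> = gm \<kappa> * (gp * gs) - gs * gp"
definition e4 :: "real \<Rightarrow> su2_free" where "e4 \<kappa> = gs * gq + gm \<kappa> * (gm \<kappa> * (gr * gp)) - 1"
definition e5 :: "real \<Rightarrow> su2_free" where "e5 \<kappa> = gq * gs + gr * gp - 1"
definition e6 :: "real \<Rightarrow> su2_free" where "e6 \<kappa> = gm \<kappa> * (gq * gp) - gp * gq"
definition e7 :: "real \<Rightarrow> su2_free" where "e7 \<kappa> = gm \<kappa> * (gq * gr) - gr * gq"

lemmas e_defs = e1_def e2_def e3_def e4_def e5_def e6_def e7_def

lemma su2_basic_eq: "su2_basic \<kappa> = {e1 \<kappa>, e2 \<kappa>, e3 \<kappa>, e4 \<kappa>, e5 \<kappa>, e6 \<kappa>, e7 \<kappa>}"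
  by (simp add: su2_basic_def e_defs)

abbreviation su2_DD :: "real \<Rightarrow> su2_free \<Rightarrow> (su2_gen list \<times> su2_gen list) \<Rightarrow>\<^sub>0 complex fls" where
  "su2_DD \<kappa> \<equiv> free_eval pm_algebra (su2_D \<kappa>)"

lemmas certificate_simps = e_defs pm.free_eval_simps pm.free_eval_cst su2_D_simps inlr_simps inlr_commute algebra_simps

text \<open>
  Normal ordering each leg of the coproduct of a relation expresses it through the relations of the legs.
\<close>

lemma coproduct_certificate1:
  "su2_DD \<kappa> (e1 \<kappa>) = - ((inl gr * inl gs) * inr (e3 \<kappa>)) + (inl gr * inl gp) * inr (e4 \<kappa>) + inl (e5 \<kappa>) * (inr gr * inr gp) - (inl gq * inl gp) * inr (e7 \<kappa>) + inl (e2 \<kappa>) * (inr gp * inr gs) - inl (e4 \<kappa>) * (inr gp * inr gr) + inl (e1 \<kappa>) * (inr gq * inr gs) + inl (e6 \<kappa>) * (inr gq * inr gr) + inr (e1 \<kappa>) - gm \<kappa> * (gm \<kappa> * ((inl gr * inl gp) * inr (e1 \<kappa>))) - (inl gr * inl gp) * inr (e5 \<kappa>)"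
  by (simp add: certificate_simps)

lemma coproduct_certificate2:
  "su2_DD \<kappa> (e2 \<kappa>) = gm \<kappa> * (inl (e5 \<kappa>) * (inr gr * inr gs)) + inl (e2 \<kappa>) * (inr gs * inr gs) - inl (e4 \<kappa>) * (inr gs * inr gr) - gm \<kappa> * (inl (e1 \<kappa>) * (inr gr * inr gs)) - gm \<kappa> * (inl (e6 \<kappa>) * (inr gr * inr gr)) + inr (e2 \<kappa>)"
  by (simp add: certificate_simps)

lemma coproduct_certificate3:
  "su2_DD \<kappa> (e3 \<kappa>) = gm \<kappa> * (gm \<kappa> * (inl (e3 \<kappa>) * (inr gp * inr gr))) + gm \<kappa> * ((inl gp * inl gs) * inr (e5 \<kappa>)) + (inl gs * inl gs) * inr (e3 \<kappa>) + inl (e3 \<kappa>) * (inr gs * inr gq) - gm \<kappa> * ((inl gp * inl gp) * inr (e7 \<kappa>)) + gm \<kappa> * (gm \<kappa> * (gm \<kappa> * ((inl gp * inl gs) * inr (e1 \<kappa>)))) - gm \<kappa> * ((inl gp * inl gs) * inr (e4 \<kappa>))"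
  by (simp add: certificate_simps)

lemma coproduct_certificate4:
  "su2_DD \<kappa> (e4 \<kappa>) = inl (e4 \<kappa>) * (inr gs * inr gq) + gm \<kappa> * (inl (e2 \<kappa>) * (inr gs * inr gp)) + gm \<kappa> * (inl (e6 \<kappa>) * (inr gr * inr gq)) - gm \<kappa> * (gm \<kappa> * (inl (e1 \<kappa>) * (inr gr * inr gp))) + gm \<kappa> * (gm \<kappa> * (inl (e5 \<kappa>) * (inr gr * inr gp))) + inr (e4 \<kappa>)"
  by (simp add: certificate_simps)

lemma coproduct_certificate5:
  "su2_DD \<kappa> (e5 \<kappa>) = inl (e5 \<kappa>) * (inr gq * inr gs) - gm \<kappa> * (gm \<kappa> * ((inl gr * inl gp) * inr (e1 \<kappa>))) - (inl gr * inl gs) * inr (e3 \<kappa>) + (inl gr * inl gp) * inr (e4 \<kappa>) + inl (e5 \<kappa>) * (inr gr * inr gp) - (inl gq * inl gp) * inr (e7 \<kappa>) + inr (e5 \<kappa>) - (inl gr * inl gp) * inr (e5 \<kappa>)"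
  by (simp add: certificate_simps)

lemma coproduct_certificate6:
  "su2_DD \<kappa> (e6 \<kappa>) = gm \<kappa> * (inl (e5 \<kappa>) * (inr gq * inr gp)) - inl (e4 \<kappa>) * (inr gp * inr gq) - gm \<kappa> * (inl (e2 \<kappa>) * (inr gp * inr gp)) + inl (e6 \<kappa>) * (inr gq * inr gq) - gm \<kappa> * (inl (e1 \<kappa>) * (inr gq * inr gp)) + inr (e6 \<kappa>)"
  by (simp add: certificate_simps)

lemma coproduct_certificate7:
  "su2_DD \<kappa> (e7 \<kappa>) = gm \<kappa> * ((inl gq * inl gr) * inr (e5 \<kappa>)) + gm \<kappa> * (gm \<kappa> * (inl (e7 \<kappa>) * (inr gp * inr gr))) + inl (e7 \<kappa>) * (inr gs * inr gq) - gm \<kappa> * ((inl gr * inl gr) * inr (e3 \<kappa>)) + (inl gq * inl gq) * inr (e7 \<kappa>) + gm \<kappa> * (gm \<kappa> * (gm \<kappa> * ((inl gq * inl gr) * inr (e1 \<kappa>)))) - gm \<kappa> * ((inl gq * inl gr) * inr (e4 \<kappa>))"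
  by (simp add: certificate_simps)

section \<open>Passage from pairs of words to the tensor square of the quantum group\<close>

abbreviation su2T :: "real \<Rightarrow> _" where "su2T \<kappa> \<equiv> tensor (su2 \<kappa>) (su2 \<kappa>)"

lemma tensor_product_su2: "tensor_product (su2 \<kappa>) (su2 \<kappa>)"
  by (simp add: tensor_product_def su2.is_assoc_algebra)

text \<open>The projection of the free tensor square onto that of \<open_dummy> replaced: identities
  between tensors are proved by ring computation upstairs and then mapped down.\<close>

definition theta :: "real \<Rightarrow> ((su2_gen list \<times> su2_gen list) \<Rightarrow>\<^sub>0 complex fls) \<Rightarrow> ((su2_carrier \<times> su2_carrier) \<Rightarrow>\<^sub>0 complex fls) set" where
  "theta \<kappa> = lin_ext (su2T \<kappa>) (\<lambda>(u, w). pure_tensor (su2 \<kappa>) (su2 \<kappa>) (cls \<kappa> (sgl u 1)) (cls \<kappa> (sgl w 1)))"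

context
  fixes \<kappa> :: real
begin

interpretation TT: tensor_product "su2 \<kappa>" "su2 \<kappa>"
  by (rule tensor_product_su2)

lemma theta_hom: "theta \<kappa> \<in> alg_hom pm_algebra (su2T \<kappa>)"
  unfolding theta_def pm_algebra_def
proof (rule TT.T.lin_ext_hom[OF monoid_UNIV])
  show "(case \<one>\<^bsub>\<lparr>carrier = UNIV, monoid.mult = (+), one = 0\<rparr>\<^esub> of (u, w) \<Rightarrow>
      pure_tensor (su2 \<kappa>) (su2 \<kappa>) (cls \<kappa> (sgl u 1)) (cls \<kappa> (sgl w 1))) = \<one>\<^bsub>su2T \<kappa>\<^esub>"
    by (simp add: TT.one_T cls_one zero_prod_def)
qed (auto simp: TT.pure_mult mult_single)

lemma theta_simps:
  "theta \<kappa> (X * Y) = theta \<kappa> X \<otimes>\<^bsub>su2T \<kappa>\<^esub> theta \<kappa> Y" "theta \<kappa> (X + Y) = theta \<kappa> X \<oplus>\<^bsub>su2T \<kappa>\<^esub> theta \<kappa> Y"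
  "theta \<kappa> (cst c * X) = c \<odot>\<^bsub>su2T \<kappa>\<^esub> theta \<kappa> X" "theta \<kappa> X \<in> carrier (su2T \<kappa>)" "theta \<kappa> 1 = \<one>\<^bsub>su2T \<kappa>\<^esub>"
  "theta \<kappa> 0 = \<zero>\<^bsub>su2T \<kappa>\<^esub>" "theta \<kappa> (X - Y) = theta \<kappa> X \<ominus>\<^bsub>su2T \<kappa>\<^esub> theta \<kappa> Y"
proof -
  note H = alg_homD(2-6)[OF theta_hom]
  show "theta \<kappa> (X * Y) = theta \<kappa> X \<otimes>\<^bsub>su2T \<kappa>\<^esub> theta \<kappa> Y" "theta \<kappa> (X + Y) = theta \<kappa> X \<oplus>\<^bsub>su2T \<kappa>\<^esub> theta \<kappa> Y"
    using H(3,4)[of X Y] by simp_all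
  show "theta \<kappa> (cst c * X) = c \<odot>\<^bsub>su2T \<kappa>\<^esub> theta \<kappa> X" "theta \<kappa> X \<in> carrier (su2T \<kappa>)" "theta \<kappa> 1 = \<one>\<^bsub>su2T \<kappa>\<^esub>"
    using H(5)[of X c] H(2)[of X] H(1) by simp_all
  show "theta \<kappa> 0 = \<zero>\<^bsub>su2T \<kappa>\<^esub>" "theta \<kappa> (X - Y) = theta \<kappa> X \<ominus>\<^bsub>su2T \<kappa>\<^esub> theta \<kappa> Y"
    using lin_map_zero[OF assoc_algebra_pm TT.assoc_algebra_T alg_homD(1)[OF theta_hom]]
      lin_map_minus[OF assoc_algebra_pm TT.assoc_algebra_T alg_homD(1)[OF theta_hom], of X Y] by simp_all
qed

lemma theta_gen:
  "theta \<kappa> (inl (gen x)) = pure_tensor (su2 \<kappa>) (su2 \<kappa>) (cls \<kappa> (gen x)) (cls \<kappa> 1)"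
  "theta \<kappa> (inr (gen x)) = pure_tensor (su2 \<kappa>) (su2 \<kappa>) (cls \<kappa> 1) (cls \<kappa> (gen x))"
  unfolding inlr_gen theta_def by (simp_all add: gen_def)

lemma theta_inl: "theta \<kappa> (inl f) = pure_tensor (su2 \<kappa>) (su2 \<kappa>) (cls \<kappa> f) (cls \<kappa> 1)"
proof -
  let ?v = "\<lambda>x. pure_tensor (su2 \<kappa>) (su2 \<kappa>) (cls \<kappa> (gen x)) (cls \<kappa> 1)"
  have "(\<lambda>f. pure_tensor (su2 \<kappa>) (su2 \<kappa>) (cls \<kappa> f) (cls \<kappa> 1)) \<in> alg_hom free_algebra (su2T \<kappa>)"
  proof (intro alg_homI lin_mapI)
    show "pure_tensor (su2 \<kappa>) (su2 \<kappa>) (cls \<kappa> (c \<odot>\<^bsub>free_algebra\<^esub> x)) (cls \<kappa> 1) =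
      c \<odot>\<^bsub>su2T \<kappa>\<^esub> pure_tensor (su2 \<kappa>) (su2 \<kappa>) (cls \<kappa> x) (cls \<kappa> 1)" for c x
      using TT.pure_smult(1)[of "cls \<kappa> x" "cls \<kappa> 1" c] by simp
    show "pure_tensor (su2 \<kappa>) (su2 \<kappa>) (cls \<kappa> (x \<oplus>\<^bsub>free_algebra\<^esub> y)) (cls \<kappa> 1) =
      pure_tensor (su2 \<kappa>) (su2 \<kappa>) (cls \<kappa> x) (cls \<kappa> 1) \<oplus>\<^bsub>su2T \<kappa>\<^esub> pure_tensor (su2 \<kappa>) (su2 \<kappa>) (cls \<kappa> y) (cls \<kappa> 1)" for x y
      using TT.pure_add_left[of "cls \<kappa> x" "cls \<kappa> y" "cls \<kappa> 1"] by simp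
  qed (auto simp: TT.one_T cls_one TT.pure_mult)
  from TT.T.free_eval_unique[of ?v, OF _ this, of f]
  have "pure_tensor (su2 \<kappa>) (su2 \<kappa>) (cls \<kappa> f) (cls \<kappa> 1) = free_eval (su2T \<kappa>) ?v f" by simp
  moreover have "theta \<kappa> (inl f) = free_eval (su2T \<kappa>) ?v f"
    by (rule TT.T.free_eval_unique[of ?v, OF _ alg_hom_comp[OF inl_hom theta_hom]])
      (simp_all add: theta_gen)
  ultimately show ?thesis by simp
qed

lemma theta_inr: "theta \<kappa> (inr f) = pure_tensor (su2 \<kappa>) (su2 \<kappa>) (cls \<kappa> 1) (cls \<kappa> f)"
proof -
  let ?v = "\<lambda>x. pure_tensor (su2 \<kappa>) (su2 \<kappa>) (cls \<kappa> 1) (cls \<kappa> (gen x))"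
  have "(\<lambda>f. pure_tensor (su2 \<kappa>) (su2 \<kappa>) (cls \<kappa> 1) (cls \<kappa> f)) \<in> alg_hom free_algebra (su2T \<kappa>)"
  proof (intro alg_homI lin_mapI)
    show "pure_tensor (su2 \<kappa>) (su2 \<kappa>) (cls \<kappa> 1) (cls \<kappa> (c \<odot>\<^bsub>free_algebra\<^esub> x)) =
      c \<odot>\<^bsub>su2T \<kappa>\<^esub> pure_tensor (su2 \<kappa>) (su2 \<kappa>) (cls \<kappa> 1) (cls \<kappa> x)" for c x
      using TT.pure_smult(2)[of "cls \<kappa> 1" "cls \<kappa> x" c] by simp
    show "pure_tensor (su2 \<kappa>) (su2 \<kappa>) (cls \<kappa> 1) (cls \<kappa> (x \<oplus>\<^bsub>free_algebra\<^esub> y)) =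
      pure_tensor (su2 \<kappa>) (su2 \<kappa>) (cls \<kappa> 1) (cls \<kappa> x) \<oplus>\<^bsub>su2T \<kappa>\<^esub> pure_tensor (su2 \<kappa>) (su2 \<kappa>) (cls \<kappa> 1) (cls \<kappa> y)" for x y
      using TT.pure_add_right[of "cls \<kappa> 1" "cls \<kappa> x" "cls \<kappa> y"] by simp
  qed (auto simp: TT.one_T cls_one TT.pure_mult)
  from TT.T.free_eval_unique[of ?v, OF _ this, of f]
  have "pure_tensor (su2 \<kappa>) (su2 \<kappa>) (cls \<kappa> 1) (cls \<kappa> f) = free_eval (su2T \<kappa>) ?v f" by simp
  moreover have "theta \<kappa> (inr f) = free_eval (su2T \<kappa>) ?v f"
    by (rule TT.T.free_eval_unique[of ?v, OF _ alg_hom_comp[OF inr_hom theta_hom]])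
      (simp_all add: theta_gen)
  ultimately show ?thesis by simp
qed

lemma theta_pure: "theta \<kappa> (inl f * inr g) = pure_tensor (su2 \<kappa>) (su2 \<kappa>) (cls \<kappa> f) (cls \<kappa> g)"
  by (simp add: theta_simps theta_inl theta_inr TT.pure_mult)

text \<open>Every term of a certificate has a relation as one of its legs, so \<open>theta\<close>
  sends it to a multiple of a pure tensor with a zero leg.\<close>

lemma theta_DD_null:
  assumes "r \<in> su2_basic \<kappa>"
  shows "theta \<kappa> (su2_DD \<kappa> r) = \<zero>\<^bsub>su2T \<kappa>\<^esub>"
proof -
  have e: "cls \<kappa> e = \<zero>\<^bsub>su2 \<kappa>\<^esub>" if "e \<in> su2_basic \<kappa>" for e
    using su2_basic_in_ideal that by (auto simp: cls_zero cls_eq_iff)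
  have z: "pure_tensor (su2 \<kappa>) (su2 \<kappa>) \<zero>\<^bsub>su2 \<kappa>\<^esub> (cls \<kappa> x) = \<zero>\<^bsub>su2T \<kappa>\<^esub>"
    "pure_tensor (su2 \<kappa>) (su2 \<kappa>) (cls \<kappa> x) \<zero>\<^bsub>su2 \<kappa>\<^esub> = \<zero>\<^bsub>su2T \<kappa>\<^esub>" for x
    using TT.pure_smult(1)[of "cls \<kappa> 0" "cls \<kappa> x" 0] TT.pure_smult(2)[of "cls \<kappa> x" "cls \<kappa> 0" 0] by (simp_all add: cls_zero)
  have L: "theta \<kappa> (inl e * X) = \<zero>\<^bsub>su2T \<kappa>\<^esub>" if "e \<in> su2_basic \<kappa>" for e X
    by (simp add: theta_simps theta_inl e[OF that] z)
  have R: "theta \<kappa> (X * inr e) = \<zero>\<^bsub>su2T \<kappa>\<^esub>" if "e \<in> su2_basic \<kappa>" for e X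
    by (simp add: theta_simps theta_inr e[OF that] z)
  have R1: "theta \<kappa> (inr e) = \<zero>\<^bsub>su2T \<kappa>\<^esub>" if "e \<in> su2_basic \<kappa>" for e
    using R[OF that, of 1] by simp
  have B: "e1 \<kappa> \<in> su2_basic \<kappa>" "e2 \<kappa> \<in> su2_basic \<kappa>" "e3 \<kappa> \<in> su2_basic \<kappa>" "e4 \<kappa> \<in> su2_basic \<kappa>"
    "e5 \<kappa> \<in> su2_basic \<kappa>" "e6 \<kappa> \<in> su2_basic \<kappa>" "e7 \<kappa> \<in> su2_basic \<kappa>" by (simp_all add: su2_basic_eq)
  have neg: "theta \<kappa> (- X) = \<ominus>\<^bsub>su2T \<kappa>\<^esub> theta \<kappa> X" for X
    using theta_simps(7)[of 0 X] by (simp add: theta_simps a_minus_def)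
  note S = L[OF B(1)] L[OF B(2)] L[OF B(3)] L[OF B(4)] L[OF B(5)] L[OF B(6)] L[OF B(7)]
    R[OF B(1)] R[OF B(2)] R[OF B(3)] R[OF B(4)] R[OF B(5)] R[OF B(6)] R[OF B(7)]
    R1[OF B(1)] R1[OF B(2)] R1[OF B(3)] R1[OF B(4)] R1[OF B(5)] R1[OF B(6)] R1[OF B(7)] theta_simps(2,3,7) neg
  from assms show ?thesis
    unfolding su2_basic_eq
    by (elim insertE emptyE; hypsubst)
      (simp_all only: coproduct_certificate1 coproduct_certificate2 coproduct_certificate3 coproduct_certificate4
        coproduct_certificate5 coproduct_certificate6 coproduct_certificate7 S TT.T.smult_zero TT.T.r_zero TT.T.zero_closed
        a_minus_def TT.T.minus_zero)
qed

lemma su2_coproduct_value: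
  "su2_gen_value \<kappa> (su2T \<kappa>)
     (\<lambda>i j. \<Oplus>\<^bsub>su2T \<kappa>\<^esub>k\<in>{1, 2}. pure_tensor (su2 \<kappa>) (su2 \<kappa>) (su2_matrix \<kappa> i k) (su2_matrix \<kappa> k j)) x =
   theta \<kappa> (su2_D \<kappa> x)"
proof -
  have sum: "(\<Oplus>\<^bsub>su2T \<kappa>\<^esub>k\<in>{1, 2}. pure_tensor (su2 \<kappa>) (su2 \<kappa>) (su2_matrix \<kappa> i k) (su2_matrix \<kappa> k j)) =
     pure_tensor (su2 \<kappa>) (su2 \<kappa>) (su2_matrix \<kappa> i 1) (su2_matrix \<kappa> 1 j) \<oplus>\<^bsub>su2T \<kappa>\<^esub>
     pure_tensor (su2 \<kappa>) (su2 \<kappa>) (su2_matrix \<kappa> i 2) (su2_matrix \<kappa> 2 j)" for i j :: nat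
    by (subst TT.T.finsum_insert) (auto simp: su2_matrix_cls Pi_iff)
  have "c \<odot>\<^bsub>su2T \<kappa>\<^esub> theta \<kappa> X = theta \<kappa> (cst c * X)" for c X
    by (rule theta_simps(3)[symmetric])
  moreover have "cst (inverse (mu \<kappa>)) * (gm \<kappa> * X) = X" for X :: "(su2_gen list \<times> su2_gen list) \<Rightarrow>\<^sub>0 complex fls"
    by (simp flip: mult.assoc cst_hom)
  ultimately show ?thesis
    by (cases x) (simp_all only: su2_gen_value.simps sum, simp_all add: su2_matrix_cls su2_D_simps
      inlr_simps inlr_commute cst_hom algebra_simps flip: theta_pure theta_simps(2))
qed

lemma su2_coproduct_null:
  assumes "r \<in> su2_basic \<kappa>"
  shows "free_eval (su2T \<kappa>) (\<lambda>x. theta \<kappa> (su2_D \<kappa> x)) r = \<zero>\<^bsub>su2T \<kappa>\<^esub>"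
proof -
  have "theta \<kappa> (su2_DD \<kappa> r) = free_eval (su2T \<kappa>) (\<lambda>x. theta \<kappa> (su2_D \<kappa> x)) r"
    by (rule TT.T.free_eval_unique[of "\<lambda>x. theta \<kappa> (su2_D \<kappa> x)", OF _ alg_hom_comp[OF pm.free_eval_hom theta_hom]])
      (simp_all add: theta_simps)
  with theta_DD_null[OF assms] show ?thesis by simp
qed

lemma su2_coproduct_hom: "su2_coproduct \<kappa> \<in> alg_hom (su2 \<kappa>) (su2T \<kappa>)"
  unfolding su2_coproduct_def Let_def su2_coproduct_value
  by (rule su2_induced_hom[OF TT.assoc_algebra_T _ su2_coproduct_null]) (auto simp: theta_simps)

lemma su2_coproduct_cls: "su2_coproduct \<kappa> (cls \<kappa> f) = theta \<kappa> (su2_DD \<kappa> f)"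
proof -
  have "theta \<kappa> (su2_DD \<kappa> f) = free_eval (su2T \<kappa>) (\<lambda>x. theta \<kappa> (su2_D \<kappa> x)) f"
    by (rule TT.T.free_eval_unique[of "\<lambda>x. theta \<kappa> (su2_D \<kappa> x)", OF _ alg_hom_comp[OF pm.free_eval_hom theta_hom]])
      (simp_all add: theta_simps)
  moreover have "su2_coproduct \<kappa> (cls \<kappa> f) = free_eval (su2T \<kappa>) (\<lambda>x. theta \<kappa> (su2_D \<kappa> x)) f"
    unfolding su2_coproduct_def Let_def su2_coproduct_value
    by (rule su2_induced_cls[OF TT.assoc_algebra_T _ su2_coproduct_null]) (auto simp: theta_simps)
  ultimately show ?thesis by simp
qed

end


section \<open>The contraction\<close>

subsection \<open>Generated subalgebras\<close>

context assoc_algebra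
begin

lemma generated_subalgebra:
  assumes "X \<subseteq> carrier A"
  shows "subring (generated_subalgebra A X) A" "submodule (generated_subalgebra A X) scalars A"
    "X \<subseteq> generated_subalgebra A X"
proof -
  let ?F = "{B. (subring B A \<and> submodule B scalars A) \<and> X \<subseteq> B}"
  have g: "generated_subalgebra A X = \<Inter>?F"
    by (simp add: generated_subalgebra_def hull_def)
  have ne: "carrier A \<in> ?F"
    using assms carrier_is_subring carrier_is_submodule by blast
  have sub: "subring B A" if "B \<in> ?F" for B using that by blast
  show "subring (generated_subalgebra A X) A"
    unfolding g
  proof (rule subringI)
    show "\<Inter>?F \<subseteq> carrier A" using ne by blast
  qed (auto intro: subringE[OF sub])
  show "submodule (generated_subalgebra A X) scalars A"
    unfolding g by (rule subspace_Inter) (use ne in auto)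
  show "X \<subseteq> generated_subalgebra A X" unfolding g by blast
qed

lemma generated_subalgebra_induct [consumes 2, case_names gen one add mult smult]:
  assumes "x \<in> generated_subalgebra A X" "X \<subseteq> carrier A"
    and gen: "\<And>x. x \<in> X \<Longrightarrow> P x" and one: "P \<one>"
    and add: "\<And>x y. \<lbrakk>x \<in> carrier A; y \<in> carrier A; P x; P y\<rbrakk> \<Longrightarrow> P (x \<oplus> y)"
    and mult: "\<And>x y. \<lbrakk>x \<in> carrier A; y \<in> carrier A; P x; P y\<rbrakk> \<Longrightarrow> P (x \<otimes> y)"
    and smult: "\<And>c x. \<lbrakk>x \<in> carrier A; P x\<rbrakk> \<Longrightarrow> P (c \<odot> x)"
  shows "P x"
proof -
  let ?K = "{x \<in> carrier A. P x}"
  have neg: "P (\<ominus> x)" if "x \<in> carrier A" "P x" for x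
    using smult[OF that, of "- 1"] that(1) by (simp add: smult_uminus)
  have zero: "P \<zero>" using smult[OF one_closed one, of 0] by simp
  have "subring ?K A" by (rule subringI) (use one add mult neg in auto)
  moreover have "submodule ?K scalars A" by (rule subspaceI) (use zero add smult in auto)
  moreover have "X \<subseteq> ?K" using gen assms(2) by auto
  ultimately have "generated_subalgebra A X \<subseteq> ?K"
    unfolding generated_subalgebra_def by (intro hull_minimal) auto
  with assms(1) show ?thesis by auto
qed

end


subsection \<open>Limits of scalars\<close>

text \<open>A relation instead of a function: that c is integral and what its reduction is are then
  derived together.\<close>

definition fls_limit :: "complex fls \<Rightarrow> complex \<Rightarrow> bool" where
  "fls_limit c l \<longleftrightarrow> (\<exists>C. c = fps_to_fls C \<and> fps_nth C 0 = l)"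

lemma fls_limit_add: "fls_limit c l \<Longrightarrow> fls_limit d m \<Longrightarrow> fls_limit (c + d) (l + m)"
  unfolding fls_limit_def by (metis fps_to_fls_plus fps_add_nth)

lemma fls_limit_diff: "fls_limit c l \<Longrightarrow> fls_limit d m \<Longrightarrow> fls_limit (c - d) (l - m)"
  unfolding fls_limit_def by (metis fps_to_fls_minus fps_sub_nth)

lemma fls_limit_uminus: "fls_limit c l \<Longrightarrow> fls_limit (- c) (- l)"
  unfolding fls_limit_def by (metis fps_to_fls_uminus fps_neg_nth)

lemma fls_limit_mult: "fls_limit c l \<Longrightarrow> fls_limit d m \<Longrightarrow> fls_limit (c * d) (l * m)"
  unfolding fls_limit_def by (metis fls_times_fps_to_fls fps_mult_nth_0)

lemma fls_limit_inverse:
  assumes "fls_limit c l" "l \<noteq> 0"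
  shows "fls_limit (inverse c) (inverse l)"
proof -
  from assms obtain C where C: "c = fps_to_fls C" "fps_nth C 0 = l" by (auto simp: fls_limit_def)
  with assms(2) have "fps_to_fls C * fps_to_fls (inverse C) = 1"
    by (simp add: inverse_mult_eq_1' flip: fls_times_fps_to_fls)
  then have "inverse c = fps_to_fls (inverse C)"
    using C(1) by (simp add: inverse_unique)
  then show ?thesis using C(2) by (auto simp: fls_limit_def)
qed

lemma fls_limit_divide: "fls_limit c l \<Longrightarrow> fls_limit d m \<Longrightarrow> m \<noteq> 0 \<Longrightarrow> fls_limit (c / d) (l / m)"
  by (simp add: divide_inverse fls_limit_mult fls_limit_inverse)

lemma fls_limit_consts:
  "fls_limit 0 0" "fls_limit 1 1" "fls_limit (numeral n) (numeral n)" "fls_limit fls_X 0"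
  "fls_limit (mu \<kappa>) 1" "fls_limit (fps_to_fls C) (fps_nth C 0)"
proof -
  show 1: "fls_limit (fps_to_fls C) (fps_nth C 0)" for C by (auto simp: fls_limit_def)
  show one: "fls_limit 1 1" using 1[of 1] by simp
  show "fls_limit 0 0" using 1[of 0] by simp
  show "fls_limit fls_X 0" using 1[of fps_X] by simp
  show "fls_limit (mu \<kappa>) 1" using 1[of "fps_exp (of_real (1 / \<kappa>))"] by (simp add: mu_def)
  have "fls_limit (of_nat m) (of_nat m)" for m
    by (induction m) (use fls_limit_add[OF one] 1[of 0] in auto)
  from this[of "numeral n"] show "fls_limit (numeral n) (numeral n)" by simp
qed

text \<open>
  The formal variable and its inverse are kept opaque, since the simplifier turns them into shifts.
\<close>

definition hh :: "complex fls" where "hh = fls_X"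
definition hinv :: "complex fls" where "hinv = inverse fls_X"

lemma hh_hinv [simp]: "hh * hinv = 1" "hinv * hh = 1" "hh * (hinv * x) = x" "hinv * (hh * x) = x" "hh \<noteq> 0" "hinv \<noteq> 0"
proof -
  show *: "hh * hinv = 1" "hinv * hh = 1"
    unfolding hh_def hinv_def by (rule right_inverse left_inverse, simp)+
  show "hh * (hinv * x) = x" "hinv * (hh * x) = x" by (simp_all add: * flip: mult.assoc)
  show "hh \<noteq> 0" "hinv \<noteq> 0" using * by (metis mult_zero_left mult_zero_right zero_neq_one)+
qed

lemma fls_cnj_hinv [simp]: "fls_cnj hinv = hinv"
  unfolding hinv_def by (simp only: fls_cnj_inverse fls_cnj_simps)

text \<open>The first-order term of \<mu> = exp(h/\<kappa>), which is the origin of the constant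
  1/\<kappa> in the relations of the limit.\<close>

lemma fls_limit_mu_diff: "fls_limit ((mu \<kappa> - 1) * hinv) (of_real (1 / \<kappa>))"
proof -
  let ?C = "fps_shift 1 (fps_exp (of_real (1 / \<kappa>)) - 1 :: complex fps)"
  have "fps_exp (of_real (1 / \<kappa>)) - 1 = fps_X * ?C"
    by (rule fps_ext) auto
  then have "mu \<kappa> - 1 = fls_X * fps_to_fls ?C"
    unfolding mu_def by (metis fls_times_fps_to_fls fps_X_to_fls fps_to_fls_minus fps_one_to_fls)
  then have "(mu \<kappa> - 1) * hinv = fps_to_fls ?C"
    unfolding hh_def[symmetric] by (simp add: mult.commute mult.left_commute)
  then show ?thesis using fls_limit_consts(6)[of ?C] by simp
qed


subsection \<open>The lattice\<close>

text \<open>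
  Elements of the span of the generators are written in the basis \<open>\<sigma>, \<sigma>\<^sup>*, \<rho>, \<rho>\<^sup>*\<close>, so that linear
  identities reduce to identities between coefficients.
\<close>

definition lc :: "complex fls \<Rightarrow> complex fls \<Rightarrow> complex fls \<Rightarrow> complex fls \<Rightarrow> su2_free" where
  "lc a b c d = cst a * gs + cst b * gq + cst c * gr + cst d * gp"

lemma lc_simps:
  "lc a b c d + lc a' b' c' d' = lc (a + a') (b + b') (c + c') (d + d')"
  "lc a b c d - lc a' b' c' d' = lc (a - a') (b - b') (c - c') (d - d')"
  "- lc a b c d = lc (- a) (- b) (- c) (- d)"
  "cst k * lc a b c d = lc (k * a) (k * b) (k * c) (k * d)"
proof -
  show "cst k * lc a b c d = lc (k * a) (k * b) (k * c) (k * d)"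
    by (simp add: lc_def cst_hom(2) distrib_left mult.assoc)
qed (simp_all add: lc_def cst_hom algebra_simps)

lemma gen_lc: "gs = lc 1 0 0 0" "gq = lc 0 1 0 0" "gr = lc 0 0 1 0" "gp = lc 0 0 0 1"
  by (simp_all add: lc_def)

lemma su2_free_star_lc: "su2_free_star (lc a b c d) = lc (fls_cnj b) (fls_cnj a) (fls_cnj d) (fls_cnj c)"
  by (simp add: lc_def gen_cst)

definition aF where "aF \<kappa> = lc (1/2) (1/2) (1/2) (- mu \<kappa> / 2)"
definition aF' where "aF' \<kappa> = lc (1/2) (1/2) (- mu \<kappa> / 2) (1/2)"
definition wF where "wF \<kappa> = lc (- (hinv / 2)) (hinv / 2) (- (hinv / 2)) (- (hinv * mu \<kappa> / 2))"
definition wF' where "wF' \<kappa> = lc (hinv / 2) (- (hinv / 2)) (- (hinv * mu \<kappa> / 2)) (- (hinv / 2))"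

lemmas gF_defs = aF_def aF'_def wF_def wF'_def

lemma su2_free_star_gF: "su2_free_star (aF \<kappa>) = aF' \<kappa>" "su2_free_star (wF \<kappa>) = wF' \<kappa>"
  by (simp_all add: gF_defs su2_free_star_lc)

lemma su2_a_cls: "su2_a \<kappa> = cls \<kappa> (aF \<kappa>)" and su2_w_cls: "su2_w \<kappa> = cls \<kappa> (wF \<kappa>)"
  unfolding su2_a_def su2_w_def Let_def hinv_def[symmetric]
  by (simp_all add: su2_class_eq gF_defs gen_lc lc_simps field_simps)

lemma one_plus_mu_nonzero: "1 + mu \<kappa> \<noteq> 0"
proof
  assume "1 + mu \<kappa> = 0"
  then have "fls_nth (1 + mu \<kappa>) 0 = 0" by simp
  then show False by (simp add: mu_def)
qed

text \<open>The inverse change of basis. As 1 + \<mu> has constant term 2 it is a unit of the power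
  series ring, so these formulas put \<sigma>, \<sigma>*, \<rho>, \<rho>* into the lattice.\<close>

lemma gen_gF:
  "gs = cst (1 / (1 + mu \<kappa>)) * (gm \<kappa> * aF \<kappa> + aF' \<kappa> + cst hh * (wF' \<kappa> - gm \<kappa> * wF \<kappa>))"
  "gq = cst (1 / (1 + mu \<kappa>)) * (gm \<kappa> * aF' \<kappa> + aF \<kappa> + cst hh * (wF \<kappa> - gm \<kappa> * wF' \<kappa>))"
  "gr = cst (1 / (1 + mu \<kappa>)) * (aF \<kappa> - aF' \<kappa> - cst hh * (wF \<kappa> + wF' \<kappa>))"
  "gp = cst (1 / (1 + mu \<kappa>)) * (aF' \<kappa> - aF \<kappa> - cst hh * (wF \<kappa> + wF' \<kappa>))"
proof -
  have "4 + mu \<kappa> * 4 = 4 * (1 + mu \<kappa>)" by (simp add: distrib_left)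
  then have "4 + mu \<kappa> * 4 \<noteq> 0" using one_plus_mu_nonzero[of \<kappa>] by (metis mult_eq_0_iff zero_neq_numeral)
  then show
    "gs = cst (1 / (1 + mu \<kappa>)) * (gm \<kappa> * aF \<kappa> + aF' \<kappa> + cst hh * (wF' \<kappa> - gm \<kappa> * wF \<kappa>))"
    "gq = cst (1 / (1 + mu \<kappa>)) * (gm \<kappa> * aF' \<kappa> + aF \<kappa> + cst hh * (wF \<kappa> - gm \<kappa> * wF' \<kappa>))"
    "gr = cst (1 / (1 + mu \<kappa>)) * (aF \<kappa> - aF' \<kappa> - cst hh * (wF \<kappa> + wF' \<kappa>))"
    "gp = cst (1 / (1 + mu \<kappa>)) * (aF' \<kappa> - aF \<kappa> - cst hh * (wF \<kappa> + wF' \<kappa>))"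
    unfolding gF_defs gen_lc lc_simps using one_plus_mu_nonzero[of \<kappa>]
    by (auto intro!: arg_cong4[where f = lc] simp: eq_divide_eq field_simps)
qed

definition e2F :: "real \<Rightarrow> e2_gen \<Rightarrow> su2_free" where
  "e2F \<kappa> x = (case x of A0 \<Rightarrow> aF \<kappa> | A0_star \<Rightarrow> aF' \<kappa> | W0 \<Rightarrow> wF \<kappa> | W0_star \<Rightarrow> wF' \<kappa>)"

lemma e2F_simps [simp]:
  "e2F \<kappa> A0 = aF \<kappa>" "e2F \<kappa> A0_star = aF' \<kappa>" "e2F \<kappa> W0 = wF \<kappa>" "e2F \<kappa> W0_star = wF' \<kappa>"
  by (simp_all add: e2F_def)

lemma e2_gen_value_eq: "e2_gen_value \<kappa> x = limit_class \<kappa> (cls \<kappa> (e2F \<kappa> x))"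
  by (cases x) (simp_all add: su2_a_cls su2_w_cls su2_free_star_gF)

lemma fps_algebra: "assoc_algebra (restrict_scalars fps_to_fls (su2 \<kappa>))"
  by (rule assoc_algebra_restrict_scalars[OF su2.is_assoc_algebra]) (simp_all add: fls_times_fps_to_fls)

interpretation latS: assoc_algebra "restrict_scalars fps_to_fls (su2 \<kappa>)" for \<kappa>
  by (rule fps_algebra)

lemma lattice_carrier_eq: "lattice_carrier \<kappa> =
    generated_subalgebra (restrict_scalars fps_to_fls (su2 \<kappa>)) (range (\<lambda>x. cls \<kappa> (e2F \<kappa> x)))"
proof -
  have "range (\<lambda>x. cls \<kappa> (e2F \<kappa> x)) = {cls \<kappa> (aF \<kappa>), cls \<kappa> (aF' \<kappa>), cls \<kappa> (wF \<kappa>), cls \<kappa> (wF' \<kappa>)}"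
    by (auto simp: image_iff) (metis e2F_simps e2_gen.exhaust)+
  then show ?thesis
    by (simp add: lattice_carrier_def su2_a_cls su2_w_cls su2_free_star_gF)
qed

lemma e2F_range: "range (\<lambda>x. cls \<kappa> (e2F \<kappa> x)) \<subseteq> carrier (restrict_scalars fps_to_fls (su2 \<kappa>))"
  by auto

lemma lattice_sub:
  "subring (lattice_carrier \<kappa>) (restrict_scalars fps_to_fls (su2 \<kappa>))"
  "submodule (lattice_carrier \<kappa>) scalars (restrict_scalars fps_to_fls (su2 \<kappa>))"
  "cls \<kappa> (e2F \<kappa> x) \<in> lattice_carrier \<kappa>"
  unfolding lattice_carrier_eq
  by (rule latS.generated_subalgebra(1)[OF e2F_range], rule latS.generated_subalgebra(2)[OF e2F_range],
      rule subsetD[OF latS.generated_subalgebra(3)[OF e2F_range] rangeI])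

lemma lattice_alg_eq: "lattice_alg \<kappa> = (restrict_scalars fps_to_fls (su2 \<kappa>))\<lparr>carrier := lattice_carrier \<kappa>\<rparr>"
  by (simp add: lattice_alg_def restrict_scalars_def)

interpretation lat: assoc_algebra "lattice_alg \<kappa>" for \<kappa>
  unfolding lattice_alg_eq by (rule latS.assoc_algebra_subalgebra[OF lattice_sub(1,2)])

lemma lattice_alg_simps [simp]:
  "carrier (lattice_alg \<kappa>) = lattice_carrier \<kappa>" "mult (lattice_alg \<kappa>) = mult (su2 \<kappa>)"
  "one (lattice_alg \<kappa>) = one (su2 \<kappa>)" "zero (lattice_alg \<kappa>) = zero (su2 \<kappa>)"
  "add (lattice_alg \<kappa>) = add (su2 \<kappa>)" "smult (lattice_alg \<kappa>) c = smult (su2 \<kappa>) (fps_to_fls c)"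
  by (simp_all add: lattice_alg_eq)

lemma lattice_subset: "lattice_carrier \<kappa> \<subseteq> carrier (su2 \<kappa>)"
  using latS.subspaceD(1)[OF lattice_sub(2)] by simp

lemma lattice_closed [intro]:
  "x \<in> lattice_carrier \<kappa> \<Longrightarrow> y \<in> lattice_carrier \<kappa> \<Longrightarrow> x \<oplus>\<^bsub>su2 \<kappa>\<^esub> y \<in> lattice_carrier \<kappa>"
  "x \<in> lattice_carrier \<kappa> \<Longrightarrow> y \<in> lattice_carrier \<kappa> \<Longrightarrow> x \<otimes>\<^bsub>su2 \<kappa>\<^esub> y \<in> lattice_carrier \<kappa>"
  "x \<in> lattice_carrier \<kappa> \<Longrightarrow> fps_to_fls C \<odot>\<^bsub>su2 \<kappa>\<^esub> x \<in> lattice_carrier \<kappa>"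
  "\<one>\<^bsub>su2 \<kappa>\<^esub> \<in> lattice_carrier \<kappa>" "\<zero>\<^bsub>su2 \<kappa>\<^esub> \<in> lattice_carrier \<kappa>"
  using lat.a_closed[of x \<kappa> y] lat.m_closed[of x \<kappa> y] lat.smult_in[of x \<kappa> C] lat.one_closed[of \<kappa>] lat.zero_closed[of \<kappa>]
  by simp_all

lemma cls_lattice:
  "cls \<kappa> f \<in> lattice_carrier \<kappa> \<Longrightarrow> cls \<kappa> g \<in> lattice_carrier \<kappa> \<Longrightarrow> cls \<kappa> (f + g) \<in> lattice_carrier \<kappa>"
  "cls \<kappa> f \<in> lattice_carrier \<kappa> \<Longrightarrow> cls \<kappa> g \<in> lattice_carrier \<kappa> \<Longrightarrow> cls \<kappa> (f * g) \<in> lattice_carrier \<kappa>"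
  "cls \<kappa> f \<in> lattice_carrier \<kappa> \<Longrightarrow> cls \<kappa> (cst (fps_to_fls C) * f) \<in> lattice_carrier \<kappa>"
  "cls \<kappa> 1 \<in> lattice_carrier \<kappa>" "cls \<kappa> 0 \<in> lattice_carrier \<kappa>"
  using lattice_closed(1,2)[of "cls \<kappa> f" \<kappa> "cls \<kappa> g"] lattice_closed(3)[of "cls \<kappa> f" \<kappa> C] lattice_closed(4,5)[of \<kappa>]
  by (simp_all add: cls_one cls_zero)

lemma lattice_induct [consumes 1, case_names gen one add mult smult]:
  assumes "x \<in> lattice_carrier \<kappa>"
    and "\<And>x. P (cls \<kappa> (e2F \<kappa> x))" "P \<one>\<^bsub>su2 \<kappa>\<^esub>"
    and "\<And>x y. \<lbrakk>x \<in> lattice_carrier \<kappa>; y \<in> lattice_carrier \<kappa>; P x; P y\<rbrakk> \<Longrightarrow> P (x \<oplus>\<^bsub>su2 \<kappa>\<^esub> y)"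
    and "\<And>x y. \<lbrakk>x \<in> lattice_carrier \<kappa>; y \<in> lattice_carrier \<kappa>; P x; P y\<rbrakk> \<Longrightarrow> P (x \<otimes>\<^bsub>su2 \<kappa>\<^esub> y)"
    and "\<And>c x. \<lbrakk>x \<in> lattice_carrier \<kappa>; P x\<rbrakk> \<Longrightarrow> P (fps_to_fls c \<odot>\<^bsub>su2 \<kappa>\<^esub> x)"
  shows "P x"
proof -
  have "x \<in> lattice_carrier \<kappa> \<and> P x"
    using assms(1)[unfolded lattice_carrier_eq] e2F_range
    by (rule latS.generated_subalgebra_induct) (use assms(2-) lattice_sub(3) in auto)
  then show ?thesis by simp
qed


subsection \<open>The limit algebra\<close>

abbreviation latC :: "real \<Rightarrow> (complex, su2_carrier) module" where
  "latC \<kappa> \<equiv> restrict_scalars fps_const (lattice_alg \<kappa>)"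

interpretation latC: assoc_algebra "latC \<kappa>" for \<kappa>
  by (rule assoc_algebra_restrict_scalars[OF lat.is_assoc_algebra]) (simp_all flip: fps_const_add fps_const_mult)

lemma h_lattice_ideal: "algebra_ideal (h_lattice \<kappa>) (latC \<kappa>)"
proof -
  have hL: "h_lattice \<kappa> = (\<lambda>x. fps_X \<odot>\<^bsub>lattice_alg \<kappa>\<^esub> x) ` lattice_carrier \<kappa>"
    by (simp add: h_lattice_def)
  have "submodule (h_lattice \<kappa>) scalars (lattice_alg \<kappa>)"
  proof (rule lat.subspaceI)
    show "h_lattice \<kappa> \<subseteq> carrier (lattice_alg \<kappa>)" using lattice_closed(3)[of _ \<kappa> fps_X] unfolding hL by auto
    show "\<zero>\<^bsub>lattice_alg \<kappa>\<^esub> \<in> h_lattice \<kappa>"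
      unfolding hL by (rule image_eqI[of _ _ "\<zero>\<^bsub>lattice_alg \<kappa>\<^esub>"]) (use lat.smult_zero[of \<kappa> fps_X] lattice_closed(5) in auto)
    show "x \<oplus>\<^bsub>lattice_alg \<kappa>\<^esub> y \<in> h_lattice \<kappa>" if xy: "x \<in> h_lattice \<kappa>" "y \<in> h_lattice \<kappa>" for x y
    proof -
      from xy obtain x' y' where "x = fps_X \<odot>\<^bsub>lattice_alg \<kappa>\<^esub> x'" "y = fps_X \<odot>\<^bsub>lattice_alg \<kappa>\<^esub> y'" "x' \<in> lattice_carrier \<kappa>" "y' \<in> lattice_carrier \<kappa>"
        unfolding hL by blast
      then show ?thesis
        unfolding hL using lat.smult_add_r[of x' \<kappa> y' fps_X] lat.a_closed[of x' \<kappa> y'] by (intro image_eqI[of _ _ "x' \<oplus>\<^bsub>lattice_alg \<kappa>\<^esub> y'"]) auto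
    qed
    show "c \<odot>\<^bsub>lattice_alg \<kappa>\<^esub> x \<in> h_lattice \<kappa>" if x: "x \<in> h_lattice \<kappa>" for c x
    proof -
      from x obtain x' where "x = fps_X \<odot>\<^bsub>lattice_alg \<kappa>\<^esub> x'" "x' \<in> lattice_carrier \<kappa>" unfolding hL by blast
      then show ?thesis
        unfolding hL using lat.smult_assoc[of x' \<kappa> fps_X c] lat.smult_assoc[of x' \<kappa> c fps_X] lat.smult_in[of x' \<kappa> c]
        by (intro image_eqI[of _ _ "c \<odot>\<^bsub>lattice_alg \<kappa>\<^esub> x'"]) (auto simp: mult.commute)
    qed
  qed
  then have sg: "subgroup (h_lattice \<kappa>) (add_monoid (lattice_alg \<kappa>))"
    by (rule submodule.axioms(1))
  have m: "y \<otimes>\<^bsub>lattice_alg \<kappa>\<^esub> x \<in> h_lattice \<kappa>" "x \<otimes>\<^bsub>lattice_alg \<kappa>\<^esub> y \<in> h_lattice \<kappa>"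
    if "x \<in> h_lattice \<kappa>" and y: "y \<in> lattice_carrier \<kappa>" for x y
  proof -
    from that obtain x' where x: "x = fps_X \<odot>\<^bsub>lattice_alg \<kappa>\<^esub> x'" "x' \<in> lattice_carrier \<kappa>" unfolding hL by blast
    show "y \<otimes>\<^bsub>lattice_alg \<kappa>\<^esub> x \<in> h_lattice \<kappa>"
      unfolding hL by (rule image_eqI[of _ _ "y \<otimes>\<^bsub>lattice_alg \<kappa>\<^esub> x'"])
        (use x y lat.smult_mult_right[of y \<kappa> x' fps_X] lat.m_closed[of y \<kappa> x'] in auto)
    show "x \<otimes>\<^bsub>lattice_alg \<kappa>\<^esub> y \<in> h_lattice \<kappa>"
      unfolding hL by (rule image_eqI[of _ _ "x' \<otimes>\<^bsub>lattice_alg \<kappa>\<^esub> y"])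
        (use x y lat.smult_mult_left[of x' \<kappa> y fps_X] lat.m_closed[of x' \<kappa> y] in auto)
  qed
  have "subgroup (h_lattice \<kappa>) (add_monoid (latC \<kappa>))"
    using sg by (simp add: restrict_scalars_def subgroup_def m_inv_def)
  then have "ideal (h_lattice \<kappa>) (latC \<kappa>)"
    by (intro idealI[OF latC.ring_axioms]) (use m in auto)
  then show ?thesis by (simp add: algebra_ideal_def latC.is_assoc_algebra)
qed

lemma contraction_eq: "contraction \<kappa> = quot_algebra (latC \<kappa>) (h_lattice \<kappa>)"
  by (simp add: contraction_def)

interpretation E: assoc_algebra "contraction \<kappa>" for \<kappa>
  unfolding contraction_eq by (rule algebra_ideal.assoc_algebra_Q[OF h_lattice_ideal])

lemma limit_class_eq: "limit_class \<kappa> x = h_lattice \<kappa> +>\<^bsub>latC \<kappa>\<^esub> x"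
  by (simp add: limit_class_def a_r_coset_def r_coset_def)

lemma limit_class_hom: "limit_class \<kappa> \<in> alg_hom (latC \<kappa>) (contraction \<kappa>)"
  using algebra_ideal.proj_hom[OF h_lattice_ideal] by (simp add: contraction_eq limit_class_eq[abs_def])

lemma limit_class_simps:
  assumes "x \<in> lattice_carrier \<kappa>" "y \<in> lattice_carrier \<kappa>"
  shows "limit_class \<kappa> (x \<oplus>\<^bsub>su2 \<kappa>\<^esub> y) = limit_class \<kappa> x \<oplus>\<^bsub>contraction \<kappa>\<^esub> limit_class \<kappa> y"
    "limit_class \<kappa> (x \<otimes>\<^bsub>su2 \<kappa>\<^esub> y) = limit_class \<kappa> x \<otimes>\<^bsub>contraction \<kappa>\<^esub> limit_class \<kappa> y"
    "limit_class \<kappa> x \<in> carrier (contraction \<kappa>)"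
  using alg_homD(3-5)[OF limit_class_hom] assms by auto

lemma limit_class_one: "limit_class \<kappa> \<one>\<^bsub>su2 \<kappa>\<^esub> = \<one>\<^bsub>contraction \<kappa>\<^esub>"
  using alg_homD(2)[OF limit_class_hom, of \<kappa>] by simp

lemma limit_class_zero: "limit_class \<kappa> \<zero>\<^bsub>su2 \<kappa>\<^esub> = \<zero>\<^bsub>contraction \<kappa>\<^esub>"
  using lin_map_zero[OF latC.is_assoc_algebra E.is_assoc_algebra alg_homD(1)[OF limit_class_hom], of \<kappa>] by simp

lemma limit_class_h: "x \<in> lattice_carrier \<kappa> \<Longrightarrow> limit_class \<kappa> (fls_X \<odot>\<^bsub>su2 \<kappa>\<^esub> x) = \<zero>\<^bsub>contraction \<kappa>\<^esub>"
  using algebra_ideal.proj_zero_iff[OF h_lattice_ideal, of "fls_X \<odot>\<^bsub>su2 \<kappa>\<^esub> x" \<kappa>] lattice_closed(3)[of x \<kappa> fps_X]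
  by (auto simp: limit_class_eq contraction_eq quot_algebra_simps h_lattice_def)

lemma limit_class_eqD:
  assumes "x \<in> lattice_carrier \<kappa>" "y \<in> lattice_carrier \<kappa>" "limit_class \<kappa> x = limit_class \<kappa> y"
  obtains z where "z \<in> lattice_carrier \<kappa>" "x = y \<oplus>\<^bsub>su2 \<kappa>\<^esub> fls_X \<odot>\<^bsub>su2 \<kappa>\<^esub> z"
proof -
  have "x \<ominus>\<^bsub>latC \<kappa>\<^esub> y \<in> h_lattice \<kappa>"
    using algebra_ideal.proj_eq_iff[OF h_lattice_ideal, of x \<kappa> y] assms by (simp add: limit_class_eq)
  then obtain z where z: "z \<in> lattice_carrier \<kappa>" "x \<ominus>\<^bsub>lattice_alg \<kappa>\<^esub> y = fps_X \<odot>\<^bsub>lattice_alg \<kappa>\<^esub> z"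
    unfolding h_lattice_def by (auto simp: a_minus_def)
  have "x = y \<oplus>\<^bsub>lattice_alg \<kappa>\<^esub> (x \<ominus>\<^bsub>lattice_alg \<kappa>\<^esub> y)"
    using assms(1,2) lat.r_neg1[of y \<kappa> x] lat.a_comm[of "x" \<kappa> "\<ominus>\<^bsub>lattice_alg \<kappa>\<^esub> y"] lat.a_inv_closed[of y \<kappa>]
    by (simp add: a_minus_def) (metis lat.a_lcomm lat.l_neg lat.r_neg lat.r_zero lattice_alg_simps(1,5))
  with z that show ?thesis by simp
qed

text \<open>A power series differs from its constant term by a multiple of h, and h annihilates the
  limit.\<close>

lemma limit_class_smult:
  assumes "x \<in> lattice_carrier \<kappa>"
  shows "limit_class \<kappa> (fps_to_fls c \<odot>\<^bsub>su2 \<kappa>\<^esub> x) = fps_nth c 0 \<odot>\<^bsub>contraction \<kappa>\<^esub> limit_class \<kappa> x"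
proof -
  have c: "c = fps_const (fps_nth c 0) + fps_X * fps_shift 1 c"
    by (rule fps_ext) (auto simp: fps_X_mult_nth)
  have "fps_to_fls c = fps_to_fls (fps_const (fps_nth c 0)) + fls_X * fps_to_fls (fps_shift 1 c)"
    by (subst c) (simp add: fls_times_fps_to_fls del: fps_const_0_eq_0)
  then have "fps_to_fls c \<odot>\<^bsub>su2 \<kappa>\<^esub> x = fps_to_fls (fps_const (fps_nth c 0)) \<odot>\<^bsub>su2 \<kappa>\<^esub> x \<oplus>\<^bsub>su2 \<kappa>\<^esub>
      fls_X \<odot>\<^bsub>su2 \<kappa>\<^esub> (fps_to_fls (fps_shift 1 c) \<odot>\<^bsub>su2 \<kappa>\<^esub> x)"
    using assms lattice_subset by (auto simp: su2.smult_add_l su2.smult_assoc subset_iff)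
  moreover have "limit_class \<kappa> (fps_to_fls (fps_const (fps_nth c 0)) \<odot>\<^bsub>su2 \<kappa>\<^esub> x) = fps_nth c 0 \<odot>\<^bsub>contraction \<kappa>\<^esub> limit_class \<kappa> x"
    using alg_homD(6)[OF limit_class_hom, of x \<kappa> "fps_nth c 0"] assms by simp
  moreover have "fls_X \<odot>\<^bsub>su2 \<kappa>\<^esub> (fps_to_fls (fps_shift 1 c) \<odot>\<^bsub>su2 \<kappa>\<^esub> x) \<in> lattice_carrier \<kappa>"
    using lattice_closed(3)[OF lattice_closed(3)[OF assms], of fps_X "fps_shift 1 c"] by simp
  ultimately show ?thesis
    using lattice_closed(3)[OF assms, of "fps_const (fps_nth c 0)"] assms lattice_closed(3) limit_class_h[OF lattice_closed(3)[OF assms]] limit_class_simps(3)[OF assms]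
    by (simp add: limit_class_simps(1))
qed

lemma contraction_carrierE:
  assumes "X \<in> carrier (contraction \<kappa>)"
  obtains x where "x \<in> lattice_carrier \<kappa>" "X = limit_class \<kappa> x"
  using assms algebra_ideal.carrier_Q[OF h_lattice_ideal, of \<kappa>] by (auto simp: contraction_eq limit_class_eq)


subsection \<open>The relations of the limit\<close>

abbreviation ev :: "real \<Rightarrow> (e2_gen list \<Rightarrow>\<^sub>0 complex) \<Rightarrow> contraction_carrier" where
  "ev \<kappa> \<equiv> free_eval (contraction \<kappa>) (e2_gen_value \<kappa>)"

lemma limit_class_closed: "x \<in> lattice_carrier \<kappa> \<Longrightarrow> limit_class \<kappa> x \<in> carrier (contraction \<kappa>)"
  by (rule limit_class_simps(3))

lemma e2_gen_value_closed [simp]: "e2_gen_value \<kappa> x \<in> carrier (contraction \<kappa>)"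
  unfolding e2_gen_value_eq by (rule limit_class_closed[OF lattice_sub(3)])

lemmas ev_simps = E.free_eval_simps[OF e2_gen_value_closed] E.free_eval_smult[OF e2_gen_value_closed]
  E.free_eval_gen[OF e2_gen_value_closed]

lemma ev_closed [simp]: "ev \<kappa> f \<in> carrier (contraction \<kappa>)"
  by (rule E.free_eval_closed) simp

text \<open>A calculus of limits: X is a representative over Laurent series whose class lies in the
  lattice and reduces to the value of f. An identity between representatives modulo
  \<open>su2_ideal\<close> then yields an element of \<open>ev_ker\<close>.\<close>

definition reduces :: "real \<Rightarrow> (e2_gen list \<Rightarrow>\<^sub>0 complex) \<Rightarrow> su2_free \<Rightarrow> bool" where
  "reduces \<kappa> f X \<longleftrightarrow> cls \<kappa> X \<in> lattice_carrier \<kappa> \<and> ev \<kappa> f = limit_class \<kappa> (cls \<kappa> X)"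

lemma reduces_gen: "reduces \<kappa> (gen x) (e2F \<kappa> x)"
  by (simp add: reduces_def lattice_sub(3) ev_simps e2_gen_value_eq)

lemma reduces_one: "reduces \<kappa> 1 1"
  using limit_class_one[of \<kappa>] by (simp add: reduces_def cls_lattice ev_simps cls_one)

lemma reduces_add: "reduces \<kappa> f X \<Longrightarrow> reduces \<kappa> g Y \<Longrightarrow> reduces \<kappa> (f + g) (X + Y)"
  using limit_class_simps(1)[of "cls \<kappa> X" \<kappa> "cls \<kappa> Y"] by (auto simp: reduces_def cls_lattice ev_simps)

lemma reduces_mult: "reduces \<kappa> f X \<Longrightarrow> reduces \<kappa> g Y \<Longrightarrow> reduces \<kappa> (f * g) (X * Y)"
  using limit_class_simps(2)[of "cls \<kappa> X" \<kappa> "cls \<kappa> Y"] by (auto simp: reduces_def cls_lattice ev_simps)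

lemma reduces_smult:
  assumes "reduces \<kappa> f X" "fls_limit c l"
  shows "reduces \<kappa> (cst l * f) (cst c * X)"
proof -
  from assms(2) obtain C where C: "c = fps_to_fls C" "l = fps_nth C 0" by (auto simp: fls_limit_def)
  then show ?thesis
    using assms(1) limit_class_smult[of "cls \<kappa> X" \<kappa> C] cls_lattice(3)[of \<kappa> X C]
    by (simp add: reduces_def E.free_eval_smult[OF e2_gen_value_closed])
qed

lemma reduces_diff: "reduces \<kappa> f X \<Longrightarrow> reduces \<kappa> g Y \<Longrightarrow> reduces \<kappa> (f - g) (X - Y)"
  using reduces_add[of \<kappa> f X, OF _ reduces_smult[OF _ fls_limit_uminus[OF fls_limit_consts(2)]], of g Y]
  by (simp add: cst_hom)

lemma reduces_cong: "reduces \<kappa> f X \<Longrightarrow> X - Y \<in> su2_ideal \<kappa> \<Longrightarrow> reduces \<kappa> f Y"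
  by (simp add: reduces_def flip: cls_eq_iff)

definition ev_ker :: "real \<Rightarrow> (e2_gen list \<Rightarrow>\<^sub>0 complex) set" where
  "ev_ker \<kappa> = {f. ev \<kappa> f = \<zero>\<^bsub>contraction \<kappa>\<^esub>}"

lemma ev_ker_closed:
  "f \<in> ev_ker \<kappa> \<Longrightarrow> g \<in> ev_ker \<kappa> \<Longrightarrow> f + g \<in> ev_ker \<kappa>" "f \<in> ev_ker \<kappa> \<Longrightarrow> g \<in> ev_ker \<kappa> \<Longrightarrow> f - g \<in> ev_ker \<kappa>"
  "f \<in> ev_ker \<kappa> \<Longrightarrow> f * g \<in> ev_ker \<kappa>" "f \<in> ev_ker \<kappa> \<Longrightarrow> g * f \<in> ev_ker \<kappa>" "f \<in> ev_ker \<kappa> \<Longrightarrow> - f \<in> ev_ker \<kappa>" "0 \<in> ev_ker \<kappa>"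
  by (simp_all add: ev_ker_def ev_simps)

lemma reduces_unique: "reduces \<kappa> f X \<Longrightarrow> reduces \<kappa> g X \<Longrightarrow> f - g \<in> ev_ker \<kappa>"
  by (simp add: reduces_def ev_ker_def ev_simps E.r_right_minus_eq limit_class_closed)

lemma reduces_eq:
  "reduces \<kappa> f X \<Longrightarrow> reduces \<kappa> g Y \<Longrightarrow> X - Y \<in> su2_ideal \<kappa> \<Longrightarrow> f - g \<in> ev_ker \<kappa>"
  using reduces_unique reduces_cong by blast

abbreviation ga :: "e2_gen list \<Rightarrow>\<^sub>0 complex" where "ga \<equiv> gen A0"
abbreviation gb :: "e2_gen list \<Rightarrow>\<^sub>0 complex" where "gb \<equiv> gen A0_star"
abbreviation gw :: "e2_gen list \<Rightarrow>\<^sub>0 complex" where "gw \<equiv> gen W0"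
abbreviation gz :: "e2_gen list \<Rightarrow>\<^sub>0 complex" where "gz \<equiv> gen W0_star"

lemma fls_limit_hh: "fls_limit hh 0"
  unfolding hh_def by (rule fls_limit_consts)

lemma reduces_gens:
  "reduces \<kappa> ga (aF \<kappa>)" "reduces \<kappa> gb (aF' \<kappa>)" "reduces \<kappa> gw (wF \<kappa>)" "reduces \<kappa> gz (wF' \<kappa>)"
  using reduces_gen[of \<kappa> A0] reduces_gen[of \<kappa> A0_star] reduces_gen[of \<kappa> W0] reduces_gen[of \<kappa> W0_star] by simp_all

text \<open>This is \<open>gen_gF\<close> at \<mu> = 1 and h = 0: \<sigma> and \<sigma>* coincide in
  the limit, and \<rho>* becomes -\<rho>.\<close>

lemma reduces_su2_gens:
  "reduces \<kappa> (cst (1/2) * (ga + gb)) gs" "reduces \<kappa> (cst (1/2) * (ga + gb)) gq"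
  "reduces \<kappa> (cst (1/2) * (ga - gb)) gr" "reduces \<kappa> (cst (1/2) * (gb - ga)) gp"
proof -
  note g = reduces_gens[of \<kappa>]
  have l: "fls_limit (1 / (1 + mu \<kappa>)) (1 / (1 + 1))"
    by (intro fls_limit_divide fls_limit_add fls_limit_consts) simp
  note R = reduces_smult[OF _ l]
  note m = reduces_smult[OF _ fls_limit_consts(5)[of \<kappa>]] and h = reduces_smult[OF _ fls_limit_hh]
  show "reduces \<kappa> (cst (1/2) * (ga + gb)) gs"
    using R[OF reduces_add[OF reduces_add[OF m[OF g(1)] g(2)] h[OF reduces_diff[OF g(4) m[OF g(3)]]]]]
    by (simp flip: gen_gF)
  have "reduces \<kappa> (cst (1/2) * (gb + ga)) gq"
    using R[OF reduces_add[OF reduces_add[OF m[OF g(2)] g(1)] h[OF reduces_diff[OF g(3) m[OF g(4)]]]]]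
    by (simp flip: gen_gF)
  then show "reduces \<kappa> (cst (1/2) * (ga + gb)) gq" by (simp add: add.commute)
  show "reduces \<kappa> (cst (1/2) * (ga - gb)) gr"
    using R[OF reduces_diff[OF reduces_diff[OF g(1,2)] h[OF reduces_add[OF g(3,4)]]]]
    by (simp flip: gen_gF)
  show "reduces \<kappa> (cst (1/2) * (gb - ga)) gp"
    using R[OF reduces_diff[OF reduces_diff[OF g(2,1)] h[OF reduces_add[OF g(3,4)]]]]
    by (simp flip: gen_gF)
qed

lemma cst_permute: "cst c * (cst d * f) = cst d * (cst c * (f :: 'm::monoid_add \<Rightarrow>\<^sub>0 'k::comm_ring_1))"
  by (rule cst_left_commute)

section \<open>Commutators of sums and differences of the lattice generators\<close>

abbreviation gi :: "real \<Rightarrow> su2_free" where "gi \<kappa> \<equiv> cst (inverse (mu \<kappa>))"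

text \<open>Sums and differences are better adapted to the relations than the generators: a - a* and
  w + w* are multiples of \<rho> - \<rho>* and \<rho> + \<rho>*, each of which merely scales on
  passing \<sigma> or \<sigma>*.\<close>

lemma sum_diff_gF:
  "aF \<kappa> + aF' \<kappa> = gs + gq + cst ((1 - mu \<kappa>) / 2) * (gr + gp)"
  "aF \<kappa> - aF' \<kappa> = cst ((1 + mu \<kappa>) / 2) * (gr - gp)"
  "wF \<kappa> + wF' \<kappa> = cst (- (hinv * (1 + mu \<kappa>) / 2)) * (gr + gp)"
  "wF' \<kappa> - wF \<kappa> = cst hinv * (gs - gq) + cst (hinv * (1 - mu \<kappa>) / 2) * (gr - gp)"
  unfolding gF_defs gen_lc lc_simps by (auto intro!: arg_cong4[where f = lc] simp: field_simps)

text \<open>Carries a commutator formula from y = \<rho> - \<rho>* or y = \<rho> + \<rho>* over to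
  the multiples a - a* and w + w*.\<close>

lemma commutator_scale:
  assumes "x * y - y * x - (cst k * (y * f) + cst l * (y * g)) \<in> su2_ideal \<kappa>"
  shows "x * (cst c * y) - (cst c * y) * x - (cst k * ((cst c * y) * f) + cst l * ((cst c * y) * g)) \<in> su2_ideal \<kappa>"
  using Idl_free(8)[OF assms, of "cst c"]
  by (simp add: right_diff_distrib distrib_left mult.assoc cst_left_commute[of x c]
      cst_left_commute[of "cst k" c] cst_left_commute[of "cst l" c])

text \<open>Here s, q, r, p stand for \<sigma>, \<sigma>*, \<rho>, \<rho>* and H, E, M, G for 1/h,
  (1 - \<mu>)/2, \<mu>, 1/\<mu>. Each left side is a commutator minus its intended value, each right
  side a combination of expressions that lie in the defining ideal.\<close>

lemma commutator_identities:
  fixes s q r p y H E M G :: "'a::ring_1"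
  assumes "\<And>z. s * (H * z) = H * (s * z)" "\<And>z. q * (H * z) = H * (q * z)" "\<And>z. r * (H * z) = H * (r * z)" "\<And>z. p * (H * z) = H * (p * z)"
    "\<And>z. y * (H * z) = H * (y * z)" "\<And>z. E * (H * z) = H * (E * z)"
    "\<And>z. s * (E * z) = E * (s * z)" "\<And>z. q * (E * z) = E * (q * z)" "\<And>z. r * (E * z) = E * (r * z)" "\<And>z. p * (E * z) = E * (p * z)"
    "\<And>z. y * (E * z) = E * (y * z)"
  shows "(s + q + E * (r + p)) * y - y * (s + q + E * (r + p)) - ((M - 1) * (y * s) + (G - 1) * (y * q)) =
      (s * y - M * (y * s)) + (q * y - G * (y * q)) + E * ((r + p) * y - y * (r + p))"
    and "(H * (s - q) + H * (E * (r - p))) * y - y * (H * (s - q) + H * (E * (r - p)))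
        - (H * ((M - 1) * (y * s)) + H * ((1 - G) * (y * q))) =
      H * ((s * y - M * (y * s)) - (q * y - G * (y * q)) + E * ((r - p) * y - y * (r - p)))"
    and "(H * (s - q) + H * (E * (r - p))) * (s + q + E * (r + p)) - (s + q + E * (r + p)) * (H * (s - q) + H * (E * (r - p)))
        - (H * ((1 - M * M) * (r * p) + (1 - M * M) * (r * p))
          + E * (H * ((M - 1) * ((r + p) * s)) + H * ((1 - G) * ((r + p) * q)))
          - H * (E * ((M - 1) * ((r - p) * s) + (G - 1) * ((r - p) * q)))) =
      H * (((s * q + M * (M * (r * p)) - 1) - (q * s + r * p - 1)) + ((s * q + M * (M * (r * p)) - 1) - (q * s + r * p - 1))
        + E * ((s * (r + p) - M * ((r + p) * s)) - (q * (r + p) - G * ((r + p) * q)))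
        - E * ((s * (r - p) - M * ((r - p) * s)) + (q * (r - p) - G * ((r - p) * q)))
        + E * (E * ((r - p) * (r + p) - (r + p) * (r - p))))"
  by (simp_all add: algebra_simps assms)

text \<open>On the left each 1/h stands next to a difference that vanishes with h, so that limits
  can be taken; on the right is the form in which \<open>commutator_identities\<close> uses the
  coefficients.\<close>

lemma commutator_coeffs:
  "cst (hinv * (1 - mu \<kappa>) / 2) * f = cst hinv * (cst ((1 - mu \<kappa>) / 2) * f)"
  "cst ((mu \<kappa> - 1) * hinv) * f = cst hinv * ((gm \<kappa> - 1) * f)"
  "cst ((1 - inverse (mu \<kappa>)) * hinv) * f = cst hinv * ((1 - gi \<kappa>) * f)"
  "cst (mu \<kappa> - 1) * f = (gm \<kappa> - 1) * f" "cst (inverse (mu \<kappa>) - 1) * f = (gi \<kappa> - 1) * f"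
  "cst (2 * ((1 - mu \<kappa> ^ 2) * hinv)) * f = cst hinv * ((1 - gm \<kappa> * gm \<kappa>) * f + (1 - gm \<kappa> * gm \<kappa>) * f)"
  for f :: su2_free
proof -
  have "2 * ((1 - mu \<kappa> ^ 2) * hinv) = hinv * ((1 - mu \<kappa> * mu \<kappa>) + (1 - mu \<kappa> * mu \<kappa>))"
    by (simp add: power2_eq_square algebra_simps)
  then show "cst (2 * ((1 - mu \<kappa> ^ 2) * hinv)) * f = cst hinv * ((1 - gm \<kappa> * gm \<kappa>) * f + (1 - gm \<kappa> * gm \<kappa>) * f)"
    by (simp only: cst_hom cst_simps distrib_right mult.assoc)
qed (simp_all add: mult.assoc mult.commute[of _ hinv] cst_hom(2)[symmetric] flip: cst_hom(3) cst_simps(2) mult.assoc)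

text \<open>The rules for y multiply it by \<mu> on passing \<sigma> and by 1/\<mu> on passing
  \<sigma>*. Subtracting y itself leaves factors \<mu> - 1 and 1/\<mu> - 1, which compensate the 1/h
  in w* - w.\<close>

lemma commutator_P_v:
  assumes y: "gs * y - gm \<kappa> * (y * gs) \<in> su2_ideal \<kappa>" "gq * y - gi \<kappa> * (y * gq) \<in> su2_ideal \<kappa>"
    "(gr + gp) * y - y * (gr + gp) \<in> su2_ideal \<kappa>" "(gr - gp) * y - y * (gr - gp) \<in> su2_ideal \<kappa>"
  shows "(aF \<kappa> + aF' \<kappa>) * y - y * (aF \<kappa> + aF' \<kappa>)
     - (cst (mu \<kappa> - 1) * (y * gs) + cst (inverse (mu \<kappa>) - 1) * (y * gq)) \<in> su2_ideal \<kappa>"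
    and "(wF' \<kappa> - wF \<kappa>) * y - y * (wF' \<kappa> - wF \<kappa>)
     - (cst ((mu \<kappa> - 1) * hinv) * (y * gs) + cst ((1 - inverse (mu \<kappa>)) * hinv) * (y * gq)) \<in> su2_ideal \<kappa>"
  unfolding sum_diff_gF commutator_coeffs
  by (subst commutator_identities(1,2); (rule cst_left_commute | intro Idl_free(4,5,8)[where R = "su2_relations \<kappa>"] y))+

lemma cst_cancel_ideal:
  assumes "cst c * f \<in> su2_ideal \<kappa>" "c \<noteq> 0"
  shows "f \<in> su2_ideal \<kappa>"
proof -
  have "cst (inverse c) * (cst c * f) = f"
    using assms(2) by (simp flip: mult.assoc cst_hom)
  then show ?thesis using Idl_free(8)[OF assms(1), of "cst (inverse c)"] by simp
qed

lemma e_in_ideal: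
  "e1 \<kappa> \<in> su2_ideal \<kappa>" "e2 \<kappa> \<in> su2_ideal \<kappa>" "e3 \<kappa> \<in> su2_ideal \<kappa>" "e4 \<kappa> \<in> su2_ideal \<kappa>"
  "e5 \<kappa> \<in> su2_ideal \<kappa>" "e6 \<kappa> \<in> su2_ideal \<kappa>" "e7 \<kappa> \<in> su2_ideal \<kappa>"
  using su2_basic_in_ideal[of \<kappa>] by (auto simp: su2_basic_eq)

lemma y_plus_minus:
  fixes \<epsilon> :: "complex fls"
  assumes "\<epsilon> = 1 \<or> \<epsilon> = - 1"
  defines "y \<equiv> gr + cst \<epsilon> * gp"
  shows "gs * y - gm \<kappa> * (y * gs) \<in> su2_ideal \<kappa>" "gq * y - gi \<kappa> * (y * gq) \<in> su2_ideal \<kappa>"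
    "(gr + gp) * y - y * (gr + gp) \<in> su2_ideal \<kappa>" "(gr - gp) * y - y * (gr - gp) \<in> su2_ideal \<kappa>"
proof -
  note I = Idl_free[where R = "su2_relations \<kappa>"]
  note e = e_in_ideal[of \<kappa>]
  show "gs * y - gm \<kappa> * (y * gs) \<in> su2_ideal \<kappa>"
    using I(6)[OF I(4)[OF e(2) I(8)[OF e(3), of "cst \<epsilon>"]]]
    by (simp add: y_def e_defs algebra_simps gen_cst cst_permute[of \<epsilon>])
  \<comment> \<open>The relations supply the rule for \<sigma>* multiplied by \<mu>; this unit is
    cancelled afterwards.\<close>
  have "gm \<kappa> * (gq * y - gi \<kappa> * (y * gq)) \<in> su2_ideal \<kappa>"
    using I(4)[OF e(7) I(8)[OF e(6), of "cst \<epsilon>"]]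
    by (simp add: y_def e_defs algebra_simps gen_cst cst_permute[of \<epsilon>] inverse_mu_cst)
  then show "gq * y - gi \<kappa> * (y * gq) \<in> su2_ideal \<kappa>"
    by (rule cst_cancel_ideal) simp
  show "(gr + gp) * y - y * (gr + gp) \<in> su2_ideal \<kappa>"
    using assms(1)
  proof
    assume "\<epsilon> = 1" then show ?thesis using I(3) by (simp add: y_def)
  next
    assume "\<epsilon> = - 1" then show ?thesis
      using I(6)[OF I(4)[OF e(1) e(1)]] by (simp add: y_def e_defs algebra_simps cst_hom)
  qed
  show "(gr - gp) * y - y * (gr - gp) \<in> su2_ideal \<kappa>"
    using assms(1)
  proof
    assume "\<epsilon> = 1" then show ?thesis using I(4)[OF e(1) e(1)] by (simp add: y_def e_defs algebra_simps)
  next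
    assume "\<epsilon> = - 1" then show ?thesis using I(3) by (simp add: y_def cst_hom)
  qed
qed

lemma y_plus_minus':
  "gs * (gr + gp) - gm \<kappa> * ((gr + gp) * gs) \<in> su2_ideal \<kappa>" "gq * (gr + gp) - gi \<kappa> * ((gr + gp) * gq) \<in> su2_ideal \<kappa>"
  "(gr + gp) * (gr + gp) - (gr + gp) * (gr + gp) \<in> su2_ideal \<kappa>" "(gr - gp) * (gr + gp) - (gr + gp) * (gr - gp) \<in> su2_ideal \<kappa>"
  "gs * (gr - gp) - gm \<kappa> * ((gr - gp) * gs) \<in> su2_ideal \<kappa>" "gq * (gr - gp) - gi \<kappa> * ((gr - gp) * gq) \<in> su2_ideal \<kappa>"
  "(gr + gp) * (gr - gp) - (gr - gp) * (gr + gp) \<in> su2_ideal \<kappa>" "(gr - gp) * (gr - gp) - (gr - gp) * (gr - gp) \<in> su2_ideal \<kappa>"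
  using y_plus_minus[of 1 \<kappa>] y_plus_minus[of "- 1" \<kappa>] by (simp_all add: cst_hom)

text \<open>The main term is twice the commutator of \<sigma> and \<sigma>* divided by h, and the
  two unitarity relations evaluate that commutator as (1 - \<mu>^2) \<rho>\<rho>*. The remaining
  terms have coefficients that vanish in the limit.\<close>

lemma commutator_v_P:
  "(wF' \<kappa> - wF \<kappa>) * (aF \<kappa> + aF' \<kappa>) - (aF \<kappa> + aF' \<kappa>) * (wF' \<kappa> - wF \<kappa>)
    - (cst (2 * ((1 - mu \<kappa> ^ 2) * hinv)) * (gr * gp)
      + cst ((1 - mu \<kappa>) / 2) * (cst ((mu \<kappa> - 1) * hinv) * ((gr + gp) * gs) + cst ((1 - inverse (mu \<kappa>)) * hinv) * ((gr + gp) * gq))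
      - cst (hinv * (1 - mu \<kappa>) / 2) * (cst (mu \<kappa> - 1) * ((gr - gp) * gs) + cst (inverse (mu \<kappa>) - 1) * ((gr - gp) * gq))) \<in> su2_ideal \<kappa>"
  unfolding sum_diff_gF commutator_coeffs
  by (subst commutator_identities(3)[where y = 0];
      (rule cst_left_commute | simp only: mult_zero_left mult_zero_right
      | intro Idl_free(4,5,8)[where R = "su2_relations \<kappa>"] e_in_ideal[unfolded e_defs] y_plus_minus'))

text \<open>
  With \<open>P = a + a*\<close>, \<open>d = a - a*\<close>, \<open>u = w + w*\<close>, \<open>v = w* - w\<close>, the limits of the relations of
  \<open>SU\<^sub>\<mu>(2)\<close> are \<open>[P, d] = [P, u] = [d, u] = 0\<close>, \<open>[v, d] = dP/\<kappa>\<close>, \<open>[v, u] = uP/\<kappa>\<close>, \<open>[v, P] = d\<^sup>2/\<kappa>\<close>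
  and \<open>P\<^sup>2 - d\<^sup>2 = 4\<close>.
\<close>

lemma cst_commutator:
  "(cst a * x) * (cst b * y) - (cst b * y) * (cst a * x) = cst a * (cst b * (x * y - y * (x :: su2_free)))"
  by (simp add: right_diff_distrib mult.assoc cst_left_commute[of x b] cst_left_commute[of y a] cst_left_commute[of "cst b" a])

lemma limit_relations:
  fixes \<kappa> :: real
  defines "k \<equiv> cst (1 / of_real \<kappa>) :: e2_gen list \<Rightarrow>\<^sub>0 complex" and "h \<equiv> cst (1/2) :: e2_gen list \<Rightarrow>\<^sub>0 complex"
  defines "P \<equiv> ga + gb" and "d \<equiv> ga - gb" and "u \<equiv> gw + gz" and "v \<equiv> gz - gw"
  shows "P * d - d * P \<in> ev_ker \<kappa>" "P * u - u * P \<in> ev_ker \<kappa>" "d * u - u * d \<in> ev_ker \<kappa>"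
    "v * d - d * v - k * (d * P) \<in> ev_ker \<kappa>" "v * u - u * v - k * (u * P) \<in> ev_ker \<kappa>"
    "v * P - P * v - k * (d * d) \<in> ev_ker \<kappa>"
    "P * P - d * d - cst 4 \<in> ev_ker \<kappa>"
proof -
  note g = reduces_gens[of \<kappa>] and G = reduces_su2_gens[of \<kappa>, folded h_def P_def d_def]
  have rP: "reduces \<kappa> P (aF \<kappa> + aF' \<kappa>)" and rd: "reduces \<kappa> d (aF \<kappa> - aF' \<kappa>)"
    and ru: "reduces \<kappa> u (wF \<kappa> + wF' \<kappa>)" and rv: "reduces \<kappa> v (wF' \<kappa> - wF \<kappa>)"
    unfolding P_def d_def u_def v_def by (intro reduces_add reduces_diff g)+
  have l0: "fls_limit (mu \<kappa> - 1) 0" "fls_limit (inverse (mu \<kappa>) - 1) 0"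
    using fls_limit_diff[OF fls_limit_consts(5)[of \<kappa>] fls_limit_consts(2)]
      fls_limit_diff[OF fls_limit_inverse[OF fls_limit_consts(5)[of \<kappa>]] fls_limit_consts(2)] by simp_all
  have l1: "fls_limit ((mu \<kappa> - 1) * hinv) (of_real (1 / \<kappa>))" by (rule fls_limit_mu_diff)
  have e2: "(1 - inverse (mu \<kappa>)) * hinv = ((mu \<kappa> - 1) * hinv) * inverse (mu \<kappa>)"
    by (simp add: field_simps)
  have l2: "fls_limit ((1 - inverse (mu \<kappa>)) * hinv) (of_real (1 / \<kappa>))"
    unfolding e2 using fls_limit_mult[OF l1 fls_limit_inverse[OF fls_limit_consts(5)[of \<kappa>]]] by simp
  have e3: "2 * ((1 - mu \<kappa> ^ 2) * hinv) = (- 2) * (((mu \<kappa> - 1) * hinv) * (1 + mu \<kappa>))"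
    by (simp add: power2_eq_square algebra_simps)
  have l3: "fls_limit (2 * ((1 - mu \<kappa> ^ 2) * hinv)) (- 4 * of_real (1 / \<kappa>))"
    unfolding e3 using fls_limit_mult[OF fls_limit_uminus[OF fls_limit_consts(3)[of "num.Bit0 num.One"]]
      fls_limit_mult[OF l1 fls_limit_add[OF fls_limit_consts(2) fls_limit_consts(5)[of \<kappa>]]]] by simp
  have l4: "fls_limit ((1 - mu \<kappa>) / 2) 0"
    using fls_limit_divide[OF fls_limit_diff[OF fls_limit_consts(2) fls_limit_consts(5)[of \<kappa>]] fls_limit_consts(3)[of "num.Bit0 num.One"]]
    by simp
  have "hinv * (1 - mu \<kappa>) / 2 = - ((mu \<kappa> - 1) * hinv) / 2" by (simp add: algebra_simps)
  with fls_limit_divide[OF fls_limit_uminus[OF l1] fls_limit_consts(3)[of "num.Bit0 num.One"]]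
  have l5: "fls_limit (hinv * (1 - mu \<kappa>) / 2) (- of_real (1 / \<kappa>) / 2)" by simp
  have l6: "fls_limit (mu \<kappa> ^ 2) 1"
    using fls_limit_mult[OF fls_limit_consts(5)[of \<kappa>] fls_limit_consts(5)[of \<kappa>]] by (simp add: power2_eq_square)
  note yp = y_plus_minus'[of \<kappa>]
  have hh: "h + h = 1" "h * x + h * x = x" for x
    by (simp_all add: h_def flip: cst_hom distrib_right)
  have cd: "P * h = h * P" "P * (h * x) = h * (P * x)" "d * h = h * d" "d * (h * x) = h * (d * x)" "u * (h * x) = h * (u * x)" "k * (h * x) = h * (k * x)" for x
    by (simp_all add: h_def cst_commute cst_left_commute)
  have c1: "(aF \<kappa> + aF' \<kappa>) * (aF \<kappa> - aF' \<kappa>) - (aF \<kappa> - aF' \<kappa>) * (aF \<kappa> + aF' \<kappa>)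
     - (cst (mu \<kappa> - 1) * ((aF \<kappa> - aF' \<kappa>) * gs) + cst (inverse (mu \<kappa>) - 1) * ((aF \<kappa> - aF' \<kappa>) * gq)) \<in> su2_ideal \<kappa>"
    using commutator_scale[OF commutator_P_v(1)[OF yp(5-8)], of "(1 + mu \<kappa>) / 2"] by (simp only: sum_diff_gF(2)[of \<kappa>])
  have c2: "(aF \<kappa> + aF' \<kappa>) * (wF \<kappa> + wF' \<kappa>) - (wF \<kappa> + wF' \<kappa>) * (aF \<kappa> + aF' \<kappa>)
     - (cst (mu \<kappa> - 1) * ((wF \<kappa> + wF' \<kappa>) * gs) + cst (inverse (mu \<kappa>) - 1) * ((wF \<kappa> + wF' \<kappa>) * gq)) \<in> su2_ideal \<kappa>"
    using commutator_scale[OF commutator_P_v(1)[OF yp(1-4)], of "- (hinv * (1 + mu \<kappa>) / 2)"] by (simp only: sum_diff_gF(3)[of \<kappa>])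
  have c4: "(wF' \<kappa> - wF \<kappa>) * (aF \<kappa> - aF' \<kappa>) - (aF \<kappa> - aF' \<kappa>) * (wF' \<kappa> - wF \<kappa>)
     - (cst ((mu \<kappa> - 1) * hinv) * ((aF \<kappa> - aF' \<kappa>) * gs) + cst ((1 - inverse (mu \<kappa>)) * hinv) * ((aF \<kappa> - aF' \<kappa>) * gq)) \<in> su2_ideal \<kappa>"
    using commutator_scale[OF commutator_P_v(2)[OF yp(5-8)], of "(1 + mu \<kappa>) / 2"] by (simp only: sum_diff_gF(2)[of \<kappa>])
  have c5: "(wF' \<kappa> - wF \<kappa>) * (wF \<kappa> + wF' \<kappa>) - (wF \<kappa> + wF' \<kappa>) * (wF' \<kappa> - wF \<kappa>)
     - (cst ((mu \<kappa> - 1) * hinv) * ((wF \<kappa> + wF' \<kappa>) * gs) + cst ((1 - inverse (mu \<kappa>)) * hinv) * ((wF \<kappa> + wF' \<kappa>) * gq)) \<in> su2_ideal \<kappa>"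
    using commutator_scale[OF commutator_P_v(2)[OF yp(1-4)], of "- (hinv * (1 + mu \<kappa>) / 2)"] by (simp only: sum_diff_gF(3)[of \<kappa>])
  show "P * d - d * P \<in> ev_ker \<kappa>"
    using reduces_eq[OF reduces_diff[OF reduces_mult[OF rP rd] reduces_mult[OF rd rP]]
      reduces_add[OF reduces_smult[OF reduces_mult[OF rd G(1)] l0(1)] reduces_smult[OF reduces_mult[OF rd G(2)] l0(2)]] c1]
    by simp
  show "P * u - u * P \<in> ev_ker \<kappa>"
    using reduces_eq[OF reduces_diff[OF reduces_mult[OF rP ru] reduces_mult[OF ru rP]]
      reduces_add[OF reduces_smult[OF reduces_mult[OF ru G(1)] l0(1)] reduces_smult[OF reduces_mult[OF ru G(2)] l0(2)]] c2]
    by simp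
  \<comment> \<open>Both factors are scalar multiples of \<rho> - \<rho>* and \<rho> + \<rho>*,
    which commute, so this commutator is zero before the limit.\<close>
  have "(aF \<kappa> - aF' \<kappa>) * (wF \<kappa> + wF' \<kappa>) - (wF \<kappa> + wF' \<kappa>) * (aF \<kappa> - aF' \<kappa>) - 0 =
     cst ((1 + mu \<kappa>) / 2) * (cst (- (hinv * (1 + mu \<kappa>) / 2)) * ((gr - gp) * (gr + gp) - (gr + gp) * (gr - gp)))"
    unfolding sum_diff_gF(2,3)
    by (simp only: cst_commutator diff_zero)
  also have "\<dots> \<in> su2_ideal \<kappa>" by (intro Idl_free(8)[where R = "su2_relations \<kappa>"] yp)
  finally have c3: "(aF \<kappa> - aF' \<kappa>) * (wF \<kappa> + wF' \<kappa>) - (wF \<kappa> + wF' \<kappa>) * (aF \<kappa> - aF' \<kappa>) - 0 \<in> su2_ideal \<kappa>" .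
  have r0: "reduces \<kappa> 0 0" using reduces_diff[OF reduces_one reduces_one, of \<kappa>] by simp
  show "d * u - u * d \<in> ev_ker \<kappa>"
    using reduces_eq[OF reduces_diff[OF reduces_mult[OF rd ru] reduces_mult[OF ru rd]] r0 c3] by simp
  show "v * d - d * v - k * (d * P) \<in> ev_ker \<kappa>"
    using reduces_eq[OF reduces_diff[OF reduces_mult[OF rv rd] reduces_mult[OF rd rv]]
      reduces_add[OF reduces_smult[OF reduces_mult[OF rd G(1)] l1] reduces_smult[OF reduces_mult[OF rd G(2)] l2]] c4]
    by (simp add: cd hh flip: k_def)
  show "v * u - u * v - k * (u * P) \<in> ev_ker \<kappa>"
    using reduces_eq[OF reduces_diff[OF reduces_mult[OF rv ru] reduces_mult[OF ru rv]]
      reduces_add[OF reduces_smult[OF reduces_mult[OF ru G(1)] l1] reduces_smult[OF reduces_mult[OF ru G(2)] l2]] c5]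
    by (simp add: cd hh flip: k_def)
  have rpm: "reduces \<kappa> (h * d + cst (1/2) * (gb - ga)) (gr + gp)" "reduces \<kappa> (h * d - cst (1/2) * (gb - ga)) (gr - gp)"
    by (intro reduces_add reduces_diff G(3) reduces_su2_gens)+
  note r6 = reduces_diff[OF reduces_add[OF reduces_smult[OF reduces_mult[OF G(3) reduces_su2_gens(4)] l3]
      reduces_smult[OF reduces_add[OF reduces_smult[OF reduces_mult[OF rpm(1) G(1)] l1] reduces_smult[OF reduces_mult[OF rpm(1) G(2)] l2]] l4]]
      reduces_smult[OF reduces_add[OF reduces_smult[OF reduces_mult[OF rpm(2) G(1)] l0(1)] reduces_smult[OF reduces_mult[OF rpm(2) G(2)] l0(2)]] l5]]
  \<comment> \<open>The product \<rho>\<rho>* tends to -d^2/4, which cancels the factor -4 of the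
    limit \<open>l3\<close>.\<close>
  have "cst (- 4 * of_real (1 / \<kappa>)) * (h * d * (h * (gb - ga))) = k * (d * d)"
  proof -
    have "gb - ga = - d" by (simp add: d_def)
    moreover have "cst (- 4 * of_real (1 / \<kappa>)) * (h * (h * x)) = - (k * x)" for x
    proof -
      have "cst (- 4 * of_real (1 / \<kappa>)) * (h * (h * x)) = cst (- 4 * of_real (1 / \<kappa>) * (1/2) * (1/2)) * x"
        unfolding h_def cst_hom(2) by (simp only: mult.assoc)
      also have "\<dots> = - (k * x)" by (simp add: k_def cst_hom flip: mult_minus_left cst_hom(4))
      finally show ?thesis .
    qed
    ultimately show ?thesis by (simp add: mult.assoc cd)
  qed
  with reduces_eq[OF reduces_diff[OF reduces_mult[OF rv rP] reduces_mult[OF rP rv]] r6 commutator_v_P]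
  show "v * P - P * v - k * (d * d) \<in> ev_ker \<kappa>"
    by (simp flip: h_def)
  \<comment> \<open>The limit of \<sigma>*\<sigma> + \<rho>\<rho>* = 1, in which \<rho>* has become
    -\<rho>. Multiplication by 4 clears the halves.\<close>
  have "h * P * (h * P) + h * d * (h * (gb - ga)) - 1 - 0 \<in> ev_ker \<kappa>"
    using reduces_eq[OF reduces_diff[OF reduces_add[OF reduces_mult[OF G(2,1)] reduces_mult[OF G(3) reduces_su2_gens(4)]] reduces_one] r0]
      e_in_ideal(5)[of \<kappa>] by (simp add: e_defs flip: h_def)
  moreover have "gb - ga = - d" by (simp add: d_def)
  ultimately have "h * P * (h * P) - h * d * (h * d) - 1 \<in> ev_ker \<kappa>" by simp
  then have "cst 4 * (h * P * (h * P) - h * d * (h * d) - 1) \<in> ev_ker \<kappa>" by (rule ev_ker_closed)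
  moreover have "cst 4 * (h * x * (h * x)) = x * x" for x
  proof -
    have "cst 4 * (h * x * (h * x)) = cst 4 * (h * (h * (x * x)))"
      unfolding h_def by (simp only: mult.assoc cst_left_commute[of x])
    also have "\<dots> = cst (4 * (1/2) * (1/2)) * (x * x)"
      unfolding h_def cst_hom(2) by (simp only: mult.assoc)
    finally show ?thesis by simp
  qed
  ultimately show "P * P - d * d - cst 4 \<in> ev_ker \<kappa>" by (simp add: right_diff_distrib)
qed

section \<open>From sums and differences back to the generators of the limit\<close>

lemma ev_ker_cancel:
  assumes "f + f + f + f \<in> ev_ker \<kappa>"
  shows "f \<in> ev_ker \<kappa>"
proof -
  have "cst (1/4) * (f + f + f + f) = cst (1/4 + 1/4 + 1/4 + 1/4) * f"
    unfolding cst_hom(1) by (simp only: distrib_left distrib_right)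
  then show ?thesis using ev_ker_closed(4)[OF assms, of "cst (1/4)"] by simp
qed

text \<open>Four times each relation is a signed sum of the relations of
  \<open>limit_relations\<close>, because each generator is half a sum or half a difference of P and
  d, or of u and v.\<close>

lemma e2_relations_in_ker: "e2_relations \<kappa> \<subseteq> ev_ker \<kappa>"
proof -
  let ?c = "cst (complex_of_real (1 / (2 * \<kappa>))) :: e2_gen list \<Rightarrow>\<^sub>0 complex"
  have "1 / complex_of_real \<kappa> = complex_of_real (1 / (2 * \<kappa>)) + complex_of_real (1 / (2 * \<kappa>))" by simp
  then have k: "cst (1 / complex_of_real \<kappa>) = ?c + ?c" by (simp only: cst_hom)
  have four: "cst 4 = (1 + 1 + 1 + 1 :: e2_gen list \<Rightarrow>\<^sub>0 complex)"
    by (simp add: cst_def)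
  note L = limit_relations[of \<kappa>, unfolded k four]
  note K = ev_ker_closed
  have ab: "ga * gb - 1 \<in> ev_ker \<kappa>"
    by (rule ev_ker_cancel) (use K(2)[OF L(7) L(1)] in \<open>simp add: algebra_simps\<close>)
  have ba: "gb * ga - 1 \<in> ev_ker \<kappa>"
    by (rule ev_ker_cancel) (use K(1)[OF L(7) L(1)] in \<open>simp add: algebra_simps\<close>)
  have comm: "ga * gb - gb * ga \<in> ev_ker \<kappa>"
    using K(2)[OF ab ba] by simp
  \<comment> \<open>The terms with d * P and d * d contribute a mixed product of a and a*; these
    multiples replace it by 1.\<close>
  note cab = K(4)[OF ab, of "?c + ?c"] and cba = K(4)[OF ba, of "?c + ?c"]
  have r1: "gb * gw - gw * gb - ?c * (gb * gb - 1) \<in> ev_ker \<kappa>"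
    by (rule ev_ker_cancel)
      (use K(2)[OF K(2)[OF K(2)[OF K(1)[OF L(2) L(6)] L(3)] L(4)] K(1)[OF cab cab]] in \<open>simp add: algebra_simps\<close>)
  have r2: "- (gb * gz - gz * gb) - ?c * (gb * gb - 1) \<in> ev_ker \<kappa>"
    by (rule ev_ker_cancel)
      (use K(2)[OF K(2)[OF K(1)[OF K(2)[OF L(6) L(2)] L(3)] L(4)] K(1)[OF cab cab]] in \<open>simp add: algebra_simps\<close>)
  have r3: "ga * gw - gw * ga - ?c * (ga * ga - 1) \<in> ev_ker \<kappa>"
    by (rule ev_ker_cancel)
      (use K(2)[OF K(1)[OF K(1)[OF K(1)[OF L(2) L(6)] L(3)] L(4)] K(1)[OF cba cba]] in \<open>simp add: algebra_simps\<close>)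
  have r4: "- (ga * gz - gz * ga) - ?c * (ga * ga - 1) \<in> ev_ker \<kappa>"
    by (rule ev_ker_cancel)
      (use K(2)[OF K(1)[OF K(2)[OF K(2)[OF L(6) L(2)] L(3)] L(4)] K(1)[OF cba cba]] in \<open>simp add: algebra_simps\<close>)
  \<comment> \<open>\<open>limit_relations\<close> has u on the left of P, the relation to be shown
    has it on the right.\<close>
  have c5: "?c * ((ga + gb) * (gw + gz) - (gw + gz) * (ga + gb)) \<in> ev_ker \<kappa>"
    by (rule K(4)[OF L(2)])
  have r5: "gw * gz - gz * gw - (- ?c) * ((ga + gb) * (gw + gz)) \<in> ev_ker \<kappa>"
    by (rule ev_ker_cancel)
      (use K(2)[OF K(1)[OF K(1)[OF c5 c5] K(1)[OF c5 c5]] K(1)[OF L(5) L(5)]] in \<open>simp add: algebra_simps\<close>)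
  show ?thesis
    unfolding e2_relations_def Let_def commutator_def free_algebra_simps a_minus_free a_inv_free
    using r1 r2 r3 r4 r5 comm ab ba by (simp only: insert_subset empty_subsetI cst_hom(4) simp_thms)
qed

lemma ev_surj:
  assumes "X \<in> carrier (contraction \<kappa>)"
  obtains f where "X = ev \<kappa> f"
proof -
  obtain x where x: "x \<in> lattice_carrier \<kappa>" "X = limit_class \<kappa> x" using assms by (rule contraction_carrierE)
  from x(1) have "\<exists>f. limit_class \<kappa> x = ev \<kappa> f"
  proof (induction x rule: lattice_induct)
    case (gen x)
    show ?case by (rule exI[of _ "gen x"]) (simp add: ev_simps flip: e2_gen_value_eq)
  next
    case one
    show ?case by (rule exI[of _ 1]) (simp add: ev_simps limit_class_one)
  next
    case (add x y)
    then obtain f g where "limit_class \<kappa> x = ev \<kappa> f" "limit_class \<kappa> y = ev \<kappa> g" by blast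
    with add show ?case by (intro exI[of _ "f + g"]) (simp add: ev_simps limit_class_simps)
  next
    case (mult x y)
    then obtain f g where "limit_class \<kappa> x = ev \<kappa> f" "limit_class \<kappa> y = ev \<kappa> g" by blast
    with mult show ?case by (intro exI[of _ "f * g"]) (simp add: ev_simps limit_class_simps)
  next
    case (smult c x)
    then obtain f where "limit_class \<kappa> x = ev \<kappa> f" by blast
    with smult show ?case
      by (intro exI[of _ "cst (fps_nth c 0) * f"]) (simp add: E.free_eval_smult[OF e2_gen_value_closed] limit_class_smult)
  qed
  with x(2) that show ?thesis by blast
qed


section \<open>Representations by difference operators\<close>

text \<open>
  \<open>SU\<^sub>\<mu>(2)\<close> acts on power series in \<open>z\<close> over \<open>\<complex>((h))\<close> by \<open>\<rho> - \<rho>\<^sup>* = z\<close>, \<open>\<rho> + \<rho>\<^sup>* = hvz\<close>,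
  \<open>\<sigma> = \<lambda>\<phi>\<tau>\<close> and \<open>\<sigma>\<^sup>* = \<lambda>\<^sup>-\<^sup>1\<tau>\<^sup>-\<^sup>1\<phi>\<close>, where \<open>\<tau>\<close> scales \<open>z\<close> by \<open>\<mu>\<close>, \<open>\<phi>\<^sup>2 = 1 - \<mu>\<^sup>2\<rho>\<rho>\<^sup>*\<close> and
  \<open>\<lambda> = e\<^sup>h\<^sup>x\<close>.  The complex numbers \<open>v, x\<close> are parameters.  The lattice preserves the power series
  with coefficients in \<open>\<complex>[[h]]\<close>, and \<open>w\<close> becomes a first order differential operator for \<open>h = 0\<close>.
\<close>

definition end_alg :: "('k::comm_ring_1, 'k fps \<Rightarrow> 'k fps) module" where
  "end_alg = \<lparr>carrier = {T. (\<forall>F G. T (F + G) = T F + T G) \<and> (\<forall>c F. T (fps_const c * F) = fps_const c * T F)},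
     mult = (\<lambda>S T F. S (T F)), one = (\<lambda>F. F), zero = (\<lambda>F. 0), add = (\<lambda>S T F. S F + T F),
     smult = (\<lambda>c T F. fps_const c * T F)\<rparr>"

lemma end_alg_simps [simp]:
  "T \<in> carrier end_alg \<longleftrightarrow> (\<forall>F G. T (F + G) = T F + T G) \<and> (\<forall>c F. T (fps_const c * F) = fps_const c * T F)"
  "mult end_alg S T = (\<lambda>F. S (T F))" "one end_alg = (\<lambda>F. F)" "zero end_alg = (\<lambda>F. 0)"
  "add end_alg S T = (\<lambda>F. S F + T F)" "smult end_alg c T = (\<lambda>F. fps_const c * T F)"
  by (simp_all add: end_alg_def)

lemma assoc_algebra_end: "assoc_algebra (end_alg :: ('k::comm_ring_1, 'k fps \<Rightarrow> 'k fps) module)"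
proof (rule assoc_algebraI)
  have neg: "\<exists>S. ((\<forall>F G. S (F + G) = S F + S G) \<and> (\<forall>c F. S (fps_const c * F) = fps_const c * S F)) \<and> (\<lambda>F. S F + T F) = (\<lambda>F. 0)"
    if "(\<forall>F G. T (F + G) = T F + T G) \<and> (\<forall>c F. T (fps_const c * F) = fps_const c * T F)" for T :: "'k fps \<Rightarrow> 'k fps"
    using that by (intro exI[of _ "\<lambda>F. - T F"]) simp
  show "ring (end_alg :: ('k, 'k fps \<Rightarrow> 'k fps) module)"
    by (intro ringI abelian_groupI monoidI) (use neg in \<open>auto simp: algebra_simps Bex_def\<close>)
qed (auto simp: algebra_simps simp flip: fps_const_add fps_const_mult)

interpretation endo: assoc_algebra "end_alg :: ('k::comm_ring_1, 'k fps \<Rightarrow> 'k fps) module"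
  by (rule assoc_algebra_end)

lemma end_alg_uminus [simp]: "T \<in> carrier end_alg \<Longrightarrow> \<ominus>\<^bsub>end_alg\<^esub> T = (\<lambda>F. - T F)"
  by (rule endo.minus_equality) auto

lemma end_alg_minus: "S \<in> carrier end_alg \<Longrightarrow> T \<in> carrier end_alg \<Longrightarrow> S \<ominus>\<^bsub>end_alg\<^esub> T = (\<lambda>F. S F - T F)"
  by (simp add: a_minus_def del: end_alg_simps(1))


subsection \<open>Reduction of power series\<close>

text \<open>Two formal variables are in play: h lives in the coefficients and is sent to 0, while
  the outer variable z is kept.\<close>

definition fps_limit :: "complex fls fps \<Rightarrow> complex fps \<Rightarrow> bool" where
  "fps_limit F f \<longleftrightarrow> (\<forall>n. fls_limit (fps_nth F n) (fps_nth f n))"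

lemma fls_limit_sum:
  "finite S \<Longrightarrow> (\<And>i. i \<in> S \<Longrightarrow> fls_limit (c i) (l i)) \<Longrightarrow> fls_limit (\<Sum>i\<in>S. c i) (\<Sum>i\<in>S. l i)"
  by (induction S rule: finite_induct) (auto intro: fls_limit_add fls_limit_consts)

lemma fls_limit_power: "fls_limit c l \<Longrightarrow> fls_limit (c ^ n) (l ^ n)"
  by (induction n) (auto intro: fls_limit_mult fls_limit_consts)

lemma fls_limit_unique: "fls_limit c l \<Longrightarrow> fls_limit c m \<Longrightarrow> l = m"
  by (auto simp: fls_limit_def)

lemma fls_limit_const: "fls_limit (fls_const c) c"
  using fls_limit_consts(6)[of "fps_const c"] by simp

lemma fps_limit_add: "fps_limit F f \<Longrightarrow> fps_limit G g \<Longrightarrow> fps_limit (F + G) (f + g)"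
  by (simp add: fps_limit_def fls_limit_add)

lemma fps_limit_diff: "fps_limit F f \<Longrightarrow> fps_limit G g \<Longrightarrow> fps_limit (F - G) (f - g)"
  by (simp add: fps_limit_def fls_limit_diff)

lemma fps_limit_mult: "fps_limit F f \<Longrightarrow> fps_limit G g \<Longrightarrow> fps_limit (F * G) (f * g)"
  by (simp add: fps_limit_def fps_mult_nth fls_limit_sum fls_limit_mult)

lemma fps_limit_const: "fls_limit c l \<Longrightarrow> fps_limit (fps_const c) (fps_const l)"
  by (simp add: fps_limit_def fls_limit_consts)

lemma fps_limit_smult: "fls_limit c l \<Longrightarrow> fps_limit F f \<Longrightarrow> fps_limit (fps_const c * F) (fps_const l * f)"
  by (simp add: fps_limit_def fls_limit_mult)

lemma fps_limit_one: "fps_limit 1 1"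
  using fps_limit_const[OF fls_limit_consts(2)] by simp

lemma fps_limit_X: "fps_limit fps_X fps_X"
  by (simp add: fps_limit_def fps_X_def fls_limit_consts)

lemma fps_limit_power: "fps_limit F f \<Longrightarrow> fps_limit (F ^ n) (f ^ n)"
  by (induction n) (auto intro: fps_limit_mult fps_limit_one)

lemma fps_limit_compose: "fps_limit F f \<Longrightarrow> fps_limit G g \<Longrightarrow> fps_limit (F oo G) (f oo g)"
  using fps_limit_power[of G g] by (simp add: fps_limit_def fps_compose_nth fls_limit_sum fls_limit_mult)

lemma fps_limit_unique: "fps_limit F f \<Longrightarrow> fps_limit F g \<Longrightarrow> f = g"
  by (auto simp: fps_limit_def fps_eq_iff intro: fls_limit_unique)

lemma fps_limit_lift: "fps_limit (Abs_fps (\<lambda>n. fls_const (fps_nth f n))) f"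
  by (simp add: fps_limit_def fls_limit_const)

lemma fps_limit_hh: "fps_limit F f \<Longrightarrow> fps_limit (fps_const hh * F) 0"
  using fps_limit_smult[OF fls_limit_hh] by simp


subsection \<open>The operators\<close>

text \<open>The substitution of c z for z; with c = \<mu> it is the operator \<tau>.\<close>

definition scale :: "complex fls \<Rightarrow> complex fls fps \<Rightarrow> complex fls fps" where
  "scale c F = Abs_fps (\<lambda>n. c ^ n * fps_nth F n)"

lemma scale_nth [simp]: "fps_nth (scale c F) n = c ^ n * fps_nth F n"
  by (simp add: scale_def)

lemma scale_simps:
  "scale c (F + G) = scale c F + scale c G" "scale c (F - G) = scale c F - scale c G"
  "scale c (fps_const k) = fps_const k" "scale c fps_X = fps_const c * fps_X" "scale c (F * G) = scale c F * scale c G"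
  "scale c (scale d F) = scale (c * d) F" "scale 1 F = F" "scale c 1 = 1"
proof -
  show "scale c (F * G) = scale c F * scale c G"
  proof (rule fps_ext)
    fix n
    have summand: "c ^ n * (fps_nth F i * fps_nth G (n - i)) = c ^ i * fps_nth F i * (c ^ (n - i) * fps_nth G (n - i))" if "i \<in> {0..n}" for i
    proof -
      have "c ^ n = c ^ i * c ^ (n - i)" using that by (simp flip: power_add)
      then show ?thesis by (simp only: mult_ac)
    qed
    show "fps_nth (scale c (F * G)) n = fps_nth (scale c F * scale c G) n"
      unfolding scale_nth fps_mult_nth sum_distrib_left by (rule sum.cong[OF refl summand])
  qed
  show "scale c fps_X = fps_const c * fps_X" by (rule fps_ext) (simp add: fps_X_def)
  show "scale c (fps_const k) = fps_const k" by (rule fps_ext) simp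
  show "scale c 1 = 1" by (rule fps_ext) simp
  show "scale c (scale d F) = scale (c * d) F" by (rule fps_ext) (simp add: power_mult_distrib)
  show "scale c (F + G) = scale c F + scale c G" "scale c (F - G) = scale c F - scale c G" "scale 1 F = F"
    by (rule fps_ext; simp add: algebra_simps)+
qed

lemma fps_limit_scale: "fls_limit c 1 \<Longrightarrow> fps_limit F f \<Longrightarrow> fps_limit (scale c F) f"
  using fls_limit_mult[OF fls_limit_power[of c 1]] by (fastforce simp: fps_limit_def)

lemma fls_limit_power_diff:
  assumes "fls_limit c 1" "fls_limit ((c - 1) * hinv) l"
  shows "fls_limit ((c ^ n - 1) * hinv) (of_nat n * l)"
proof (induction n)
  case (Suc n)
  have "(c ^ Suc n - 1) * hinv = c * ((c ^ n - 1) * hinv) + (c - 1) * hinv"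
    by (simp add: algebra_simps)
  with fls_limit_add[OF fls_limit_mult[OF assms(1) Suc] assms(2)] show ?case
    by (simp add: algebra_simps)
qed (simp add: fls_limit_consts)

text \<open>On the coefficient of z^n the difference quotient is (c^n - 1)/h, which tends to n l; so
  the dilation degenerates to a multiple of the Euler operator z d/dz.\<close>

lemma fps_limit_scale_diff:
  assumes "fls_limit c 1" "fls_limit ((c - 1) * hinv) l" "fps_limit F f"
  shows "fps_limit (fps_const hinv * (scale c F - F)) (fps_const l * (fps_X * fps_deriv f))"
proof -
  have e1: "fps_nth (fps_const l * (fps_X * fps_deriv f)) n = (of_nat n * l) * fps_nth f n" for n
    by (cases n) (simp_all add: algebra_simps)
  have e2: "fps_nth (fps_const hinv * (scale c F - F)) n = ((c ^ n - 1) * hinv) * fps_nth F n" for n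
    by (simp add: algebra_simps)
  show ?thesis
    unfolding fps_limit_def e1 e2
    using assms(3) by (intro allI fls_limit_mult fls_limit_power_diff[OF assms(1,2)]) (simp add: fps_limit_def)
qed

text \<open>The coefficient of z^2 in 1 - \<mu>^2 \<rho>\<rho>*, where \<rho>\<rho>* acts as (h^2
  v^2 - 1)/4 times z^2.\<close>

definition phi_coeff :: "real \<Rightarrow> complex \<Rightarrow> complex fls" where
  "phi_coeff \<kappa> v = mu \<kappa> ^ 2 * (1 - hh ^ 2 * fls_const (v ^ 2)) / 4"

definition sqrt_series :: "complex fps" where "sqrt_series = fps_binomial (1/2)"

text \<open>A square root of 1 - \<mu>^2 \<rho>\<rho>*. Composing the complex binomial series with
  an integral argument makes its coefficients integral and gives its limit.\<close>

definition phi :: "real \<Rightarrow> complex \<Rightarrow> complex fls fps" where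
  "phi \<kappa> v = Abs_fps (\<lambda>n. fls_const (fps_nth sqrt_series n)) oo (fps_const (phi_coeff \<kappa> v) * fps_X ^ 2)"

definition phi0 :: "complex fps" where
  "phi0 = sqrt_series oo (fps_const (1/4) * fps_X ^ 2)"

lemma sqrt_series_square: "sqrt_series * sqrt_series = 1 + fps_X"
  unfolding sqrt_series_def by (simp add: fps_binomial_1 flip: fps_binomial_add_mult)

lemma phi_square: "phi \<kappa> v * phi \<kappa> v = 1 + fps_const (phi_coeff \<kappa> v) * fps_X ^ 2"
proof -
  let ?B = "Abs_fps (\<lambda>n. fls_const (fps_nth sqrt_series n))"
  have s: "(\<Sum>i\<in>S. fls_const (g i)) = fls_const (\<Sum>i\<in>S. g i)" if "finite S" for S :: "nat set" and g :: "nat \<Rightarrow> complex"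
    using that by (induction S rule: finite_induct) (simp_all add: fls_plus_const)
  have "?B * ?B = Abs_fps (\<lambda>n. fls_const (fps_nth (sqrt_series * sqrt_series) n))"
    by (rule fps_ext) (simp add: fps_mult_nth s)
  also have "\<dots> = 1 + fps_X"
    unfolding sqrt_series_square by (rule fps_ext) (simp add: fps_X_def)
  finally have B: "?B * ?B = 1 + fps_X" .
  have "phi \<kappa> v * phi \<kappa> v = (?B * ?B) oo (fps_const (phi_coeff \<kappa> v) * fps_X ^ 2)"
    unfolding phi_def by (rule fps_compose_mult_distrib[symmetric]) (simp add: power2_eq_square)
  then show ?thesis by (simp add: B fps_compose_add_distrib power2_eq_square)
qed

lemma phi0_square: "phi0 * phi0 = 1 + fps_const (1/4) * fps_X ^ 2"
proof -
  have "phi0 * phi0 = (sqrt_series * sqrt_series) oo (fps_const (1/4) * fps_X ^ 2)"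
    unfolding phi0_def by (rule fps_compose_mult_distrib[symmetric]) (simp add: power2_eq_square)
  then show ?thesis by (simp add: sqrt_series_square fps_compose_add_distrib power2_eq_square)
qed

lemma fps_limit_phi: "fps_limit (phi \<kappa> v) phi0"
proof -
  have "fls_limit (phi_coeff \<kappa> v) (1 ^ 2 * (1 - 0 ^ 2 * v ^ 2) / 4)"
    unfolding phi_coeff_def
    by (intro fls_limit_divide fls_limit_mult fls_limit_diff fls_limit_power fls_limit_consts fls_limit_hh fls_limit_const) simp
  then show ?thesis
    unfolding phi_def phi0_def
    by (intro fps_limit_compose fps_limit_lift fps_limit_smult fps_limit_power fps_limit_X) simp
qed

definition lam :: "complex \<Rightarrow> complex fls" where "lam x = fps_to_fls (fps_exp x)"

lemma lam_inverse: "lam x * lam (- x) = 1" "lam (- x) * lam x = 1"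
  by (simp_all add: lam_def flip: fls_times_fps_to_fls fps_exp_add_mult)

lemma fls_limit_lam: "fls_limit (lam x) 1"
  using fls_limit_consts(6)[of "fps_exp x"] by (simp add: lam_def)

lemma fls_limit_lam_diff: "fls_limit ((lam x - 1) * hinv) x"
proof -
  let ?C = "fps_shift 1 (fps_exp x - 1 :: complex fps)"
  have "fps_exp x - 1 = fps_X * ?C" by (rule fps_ext) auto
  then have "lam x - 1 = fls_X * fps_to_fls ?C"
    unfolding lam_def by (metis fls_times_fps_to_fls fps_X_to_fls fps_to_fls_minus fps_one_to_fls)
  then have "(lam x - 1) * hinv = fps_to_fls ?C"
    unfolding hh_def[symmetric] by (simp add: mult.commute mult.left_commute)
  then show ?thesis using fls_limit_consts(6)[of ?C] by simp
qed

text \<open>The factors (1 + h v)/2 and (h v - 1)/2 solve the conditions that \<rho> - \<rho>* is z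
  and \<rho> + \<rho>* is h v z.\<close>

definition su2_op :: "real \<Rightarrow> complex \<Rightarrow> complex \<Rightarrow> su2_gen \<Rightarrow> complex fls fps \<Rightarrow> complex fls fps" where
  "su2_op \<kappa> v x g F = (case g of
       Sigma \<Rightarrow> fps_const (lam x) * (phi \<kappa> v * scale (mu \<kappa>) F)
     | Sigma_star \<Rightarrow> fps_const (lam (- x)) * scale (inverse (mu \<kappa>)) (phi \<kappa> v * F)
     | Rho \<Rightarrow> fps_const ((1 + hh * fls_const v) / 2) * (fps_X * F)
     | Rho_star \<Rightarrow> fps_const ((hh * fls_const v - 1) / 2) * (fps_X * F))"

lemma su2_op_simps:
  "su2_op \<kappa> v x Sigma F = fps_const (lam x) * (phi \<kappa> v * scale (mu \<kappa>) F)"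
  "su2_op \<kappa> v x Sigma_star F = fps_const (lam (- x)) * scale (inverse (mu \<kappa>)) (phi \<kappa> v * F)"
  "su2_op \<kappa> v x Rho F = fps_const ((1 + hh * fls_const v) / 2) * (fps_X * F)"
  "su2_op \<kappa> v x Rho_star F = fps_const ((hh * fls_const v - 1) / 2) * (fps_X * F)"
  by (simp_all add: su2_op_def)

lemma su2_op_carrier [simp]: "su2_op \<kappa> v x g \<in> carrier end_alg"
  by (cases g) (simp_all add: su2_op_simps scale_simps distrib_left mult.left_commute)

abbreviation rep :: "real \<Rightarrow> complex \<Rightarrow> complex \<Rightarrow> su2_free \<Rightarrow> complex fls fps \<Rightarrow> complex fls fps" where
  "rep \<kappa> v x \<equiv> free_eval end_alg (su2_op \<kappa> v x)"

lemma rep_simps: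
  "rep \<kappa> v x (f * g) F = rep \<kappa> v x f (rep \<kappa> v x g F)" "rep \<kappa> v x (f + g) F = rep \<kappa> v x f F + rep \<kappa> v x g F"
  "rep \<kappa> v x (f - g) F = rep \<kappa> v x f F - rep \<kappa> v x g F" "rep \<kappa> v x 1 F = F" "rep \<kappa> v x 0 F = 0"
  "rep \<kappa> v x (cst c) F = fps_const c * F" "rep \<kappa> v x (gen y) F = su2_op \<kappa> v x y F"
proof -
  note c = endo.free_eval_closed[OF su2_op_carrier[of \<kappa> v x]]
  note S = endo.free_eval_simps[OF su2_op_carrier[of \<kappa> v x]] endo.free_eval_smult[OF su2_op_carrier[of \<kappa> v x]]
  show "rep \<kappa> v x (f - g) F = rep \<kappa> v x f F - rep \<kappa> v x g F"
    unfolding S(3) by (simp only: end_alg_minus[OF c c])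
  show "rep \<kappa> v x (f * g) F = rep \<kappa> v x f (rep \<kappa> v x g F)" "rep \<kappa> v x (f + g) F = rep \<kappa> v x f F + rep \<kappa> v x g F"
    unfolding S(1,2) by simp_all
  show "rep \<kappa> v x 1 F = F" "rep \<kappa> v x 0 F = 0"
    unfolding S(5,6) by simp_all
  show "rep \<kappa> v x (cst c) F = fps_const c * F"
    using endo.free_eval_smult[of "su2_op \<kappa> v x" c 1, OF su2_op_carrier] by (simp add: S(6))
  show "rep \<kappa> v x (gen y) F = su2_op \<kappa> v x y F"
    by (simp only: endo.free_eval_gen[OF su2_op_carrier])
qed

text \<open>Dilation gives the commutation rules. In \<sigma>\<sigma>* the dilations cancel and
  leave the square of \<open>phi\<close>; in \<sigma>*\<sigma> they leave the square of its dilate Q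
  by 1/\<mu>, which removes the factor \<mu>^2 and gives 1 - \<rho>\<rho>*.\<close>

lemma rep_basic:
  assumes "r \<in> su2_basic \<kappa>"
  shows "rep \<kappa> v x r = \<zero>\<^bsub>end_alg\<^esub>"
proof -
  let ?a = "(1 + hh * fls_const v) / 2" and ?b = "(hh * fls_const v - 1) / 2"
  define M N L L' A B P Q where "M = fps_const (mu \<kappa>)" "N = fps_const (inverse (mu \<kappa>))"
    "L = fps_const (lam x)" "L' = fps_const (lam (- x))" "A = fps_const ?a" "B = fps_const ?b"
    "P = phi \<kappa> v" "Q = scale (inverse (mu \<kappa>)) P"
  note D = this
  have MN: "M * N = 1" and LL: "L * L' = 1" by (simp_all add: D(1-4) lam_inverse)
  have "?a * ?b = (hh ^ 2 * fls_const (v ^ 2) - 1) / 4"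
    by (simp add: field_simps power2_eq_square flip: fls_const_mult_const)
  then have "phi_coeff \<kappa> v = - (mu \<kappa> * mu \<kappa> * (?a * ?b))"
    by (simp add: phi_coeff_def power2_eq_square field_simps)
  then have "fps_const (phi_coeff \<kappa> v) = - (M * M * (A * B))"
    unfolding D(1,5,6) by (simp only: fps_const_mult fps_const_neg)
  then have PP: "P * P = 1 - M * M * (A * B) * (fps_X * fps_X)"
    using phi_square[of \<kappa> v] by (simp add: D(7) power2_eq_square)
  have "Q * Q = scale (inverse (mu \<kappa>)) (P * P)" by (simp add: D(8) scale_simps)
  also have "\<dots> = 1 - M * M * (A * B) * ((N * fps_X) * (N * fps_X))"
    unfolding PP by (simp only: scale_simps D(1,2,5,6))
  also have "M * M * (A * B) * ((N * fps_X) * (N * fps_X)) = (M * N) * (M * N) * (A * B * (fps_X * fps_X))"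
    by (simp only: mult_ac)
  finally have QQ: "Q * Q = 1 - A * B * (fps_X * fps_X)" by (simp add: MN)
  have SS: "scale (inverse (mu \<kappa>)) (scale (mu \<kappa>) F) = F" "scale (mu \<kappa>) (scale (inverse (mu \<kappa>)) F) = F"
    "scale (mu \<kappa>) Q = P" for F
    by (simp_all add: scale_simps D(8))
  have SC: "scale c A = A" "scale c B = B" "scale c L = L" "scale c L' = L'" for c
    by (simp_all add: D(3-6) scale_simps)
  have MN': "N * (M * G) = G" "M * (N * G) = G" and LL': "L * (L' * G) = G" "L' * (L * G) = G" for G
  proof -
    have "N * (M * G) = (M * N) * G" "M * (N * G) = (M * N) * G" "L * (L' * G) = (L * L') * G" "L' * (L * G) = (L * L') * G"
      by (simp_all only: mult_ac)
    then show "N * (M * G) = G" "M * (N * G) = G" "L * (L' * G) = G" "L' * (L * G) = G" by (simp_all add: MN LL)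
  qed
  have PP': "P * (P * G) = G - M * (M * (A * (B * (fps_X * (fps_X * G)))))"
    and QQ': "Q * (Q * G) = G - A * (B * (fps_X * (fps_X * G)))" for G
    using PP QQ by (simp_all add: left_diff_distrib mult.assoc flip: mult.assoc[of P P] mult.assoc[of Q Q])
  note R = rep_simps su2_op_simps SS scale_simps(1,2,4,5) D[symmetric] SC mult.assoc
  have "rep \<kappa> v x r F = 0" for F
    using assms unfolding su2_basic_def
  proof (elim insertE emptyE; hypsubst)
    show "rep \<kappa> v x (gr * gp - gp * gr) F = 0"
      unfolding R by (simp add: mult.left_commute)
    show "rep \<kappa> v x (gm \<kappa> * (gr * gs) - gs * gr) F = 0" "rep \<kappa> v x (gm \<kappa> * (gp * gs) - gs * gp) F = 0"
      unfolding R by (simp_all add: mult.left_commute)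
    show "rep \<kappa> v x (gm \<kappa> * (gq * gp) - gp * gq) F = 0"
      unfolding R by (simp only: mult.left_commute[of L' N] mult.left_commute[of Q N] mult.left_commute[of B N] MN')
        (simp add: mult.left_commute)
    show "rep \<kappa> v x (gm \<kappa> * (gq * gr) - gr * gq) F = 0"
      unfolding R by (simp only: mult.left_commute[of L' N] mult.left_commute[of Q N] mult.left_commute[of A N] MN')
        (simp add: mult.left_commute)
    show "rep \<kappa> v x (gs * gq + gm \<kappa> * (gm \<kappa> * (gr * gp)) - 1) F = 0"
      unfolding R by (simp only: mult.left_commute[of P L'] LL' PP') (simp add: mult.left_commute)
    show "rep \<kappa> v x (gq * gs + gr * gp - 1) F = 0"
      unfolding R by (simp only: mult.left_commute[of Q L] LL' QQ') (simp add: mult.left_commute)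
  qed
  then show ?thesis by (simp add: fun_eq_iff)
qed

definition repc :: "real \<Rightarrow> complex \<Rightarrow> complex \<Rightarrow> su2_carrier \<Rightarrow> complex fls fps \<Rightarrow> complex fls fps" where
  "repc \<kappa> v x = coset_map (rep \<kappa> v x)"

lemma repc_cls [simp]: "repc \<kappa> v x (cls \<kappa> f) = rep \<kappa> v x f"
  unfolding repc_def by (rule su2_induced_cls[OF assoc_algebra_end su2_op_carrier rep_basic])

lemma repc_hom: "repc \<kappa> v x \<in> alg_hom (su2 \<kappa>) end_alg"
  unfolding repc_def by (rule su2_induced_hom[OF assoc_algebra_end su2_op_carrier rep_basic])


subsection \<open>The limit representation\<close>

text \<open>The series by which a acts in the limit, formally exp(arsinh(z/2)); a* acts by its
  inverse \<open>b0'\<close>.\<close>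

definition b0 :: "complex fps" where "b0 = phi0 + fps_const (1/2) * fps_X"
definition b0' :: "complex fps" where "b0' = phi0 - fps_const (1/2) * fps_X"

lemma b0_inverse: "b0 * b0' = 1"
proof -
  have "b0 * b0' = phi0 * phi0 - fps_const (1/2 * (1/2)) * fps_X ^ 2"
    unfolding b0_def b0'_def fps_const_mult[symmetric] by (simp only: algebra_simps power2_eq_square)
  then show ?thesis by (simp add: phi0_square)
qed

text \<open>The first bracket is the limit of the difference of \<sigma> and \<sigma>* divided by h:
  \<lambda> contributes 2 x \<open>phi0\<close>, and the dilations contribute Euler operators on
  opposite sides of \<open>phi0\<close>. The last term is the limit of \<rho> + \<mu>\<rho>* divided
  by 2 h.\<close>

definition w_op :: "real \<Rightarrow> complex \<Rightarrow> complex \<Rightarrow> complex fps \<Rightarrow> complex fps" where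
  "w_op \<kappa> v x f = fps_const (- 1/2) *
     (fps_const (2 * x) * (phi0 * f) + fps_const (1 / of_real \<kappa>) * (phi0 * (fps_X * fps_deriv f) + fps_X * fps_deriv (phi0 * f)))
     - fps_const ((v - 1 / (2 * of_real \<kappa>)) / 2) * (fps_X * f)"

text \<open>The sum w + w* is -(1 + \<mu>)/(2 h) times \<rho> + \<rho>* and so tends to
  multiplication by -v z; this determines the value at \<open>W0_star\<close>.\<close>

definition e2_op :: "real \<Rightarrow> complex \<Rightarrow> complex \<Rightarrow> e2_gen \<Rightarrow> complex fps \<Rightarrow> complex fps" where
  "e2_op \<kappa> v x g f = (case g of A0 \<Rightarrow> b0 * f | A0_star \<Rightarrow> b0' * f | W0 \<Rightarrow> w_op \<kappa> v x f
     | W0_star \<Rightarrow> - w_op \<kappa> v x f - fps_const v * (fps_X * f))"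

lemma e2_op_simps:
  "e2_op \<kappa> v x A0 f = b0 * f" "e2_op \<kappa> v x A0_star f = b0' * f" "e2_op \<kappa> v x W0 f = w_op \<kappa> v x f"
  "e2_op \<kappa> v x W0_star f = - w_op \<kappa> v x f - fps_const v * (fps_X * f)"
  by (simp_all add: e2_op_def)

lemma w_op_linear:
  "w_op \<kappa> v x (f + g) = w_op \<kappa> v x f + w_op \<kappa> v x g" "w_op \<kappa> v x (fps_const c * f) = fps_const c * w_op \<kappa> v x f"
  by (simp_all add: w_op_def distrib_left distrib_right right_diff_distrib)

lemma e2_op_carrier [simp]: "e2_op \<kappa> v x g \<in> carrier end_alg"
  by (cases g) (auto simp: e2_op_simps w_op_linear distrib_left right_diff_distrib mult.left_commute)

abbreviation lrep :: "real \<Rightarrow> complex \<Rightarrow> complex \<Rightarrow> (e2_gen list \<Rightarrow>\<^sub>0 complex) \<Rightarrow> complex fps \<Rightarrow> complex fps" where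
  "lrep \<kappa> v x \<equiv> free_eval end_alg (e2_op \<kappa> v x)"

lemma lrep_simps:
  "lrep \<kappa> v x (f * g) F = lrep \<kappa> v x f (lrep \<kappa> v x g F)" "lrep \<kappa> v x (f + g) F = lrep \<kappa> v x f F + lrep \<kappa> v x g F"
  "lrep \<kappa> v x (f - g) F = lrep \<kappa> v x f F - lrep \<kappa> v x g F" "lrep \<kappa> v x 1 F = F" "lrep \<kappa> v x 0 F = 0"
  "lrep \<kappa> v x (cst c) F = fps_const c * F" "lrep \<kappa> v x (gen y) F = e2_op \<kappa> v x y F"
proof -
  note c = endo.free_eval_closed[OF e2_op_carrier[of \<kappa> v x]]
  note S = endo.free_eval_simps[OF e2_op_carrier[of \<kappa> v x]] endo.free_eval_smult[OF e2_op_carrier[of \<kappa> v x]]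
  show "lrep \<kappa> v x (f - g) F = lrep \<kappa> v x f F - lrep \<kappa> v x g F"
    unfolding S(3) by (simp only: end_alg_minus[OF c c])
  show "lrep \<kappa> v x (f * g) F = lrep \<kappa> v x f (lrep \<kappa> v x g F)" "lrep \<kappa> v x (f + g) F = lrep \<kappa> v x f F + lrep \<kappa> v x g F"
    unfolding S(1,2) by simp_all
  show "lrep \<kappa> v x 1 F = F" "lrep \<kappa> v x 0 F = 0"
    unfolding S(5,6) by simp_all
  show "lrep \<kappa> v x (cst c) F = fps_const c * F"
    using endo.free_eval_smult[of "e2_op \<kappa> v x" c 1, OF e2_op_carrier] by (simp add: S(6))
  show "lrep \<kappa> v x (gen y) F = e2_op \<kappa> v x y F"
    by (simp only: endo.free_eval_gen[OF e2_op_carrier])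
qed

text \<open>Splits the difference of \<sigma> and \<sigma>* divided by h into quotients that have
  limits one by one: those of the two scalars \<lambda> and 1/\<lambda>, and those of the two
  dilations, compared through the common value P * F.\<close>

lemma difference_identity:
  fixes H L L' P S Q F :: "'a::comm_ring_1"
  shows "H * (L * (P * S) - L' * Q) = ((L - 1) * H) * (P * S) - ((L' - 1) * H) * Q + (P * (H * (S - F)) - H * (Q - P * F))"
  by (simp add: algebra_simps)

lemma combination_identity:
  fixes H k c s q t :: "'a::comm_ring_1"
  shows "- (k * H) * s + k * H * q + - c * t = - k * (H * (s - q)) - c * t"
    "k * H * s + - (k * H) * q + - c * t = k * (H * (s - q)) - c * t"
  by (simp_all add: algebra_simps)

text \<open>All four generators are combinations of \<sigma> F, \<sigma>* F and z F. The
  coefficients for a and a* are integral; for w and w* the factor 1/h occurs only in the quotients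
  \<open>D\<close> and \<open>hab\<close>, whose numerators vanish at h = 0.\<close>

lemma rep_gens_limit:
  assumes F: "fps_limit F f"
  shows "fps_limit (rep \<kappa> v x (e2F \<kappa> g) F) (e2_op \<kappa> v x g f)"
proof -
  let ?s = "su2_op \<kappa> v x Sigma F" and ?q = "su2_op \<kappa> v x Sigma_star F"
  let ?m = "mu \<kappa>" and ?p = "phi \<kappa> v" and ?a = "(1 + hh * fls_const v) / 2" and ?b = "(hh * fls_const v - 1) / 2"
  note lims = fls_limit_consts fls_limit_hh fls_limit_const fls_limit_add fls_limit_diff fls_limit_mult fls_limit_divide
  have two: "fls_limit 2 2" "fls_limit (1/2) (1/2)"
    using fls_limit_consts(3)[of "num.Bit0 num.One"] fls_limit_divide[OF fls_limit_consts(2) fls_limit_consts(3)[of "num.Bit0 num.One"]] by simp_all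
  have hv: "fls_limit (hh * fls_const v) 0"
    using fls_limit_mult[OF fls_limit_hh fls_limit_const[of v]] by simp
  have m1: "fls_limit ?m 1" "fls_limit (inverse ?m) 1"
    using fls_limit_consts(5)[of \<kappa>] fls_limit_inverse[OF fls_limit_consts(5)[of \<kappa>]] by simp_all
  have md: "fls_limit ((?m - 1) * hinv) (1 / of_real \<kappa>)" using fls_limit_mu_diff[of \<kappa>] by simp
  have "(inverse ?m - 1) * hinv = - ((?m - 1) * hinv) * inverse ?m" by (simp add: field_simps)
  with fls_limit_mult[OF fls_limit_uminus[OF md] m1(2)]
  have mid: "fls_limit ((inverse ?m - 1) * hinv) (- 1 / of_real \<kappa>)" by simp
  have s: "fps_limit ?s (phi0 * f)"
    using fps_limit_smult[OF fls_limit_lam fps_limit_mult[OF fps_limit_phi fps_limit_scale[OF m1(1) F]]]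
    by (simp add: su2_op_simps)
  have q: "fps_limit ?q (phi0 * f)"
    using fps_limit_smult[OF fls_limit_lam fps_limit_scale[OF m1(2) fps_limit_mult[OF fps_limit_phi F]]]
    by (simp add: su2_op_simps)
  have XF: "fps_limit (fps_X * F) (fps_X * f)" by (rule fps_limit_mult[OF fps_limit_X F])
  have ab: "fls_limit ?a (1/2)" "fls_limit ?b (- 1/2)"
    using fls_limit_divide[OF fls_limit_add[OF fls_limit_consts(2) hv] two(1)]
      fls_limit_divide[OF fls_limit_diff[OF hv fls_limit_consts(2)] two(1)] by simp_all
  have r: "fps_limit (su2_op \<kappa> v x Rho F) (fps_const (1/2) * (fps_X * f))"
    and p: "fps_limit (su2_op \<kappa> v x Rho_star F) (fps_const (- 1/2) * (fps_X * f))"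
    unfolding su2_op_simps by (intro fps_limit_smult ab XF)+
  have half: "fps_const (1/2 :: complex) * G + fps_const (1/2) * G = G" for G
    by (simp flip: distrib_right fps_const_add)
  let ?D = "fps_const (2 * x) * (phi0 * f) + fps_const (1 / of_real \<kappa>) * (phi0 * (fps_X * fps_deriv f) + fps_X * fps_deriv (phi0 * f))"
  have D: "fps_limit (fps_const hinv * (?s - ?q)) ?D"
  proof -
    have e1: "fps_limit (fps_const ((lam x - 1) * hinv) * (?p * scale ?m F)) (fps_const x * (phi0 * f))"
      by (intro fps_limit_smult fls_limit_lam_diff fps_limit_mult fps_limit_phi fps_limit_scale m1 F)
    have e2: "fps_limit (fps_const ((lam (- x) - 1) * hinv) * scale (inverse ?m) (?p * F)) (fps_const (- x) * (phi0 * f))"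
      by (intro fps_limit_smult fls_limit_lam_diff fps_limit_mult fps_limit_phi fps_limit_scale m1 F)
    have e3: "fps_limit (?p * (fps_const hinv * (scale ?m F - F))) (phi0 * (fps_const (1 / of_real \<kappa>) * (fps_X * fps_deriv f)))"
      by (intro fps_limit_mult fps_limit_phi fps_limit_scale_diff m1 md F)
    have e4: "fps_limit (fps_const hinv * (scale (inverse ?m) (?p * F) - ?p * F)) (fps_const (- 1 / of_real \<kappa>) * (fps_X * fps_deriv (phi0 * f)))"
      by (intro fps_limit_mult fps_limit_phi fps_limit_scale_diff m1 mid F)
    have "fps_const hinv * (?s - ?q) = (fps_const ((lam x - 1) * hinv) * (?p * scale ?m F) - fps_const ((lam (- x) - 1) * hinv) * scale (inverse ?m) (?p * F))
        + (?p * (fps_const hinv * (scale ?m F - F)) - fps_const hinv * (scale (inverse ?m) (?p * F) - ?p * F))"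
      unfolding su2_op_simps fps_const_mult[symmetric] fps_const_sub[symmetric] fps_const_1_eq_1 by (rule difference_identity)
    moreover have "fps_const x * (phi0 * f) - fps_const (- x) * (phi0 * f) + (phi0 * (fps_const (1 / of_real \<kappa>) * (fps_X * fps_deriv f)) -
        fps_const (- 1 / of_real \<kappa>) * (fps_X * fps_deriv (phi0 * f))) = ?D"
    proof -
      have "fps_const (2 * x) = fps_const x + fps_const x" by simp
      moreover have "fps_const (- 1 / of_real \<kappa>) = - fps_const (1 / complex_of_real \<kappa>)" by simp
      moreover have "fps_const (- x) = - fps_const x" by simp
      ultimately show ?thesis by (simp only: distrib_left distrib_right mult_minus_left diff_minus_eq_add mult.left_commute[of phi0] add_ac)
    qed
    ultimately show ?thesis
      using fps_limit_add[OF fps_limit_diff[OF e1 e2] fps_limit_diff[OF e3 e4]] by simp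
  qed
  \<comment> \<open>At h = 0 both numerators are 1/2 - 1/2. Their first-order terms are v and half
    the first-order term of \<mu>, with opposite signs in the two cases.\<close>
  have hab: "fls_limit (hinv * (?a + ?m * ?b)) (v - 1 / (2 * of_real \<kappa>))" "fls_limit (hinv * (?m * ?a + ?b)) (v + 1 / (2 * of_real \<kappa>))"
  proof -
    have "hinv * (?a + ?m * ?b) = fls_const v * (1 + ?m) / 2 - (?m - 1) * hinv / 2"
      "hinv * (?m * ?a + ?b) = fls_const v * (1 + ?m) / 2 + (?m - 1) * hinv / 2"
      by (simp_all add: algebra_simps add_divide_distrib diff_divide_distrib)
    moreover have "fls_limit (fls_const v * (1 + ?m) / 2) (v * (1 + 1) / 2)" "fls_limit ((?m - 1) * hinv / 2) (1 / of_real \<kappa> / 2)"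
      by (intro fls_limit_divide fls_limit_mult fls_limit_add fls_limit_consts fls_limit_const md two m1; simp)+
    ultimately show "fls_limit (hinv * (?a + ?m * ?b)) (v - 1 / (2 * of_real \<kappa>))" "fls_limit (hinv * (?m * ?a + ?b)) (v + 1 / (2 * of_real \<kappa>))"
      using fls_limit_diff[of "fls_const v * (1 + ?m) / 2" "v * (1 + 1) / 2" "(?m - 1) * hinv / 2"]
        fls_limit_add[of "fls_const v * (1 + ?m) / 2" "v * (1 + 1) / 2" "(?m - 1) * hinv / 2"] by (simp_all add: mult.commute)
  qed
  have lcF: "rep \<kappa> v x (lc c1 c2 c3 c4) F = fps_const c1 * ?s + fps_const c2 * ?q + fps_const (c3 * ?a + c4 * ?b) * (fps_X * F)" for c1 c2 c3 c4
    unfolding lc_def rep_simps fps_const_add[symmetric] fps_const_mult[symmetric] by (simp only: su2_op_simps(3,4) distrib_right mult.assoc add.assoc)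
  show ?thesis
  proof (cases g)
    case A0
    have c: "fls_limit (1/2 * ?a + - ?m / 2 * ?b) (1/2)"
      using fls_limit_add[OF fls_limit_mult[OF two(2) ab(1)] fls_limit_mult[OF fls_limit_divide[OF fls_limit_uminus[OF m1(1)] two(1)] ab(2)]] by simp
    show ?thesis
      using fps_limit_add[OF fps_limit_add[OF fps_limit_smult[OF two(2) s] fps_limit_smult[OF two(2) q]] fps_limit_smult[OF c XF]]
      by (simp only: A0 e2F_simps aF_def lcF e2_op_simps b0_def distrib_right half mult.assoc)
  next
    case A0_star
    have c: "fls_limit (- ?m / 2 * ?a + 1/2 * ?b) (- 1/2)"
      using fls_limit_add[OF fls_limit_mult[OF fls_limit_divide[OF fls_limit_uminus[OF m1(1)] two(1)] ab(1)] fls_limit_mult[OF two(2) ab(2)]] by simp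
    have "fps_const (- 1/2) = - fps_const (1/2 :: complex)" by simp
    then show ?thesis
      using fps_limit_add[OF fps_limit_add[OF fps_limit_smult[OF two(2) s] fps_limit_smult[OF two(2) q]] fps_limit_smult[OF c XF]]
      by (simp only: A0_star e2F_simps aF'_def lcF e2_op_simps b0'_def distrib_right half mult.assoc mult_minus_left diff_conv_add_uminus)
  next
    case W0
    have c: "- (hinv / 2) * ?a + - (hinv * ?m / 2) * ?b = - (hinv * (?a + ?m * ?b) / 2)"
      by (simp add: algebra_simps add_divide_distrib diff_divide_distrib)
    have "rep \<kappa> v x (wF \<kappa>) F = fps_const (- 1/2) * (fps_const hinv * (?s - ?q)) - fps_const (hinv * (?a + ?m * ?b) / 2) * (fps_X * F)"
    proof -
      have "fps_const (- (hinv / 2)) = - (fps_const (1/2) * fps_const hinv)" "fps_const (hinv / 2) = fps_const (1/2) * fps_const hinv"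
        "fps_const (- 1/2 :: complex fls) = - fps_const (1/2)" by simp_all
      then show ?thesis
        unfolding wF_def lcF c fps_const_neg[symmetric] by (simp only: combination_identity)
    qed
    moreover have "fls_limit (- 1/2) (- 1/2)" using fls_limit_divide[OF fls_limit_uminus[OF fls_limit_consts(2)] two(1)] by simp
    ultimately show ?thesis
      using fps_limit_diff[OF fps_limit_smult[OF _ D] fps_limit_smult[OF fls_limit_divide[OF hab(1) two(1)] XF]]
      by (simp add: W0 e2_op_simps w_op_def)
  next
    case W0_star
    have c: "- (hinv * ?m / 2) * ?a + - (hinv / 2) * ?b = - (hinv * (?m * ?a + ?b) / 2)"
      by (simp add: algebra_simps add_divide_distrib diff_divide_distrib)
    have r: "rep \<kappa> v x (wF' \<kappa>) F = fps_const (1/2) * (fps_const hinv * (?s - ?q)) - fps_const (hinv * (?m * ?a + ?b) / 2) * (fps_X * F)"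
    proof -
      have "fps_const (- (hinv / 2)) = - (fps_const (1/2) * fps_const hinv)" "fps_const (hinv / 2) = fps_const (1/2) * fps_const hinv" by simp_all
      then show ?thesis
        unfolding wF'_def lcF c fps_const_neg[symmetric] by (simp only: combination_identity)
    qed
    have L: "fps_limit (rep \<kappa> v x (wF' \<kappa>) F) (fps_const (1/2) * ?D - fps_const ((v + 1 / (2 * of_real \<kappa>)) / 2) * (fps_X * f))"
      unfolding r by (intro fps_limit_diff fps_limit_smult two D fls_limit_divide hab XF) simp
    have "- (fps_const (- 1/2) * ?D - fps_const ((v - 1 / (2 * of_real \<kappa>)) / 2) * (fps_X * f)) - fps_const v * (fps_X * f) =
       fps_const (1/2) * ?D - fps_const ((v + 1 / (2 * of_real \<kappa>)) / 2) * (fps_X * f)"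
    proof -
      have "fps_const (- 1/2) = - fps_const (1/2 :: complex)"
        "fps_const v = fps_const ((v + 1 / (2 * of_real \<kappa>)) / 2) + fps_const ((v - 1 / (2 * of_real \<kappa>)) / 2)"
        by (simp_all add: field_simps)
      then show ?thesis by (simp only: mult_minus_left distrib_right) simp
    qed
    with L show ?thesis by (simp only: W0_star e2F_simps e2_op_simps w_op_def)
  qed
qed


subsection \<open>Normal forms\<close>

abbreviation e2_ideal :: "real \<Rightarrow> (e2_gen list \<Rightarrow>\<^sub>0 complex) set" where
  "e2_ideal \<kappa> \<equiv> Idl\<^bsub>free_algebra\<^esub> (e2_relations \<kappa>)"

text \<open>It replaces w* as a generator: modulo the relations it commutes with a and a*, and its
  commutator with w is again a multiple of itself, so ordered monomials with the power of w last are
  enough.\<close>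

definition gS :: "e2_gen list \<Rightarrow>\<^sub>0 complex" where "gS = gw + gz"

definition kc :: "real \<Rightarrow> (e2_gen list \<Rightarrow>\<^sub>0 complex)" where "kc \<kappa> = cst (complex_of_real (1 / (2 * \<kappa>)))"

lemma e2_ideal_facts:
  "ga * gw - gw * ga - kc \<kappa> * (ga * ga - 1) \<in> e2_ideal \<kappa>"
  "ga * gS - gS * ga \<in> e2_ideal \<kappa>" "gb * gS - gS * gb \<in> e2_ideal \<kappa>"
  "gS * gw - gw * gS - kc \<kappa> * ((ga + gb) * gS) \<in> e2_ideal \<kappa>" "ga * gb - 1 \<in> e2_ideal \<kappa>"
proof -
  note I = Idl_free[where R = "e2_relations \<kappa>"]
  have R: "gb * gw - gw * gb - kc \<kappa> * (gb * gb - 1) \<in> e2_ideal \<kappa>" "- (gb * gz - gz * gb) - kc \<kappa> * (gb * gb - 1) \<in> e2_ideal \<kappa>"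
    "ga * gw - gw * ga - kc \<kappa> * (ga * ga - 1) \<in> e2_ideal \<kappa>" "- (ga * gz - gz * ga) - kc \<kappa> * (ga * ga - 1) \<in> e2_ideal \<kappa>"
    "gw * gz - gz * gw - (- kc \<kappa>) * ((ga + gb) * (gw + gz)) \<in> e2_ideal \<kappa>" "ga * gb - 1 \<in> e2_ideal \<kappa>"
    using I(2) unfolding e2_relations_def Let_def commutator_def free_algebra_simps a_minus_free a_inv_free
    by (simp_all only: insert_subset cst_hom(4) kc_def)
  show "ga * gw - gw * ga - kc \<kappa> * (ga * ga - 1) \<in> e2_ideal \<kappa>" "ga * gb - 1 \<in> e2_ideal \<kappa>"
    by (rule R)+
  show "ga * gS - gS * ga \<in> e2_ideal \<kappa>" "gb * gS - gS * gb \<in> e2_ideal \<kappa>"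
    using I(5)[OF R(3,4)] I(5)[OF R(1,2)] by (simp_all add: gS_def algebra_simps)
  show "gS * gw - gw * gS - kc \<kappa> * ((ga + gb) * gS) \<in> e2_ideal \<kappa>"
    using I(6)[OF R(5)] by (simp add: gS_def algebra_simps)
qed

lemma cst_past:
  fixes x :: "'m::monoid_add \<Rightarrow>\<^sub>0 'k::comm_ring_1"
  shows "x * cst c = cst c * x" "x * (cst c * y) = cst c * (x * y)"
  by (simp_all add: cst_commute cst_left_commute)

lemma power_past: "x ^ n * (x * y) = x * (x ^ n * y)" for x y :: "'a::monoid_mult"
  by (simp add: power_commutes flip: mult.assoc)

text \<open>The commutator with w is a derivation, which brings down a factor n on n-th
  powers.\<close>

definition Cn :: "real \<Rightarrow> nat \<Rightarrow> (e2_gen list \<Rightarrow>\<^sub>0 complex)" where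
  "Cn \<kappa> n = cst (of_nat n * complex_of_real (1 / (2 * \<kappa>)))"

lemma Cn_simps: "Cn \<kappa> 0 = 0" "Cn \<kappa> (Suc n) = kc \<kappa> + Cn \<kappa> n"
  by (simp_all only: Cn_def kc_def of_nat_0 mult_zero_left cst_simps of_nat_Suc distrib_right mult_1_left cst_hom(1))

lemma Cn_past: "x * (Cn \<kappa> n * y) = Cn \<kappa> n * (x * y)" "x * (kc \<kappa> * y) = kc \<kappa> * (x * y)"
  by (simp_all add: Cn_def kc_def cst_past)

text \<open>The commutator of a^n with w is n/(2\<kappa>) times (a^2 - 1) a^(n-1); the factor a in
  front avoids the exponent n - 1.\<close>

lemma commute_powers:
  "ga * (ga ^ n * gw - gw * ga ^ n) - Cn \<kappa> n * ((ga * ga - 1) * ga ^ n) \<in> e2_ideal \<kappa>"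
  "gS ^ n * gw - gw * gS ^ n - Cn \<kappa> n * ((ga + gb) * gS ^ n) \<in> e2_ideal \<kappa>"
  "ga ^ n * gS - gS * ga ^ n \<in> e2_ideal \<kappa>"
proof -
  note I = Idl_free[where R = "e2_relations \<kappa>"] and F = e2_ideal_facts[of \<kappa>]
  show "ga * (ga ^ n * gw - gw * ga ^ n) - Cn \<kappa> n * ((ga * ga - 1) * ga ^ n) \<in> e2_ideal \<kappa>"
  proof (induction n)
    case (Suc n)
    have "ga * (ga ^ Suc n * gw - gw * ga ^ Suc n) - Cn \<kappa> (Suc n) * ((ga * ga - 1) * ga ^ Suc n) =
       ga * (ga * (ga ^ n * gw - gw * ga ^ n) - Cn \<kappa> n * ((ga * ga - 1) * ga ^ n))
       + ga * ((ga * gw - gw * ga - kc \<kappa> * (ga * ga - 1)) * ga ^ n)"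
      by (simp add: Cn_simps Cn_past[of ga] algebra_simps)
    then show ?case using I(4)[OF I(8)[OF Suc] I(8)[OF I(7)[OF F(1)]]] by simp
  qed (simp add: Cn_simps I(3))
  show "ga ^ n * gS - gS * ga ^ n \<in> e2_ideal \<kappa>"
  proof (induction n)
    case (Suc n)
    have "ga ^ Suc n * gS - gS * ga ^ Suc n = ga * (ga ^ n * gS - gS * ga ^ n) + (ga * gS - gS * ga) * ga ^ n"
      by (simp add: algebra_simps)
    then show ?case using I(4)[OF I(8)[OF Suc] I(7)[OF F(2)]] by simp
  qed (simp add: I(3))
  show "gS ^ n * gw - gw * gS ^ n - Cn \<kappa> n * ((ga + gb) * gS ^ n) \<in> e2_ideal \<kappa>"
  proof (induction n)
    case (Suc n)
    have "gS ^ Suc n * gw - gw * gS ^ Suc n - Cn \<kappa> (Suc n) * ((ga + gb) * gS ^ Suc n) =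
      gS * (gS ^ n * gw - gw * gS ^ n - Cn \<kappa> n * ((ga + gb) * gS ^ n))
      + (gS * gw - gw * gS - kc \<kappa> * ((ga + gb) * gS)) * gS ^ n
      - Cn \<kappa> n * (((ga * gS - gS * ga) + (gb * gS - gS * gb)) * gS ^ n)"
      by (simp add: Cn_simps Cn_past[of gS] algebra_simps)
    then show ?case
      using I(5)[OF I(4)[OF I(8)[OF Suc] I(7)[OF F(4)]] I(8)[OF I(7)[OF I(4)[OF F(2,3)]]]] by simp
  qed (simp add: Cn_simps I(3))
qed

text \<open>The exponent of w comes first in the index because the independence proof eliminates the
  powers of w before the others.\<close>

definition e2_monomial :: "nat \<times> nat \<times> nat \<Rightarrow> (e2_gen list \<Rightarrow>\<^sub>0 complex)" where
  "e2_monomial = (\<lambda>(j, i, n). ga ^ n * (gS ^ i * gw ^ j))"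

text \<open>The span of the monomials modulo the ideal. Congruence is one of the rules, so
  membership is shown by exhibiting a congruent element.\<close>

inductive_set NF :: "real \<Rightarrow> (e2_gen list \<Rightarrow>\<^sub>0 complex) set" for \<kappa> where
  mono: "cst c * e2_monomial t \<in> NF \<kappa>"
| add: "x \<in> NF \<kappa> \<Longrightarrow> y \<in> NF \<kappa> \<Longrightarrow> x + y \<in> NF \<kappa>"
| cong: "x \<in> NF \<kappa> \<Longrightarrow> x - y \<in> e2_ideal \<kappa> \<Longrightarrow> y \<in> NF \<kappa>"

lemma NF_mult:
  assumes "\<And>t. g * e2_monomial t \<in> NF \<kappa>" and cst: "\<And>c x. x \<in> NF \<kappa> \<Longrightarrow> cst c * x \<in> NF \<kappa>" and "x \<in> NF \<kappa>"
  shows "g * x \<in> NF \<kappa>"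
  using assms(3)
proof induction
  case (mono c t)
  show ?case using cst[OF assms(1)[of t], of c] by (simp add: cst_past)
next
  case (add x y)
  then show ?case by (simp add: distrib_left NF.add)
next
  case (cong x y)
  have "g * x - g * y \<in> e2_ideal \<kappa>"
    using Idl_free(8)[OF cong.hyps(2), of g] by (simp only: right_diff_distrib)
  with cong.IH show ?case by (rule NF.cong)
qed

lemma NF_cst: "x \<in> NF \<kappa> \<Longrightarrow> cst c * x \<in> NF \<kappa>"
proof (induction rule: NF.induct)
  case (mono d t)
  show ?case using NF.mono[of "c * d" t] by (simp add: cst_hom(2) mult.assoc)
next
  case (add x y)
  then show ?case by (simp add: distrib_left NF.add)
next
  case (cong x y)
  have "cst c * x - cst c * y \<in> e2_ideal \<kappa>"
    using Idl_free(8)[OF cong.hyps(2), of "cst c"] by (simp only: right_diff_distrib)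
  with cong.IH show ?case by (rule NF.cong)
qed

lemma NF_mono1: "e2_monomial t \<in> NF \<kappa>"
  using NF.mono[of 1 t] by simp

lemma NF_diff: "x \<in> NF \<kappa> \<Longrightarrow> y \<in> NF \<kappa> \<Longrightarrow> x - y \<in> NF \<kappa>"
  using NF.add[OF _ NF_cst[of y \<kappa> "- 1"], of x] by (simp add: cst_hom)

lemma NF_ga: "x \<in> NF \<kappa> \<Longrightarrow> ga * x \<in> NF \<kappa>"
proof (rule NF_mult[OF _ NF_cst])
  fix t :: "nat \<times> nat \<times> nat"
  show "ga * e2_monomial t \<in> NF \<kappa>"
    using NF_mono1[of "(fst t, fst (snd t), Suc (snd (snd t)))"] by (cases t) (simp add: e2_monomial_def mult.assoc)
qed

lemma NF_ga_power: "x \<in> NF \<kappa> \<Longrightarrow> ga ^ n * x \<in> NF \<kappa>"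
  by (induction n) (simp_all add: mult.assoc NF_ga)

lemma NF_gS: "x \<in> NF \<kappa> \<Longrightarrow> gS * x \<in> NF \<kappa>"
proof (rule NF_mult[OF _ NF_cst])
  fix t :: "nat \<times> nat \<times> nat"
  obtain j i n where t: "t = (j, i, n)" by (cases t)
  have "e2_monomial (j, Suc i, n) - gS * e2_monomial t = (ga ^ n * gS - gS * ga ^ n) * (gS ^ i * gw ^ j)"
    by (simp add: e2_monomial_def t algebra_simps)
  also have "\<dots> \<in> e2_ideal \<kappa>" by (rule Idl_free(7)[OF commute_powers(3)])
  finally show "gS * e2_monomial t \<in> NF \<kappa>" by (rule NF.cong[OF NF_mono1])
qed

text \<open>Multiplication by w alone leaves the span: moving w past a power of w + w* creates a
  factor a*. A factor a in front absorbs it.\<close>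

lemma NF_ga_gw: "x \<in> NF \<kappa> \<Longrightarrow> (ga * gw) * x \<in> NF \<kappa>"
proof (rule NF_mult[OF _ NF_cst])
  note I = Idl_free[where R = "e2_relations \<kappa>"]
  fix t :: "nat \<times> nat \<times> nat"
  obtain j i n where t: "t = (j, i, n)" by (cases t)
  let ?R = "gS ^ i * gw ^ j"
  \<comment> \<open>The reordered product with two corrections: moving w past the power of w + w*
    gives a + a*, which with the extra a becomes a^2 + 1, and moving it past a^n gives a^2 -
    1.\<close>
  let ?y = "e2_monomial (Suc j, i, Suc n) - Cn \<kappa> i * (e2_monomial (j, i, Suc (Suc n)) + e2_monomial (j, i, n))
     - Cn \<kappa> n * (e2_monomial (j, i, Suc (Suc n)) - e2_monomial (j, i, n))"
  have y: "?y \<in> NF \<kappa>"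
    unfolding Cn_def by (intro NF_diff NF.add NF_cst NF_mono1)
  have "?y - ga * gw * e2_monomial t =
      (ga * (ga ^ n * gw - gw * ga ^ n) - Cn \<kappa> n * ((ga * ga - 1) * ga ^ n)) * ?R * (-1) * (-1)
      + ga * ga ^ n * ((gS ^ i * gw - gw * gS ^ i - Cn \<kappa> i * ((ga + gb) * gS ^ i)) * gw ^ j)
      + Cn \<kappa> i * (ga ^ n * ((ga * gb - 1) * ?R))"
    by (simp add: e2_monomial_def t power_past power_commutes Cn_past[of ga] Cn_past[of "ga ^ n"] algebra_simps)
  also have "\<dots> \<in> e2_ideal \<kappa>"
    by (intro I(4,7,8) commute_powers e2_ideal_facts)
  finally show "ga * gw * e2_monomial t \<in> NF \<kappa>" by (rule NF.cong[OF y])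
qed

text \<open>Each letter of a word costs at most one further factor a: it cancels a*, and it is what
  w requires by \<open>NF_ga_gw\<close>.\<close>

lemma normal_form: "\<exists>N. ga ^ N * f \<in> NF \<kappa>"
proof (induction f rule: free_induct)
  case one
  have "ga ^ 0 * 1 \<in> NF \<kappa>" using NF_mono1[of "(0, 0, 0)"] by (simp add: e2_monomial_def)
  then show ?case by blast
next
  case (add f g)
  then obtain M N where MN: "ga ^ M * f \<in> NF \<kappa>" "ga ^ N * g \<in> NF \<kappa>" by blast
  have "ga ^ (M + N) * (f + g) = ga ^ N * (ga ^ M * f) + ga ^ M * (ga ^ N * g)"
    by (simp add: distrib_left power_add flip: mult.assoc) (simp add: add.commute flip: power_add)
  with MN show ?case by (metis NF.add NF_ga_power)
next
  case (smult c f)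
  then obtain N where "ga ^ N * f \<in> NF \<kappa>" by blast
  from NF_cst[OF this, of c] show ?case by (intro exI[of _ N]) (simp add: cst_past)
next
  case (gen_mult x f)
  note I = Idl_free[where R = "e2_relations \<kappa>"]
  from gen_mult obtain N where N: "ga ^ N * f \<in> NF \<kappa>" by blast
  have W: "ga ^ Suc N * (gw * f) \<in> NF \<kappa>"
  proof (rule NF.cong)
    show "(ga * gw) * (ga ^ N * f) + Cn \<kappa> N * (ga * (ga * (ga ^ N * f)) - ga ^ N * f) \<in> NF \<kappa>"
      unfolding Cn_def by (intro NF.add NF_ga_gw NF_cst NF_diff NF_ga N)
    have "(ga * gw) * (ga ^ N * f) + Cn \<kappa> N * (ga * (ga * (ga ^ N * f)) - ga ^ N * f) - ga ^ Suc N * (gw * f) =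
       - ((ga * (ga ^ N * gw - gw * ga ^ N) - Cn \<kappa> N * ((ga * ga - 1) * ga ^ N)) * f)"
      by (simp add: algebra_simps)
    also have "\<dots> \<in> e2_ideal \<kappa>" by (intro I(6,7) commute_powers)
    finally show "(ga * gw) * (ga ^ N * f) + Cn \<kappa> N * (ga * (ga * (ga ^ N * f)) - ga ^ N * f) - ga ^ Suc N * (gw * f) \<in> e2_ideal \<kappa>" .
  qed
  show ?case
  proof (cases x)
    case A0
    show ?thesis using NF_ga[OF N] by (intro exI[of _ N]) (simp add: A0 power_past)
  next
    case A0_star
    have "ga ^ N * f - ga ^ Suc N * (gb * f) = - (ga ^ N * ((ga * gb - 1) * f))"
      by (simp add: power_past algebra_simps)
    also have "\<dots> \<in> e2_ideal \<kappa>" by (intro I(6,7,8) e2_ideal_facts)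
    finally show ?thesis unfolding A0_star by (intro exI[of _ "Suc N"]) (rule NF.cong[OF N])
  next
    case W0
    with W show ?thesis by blast
  next
    case W0_star
    have S: "ga ^ Suc N * (gS * f) \<in> NF \<kappa>"
    proof (rule NF.cong)
      show "gS * (ga * (ga ^ N * f)) \<in> NF \<kappa>" by (intro NF_gS NF_ga N)
      have "gS * (ga * (ga ^ N * f)) - ga ^ Suc N * (gS * f) = - ((ga ^ Suc N * gS - gS * ga ^ Suc N) * f)"
        by (simp add: algebra_simps)
      also have "\<dots> \<in> e2_ideal \<kappa>" by (intro I(6,7) commute_powers)
      finally show "gS * (ga * (ga ^ N * f)) - ga ^ Suc N * (gS * f) \<in> e2_ideal \<kappa>" .
    qed
    have "ga ^ Suc N * (gz * f) = ga ^ Suc N * (gS * f) - ga ^ Suc N * (gw * f)"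
      by (simp add: gS_def algebra_simps)
    with NF_diff[OF S W] show ?thesis unfolding W0_star by metis
  qed
qed

definition nf :: "(nat \<times> nat \<times> nat \<Rightarrow>\<^sub>0 complex) \<Rightarrow> (e2_gen list \<Rightarrow>\<^sub>0 complex)" where
  "nf c = (\<Sum>t\<in>kys c. cst (lkp c t) * e2_monomial t)"

lemma nf_superset: "finite S \<Longrightarrow> kys c \<subseteq> S \<Longrightarrow> nf c = (\<Sum>t\<in>S. cst (lkp c t) * e2_monomial t)"
  unfolding nf_def by (intro sum.mono_neutral_left) (auto simp: in_keys_iff)

lemma NF_nf: "x \<in> NF \<kappa> \<Longrightarrow> \<exists>c. x - nf c \<in> e2_ideal \<kappa>"
proof (induction rule: NF.induct)
  case (mono c t)
  have "nf (sgl t c) = cst c * e2_monomial t" by (subst nf_superset[of "{t}"]) auto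
  then show ?case using Idl_free(3)[where R = "e2_relations \<kappa>"] by (intro exI[of _ "sgl t c"]) simp
next
  case (add x y)
  then obtain c d where cd: "x - nf c \<in> e2_ideal \<kappa>" "y - nf d \<in> e2_ideal \<kappa>" by blast
  have "nf (c + d) = nf c + nf d"
    using Poly_Mapping.keys_add[of c d]
    by (subst (1 2 3) nf_superset[of "kys c \<union> kys d"]) (auto simp: lookup_add cst_hom distrib_right sum.distrib)
  with Idl_free(4)[OF cd] show ?case by (intro exI[of _ "c + d"]) (simp add: algebra_simps)
next
  case (cong x y)
  then obtain c where "x - nf c \<in> e2_ideal \<kappa>" by blast
  from Idl_free(5)[OF this cong.hyps(2)] show ?case by (intro exI[of _ c]) simp
qed


subsection \<open>Independence of the normal monomials\<close>

text \<open>Each coefficient of the series is a complex polynomial in the parameter x that vanishes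
  everywhere.\<close>

lemma fps_polynomial_zero:
  assumes "\<And>x::complex. (\<Sum>m\<le>n. fps_const (x ^ m) * a m) = 0" "m \<le> n"
  shows "a m = 0"
proof (rule fps_ext)
  fix k
  have "(\<Sum>m\<le>n. fps_nth (a m) k * x ^ m) = 0" for x
    using arg_cong[OF assms(1)[of x], of "\<lambda>f. fps_nth f k"] by (simp add: fps_sum_nth mult.commute)
  then show "fps_nth (a m) k = fps_nth 0 k"
    using polyfun_eq_0[where n = n and c = "\<lambda>m. fps_nth (a m) k"] assms(2) by simp
qed

lemma phi0_nth0: "fps_nth phi0 0 = 1"
  by (simp add: phi0_def sqrt_series_def)

text \<open>The series b0 - 1 is nonzero and has no constant term, so composition with it is
  injective. A polynomial equation for b0, rewritten in powers of b0 - 1, therefore has a zero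
  polynomial.\<close>

lemma b0_independent:
  assumes "(\<Sum>n<D. fps_const (c n) * b0 ^ n) = 0" "n < D"
  shows "c n = 0"
proof -
  let ?y = "b0 - 1"
  have y0: "fps_nth ?y 0 = 0" by (simp add: b0_def phi0_nth0)
  have "?y \<noteq> 0"
  proof
    assume "?y = 0"
    then have "b0 = 1" by simp
    with b0_inverse have "b0' = 1" by simp
    with \<open>b0 = 1\<close> have "b0 - b0' = 0" by simp
    then have "fps_nth (b0 - b0') 1 = 0" by simp
    then show False by (simp add: b0_def b0'_def)
  qed
  define p where "p = (\<Sum>n<D. Polynomial.monom (c n) n)"
  have monom: "pcompose (Polynomial.monom d n) q = Polynomial.smult d (q ^ n)" for d :: complex and n q
    by (induction n) (simp_all add: monom_0 monom_Suc pcompose_pCons)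
  have "fps_of_poly (pcompose p [:1, 1:]) = (\<Sum>n<D. fps_const (c n) * (1 + fps_X) ^ n)"
    by (simp add: p_def pcompose_sum monom fps_of_poly_sum fps_of_poly_smult fps_of_poly_power fps_of_poly_pCons)
  moreover have "(\<Sum>n<D. fps_const (c n) * (1 + fps_X) ^ n) oo ?y = (\<Sum>n<D. fps_const (c n) * b0 ^ n)"
    unfolding fps_compose_sum_distrib
    by (intro sum.cong refl) (simp add: fps_compose_mult_distrib[OF y0] fps_compose_power[OF y0, symmetric] fps_compose_add_distrib fps_X_fps_compose_startby0[OF y0])
  ultimately have "fps_of_poly (pcompose p [:1, 1:]) oo ?y = 0" using assms(1) by simp
  with \<open>?y \<noteq> 0\<close> y0 have "fps_of_poly (pcompose p [:1, 1:]) = 0" by (simp add: fps_compose_eq_0_iff)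
  then have "pcompose p [:1, 1:] = 0" by (metis fps_of_poly_0 fps_of_poly_eq_iff)
  then have "p = 0" by (rule pcompose_eq_0) simp
  then have "Polynomial.coeff p n = 0" by simp
  moreover have "Polynomial.coeff p n = c n"
    using assms(2) by (simp add: p_def coeff_sum sum.delta)
  ultimately show ?thesis by simp
qed

lemma w_op_x: "w_op \<kappa> v x f = w_op \<kappa> v 0 f - fps_const x * (phi0 * f)"
proof -
  have "fps_const (- 1/2) * fps_const (2 * x) = - fps_const x" by simp
  then have "fps_const (- 1/2) * (fps_const (2 * x) * (phi0 * f)) = - (fps_const x * (phi0 * f))"
    by (metis mult.assoc mult_minus_left)
  then show ?thesis by (simp add: w_op_def distrib_left)
qed

lemma w_op_sum: "w_op \<kappa> v x (\<Sum>m\<in>S. fps_const (c m) * q m) = (\<Sum>m\<in>S. fps_const (c m) * w_op \<kappa> v x (q m))"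
proof (induction S rule: infinite_finite_induct)
  case empty
  show ?case by (simp add: w_op_def)
next
  case (infinite S)
  then show ?case by (simp add: w_op_def)
qed (simp add: w_op_linear)

text \<open>By \<open>w_op_x\<close> the parameter enters only through -x times \<open>phi0\<close>,
  so each application raises the degree in x by at most one and multiplies the top coefficient by
  -\<open>phi0\<close>.\<close>

lemma w_op_power:
  "\<exists>q. (\<forall>x. (w_op \<kappa> v x ^^ j) 1 = (\<Sum>m\<le>j. fps_const (x ^ m) * q m)) \<and> q j = (- phi0) ^ j"
proof (induction j)
  case 0
  show ?case by (intro exI[of _ "\<lambda>_. 1"]) simp
next
  case (Suc j)
  then obtain q where q: "\<And>x. (w_op \<kappa> v x ^^ j) 1 = (\<Sum>m\<le>j. fps_const (x ^ m) * q m)" "q j = (- phi0) ^ j" by blast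
  \<comment> \<open>The operator at x = 0 acts on each coefficient, and multiplication by -x
    \<open>phi0\<close> shifts the degree by one.\<close>
  define r where "r m = (if m \<le> j then w_op \<kappa> v 0 (q m) else 0) - (if m = 0 then 0 else phi0 * q (m - 1))" for m
  have "(w_op \<kappa> v x ^^ Suc j) 1 = (\<Sum>m\<le>Suc j. fps_const (x ^ m) * r m)" for x
  proof -
    have shift: "fps_const x * (phi0 * (fps_const (x ^ m) * q m)) = fps_const (x ^ Suc m) * (phi0 * q m)" for m
      by (simp only: power_Suc fps_const_mult[symmetric] mult_ac)
    let ?S = "\<Sum>m\<le>j. fps_const (x ^ m) * q m"
    have "(w_op \<kappa> v x ^^ Suc j) 1 = w_op \<kappa> v x ?S"
      by (simp only: funpow.simps comp_apply q(1))
    also have "\<dots> = w_op \<kappa> v 0 ?S - fps_const x * (phi0 * ?S)" by (rule w_op_x)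
    also have "\<dots> = (\<Sum>m\<le>j. fps_const (x ^ m) * w_op \<kappa> v 0 (q m)) - (\<Sum>m\<le>j. fps_const (x ^ Suc m) * (phi0 * q m))"
      by (simp only: w_op_sum sum_distrib_left shift)
    also have "(\<Sum>m\<le>j. fps_const (x ^ m) * w_op \<kappa> v 0 (q m)) = (\<Sum>m\<le>Suc j. fps_const (x ^ m) * (if m \<le> j then w_op \<kappa> v 0 (q m) else 0))"
      by simp
    also have "(\<Sum>m\<le>j. fps_const (x ^ Suc m) * (phi0 * q m)) = (\<Sum>m\<le>Suc j. fps_const (x ^ m) * (if m = 0 then 0 else phi0 * q (m - 1)))"
      by (simp add: sum.atMost_Suc_shift del: sum.atMost_Suc)
    finally show ?thesis by (simp only: r_def right_diff_distrib sum_subtractf)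
  qed
  moreover have "r (Suc j) = (- phi0) ^ Suc j" by (simp add: r_def q(2))
  ultimately show ?case by blast
qed

text \<open>Only the highest power w^J reaches degree J in x, so its coefficient times a power of
  \<open>phi0\<close> vanishes for all v. As a polynomial in v this separates the exponents i, and
  \<open>b0_independent\<close> separates the exponents n. Induction on J then removes the lower
  powers.\<close>

lemma monomials_independent:
  fixes C :: "nat \<Rightarrow> nat \<Rightarrow> nat \<Rightarrow> complex"
  assumes "\<And>v x. (\<Sum>j<J. \<Sum>i<D. \<Sum>n<D. fps_const (C j i n) * (b0 ^ n * ((fps_const (- v) * fps_X) ^ i * (w_op \<kappa> v x ^^ j) 1))) = 0"
    and "j < J" "i < D" "n < D"
  shows "C j i n = 0"
  using assms
proof (induction J arbitrary: j i n)
  case (Suc J)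
  define p where "p j v = (\<Sum>i<D. \<Sum>n<D. fps_const (C j i n) * (b0 ^ n * (fps_const (- v) * fps_X) ^ i))" for j v
  have sum: "(\<Sum>j<Suc J. p j v * (w_op \<kappa> v x ^^ j) 1) = 0" for v x
    using Suc.prems(1)[of v x] by (simp only: p_def sum_distrib_right mult.assoc)
  have pJ: "p J v = 0" for v
  proof -
    obtain q where q: "\<And>j x. (w_op \<kappa> v x ^^ j) 1 = (\<Sum>m\<le>j. fps_const (x ^ m) * q j m)" "\<And>j. q j j = (- phi0) ^ j"
      using w_op_power[of _ \<kappa> v] by metis
    \<comment> \<open>The coefficient of x^m in the whole sum; w^j contributes to it only for m at
      most j.\<close>
    define a where "a m = (\<Sum>j<Suc J. if m \<le> j then p j v * q j m else 0)" for m
    have "(\<Sum>m\<le>J. fps_const (x ^ m) * a m) = 0" for x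
    proof -
      have "(\<Sum>m\<le>J. fps_const (x ^ m) * a m) = (\<Sum>m\<le>J. \<Sum>j<Suc J. if m \<le> j then p j v * (fps_const (x ^ m) * q j m) else 0)"
        unfolding a_def sum_distrib_left by (intro sum.cong refl) (simp add: mult.left_commute)
      also have "\<dots> = (\<Sum>j<Suc J. \<Sum>m\<le>J. if m \<le> j then p j v * (fps_const (x ^ m) * q j m) else 0)"
        by (rule sum.swap)
      also have "\<dots> = (\<Sum>j<Suc J. p j v * (w_op \<kappa> v x ^^ j) 1)"
      proof (rule sum.cong[OF refl])
        fix j assume "j \<in> {..<Suc J}"
        then have "(\<Sum>m\<le>J. if m \<le> j then p j v * (fps_const (x ^ m) * q j m) else 0) = (\<Sum>m\<le>j. p j v * (fps_const (x ^ m) * q j m))"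
          by (intro sum.mono_neutral_cong_right) auto
        then show "(\<Sum>m\<le>J. if m \<le> j then p j v * (fps_const (x ^ m) * q j m) else 0) = p j v * (w_op \<kappa> v x ^^ j) 1"
          by (simp add: q(1) sum_distrib_left)
      qed
      finally show ?thesis using sum by simp
    qed
    from fps_polynomial_zero[OF this, of J] have "a J = 0" by simp
    moreover have "a J = p J v * (- phi0) ^ J"
      by (simp add: a_def q(2))
    moreover have "phi0 \<noteq> 0" using phi0_nth0 by auto
    ultimately show ?thesis by simp
  qed
  have top: "C J i n = 0" if "i < D" "n < D" for i n
  proof -
    define s where "s i = (- fps_X) ^ i * (\<Sum>n<D. fps_const (C J i n) * b0 ^ n)" for i
    have "D > 0" using that by linarith
    then obtain D' where D': "D = Suc D'" by (metis gr0_implies_Suc)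
    have "(\<Sum>i\<le>D'. fps_const (v ^ i) * s i) = 0" for v
    proof -
      have e: "(fps_const (- v) * fps_X) ^ i = fps_const (v ^ i) * (- fps_X) ^ i" for i
      proof -
        have "fps_const (- v) * fps_X = fps_const v * (- fps_X)" by (simp flip: fps_const_neg)
        then show ?thesis by (simp only: power_mult_distrib fps_const_power)
      qed
      have "fps_const (v ^ i) * s i = (\<Sum>n<D. fps_const (C J i n) * (b0 ^ n * (fps_const (- v) * fps_X) ^ i))" for i
        unfolding s_def sum_distrib_left e by (intro sum.cong refl) (simp only: mult_ac)
      then have "(\<Sum>i<D. fps_const (v ^ i) * s i) = p J v" by (simp add: p_def)
      then show ?thesis by (simp only: pJ D' lessThan_Suc_atMost)
    qed
    from fps_polynomial_zero[OF this, of i] have "s i = 0" using that D' by simp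
    then have "(\<Sum>n<D. fps_const (C J i n) * b0 ^ n) = 0" by (simp add: s_def)
    from b0_independent[OF this \<open>n < D\<close>] show ?thesis .
  qed
  have "(\<Sum>j<J. \<Sum>i<D. \<Sum>n<D. fps_const (C j i n) * (b0 ^ n * ((fps_const (- v) * fps_X) ^ i * (w_op \<kappa> v x ^^ j) 1))) = 0" for v x
    using Suc.prems(1)[of v x] top by simp
  from Suc.IH[OF this] Suc.prems(2-4) top show ?case by (cases "j = J") auto
qed simp

lemma lrep_power: "lrep \<kappa> v x (g ^ n) F = (lrep \<kappa> v x g ^^ n) F"
  by (induction n arbitrary: F) (simp_all add: lrep_simps funpow_swap1)

lemma lrep_monomial: "lrep \<kappa> v x (e2_monomial (j, i, n)) F = b0 ^ n * ((fps_const (- v) * fps_X) ^ i * (w_op \<kappa> v x ^^ j) F)"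
proof -
  have p: "(lrep \<kappa> v x g ^^ n) F = G ^ n * F" if "\<And>F. lrep \<kappa> v x g F = G * F" for g G n F
    by (induction n) (simp_all add: that mult.assoc)
  have S: "lrep \<kappa> v x gS F = (fps_const (- v) * fps_X) * F" for F
  proof -
    have "lrep \<kappa> v x gS F = - (fps_const v * (fps_X * F))" by (simp add: gS_def lrep_simps e2_op_simps)
    then show ?thesis by (simp add: mult.assoc flip: fps_const_neg)
  qed
  have W: "lrep \<kappa> v x gw = w_op \<kappa> v x" by (rule ext) (simp add: lrep_simps e2_op_simps)
  have A: "lrep \<kappa> v x ga F = b0 * F" for F by (simp add: lrep_simps e2_op_simps)
  show ?thesis
    by (simp add: e2_monomial_def lrep_simps(1) lrep_power p[OF A] p[OF S] W)
qed

lemma lrep_sum: "lrep \<kappa> v x (\<Sum>t\<in>S. g t) F = (\<Sum>t\<in>S. lrep \<kappa> v x (g t) F)"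
  by (induction S rule: infinite_finite_induct) (simp_all add: lrep_simps)

lemma nf_faithful:
  assumes "\<And>v x. lrep \<kappa> v x (nf c) 1 = 0"
  shows "c = 0"
proof (rule ccontr)
  assume "c \<noteq> 0"
  then obtain t where t: "t \<in> kys c" by (metis keys_eq_empty ex_in_conv)
  define D where "D = Suc (Max ((\<lambda>(j, i, n). max j (max i n)) ` kys c))"
  have bound: "max j (max i n) < D" if "(j, i, n) \<in> kys c" for j i n
  proof -
    have "(case (j, i, n) of (j, i, n) \<Rightarrow> max j (max i n)) \<le> Max ((\<lambda>(j, i, n). max j (max i n)) ` kys c)"
      by (rule Max_ge) (use that in \<open>auto simp: image_iff intro!: bexI[of _ "(j, i, n)"]\<close>)
    then show ?thesis by (simp add: D_def)
  qed
  then have sub: "kys c \<subseteq> {..<D} \<times> ({..<D} \<times> {..<D})" by fastforce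
  have "lrep \<kappa> v x (nf c) 1 = (\<Sum>j<D. \<Sum>i<D. \<Sum>n<D. fps_const (lkp c (j, i, n)) * (b0 ^ n * ((fps_const (- v) * fps_X) ^ i * (w_op \<kappa> v x ^^ j) 1)))" for v x
    by (subst nf_superset[OF _ sub])
      (simp_all add: lrep_sum lrep_simps(1,6) lrep_monomial sum.cartesian_product')
  with assms have "(\<Sum>j<D. \<Sum>i<D. \<Sum>n<D. fps_const (lkp c (j, i, n)) * (b0 ^ n * ((fps_const (- v) * fps_X) ^ i * (w_op \<kappa> v x ^^ j) 1))) = 0" for v x
    by simp
  note z = monomials_independent[where J = D and D = D and C = "\<lambda>j i n. lkp c (j, i, n)" and \<kappa> = \<kappa>, OF this]
  obtain j i n where "t = (j, i, n)" by (cases t)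
  with t bound[of j i n] z[of j i n] show False by (simp add: in_keys_iff)
qed


subsection \<open>Faithfulness and separation\<close>

text \<open>The counterpart of \<open>reduces\<close> for operators. It relates \<open>lrep\<close>,
  so far defined on the free algebra only, to elements of the quantum group.\<close>

definition rep_reduces :: "real \<Rightarrow> (e2_gen list \<Rightarrow>\<^sub>0 complex) \<Rightarrow> su2_free \<Rightarrow> bool" where
  "rep_reduces \<kappa> f X \<longleftrightarrow> (\<forall>v x F g. fps_limit F g \<longrightarrow> fps_limit (rep \<kappa> v x X F) (lrep \<kappa> v x f g))"

lemma reduces_exists: "\<exists>X. reduces \<kappa> f X \<and> rep_reduces \<kappa> f X"
proof (induction f rule: free_induct)
  case one
  show ?case by (rule exI[of _ 1]) (simp add: reduces_one rep_reduces_def rep_simps lrep_simps)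
next
  case (add f g)
  then obtain X Y where "reduces \<kappa> f X" "rep_reduces \<kappa> f X" "reduces \<kappa> g Y" "rep_reduces \<kappa> g Y" by blast
  then show ?case by (intro exI[of _ "X + Y"]) (auto simp: reduces_add rep_reduces_def rep_simps lrep_simps fps_limit_add)
next
  case (smult c f)
  then obtain X where "reduces \<kappa> f X" "rep_reduces \<kappa> f X" by blast
  then show ?case
    by (intro exI[of _ "cst (fls_const c) * X"])
      (auto simp: reduces_smult fls_limit_const rep_reduces_def rep_simps lrep_simps fps_limit_smult)
next
  case (gen_mult x f)
  then obtain X where "reduces \<kappa> f X" "rep_reduces \<kappa> f X" by blast
  then show ?case
    by (intro exI[of _ "e2F \<kappa> x * X"])
      (auto simp: reduces_mult reduces_gen rep_reduces_def rep_simps(1) lrep_simps(1,7) rep_gens_limit)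
qed

text \<open>The generators send every integral series to an integral one, and this is stable under
  sums, compositions and integral scalars. F stays arbitrary in the induction for the sake of
  products.\<close>

lemma lattice_integral:
  assumes "x \<in> lattice_carrier \<kappa>" "fps_limit F f"
  shows "\<exists>g. fps_limit (repc \<kappa> v y x F) g"
  using assms
proof (induction x arbitrary: F f rule: lattice_induct)
  case (gen x)
  then show ?case by (intro exI[of _ "e2_op \<kappa> v y x f"]) (simp add: rep_gens_limit)
next
  case one
  then show ?case using alg_homD(2)[OF repc_hom, of \<kappa> v y] by auto
next
  case (add x z)
  have xz: "x \<in> carrier (su2 \<kappa>)" "z \<in> carrier (su2 \<kappa>)" using add(1,2) lattice_subset by auto
  obtain g h where "fps_limit (repc \<kappa> v y x F) g" "fps_limit (repc \<kappa> v y z F) h" using add by blast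
  then show ?case using alg_homD(5)[OF repc_hom xz, of v y] by (auto intro: fps_limit_add)
next
  case (mult x z)
  have xz: "x \<in> carrier (su2 \<kappa>)" "z \<in> carrier (su2 \<kappa>)" using mult(1,2) lattice_subset by auto
  obtain g where g: "fps_limit (repc \<kappa> v y z F) g" using mult by blast
  obtain h where "fps_limit (repc \<kappa> v y x (repc \<kappa> v y z F)) h" using mult.IH(1)[OF g] by blast
  then show ?case using alg_homD(4)[OF repc_hom xz, of v y] by auto
next
  case (smult c x)
  have x: "x \<in> carrier (su2 \<kappa>)" using smult(1) lattice_subset by auto
  obtain g where "fps_limit (repc \<kappa> v y x F) g" using smult by blast
  then show ?case using alg_homD(6)[OF repc_hom x, of v y "fps_to_fls c"] by (auto intro: fps_limit_smult fls_limit_consts(6))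
qed

lemma repc_h:
  assumes "z \<in> lattice_carrier \<kappa>" "fps_limit F f"
  shows "fps_limit (repc \<kappa> v y (fls_X \<odot>\<^bsub>su2 \<kappa>\<^esub> z) F) 0"
proof -
  have z: "z \<in> carrier (su2 \<kappa>)" using assms(1) lattice_subset by auto
  obtain g where "fps_limit (repc \<kappa> v y z F) g" using lattice_integral[OF assms] by blast
  from fps_limit_hh[OF this] show ?thesis
    using alg_homD(6)[OF repc_hom z, of v y fls_X] by (simp add: hh_def)
qed

text \<open>If f vanishes in the limit, a representative of it is h times a lattice element; the
  latter acts integrally, so the reduction of the action is zero. In this way the operators
  \<open>e2_op\<close> satisfy the relations of the limit without being computed with.\<close>

lemma lrep_ker:
  assumes "f \<in> ev_ker \<kappa>"
  shows "lrep \<kappa> v x f g = 0"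
proof -
  obtain X where X: "reduces \<kappa> f X" "rep_reduces \<kappa> f X" using reduces_exists by blast
  have "limit_class \<kappa> (cls \<kappa> X) = limit_class \<kappa> \<zero>\<^bsub>su2 \<kappa>\<^esub>"
    using X(1) assms by (simp add: reduces_def ev_ker_def limit_class_zero)
  then obtain z where z: "z \<in> lattice_carrier \<kappa>" "cls \<kappa> X = \<zero>\<^bsub>su2 \<kappa>\<^esub> \<oplus>\<^bsub>su2 \<kappa>\<^esub> fls_X \<odot>\<^bsub>su2 \<kappa>\<^esub> z"
    using limit_class_eqD[of "cls \<kappa> X" \<kappa> "\<zero>\<^bsub>su2 \<kappa>\<^esub>"] X(1) lattice_closed(5) by (metis reduces_def)
  have "z \<in> carrier (su2 \<kappa>)" using z(1) lattice_subset by auto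
  with z(2) have e: "cls \<kappa> X = fls_X \<odot>\<^bsub>su2 \<kappa>\<^esub> z" by simp
  note lift = fps_limit_lift[of g]
  have "fps_limit (rep \<kappa> v x X (Abs_fps (\<lambda>n. fls_const (fps_nth g n)))) 0"
    using repc_h[OF z(1) lift, of v x] by (simp flip: e)
  moreover have "fps_limit (rep \<kappa> v x X (Abs_fps (\<lambda>n. fls_const (fps_nth g n)))) (lrep \<kappa> v x f g)"
    using X(2) lift by (simp add: rep_reduces_def)
  ultimately show ?thesis using fps_limit_unique by blast
qed

lemma e2_ideal_in_ker: "f \<in> e2_ideal \<kappa> \<Longrightarrow> f \<in> ev_ker \<kappa>"
proof -
  assume f: "f \<in> e2_ideal \<kappa>"
  have "ev \<kappa> f = \<zero>\<^bsub>contraction \<kappa>\<^esub>"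
    by (rule E.free_eval_Idl[OF _ _ f]) (use e2_relations_in_ker[of \<kappa>] in \<open>auto simp: ev_ker_def\<close>)
  then show ?thesis by (simp add: ev_ker_def)
qed

text \<open>Some a^N f is congruent to a combination of normal monomials. The action on the series 1
  forces its coefficients to vanish, and the power of a is then cancelled with a*.\<close>

lemma lrep_faithful:
  assumes "\<And>v x. lrep \<kappa> v x f 1 = 0"
  shows "f \<in> e2_ideal \<kappa>"
proof -
  note I = Idl_free[where R = "e2_relations \<kappa>"]
  obtain N where "ga ^ N * f \<in> NF \<kappa>" using normal_form by blast
  then obtain c where c: "ga ^ N * f - nf c \<in> e2_ideal \<kappa>" using NF_nf by blast
  have "lrep \<kappa> v x (nf c) 1 = 0" for v x
  proof -
    have "lrep \<kappa> v x (ga ^ N * f - nf c) 1 = 0" by (rule lrep_ker[OF e2_ideal_in_ker[OF c]])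
    moreover have "lrep \<kappa> v x (ga ^ N * f) 1 = 0"
    proof -
      have z: "lrep \<kappa> v x g 0 = 0" for g
      proof -
        have "lrep \<kappa> v x g \<in> carrier end_alg" by (rule endo.free_eval_closed[OF e2_op_carrier])
        then have "lrep \<kappa> v x g (0 + 0) = lrep \<kappa> v x g 0 + lrep \<kappa> v x g 0" unfolding end_alg_simps(1) by blast
        then show ?thesis by simp
      qed
      show ?thesis by (simp add: lrep_simps(1) assms z)
    qed
    ultimately show ?thesis by (simp add: lrep_simps)
  qed
  then have "c = 0" by (rule nf_faithful)
  with c have A: "ga ^ N * f \<in> e2_ideal \<kappa>" by (simp add: nf_def)
  then show ?thesis
  proof (induction N)
    case (Suc N)
    have ba: "gb * ga - 1 \<in> e2_ideal \<kappa>"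
      using I(2) unfolding e2_relations_def Let_def free_algebra_simps a_minus_free by (simp only: insert_subset)
    have "ga ^ N * f = gb * (ga ^ Suc N * f) - (gb * ga - 1) * (ga ^ N * f)" by (simp add: algebra_simps)
    with I(5)[OF I(8)[OF Suc.prems, of gb] I(7)[OF ba, of "ga ^ N * f"]] Suc.IH show ?case by simp
  qed simp
qed

text \<open>Closes a cycle of inclusions: the relations hold in the limit, what is zero in the limit
  acts as zero, and what kills the series 1 for all parameters lies in the ideal of the
  relations.\<close>

lemma ev_ker_eq: "ev_ker \<kappa> = e2_ideal \<kappa>"
  using e2_ideal_in_ker lrep_faithful lrep_ker by blast

text \<open>Faithfulness in terms of lattice elements. The coefficients of the image of 1 are the
  functionals that will be multiplied on the tensor square.\<close>

lemma lattice_separation: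
  assumes x: "x \<in> lattice_carrier \<kappa>"
    and null: "\<And>v y n. fls_limit (fps_nth (repc \<kappa> v y x 1) n) 0"
  shows "limit_class \<kappa> x = \<zero>\<^bsub>contraction \<kappa>\<^esub>"
proof -
  obtain f where f: "limit_class \<kappa> x = ev \<kappa> f" using ev_surj[OF limit_class_closed[OF x]] by blast
  obtain X where X: "reduces \<kappa> f X" "rep_reduces \<kappa> f X" using reduces_exists by blast
  obtain z where z: "z \<in> lattice_carrier \<kappa>" "cls \<kappa> X = x \<oplus>\<^bsub>su2 \<kappa>\<^esub> fls_X \<odot>\<^bsub>su2 \<kappa>\<^esub> z"
    using limit_class_eqD[of "cls \<kappa> X" \<kappa> x] X(1) x f by (metis reduces_def)
  have xz: "x \<in> carrier (su2 \<kappa>)" "fls_X \<odot>\<^bsub>su2 \<kappa>\<^esub> z \<in> carrier (su2 \<kappa>)" using x z(1) lattice_subset by auto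
  have "lrep \<kappa> v y f 1 = 0" for v y
  proof -
    have "fps_limit (repc \<kappa> v y x 1) 0" using null by (simp add: fps_limit_def)
    from fps_limit_add[OF this repc_h[OF z(1) fps_limit_one, of v y]]
    have "fps_limit (rep \<kappa> v y X 1) 0"
      using alg_homD(5)[OF repc_hom xz, of v y] by (simp flip: z(2))
    moreover have "fps_limit (rep \<kappa> v y X 1) (lrep \<kappa> v y f 1)"
      using X(2) fps_limit_one by (simp add: rep_reduces_def)
    ultimately show ?thesis using fps_limit_unique by blast
  qed
  then have "f \<in> ev_ker \<kappa>" using lrep_faithful ev_ker_eq by blast
  then show ?thesis by (simp add: f ev_ker_def)
qed

lemma contraction_presented: "presented_by (contraction \<kappa>) (e2_gen_value \<kappa>) (e2_relations \<kappa>)"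
  unfolding presented_by_def
proof (intro conjI)
  show "ev \<kappa> \<in> alg_hom free_algebra (contraction \<kappa>)" by (rule E.free_eval_hom) simp
  show "ev \<kappa> ` carrier free_algebra = carrier (contraction \<kappa>)"
  proof
    show "carrier (contraction \<kappa>) \<subseteq> ev \<kappa> ` carrier free_algebra"
    proof
      fix X assume "X \<in> carrier (contraction \<kappa>)"
      then obtain f where "X = ev \<kappa> f" by (rule ev_surj)
      then show "X \<in> ev \<kappa> ` carrier free_algebra" by simp
    qed
  qed auto
  show "a_kernel free_algebra (contraction \<kappa>) (ev \<kappa>) = e2_ideal \<kappa>"
    by (simp add: a_kernel_def' ev_ker_def flip: ev_ker_eq)
qed


section \<open>The induced coproduct\<close>

subsection \<open>Separating functionals on a tensor product\<close>

context tensor_product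
begin

lemma pure_zero [simp]:
  "y \<in> carrier B \<Longrightarrow> \<zero>\<^bsub>A\<^esub> \<otimes>\<otimes> y = \<zero>\<^bsub>T\<^esub>" "x \<in> carrier A \<Longrightarrow> x \<otimes>\<otimes> \<zero>\<^bsub>B\<^esub> = \<zero>\<^bsub>T\<^esub>"
  using pure_smult(1)[of "\<zero>\<^bsub>A\<^esub>" y 0] pure_smult(2)[of x "\<zero>\<^bsub>B\<^esub>" 0] by simp_all

text \<open>A list fixes a number of pure tensors, on which the separation argument is by
  induction.\<close>

definition tensor_list :: "('a \<times> 'b) list \<Rightarrow> (('a \<times> 'b) \<Rightarrow>\<^sub>0 'k) set" where
  "tensor_list xs = foldr (\<lambda>(x, y) t. (x \<otimes>\<otimes> y) \<oplus>\<^bsub>T\<^esub> t) xs \<zero>\<^bsub>T\<^esub>"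

text \<open>The map id \<otimes> c applied to a list of pure tensors; for a general function c it
  depends on the list and not only on the tensor.\<close>

definition contract_list :: "('b \<Rightarrow> 'k) \<Rightarrow> ('a \<times> 'b) list \<Rightarrow> 'a" where
  "contract_list c xs = foldr (\<lambda>(x, y) t. (c y \<odot>\<^bsub>A\<^esub> x) \<oplus>\<^bsub>A\<^esub> t) xs \<zero>\<^bsub>A\<^esub>"

lemma tensor_list_simps [simp]:
  "tensor_list [] = \<zero>\<^bsub>T\<^esub>" "tensor_list ((x, y) # xs) = (x \<otimes>\<otimes> y) \<oplus>\<^bsub>T\<^esub> tensor_list xs"
  "contract_list c [] = \<zero>\<^bsub>A\<^esub>" "contract_list c ((x, y) # xs) = (c y \<odot>\<^bsub>A\<^esub> x) \<oplus>\<^bsub>A\<^esub> contract_list c xs"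
  by (simp_all add: tensor_list_def contract_list_def)

lemma tensor_list_closed [simp]:
  "set xs \<subseteq> carrier A \<times> carrier B \<Longrightarrow> tensor_list xs \<in> carrier T"
  "set xs \<subseteq> carrier A \<times> carrier B \<Longrightarrow> contract_list c xs \<in> carrier A"
  by (induction xs) auto

lemma tensor_listE:
  assumes "t \<in> carrier T"
  obtains xs where "set xs \<subseteq> carrier A \<times> carrier B" "t = tensor_list xs"
proof -
  from assms have "\<exists>xs. set xs \<subseteq> carrier A \<times> carrier B \<and> t = tensor_list xs"
  proof (induction t rule: tensor_induct)
    case zero
    show ?case by (rule exI[of _ "[]"]) simp
  next
    case (add x y t)
    then obtain xs where "set xs \<subseteq> carrier A \<times> carrier B" "t = tensor_list xs" by blast
    with add show ?case by (intro exI[of _ "(x, y) # xs"]) simp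
  qed
  with that show ?thesis by blast
qed

text \<open>If a first leg is a combination of the first legs of a list, the pure tensor is absorbed
  by moving its coefficients to the second legs.\<close>

lemma tensor_list_shift:
  assumes "set xs \<subseteq> carrier A \<times> carrier B" "y \<in> carrier B"
  shows "tensor_list (map (\<lambda>(x', y'). (x', y' \<oplus>\<^bsub>B\<^esub> c y' \<odot>\<^bsub>B\<^esub> y)) xs) = (contract_list c xs \<otimes>\<otimes> y) \<oplus>\<^bsub>T\<^esub> tensor_list xs"
  using assms(1)
proof (induction xs)
  case Nil
  then show ?case using assms(2) by simp
next
  case (Cons p xs)
  obtain x' y' where p: "p = (x', y')" "x' \<in> carrier A" "y' \<in> carrier B" using Cons.prems by (cases p) auto
  have xs: "set xs \<subseteq> carrier A \<times> carrier B" using Cons.prems by simp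
  have "x' \<otimes>\<otimes> (y' \<oplus>\<^bsub>B\<^esub> c y' \<odot>\<^bsub>B\<^esub> y) = x' \<otimes>\<otimes> y' \<oplus>\<^bsub>T\<^esub> (c y' \<odot>\<^bsub>A\<^esub> x') \<otimes>\<otimes> y"
    using p assms(2) by (simp add: pure_add_right pure_smult)
  then show ?case
    using Cons.IH[OF xs] p assms(2) xs by (simp add: pure_add_left T.a_ac)
qed

end

lemma contract_list_smult:
  assumes "tensor_product A B" "set xs \<subseteq> carrier A \<times> carrier B"
  shows "tensor_product.contract_list A (\<lambda>y. d * c y) xs = d \<odot>\<^bsub>A\<^esub> tensor_product.contract_list A c xs"
proof -
  interpret tensor_product A B by (rule assms)
  show ?thesis
    using assms(2) by (induction xs) (auto simp: A.smult_add_r A.smult_assoc)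
qed

text \<open>
  Functionals that separate the points of \<open>A\<close> and of \<open>B\<close> separate those of \<open>A \<otimes> B\<close>: one of
  the first legs is a combination of the others, so the number of pure tensors can be decreased.
\<close>

lemma tensor_list_separation:
  fixes A :: "('k::field, 'a) module"
  assumes AB: "tensor_product A B"
    and sepA: "\<And>x. \<lbrakk>x \<in> carrier A; \<And>\<phi>. \<phi> \<in> \<Phi> \<Longrightarrow> \<phi> x = 0\<rbrakk> \<Longrightarrow> x = \<zero>\<^bsub>A\<^esub>"
    and sepB: "\<And>y. \<lbrakk>y \<in> carrier B; \<And>\<psi>. \<psi> \<in> \<Psi> \<Longrightarrow> \<psi> y = 0\<rbrakk> \<Longrightarrow> y = \<zero>\<^bsub>B\<^esub>"
    and lin: "\<And>\<phi>. \<phi> \<in> \<Phi> \<Longrightarrow> \<phi> \<in> lin_map A scalars" "\<And>\<psi>. \<psi> \<in> \<Psi> \<Longrightarrow> \<psi> \<in> lin_map B scalars"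
    and t: "t \<in> carrier (tensor A B)"
    and null: "\<And>\<phi> \<psi>. \<phi> \<in> \<Phi> \<Longrightarrow> \<psi> \<in> \<Psi> \<Longrightarrow> tensor_lift scalars (\<lambda>x y. \<phi> x * \<psi> y) t = 0"
  shows "t = \<zero>\<^bsub>tensor A B\<^esub>"
proof -
  interpret tensor_product A B by (rule AB)
  have bil: "bilinear_map A B scalars (\<lambda>x y. \<phi> x * \<psi> y)" if "\<phi> \<in> \<Phi>" "\<psi> \<in> \<Psi>" for \<phi> \<psi>
    using lin_mapD[OF lin(1)[OF that(1)]] lin_mapD[OF lin(2)[OF that(2)]]
    by (auto simp: bilinear_map_def distrib_left distrib_right intro!: lin_mapI)
  note L = lin_mapD[OF tensor_lift_lin[OF assoc_algebra_scalars bil]]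
  have ev: "tensor_lift scalars (\<lambda>x y. \<phi> x * \<psi> y) (tensor_list xs) = \<phi> (contract_list \<psi> xs)"
    if "\<phi> \<in> \<Phi>" "\<psi> \<in> \<Psi>" "set xs \<subseteq> carrier A \<times> carrier B" for \<phi> \<psi> xs
    using that(3)
  proof (induction xs)
    case Nil
    show ?case
      using lin_map_zero[OF assoc_algebra_T assoc_algebra_scalars tensor_lift_lin[OF assoc_algebra_scalars bil[OF that(1,2)]]]
        lin_map_zero[OF A.is_assoc_algebra assoc_algebra_scalars lin(1)[OF that(1)]] by simp
  next
    case (Cons p xs)
    obtain x y where p: "p = (x, y)" "x \<in> carrier A" "y \<in> carrier B" using Cons.prems by (cases p) auto
    have xs: "set xs \<subseteq> carrier A \<times> carrier B" using Cons.prems by simp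
    show ?case
      using L(2)[OF that(1,2) pure_closed[OF p(2,3)] tensor_list_closed(1)[OF xs]] Cons.IH[OF xs] p xs
        lin_mapD(2,3)[OF lin(1)[OF that(1)]]
      by (simp add: tensor_lift_pure[OF assoc_algebra_scalars bil[OF that(1,2)]])
  qed
  \<comment> \<open>The vanishing of the contractions is the invariant of the induction on the
    length of the list.\<close>
  have zero: "tensor_list xs = \<zero>\<^bsub>T\<^esub>"
    if "set xs \<subseteq> carrier A \<times> carrier B" "\<And>\<psi>. \<psi> \<in> \<Psi> \<Longrightarrow> contract_list \<psi> xs = \<zero>\<^bsub>A\<^esub>" for xs
    using that
  proof (induction "length xs" arbitrary: xs)
    case (Suc n)
    then obtain x y xs' where xs: "xs = (x, y) # xs'" by (cases xs) auto
    with Suc.prems have c: "x \<in> carrier A" "y \<in> carrier B" "set xs' \<subseteq> carrier A \<times> carrier B" by auto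
    show ?case
    proof (cases "\<forall>\<psi>\<in>\<Psi>. \<psi> y = 0")
      case True
      then have "y = \<zero>\<^bsub>B\<^esub>" using sepB c(2) by blast
      moreover have "contract_list \<psi> xs' = \<zero>\<^bsub>A\<^esub>" if "\<psi> \<in> \<Psi>" for \<psi>
      proof -
        have "\<psi> y = 0" using True that by blast
        with Suc.prems(2)[OF that] c show ?thesis by (simp add: xs)
      qed
      ultimately show ?thesis using Suc.hyps c by (simp add: xs)
    next
      case False
      then obtain \<psi> where \<psi>: "\<psi> \<in> \<Psi>" "\<psi> y \<noteq> 0" by blast
      \<comment> \<open>Obtained by solving the vanishing of the contraction with \<psi> for the
        first leg x, which has the nonzero coefficient \<psi> y.\<close>
      define c where "c = (\<lambda>y'. (- inverse (\<psi> y)) * \<psi> y')"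
      have x: "x = contract_list c xs'"
      proof -
        have "contract_list c xs' = (- inverse (\<psi> y)) \<odot>\<^bsub>A\<^esub> contract_list \<psi> xs'"
          unfolding c_def by (rule contract_list_smult[OF AB c(3)])
        moreover have "inverse (\<psi> y) \<odot>\<^bsub>A\<^esub> (\<psi> y \<odot>\<^bsub>A\<^esub> x \<oplus>\<^bsub>A\<^esub> contract_list \<psi> xs') = \<zero>\<^bsub>A\<^esub>"
          using Suc.prems(2)[OF \<psi>(1)] by (simp add: xs)
        then have "x \<oplus>\<^bsub>A\<^esub> inverse (\<psi> y) \<odot>\<^bsub>A\<^esub> contract_list \<psi> xs' = \<zero>\<^bsub>A\<^esub>"
          using c \<psi>(2) by (simp add: A.smult_add_r flip: A.smult_assoc)
        ultimately show ?thesis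
          using c by (simp add: A.smult_uminus A.minus_equality A.smult_in)
      qed
      define zs where "zs = map (\<lambda>(x', y'). (x', y' \<oplus>\<^bsub>B\<^esub> c y' \<odot>\<^bsub>B\<^esub> y)) xs'"
      have zs: "set zs \<subseteq> carrier A \<times> carrier B" using c by (auto simp: zs_def)
      have eq: "tensor_list zs = tensor_list xs"
        unfolding zs_def using tensor_list_shift[OF c(3,2), of c] by (simp add: xs flip: x)
      \<comment> \<open>The shorter list represents the same tensor. Testing with \<Phi> turns its
        contractions into values on that tensor, so they agree with those of the original
        list.\<close>
      have "contract_list \<chi> zs = \<zero>\<^bsub>A\<^esub>" if "\<chi> \<in> \<Psi>" for \<chi>
      proof (rule sepA[OF tensor_list_closed(2)[OF zs]])
        fix \<phi> assume "\<phi> \<in> \<Phi>"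
        have "\<phi> (contract_list \<chi> zs) = \<phi> (contract_list \<chi> xs)"
          using ev[OF \<open>\<phi> \<in> \<Phi>\<close> that zs] ev[OF \<open>\<phi> \<in> \<Phi>\<close> that Suc.prems(1)] eq by simp
        also have "\<dots> = 0"
          using lin_map_zero[OF A.is_assoc_algebra assoc_algebra_scalars lin(1)[OF \<open>\<phi> \<in> \<Phi>\<close>]] Suc.prems(2)[OF that] by simp
        finally show "\<phi> (contract_list \<chi> zs) = 0" .
      qed
      moreover have "n = length zs" using Suc.hyps(2) by (simp add: zs_def xs)
      ultimately show ?thesis using Suc.hyps(1)[of zs] zs eq by simp
    qed
  qed simp
  obtain xs where xs: "set xs \<subseteq> carrier A \<times> carrier B" "t = tensor_list xs" using t by (rule tensor_listE)
  have "contract_list \<psi> xs = \<zero>\<^bsub>A\<^esub>" if "\<psi> \<in> \<Psi>" for \<psi>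
  proof (rule sepA[OF tensor_list_closed(2)[OF xs(1)]])
    fix \<phi> assume "\<phi> \<in> \<Phi>"
    then show "\<phi> (contract_list \<psi> xs) = 0" using ev[OF _ that xs(1)] null[OF _ that] xs(2) by simp
  qed
  with zero xs show ?thesis by blast
qed


subsection \<open>The coproduct of the generators\<close>

definition su2_coef :: "complex fls \<Rightarrow> complex fls \<Rightarrow> complex fls \<Rightarrow> complex fls \<Rightarrow> su2_gen \<Rightarrow> complex fls" where
  "su2_coef a b c d x = (case x of Sigma \<Rightarrow> a | Sigma_star \<Rightarrow> b | Rho \<Rightarrow> c | Rho_star \<Rightarrow> d)"

text \<open>Coordinates for sums of products of one generator in each leg, as \<open>lc\<close>
  provides for a single leg; identities of coproducts become identities of coefficients.\<close>

definition bil :: "(su2_gen \<Rightarrow> su2_gen \<Rightarrow> complex fls) \<Rightarrow> ((su2_gen list \<times> su2_gen list) \<Rightarrow>\<^sub>0 complex fls)" where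
  "bil m = (\<Sum>x\<in>{Sigma, Sigma_star, Rho, Rho_star}. \<Sum>y\<in>{Sigma, Sigma_star, Rho, Rho_star}.
     cst (m x y) * (inl (gen x) * inr (gen y)))"

lemma bil_simps:
  "bil m + bil m' = bil (\<lambda>x y. m x y + m' x y)" "cst k * bil m = bil (\<lambda>x y. k * m x y)"
  "inl (lc a b c d) * inr (lc a' b' c' d') = bil (\<lambda>x y. su2_coef a b c d x * su2_coef a' b' c' d' y)"
proof -
  show "bil m + bil m' = bil (\<lambda>x y. m x y + m' x y)"
    unfolding bil_def cst_hom(1) distrib_right sum.distrib ..
  show "cst k * bil m = bil (\<lambda>x y. k * m x y)"
    unfolding bil_def cst_hom(2) sum_distrib_left mult.assoc ..
  have l: "inl (lc a b c d) = (\<Sum>x\<in>{Sigma, Sigma_star, Rho, Rho_star}. cst (su2_coef a b c d x) * inl (gen x))"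
    by (simp add: lc_def inlr_simps su2_coef_def add.assoc)
  have r: "inr (lc a' b' c' d') = (\<Sum>x\<in>{Sigma, Sigma_star, Rho, Rho_star}. cst (su2_coef a' b' c' d' x) * inr (gen x))"
    by (simp add: lc_def inlr_simps su2_coef_def add.assoc)
  have "cst u * inl (gen x) * (cst v * inr (gen y)) = cst (u * v) * (inl (gen x) * inr (gen y))" for u v x y
    by (simp add: cst_hom(2) mult.assoc inlr_commute)
  then show "inl (lc a b c d) * inr (lc a' b' c' d') = bil (\<lambda>x y. su2_coef a b c d x * su2_coef a' b' c' d' y)"
    unfolding l r sum_product bil_def by simp
qed

definition su2_D_coef :: "real \<Rightarrow> su2_gen \<Rightarrow> su2_gen \<Rightarrow> su2_gen \<Rightarrow> complex fls" where
  "su2_D_coef \<kappa> z x y = (case z of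
     Sigma \<Rightarrow> (case x of Sigma \<Rightarrow> su2_coef 1 0 0 0 y | Rho_star \<Rightarrow> su2_coef 0 0 (- mu \<kappa>) 0 y | _ \<Rightarrow> 0)
   | Sigma_star \<Rightarrow> (case x of Sigma_star \<Rightarrow> su2_coef 0 1 0 0 y | Rho \<Rightarrow> su2_coef 0 0 0 (- mu \<kappa>) y | _ \<Rightarrow> 0)
   | Rho \<Rightarrow> (case x of Rho \<Rightarrow> su2_coef 1 0 0 0 y | Sigma_star \<Rightarrow> su2_coef 0 0 1 0 y | _ \<Rightarrow> 0)
   | Rho_star \<Rightarrow> (case x of Sigma \<Rightarrow> su2_coef 0 0 0 1 y | Rho_star \<Rightarrow> su2_coef 0 1 0 0 y | _ \<Rightarrow> 0))"

lemma su2_D_bil: "su2_D \<kappa> z = bil (su2_D_coef \<kappa> z)"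
  by (cases z) (simp_all add: bil_def su2_D_coef_def su2_coef_def su2_D_simps cst_hom)

lemma su2_DD_lc: "su2_DD \<kappa> (lc a b c d) = bil (\<lambda>x y. a * su2_D_coef \<kappa> Sigma x y + b * su2_D_coef \<kappa> Sigma_star x y +
    c * su2_D_coef \<kappa> Rho x y + d * su2_D_coef \<kappa> Rho_star x y)"
proof -
  have "su2_DD \<kappa> (lc a b c d) = cst a * su2_D \<kappa> Sigma + cst b * su2_D \<kappa> Sigma_star + cst c * su2_D \<kappa> Rho + cst d * su2_D \<kappa> Rho_star"
    by (simp add: lc_def pm.free_eval_simps pm.free_eval_cst)
  then show ?thesis by (simp add: su2_D_bil bil_simps)
qed

text \<open>In the orthonormal basis of (1, 1) and (-1, 1), both divided by the square root of 2,
  the matrix g has first row a, h w; its second row is \<open>cF\<close>, \<open>dF\<close>. The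
  primed elements are the adjoints.\<close>

definition cF where "cF \<kappa> = lc (- 1/2) (1/2) (1/2) (mu \<kappa> / 2)"
definition cF' where "cF' \<kappa> = lc (1/2) (- 1/2) (mu \<kappa> / 2) (1/2)"
definition dF where "dF \<kappa> = lc (1/2) (1/2) (- 1/2) (mu \<kappa> / 2)"
definition dF' where "dF' \<kappa> = lc (1/2) (1/2) (mu \<kappa> / 2) (- 1/2)"

text \<open>The matrix coproduct in the rotated basis. For a the second summand keeps the h of the
  entry h w; for w this h is common to all terms and cancels.\<close>

lemma su2_DD_gens:
  "su2_DD \<kappa> (aF \<kappa>) = inl (aF \<kappa>) * inr (aF \<kappa>) + cst hh * (inl (wF \<kappa>) * inr (cF \<kappa>))"
  "su2_DD \<kappa> (aF' \<kappa>) = inl (aF' \<kappa>) * inr (aF' \<kappa>) + cst hh * (inl (wF' \<kappa>) * inr (cF' \<kappa>))"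
  "su2_DD \<kappa> (wF \<kappa>) = inl (wF \<kappa>) * inr (dF \<kappa>) + inl (aF \<kappa>) * inr (wF \<kappa>)"
  "su2_DD \<kappa> (wF' \<kappa>) = inl (wF' \<kappa>) * inr (dF' \<kappa>) + inl (aF' \<kappa>) * inr (wF' \<kappa>)"
proof -
  have eq: "bil m = bil m'" if "\<And>x y. m x y = m' x y" for m m' using that by presburger
  note S = gF_defs cF_def cF'_def dF_def dF'_def
  note C = su2_D_coef_def su2_coef_def
  show "su2_DD \<kappa> (aF \<kappa>) = inl (aF \<kappa>) * inr (aF \<kappa>) + cst hh * (inl (wF \<kappa>) * inr (cF \<kappa>))"
    unfolding S su2_DD_lc bil_simps
    by (rule eq, case_tac x; case_tac y) (simp_all add: C field_simps)
  show "su2_DD \<kappa> (aF' \<kappa>) = inl (aF' \<kappa>) * inr (aF' \<kappa>) + cst hh * (inl (wF' \<kappa>) * inr (cF' \<kappa>))"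
    unfolding S su2_DD_lc bil_simps
    by (rule eq, case_tac x; case_tac y) (simp_all add: C field_simps)
  show "su2_DD \<kappa> (wF \<kappa>) = inl (wF \<kappa>) * inr (dF \<kappa>) + inl (aF \<kappa>) * inr (wF \<kappa>)"
    unfolding S su2_DD_lc bil_simps
    by (rule eq, case_tac x; case_tac y) (simp_all add: C field_simps)
  show "su2_DD \<kappa> (wF' \<kappa>) = inl (wF' \<kappa>) * inr (dF' \<kappa>) + inl (aF' \<kappa>) * inr (wF' \<kappa>)"
    unfolding S su2_DD_lc bil_simps
    by (rule eq, case_tac x; case_tac y) (simp_all add: C field_simps)
qed

lemma reduces_lc:
  assumes "fls_limit a a'" "fls_limit b b'" "fls_limit c c'" "fls_limit d d'"
  shows "reduces \<kappa> (cst ((a' + b' + c' - d') / 2) * ga + cst ((a' + b' - c' + d') / 2) * gb) (lc a b c d)"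
proof -
  note R = reduces_su2_gens[of \<kappa>]
  have "reduces \<kappa> (cst a' * (cst (1/2) * (ga + gb)) + cst b' * (cst (1/2) * (ga + gb)) + cst c' * (cst (1/2) * (ga - gb))
      + cst d' * (cst (1/2) * (gb - ga))) (lc a b c d)"
    unfolding lc_def by (intro reduces_add reduces_smult R assms)
  moreover have "cst a' * (cst (1/2) * (ga + gb)) + cst b' * (cst (1/2) * (ga + gb)) + cst c' * (cst (1/2) * (ga - gb))
      + cst d' * (cst (1/2) * (gb - ga)) = cst ((a' + b' + c' - d') / 2) * ga + cst ((a' + b' - c' + d') / 2) * gb"
    by (simp add: add_divide_distrib diff_divide_distrib cst_hom(1,3) distrib_left distrib_right left_diff_distrib right_diff_distrib
        algebra_simps flip: mult.assoc cst_hom(2))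
  ultimately show ?thesis by simp
qed

text \<open>For c membership in the lattice is enough, since it occurs with a factor h. The limit of
  d is a*, which is how a* enters the coproduct of w.\<close>

lemma reduces_cd:
  "\<exists>f. reduces \<kappa> f (cF \<kappa>)" "\<exists>f. reduces \<kappa> f (cF' \<kappa>)" "reduces \<kappa> gb (dF \<kappa>)" "reduces \<kappa> ga (dF' \<kappa>)"
proof -
  note C = fls_limit_consts(2,3,5)
  have h: "fls_limit (1/2) (1/2)" "fls_limit (- 1/2) (- 1/2)" "fls_limit (mu \<kappa> / 2) (1/2)"
    by (intro fls_limit_divide fls_limit_uminus C; simp)+
  note R = reduces_lc[where \<kappa> = \<kappa>]
  show "\<exists>f. reduces \<kappa> f (cF \<kappa>)" "\<exists>f. reduces \<kappa> f (cF' \<kappa>)"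
    unfolding cF_def cF'_def by (rule exI, rule R; rule h)+
  show "reduces \<kappa> gb (dF \<kappa>)" "reduces \<kappa> ga (dF' \<kappa>)"
    using R[OF h(1,1,2,3)] R[OF h(1,1,3,2)] by (simp_all add: dF_def dF'_def)
qed


subsection \<open>The coproduct on the lattice\<close>

abbreviation latT :: "real \<Rightarrow> _" where "latT \<kappa> \<equiv> tensor (lattice_alg \<kappa>) (lattice_alg \<kappa>)"
abbreviation pureL :: "real \<Rightarrow> _" where "pureL \<kappa> \<equiv> pure_tensor (lattice_alg \<kappa>) (lattice_alg \<kappa>)"
abbreviation pureS :: "real \<Rightarrow> _" where "pureS \<kappa> \<equiv> pure_tensor (su2 \<kappa>) (su2 \<kappa>)"
abbreviation E2T :: "real \<Rightarrow> _" where "E2T \<kappa> \<equiv> tensor (contraction \<kappa>) (contraction \<kappa>)"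
abbreviation pureE :: "real \<Rightarrow> _" where "pureE \<kappa> \<equiv> pure_tensor (contraction \<kappa>) (contraction \<kappa>)"

lemma tensor_product_lat: "tensor_product (lattice_alg \<kappa>) (lattice_alg \<kappa>)"
  by (simp add: tensor_product_def lat.is_assoc_algebra)

lemma tensor_product_E: "tensor_product (contraction \<kappa>) (contraction \<kappa>)"
  by (simp add: tensor_product_def E.is_assoc_algebra)

context
  fixes \<kappa> :: real
begin

interpretation LT: tensor_product "lattice_alg \<kappa>" "lattice_alg \<kappa>"
  by (rule tensor_product_lat)

interpretation ST: tensor_product "su2 \<kappa>" "su2 \<kappa>"
  by (rule tensor_product_su2)

interpretation ET: tensor_product "contraction \<kappa>" "contraction \<kappa>"
  by (rule tensor_product_E)

lemma latD: "x \<in> lattice_carrier \<kappa> \<Longrightarrow> x \<in> carrier (su2 \<kappa>)"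
  using lattice_subset by blast

lemma incl_bilinear:
  "assoc_algebra (restrict_scalars fps_to_fls (su2T \<kappa>))"
  "bilinear_map (lattice_alg \<kappa>) (lattice_alg \<kappa>) (restrict_scalars fps_to_fls (su2T \<kappa>)) (pureS \<kappa>)"
proof -
  show "assoc_algebra (restrict_scalars fps_to_fls (su2T \<kappa>))"
    by (rule assoc_algebra_restrict_scalars[OF ST.assoc_algebra_T]) (simp_all add: fls_times_fps_to_fls)
  show "bilinear_map (lattice_alg \<kappa>) (lattice_alg \<kappa>) (restrict_scalars fps_to_fls (su2T \<kappa>)) (pureS \<kappa>)"
    by (auto simp: bilinear_map_def latD ST.pure_add_left ST.pure_add_right ST.pure_smult intro!: lin_mapI)
qed

lemma incl_hom: "lattice_tensor_incl \<kappa> \<in> alg_hom (latT \<kappa>) (restrict_scalars fps_to_fls (su2T \<kappa>))"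
  unfolding lattice_tensor_incl_def
  by (rule LT.tensor_lift_hom[OF incl_bilinear]) (auto simp: latD ST.pure_mult ST.one_T)

lemma incl_pure: "x \<in> lattice_carrier \<kappa> \<Longrightarrow> y \<in> lattice_carrier \<kappa> \<Longrightarrow> lattice_tensor_incl \<kappa> (pureL \<kappa> x y) = pureS \<kappa> x y"
  unfolding lattice_tensor_incl_def by (rule LT.tensor_lift_pure[OF incl_bilinear]) simp_all

lemma limit_bilinear:
  "assoc_algebra (restrict_scalars (\<lambda>c. fps_nth c 0) (E2T \<kappa>))"
  "bilinear_map (lattice_alg \<kappa>) (lattice_alg \<kappa>) (restrict_scalars (\<lambda>c. fps_nth c 0) (E2T \<kappa>))
     (\<lambda>x y. pureE \<kappa> (limit_class \<kappa> x) (limit_class \<kappa> y))"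
proof -
  show "assoc_algebra (restrict_scalars (\<lambda>c. fps_nth c 0) (E2T \<kappa>))"
    by (rule assoc_algebra_restrict_scalars[OF ET.assoc_algebra_T]) simp_all
  show "bilinear_map (lattice_alg \<kappa>) (lattice_alg \<kappa>) (restrict_scalars (\<lambda>c. fps_nth c 0) (E2T \<kappa>))
     (\<lambda>x y. pureE \<kappa> (limit_class \<kappa> x) (limit_class \<kappa> y))"
    by (auto simp: bilinear_map_def limit_class_closed limit_class_simps(1) limit_class_smult
      ET.pure_add_left ET.pure_add_right ET.pure_smult intro!: lin_mapI)
qed

lemma tensor_limit_hom: "lattice_tensor_limit \<kappa> \<in> alg_hom (latT \<kappa>) (restrict_scalars (\<lambda>c. fps_nth c 0) (E2T \<kappa>))"
  unfolding lattice_tensor_limit_def Let_def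
  by (rule LT.tensor_lift_hom[OF limit_bilinear])
    (auto simp: limit_class_closed limit_class_simps(2) ET.pure_mult ET.one_T limit_class_one)

lemma tensor_limit_pure:
  "x \<in> lattice_carrier \<kappa> \<Longrightarrow> y \<in> lattice_carrier \<kappa> \<Longrightarrow>
     lattice_tensor_limit \<kappa> (pureL \<kappa> x y) = pureE \<kappa> (limit_class \<kappa> x) (limit_class \<kappa> y)"
  unfolding lattice_tensor_limit_def Let_def by (rule LT.tensor_lift_pure[OF limit_bilinear]) simp_all

lemma contraction_induced:
  assumes "assoc_algebra V" "\<phi> \<in> lin_map (latC \<kappa>) V"
    and "\<And>z. z \<in> lattice_carrier \<kappa> \<Longrightarrow> \<phi> (fls_X \<odot>\<^bsub>su2 \<kappa>\<^esub> z) = \<zero>\<^bsub>V\<^esub>"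
  shows "coset_map \<phi> \<in> lin_map (contraction \<kappa>) V"
    and "x \<in> lattice_carrier \<kappa> \<Longrightarrow> coset_map \<phi> (limit_class \<kappa> x) = \<phi> x"
    and "\<phi> \<in> alg_hom (latC \<kappa>) V \<Longrightarrow> coset_map \<phi> \<in> alg_hom (contraction \<kappa>) V"
proof -
  have null: "\<phi> x = \<zero>\<^bsub>V\<^esub>" if "x \<in> h_lattice \<kappa>" for x
    using that assms(3) by (auto simp: h_lattice_def)
  note I = algebra_ideal.coset_map_lin_map[OF h_lattice_ideal assms(1,2) null]
    algebra_ideal.coset_map_lin[OF h_lattice_ideal assms(1,2) null]
    algebra_ideal.coset_map_hom[OF h_lattice_ideal assms(1,2) null]
  show "coset_map \<phi> \<in> lin_map (contraction \<kappa>) V" unfolding contraction_eq by (rule I(1))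
  show "x \<in> lattice_carrier \<kappa> \<Longrightarrow> coset_map \<phi> (limit_class \<kappa> x) = \<phi> x"
    unfolding limit_class_eq by (rule I(2)) simp_all
  show "\<phi> \<in> alg_hom (latC \<kappa>) V \<Longrightarrow> coset_map \<phi> \<in> alg_hom (contraction \<kappa>) V"
    unfolding contraction_eq by (rule I(3))
qed

section \<open>Matrix coefficients and their limits\<close>

definition coefficient :: "complex \<Rightarrow> complex \<Rightarrow> nat \<Rightarrow> su2_carrier \<Rightarrow> complex fls" where
  "coefficient v y n x = fps_nth (repc \<kappa> v y x 1) n"

text \<open>Taking the coefficient of h^0 is defined and linear on all Laurent series, and on the
  lattice, where the matrix coefficients are integral, it is the reduction modulo h.\<close>

definition limit_coefficient :: "complex \<Rightarrow> complex \<Rightarrow> nat \<Rightarrow> contraction_carrier \<Rightarrow> complex" where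
  "limit_coefficient v y n = coset_map (\<lambda>x. fls_nth (coefficient v y n x) 0)"

lemma fls_limit_nth: "fls_limit c l \<Longrightarrow> fls_nth c 0 = l"
  by (auto simp: fls_limit_def)

lemma coefficient_lin: "coefficient v y n \<in> lin_map (su2 \<kappa>) scalars"
  using alg_homD(5,6)[OF repc_hom, of _ \<kappa>] by (auto simp: coefficient_def intro!: lin_mapI)

lemma coefficient_limit: "x \<in> lattice_carrier \<kappa> \<Longrightarrow> fls_limit (coefficient v y n x) (fls_nth (coefficient v y n x) 0)"
  using lattice_integral[OF _ fps_limit_one, of x \<kappa> v y] by (metis coefficient_def fls_limit_nth fps_limit_def)

lemma limit_coefficient:
  "limit_coefficient v y n \<in> lin_map (contraction \<kappa>) scalars"
  "x \<in> lattice_carrier \<kappa> \<Longrightarrow> fls_limit (coefficient v y n x) (limit_coefficient v y n (limit_class \<kappa> x))"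
proof -
  have lin: "(\<lambda>x. fls_nth (coefficient v y n x) 0) \<in> lin_map (latC \<kappa>) scalars"
    using lin_mapD(2,3)[OF coefficient_lin] by (intro lin_mapI) (simp_all add: latD)
  have null: "fls_nth (coefficient v y n (fls_X \<odot>\<^bsub>su2 \<kappa>\<^esub> z)) 0 = \<zero>\<^bsub>scalars\<^esub>" if "z \<in> lattice_carrier \<kappa>" for z
    using repc_h[OF that fps_limit_one, of v y] by (auto simp: coefficient_def fps_limit_def fls_limit_nth)
  show "limit_coefficient v y n \<in> lin_map (contraction \<kappa>) scalars"
    unfolding limit_coefficient_def by (rule contraction_induced(1)[OF assoc_algebra_scalars lin null])
  show "x \<in> lattice_carrier \<kappa> \<Longrightarrow> fls_limit (coefficient v y n x) (limit_coefficient v y n (limit_class \<kappa> x))"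
    using contraction_induced(2)[OF assoc_algebra_scalars lin null, of x] coefficient_limit[of x v y n]
    by (simp add: limit_coefficient_def)
qed

lemma limit_coefficient_separation:
  assumes "X \<in> carrier (contraction \<kappa>)" "\<And>v y n. limit_coefficient v y n X = 0"
  shows "X = \<zero>\<^bsub>contraction \<kappa>\<^esub>"
proof -
  obtain x where x: "x \<in> lattice_carrier \<kappa>" "X = limit_class \<kappa> x" using assms(1) by (rule contraction_carrierE)
  have "fls_limit (fps_nth (repc \<kappa> v y x 1) n) 0" for v y n
    using limit_coefficient(2)[OF x(1), of v y n] assms(2) by (simp add: x(2) coefficient_def)
  then show ?thesis unfolding x(2) by (rule lattice_separation[OF x(1)])
qed

text \<open>
  The coproduct of the limit is well defined because the kernel of \<open>L \<otimes> L \<rightarrow> SU\<^sub>\<mu>(2) \<otimes> SU\<^sub>\<mu>(2)\<close> vanishes in the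
  limit; this is seen by evaluating products of matrix coefficients.
\<close>

lemma tensor_limit_unique:
  assumes t: "t \<in> carrier (latT \<kappa>)" and null: "lattice_tensor_incl \<kappa> t = \<zero>\<^bsub>su2T \<kappa>\<^esub>"
  shows "lattice_tensor_limit \<kappa> t = \<zero>\<^bsub>E2T \<kappa>\<^esub>"
proof (rule tensor_list_separation[OF tensor_product_E])
  let ?\<Phi> = "{limit_coefficient v y n | v y n. True}"
  show "X = \<zero>\<^bsub>contraction \<kappa>\<^esub>" if "X \<in> carrier (contraction \<kappa>)" "\<And>\<phi>. \<phi> \<in> ?\<Phi> \<Longrightarrow> \<phi> X = 0" for X
    by (rule limit_coefficient_separation[OF that(1)]) (use that(2) in blast)
  then show "X = \<zero>\<^bsub>contraction \<kappa>\<^esub>" if "X \<in> carrier (contraction \<kappa>)" "\<And>\<phi>. \<phi> \<in> ?\<Phi> \<Longrightarrow> \<phi> X = 0" for X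
    using that by blast
  show "\<phi> \<in> lin_map (contraction \<kappa>) scalars" if "\<phi> \<in> ?\<Phi>" for \<phi> using that limit_coefficient(1) by blast
  then show "\<phi> \<in> lin_map (contraction \<kappa>) scalars" if "\<phi> \<in> ?\<Phi>" for \<phi> using that by blast
  show "lattice_tensor_limit \<kappa> t \<in> carrier (E2T \<kappa>)" using alg_homD(3)[OF tensor_limit_hom t] by simp
  show "tensor_lift scalars (\<lambda>x y. \<phi> x * \<psi> y) (lattice_tensor_limit \<kappa> t) = 0" if "\<phi> \<in> ?\<Phi>" "\<psi> \<in> ?\<Phi>" for \<phi> \<psi>
  proof -
    obtain v y n v' y' n' where \<phi>: "\<phi> = limit_coefficient v y n" "\<psi> = limit_coefficient v' y' n'" using \<open>\<phi> \<in> ?\<Phi>\<close> \<open>\<psi> \<in> ?\<Phi>\<close> by blast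
    let ?c = "coefficient v y n" and ?c' = "coefficient v' y' n'"
    have bS: "bilinear_map (su2 \<kappa>) (su2 \<kappa>) scalars (\<lambda>x y. ?c x * ?c' y)"
      using lin_mapD(2,3)[OF coefficient_lin]
      by (auto simp: bilinear_map_def distrib_left distrib_right intro!: lin_mapI)
    have bE: "bilinear_map (contraction \<kappa>) (contraction \<kappa>) scalars (\<lambda>x y. \<phi> x * \<psi> y)"
      using lin_mapD(2,3)[OF limit_coefficient(1)] unfolding \<phi>
      by (auto simp: bilinear_map_def distrib_left distrib_right intro!: lin_mapI)
    let ?CS = "tensor_lift scalars (\<lambda>x y. ?c x * ?c' y)" and ?CE = "tensor_lift scalars (\<lambda>x y. \<phi> x * \<psi> y)"
    note LS = lin_mapD[OF ST.tensor_lift_lin[OF assoc_algebra_scalars bS]]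
    note LE = lin_mapD[OF ET.tensor_lift_lin[OF assoc_algebra_scalars bE]]
    note ZS = lin_map_zero[OF ST.assoc_algebra_T assoc_algebra_scalars ST.tensor_lift_lin[OF assoc_algebra_scalars bS]]
    note ZE = lin_map_zero[OF ET.assoc_algebra_T assoc_algebra_scalars ET.tensor_lift_lin[OF assoc_algebra_scalars bE]]
    note ZI = lin_map_zero[OF LT.assoc_algebra_T incl_bilinear(1) alg_homD(1)[OF incl_hom]]
    note ZL = lin_map_zero[OF LT.assoc_algebra_T limit_bilinear(1) alg_homD(1)[OF tensor_limit_hom]]
    \<comment> \<open>Holds for every element of the tensor square of the lattice, by additivity;
      that its image is zero is used only afterwards.\<close>
    have "fls_limit (?CS (lattice_tensor_incl \<kappa> t)) (?CE (lattice_tensor_limit \<kappa> t))"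
      using t
    proof (induction t rule: LT.tensor_induct)
      case zero
      show ?case using ZI ZL ZS ZE fls_limit_consts(1) by simp
    next
      case (add p q s)
      have pq: "p \<in> lattice_carrier \<kappa>" "q \<in> lattice_carrier \<kappa>" using add by simp_all
      have I: "lattice_tensor_incl \<kappa> (pureL \<kappa> p q \<oplus>\<^bsub>latT \<kappa>\<^esub> s) = pureS \<kappa> p q \<oplus>\<^bsub>su2T \<kappa>\<^esub> lattice_tensor_incl \<kappa> s"
        "lattice_tensor_incl \<kappa> s \<in> carrier (su2T \<kappa>)"
        using alg_homD(5)[OF incl_hom LT.pure_closed[OF add(1,2)] add(3)] alg_homD(3)[OF incl_hom add(3)] pq by (simp_all add: incl_pure)
      have L: "lattice_tensor_limit \<kappa> (pureL \<kappa> p q \<oplus>\<^bsub>latT \<kappa>\<^esub> s) = pureE \<kappa> (limit_class \<kappa> p) (limit_class \<kappa> q) \<oplus>\<^bsub>E2T \<kappa>\<^esub> lattice_tensor_limit \<kappa> s"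
        "lattice_tensor_limit \<kappa> s \<in> carrier (E2T \<kappa>)"
        using alg_homD(5)[OF tensor_limit_hom LT.pure_closed[OF add(1,2)] add(3)] alg_homD(3)[OF tensor_limit_hom add(3)] pq by (simp_all add: tensor_limit_pure)
      have "?CS (pureS \<kappa> p q) = ?c p * ?c' q" "?CE (pureE \<kappa> (limit_class \<kappa> p) (limit_class \<kappa> q)) = \<phi> (limit_class \<kappa> p) * \<psi> (limit_class \<kappa> q)"
        using pq by (simp_all add: ST.tensor_lift_pure[OF assoc_algebra_scalars bS] ET.tensor_lift_pure[OF assoc_algebra_scalars bE] latD limit_class_closed)
      moreover have "fls_limit (?c p * ?c' q) (\<phi> (limit_class \<kappa> p) * \<psi> (limit_class \<kappa> q))"
        unfolding \<phi> by (intro fls_limit_mult limit_coefficient pq)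
      ultimately show ?case
        using add.IH LS(2)[OF ST.pure_closed[OF latD latD] I(2)] LE(2)[OF ET.pure_closed[OF limit_class_closed limit_class_closed] L(2)] pq
        by (simp add: I(1) L(1) fls_limit_add)
    qed
    then have "fls_limit 0 (?CE (lattice_tensor_limit \<kappa> t))" by (simp add: null ZS)
    then show ?thesis using fls_limit_nth by force
  qed
qed

section \<open>Lifts of the coproduct to the lattice\<close>

definition coproduct_lift :: "su2_carrier \<Rightarrow> ((su2_carrier \<times> su2_carrier) \<Rightarrow>\<^sub>0 complex fps) set \<Rightarrow> bool" where
  "coproduct_lift x t \<longleftrightarrow> t \<in> carrier (latT \<kappa>) \<and> lattice_tensor_incl \<kappa> t = su2_coproduct \<kappa> x"

text \<open>Two lifts differ by an element of the kernel of the inclusion, to which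
  \<open>tensor_limit_unique\<close> applies.\<close>

lemma coproduct_lift_unique:
  assumes "coproduct_lift x s" "coproduct_lift x t"
  shows "lattice_tensor_limit \<kappa> s = lattice_tensor_limit \<kappa> t"
proof -
  have st: "s \<in> carrier (latT \<kappa>)" "t \<in> carrier (latT \<kappa>)" using assms by (auto simp: coproduct_lift_def)
  have eq: "lattice_tensor_incl \<kappa> s = lattice_tensor_incl \<kappa> t" using assms by (simp add: coproduct_lift_def)
  have c: "lattice_tensor_incl \<kappa> t \<in> carrier (su2T \<kappa>)" "lattice_tensor_limit \<kappa> s \<in> carrier (E2T \<kappa>)" "lattice_tensor_limit \<kappa> t \<in> carrier (E2T \<kappa>)"
    using alg_homD(3)[OF incl_hom st(2)] alg_homD(3)[OF tensor_limit_hom] st by simp_all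
  have "lattice_tensor_incl \<kappa> (s \<ominus>\<^bsub>latT \<kappa>\<^esub> t) = \<zero>\<^bsub>su2T \<kappa>\<^esub>"
    using lin_map_minus[OF LT.assoc_algebra_T incl_bilinear(1) alg_homD(1)[OF incl_hom] st] c(1)
    by (simp add: eq a_minus_def ST.T.r_neg)
  then have "lattice_tensor_limit \<kappa> (s \<ominus>\<^bsub>latT \<kappa>\<^esub> t) = \<zero>\<^bsub>E2T \<kappa>\<^esub>"
    using st by (intro tensor_limit_unique) simp_all
  then have "lattice_tensor_limit \<kappa> s \<ominus>\<^bsub>E2T \<kappa>\<^esub> lattice_tensor_limit \<kappa> t = \<zero>\<^bsub>E2T \<kappa>\<^esub>"
    using lin_map_minus[OF LT.assoc_algebra_T limit_bilinear(1) alg_homD(1)[OF tensor_limit_hom] st]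
    by (simp add: a_minus_def)
  then show ?thesis using c by simp
qed

lemma coproduct_lift_closed:
  "coproduct_lift \<one>\<^bsub>su2 \<kappa>\<^esub> \<one>\<^bsub>latT \<kappa>\<^esub>"
  "\<lbrakk>x \<in> lattice_carrier \<kappa>; y \<in> lattice_carrier \<kappa>; coproduct_lift x s; coproduct_lift y t\<rbrakk> \<Longrightarrow> coproduct_lift (x \<oplus>\<^bsub>su2 \<kappa>\<^esub> y) (s \<oplus>\<^bsub>latT \<kappa>\<^esub> t)"
  "\<lbrakk>x \<in> lattice_carrier \<kappa>; y \<in> lattice_carrier \<kappa>; coproduct_lift x s; coproduct_lift y t\<rbrakk> \<Longrightarrow> coproduct_lift (x \<otimes>\<^bsub>su2 \<kappa>\<^esub> y) (s \<otimes>\<^bsub>latT \<kappa>\<^esub> t)"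
  "\<lbrakk>x \<in> lattice_carrier \<kappa>; coproduct_lift x s\<rbrakk> \<Longrightarrow> coproduct_lift (fps_to_fls c \<odot>\<^bsub>su2 \<kappa>\<^esub> x) (c \<odot>\<^bsub>latT \<kappa>\<^esub> s)"
  using alg_homD(2)[OF su2_coproduct_hom[of \<kappa>]] alg_homD(4-6)[OF su2_coproduct_hom[of \<kappa>]] alg_homD(2)[OF incl_hom] alg_homD(4-6)[OF incl_hom]
  by (simp_all add: coproduct_lift_def latD)

lemma lattice_mem:
  "cls \<kappa> (aF \<kappa>) \<in> lattice_carrier \<kappa>" "cls \<kappa> (aF' \<kappa>) \<in> lattice_carrier \<kappa>" "cls \<kappa> (wF \<kappa>) \<in> lattice_carrier \<kappa>" "cls \<kappa> (wF' \<kappa>) \<in> lattice_carrier \<kappa>"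
  "cls \<kappa> (cF \<kappa>) \<in> lattice_carrier \<kappa>" "cls \<kappa> (cF' \<kappa>) \<in> lattice_carrier \<kappa>" "cls \<kappa> (dF \<kappa>) \<in> lattice_carrier \<kappa>" "cls \<kappa> (dF' \<kappa>) \<in> lattice_carrier \<kappa>"
  using reduces_gens[of \<kappa>] reduces_cd[of \<kappa>] by (auto simp: reduces_def)

lemma coproduct_lift_gens:
  "coproduct_lift (cls \<kappa> (aF \<kappa>)) (pureL \<kappa> (cls \<kappa> (aF \<kappa>)) (cls \<kappa> (aF \<kappa>)) \<oplus>\<^bsub>latT \<kappa>\<^esub> fps_X \<odot>\<^bsub>latT \<kappa>\<^esub> pureL \<kappa> (cls \<kappa> (wF \<kappa>)) (cls \<kappa> (cF \<kappa>)))"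
  "coproduct_lift (cls \<kappa> (aF' \<kappa>)) (pureL \<kappa> (cls \<kappa> (aF' \<kappa>)) (cls \<kappa> (aF' \<kappa>)) \<oplus>\<^bsub>latT \<kappa>\<^esub> fps_X \<odot>\<^bsub>latT \<kappa>\<^esub> pureL \<kappa> (cls \<kappa> (wF' \<kappa>)) (cls \<kappa> (cF' \<kappa>)))"
  "coproduct_lift (cls \<kappa> (wF \<kappa>)) (pureL \<kappa> (cls \<kappa> (wF \<kappa>)) (cls \<kappa> (dF \<kappa>)) \<oplus>\<^bsub>latT \<kappa>\<^esub> pureL \<kappa> (cls \<kappa> (aF \<kappa>)) (cls \<kappa> (wF \<kappa>)))"
  "coproduct_lift (cls \<kappa> (wF' \<kappa>)) (pureL \<kappa> (cls \<kappa> (wF' \<kappa>)) (cls \<kappa> (dF' \<kappa>)) \<oplus>\<^bsub>latT \<kappa>\<^esub> pureL \<kappa> (cls \<kappa> (aF' \<kappa>)) (cls \<kappa> (wF' \<kappa>)))"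
  using alg_homD(5,6)[OF incl_hom]
  by (simp_all add: coproduct_lift_def lattice_mem incl_pure su2_coproduct_cls su2_DD_gens theta_simps(2,3) theta_pure hh_def)

lemma coproduct_lift_exists:
  assumes "x \<in> lattice_carrier \<kappa>"
  shows "\<exists>t. coproduct_lift x t"
  using assms
proof (induction x rule: lattice_induct)
  case (gen x)
  then show ?case using coproduct_lift_gens by (cases x) auto
next
  case one
  show ?case using coproduct_lift_closed(1) by blast
next
  case (add x y)
  then show ?case using coproduct_lift_closed(2)[OF add(1,2)] by blast
next
  case (mult x y)
  then show ?case using coproduct_lift_closed(3)[OF mult(1,2)] by blast
next
  case (smult c x)
  then show ?case using coproduct_lift_closed(4)[OF smult(1)] by blast
qed

text \<open>Any lift may be chosen, because all lifts have the same limit.\<close>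

definition contraction_coproduct :: "contraction_carrier \<Rightarrow> ((contraction_carrier \<times> contraction_carrier) \<Rightarrow>\<^sub>0 complex) set" where
  "contraction_coproduct = coset_map (\<lambda>x. lattice_tensor_limit \<kappa> (SOME t. coproduct_lift x t))"

lemma contraction_coproduct:
  "contraction_coproduct \<in> alg_hom (contraction \<kappa>) (E2T \<kappa>)"
  "\<lbrakk>x \<in> lattice_carrier \<kappa>; coproduct_lift x t\<rbrakk> \<Longrightarrow> contraction_coproduct (limit_class \<kappa> x) = lattice_tensor_limit \<kappa> t"
proof -
  let ?f = "\<lambda>x. lattice_tensor_limit \<kappa> (SOME t. coproduct_lift x t)"
  have f: "?f x = lattice_tensor_limit \<kappa> t" if "coproduct_lift x t" for x t
    by (rule coproduct_lift_unique[OF someI[of "coproduct_lift x", OF that] that])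
  note H = alg_homD(2)[OF tensor_limit_hom] alg_homD(3-6)[OF tensor_limit_hom]
  have lin: "?f \<in> alg_hom (latC \<kappa>) (E2T \<kappa>)"
  proof (intro alg_homI lin_mapI)
    show "?f \<one>\<^bsub>latC \<kappa>\<^esub> = \<one>\<^bsub>E2T \<kappa>\<^esub>" using f[OF coproduct_lift_closed(1)] H(1) by simp
  next
    fix x assume "x \<in> carrier (latC \<kappa>)"
    then have x: "x \<in> lattice_carrier \<kappa>" by simp
    then obtain s where s: "coproduct_lift x s" using coproduct_lift_exists by blast
    then have sc: "s \<in> carrier (latT \<kappa>)" by (simp add: coproduct_lift_def)
    show "?f x \<in> carrier (E2T \<kappa>)" using f[OF s] H(2)[OF sc] by simp
    show "?f (c \<odot>\<^bsub>latC \<kappa>\<^esub> x) = c \<odot>\<^bsub>E2T \<kappa>\<^esub> ?f x" for c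
      using f[OF s] f[OF coproduct_lift_closed(4)[OF x s, of "fps_const c"]] H(5)[OF sc] by simp
    fix y assume "y \<in> carrier (latC \<kappa>)"
    then have y: "y \<in> lattice_carrier \<kappa>" by simp
    then obtain t where t: "coproduct_lift y t" using coproduct_lift_exists by blast
    then have tc: "t \<in> carrier (latT \<kappa>)" by (simp add: coproduct_lift_def)
    show "?f (x \<oplus>\<^bsub>latC \<kappa>\<^esub> y) = ?f x \<oplus>\<^bsub>E2T \<kappa>\<^esub> ?f y"
      using f[OF s] f[OF t] f[OF coproduct_lift_closed(2)[OF x y s t]] H(4)[OF sc tc] by simp
    show "?f (x \<otimes>\<^bsub>latC \<kappa>\<^esub> y) = ?f x \<otimes>\<^bsub>E2T \<kappa>\<^esub> ?f y"
      using f[OF s] f[OF t] f[OF coproduct_lift_closed(3)[OF x y s t]] H(3)[OF sc tc] by simp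
  qed
  have null: "?f (fls_X \<odot>\<^bsub>su2 \<kappa>\<^esub> z) = \<zero>\<^bsub>E2T \<kappa>\<^esub>" if z: "z \<in> lattice_carrier \<kappa>" for z
  proof -
    obtain s where s: "coproduct_lift z s" using coproduct_lift_exists[OF z] by blast
    then have sc: "s \<in> carrier (latT \<kappa>)" by (simp add: coproduct_lift_def)
    show ?thesis using f[OF coproduct_lift_closed(4)[OF z s, of fps_X]] H(5)[OF sc] H(2)[OF sc] by simp
  qed
  note I = contraction_induced[OF ET.assoc_algebra_T alg_homD(1)[OF lin] null]
  show "contraction_coproduct \<in> alg_hom (contraction \<kappa>) (E2T \<kappa>)"
    unfolding contraction_coproduct_def by (rule I(3)[OF _ lin])
  show "contraction_coproduct (limit_class \<kappa> x) = lattice_tensor_limit \<kappa> t" if "x \<in> lattice_carrier \<kappa>" "coproduct_lift x t"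
    unfolding contraction_coproduct_def using I(2)[OF _ that(1)] f[OF that(2)] by simp
qed

lemma contraction_coproduct_induced: "induced_coproduct \<kappa> contraction_coproduct"
  unfolding induced_coproduct_def
  using coproduct_lift_exists contraction_coproduct(2) unfolding coproduct_lift_def by blast

lemma contraction_coproduct_gens:
  "contraction_coproduct (e2_gen_value \<kappa> A0) = pureE \<kappa> (e2_gen_value \<kappa> A0) (e2_gen_value \<kappa> A0)"
  "contraction_coproduct (e2_gen_value \<kappa> A0_star) = pureE \<kappa> (e2_gen_value \<kappa> A0_star) (e2_gen_value \<kappa> A0_star)"
  "contraction_coproduct (e2_gen_value \<kappa> W0) =
     pureE \<kappa> (e2_gen_value \<kappa> W0) (e2_gen_value \<kappa> A0_star) \<oplus>\<^bsub>E2T \<kappa>\<^esub> pureE \<kappa> (e2_gen_value \<kappa> A0) (e2_gen_value \<kappa> W0)"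
  "contraction_coproduct (e2_gen_value \<kappa> W0_star) =
     pureE \<kappa> (e2_gen_value \<kappa> W0_star) (e2_gen_value \<kappa> A0) \<oplus>\<^bsub>E2T \<kappa>\<^esub> pureE \<kappa> (e2_gen_value \<kappa> A0_star) (e2_gen_value \<kappa> W0_star)"
proof -
  note H = alg_homD(3,5,6)[OF tensor_limit_hom]
  note M = lattice_mem
  have d: "limit_class \<kappa> (cls \<kappa> (dF \<kappa>)) = limit_class \<kappa> (cls \<kappa> (aF' \<kappa>))" "limit_class \<kappa> (cls \<kappa> (dF' \<kappa>)) = limit_class \<kappa> (cls \<kappa> (aF \<kappa>))"
    using reduces_cd(3,4)[of \<kappa>] reduces_gens(1,2)[of \<kappa>] by (simp_all add: reduces_def)
  have c: "limit_class \<kappa> (cls \<kappa> f) \<in> carrier (contraction \<kappa>)" if "cls \<kappa> f \<in> lattice_carrier \<kappa>" for f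
    by (rule limit_class_closed[OF that])
  note S = e2_gen_value_eq e2F_simps M H tensor_limit_pure d c
  show "contraction_coproduct (e2_gen_value \<kappa> A0) = pureE \<kappa> (e2_gen_value \<kappa> A0) (e2_gen_value \<kappa> A0)"
    using contraction_coproduct(2)[OF M(1) coproduct_lift_gens(1)] by (simp add: S del: e2_gen_value.simps)
  show "contraction_coproduct (e2_gen_value \<kappa> A0_star) = pureE \<kappa> (e2_gen_value \<kappa> A0_star) (e2_gen_value \<kappa> A0_star)"
    using contraction_coproduct(2)[OF M(2) coproduct_lift_gens(2)] by (simp add: S del: e2_gen_value.simps)
  show "contraction_coproduct (e2_gen_value \<kappa> W0) =
     pureE \<kappa> (e2_gen_value \<kappa> W0) (e2_gen_value \<kappa> A0_star) \<oplus>\<^bsub>E2T \<kappa>\<^esub> pureE \<kappa> (e2_gen_value \<kappa> A0) (e2_gen_value \<kappa> W0)"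
    using contraction_coproduct(2)[OF M(3) coproduct_lift_gens(3)] by (simp add: S del: e2_gen_value.simps)
  show "contraction_coproduct (e2_gen_value \<kappa> W0_star) =
     pureE \<kappa> (e2_gen_value \<kappa> W0_star) (e2_gen_value \<kappa> A0) \<oplus>\<^bsub>E2T \<kappa>\<^esub> pureE \<kappa> (e2_gen_value \<kappa> A0_star) (e2_gen_value \<kappa> W0_star)"
    using contraction_coproduct(2)[OF M(4) coproduct_lift_gens(4)] by (simp add: S del: e2_gen_value.simps)
qed

end


section \<open>Hopf algebras from generators\<close>

lemma tensor_map_hom:
  assumes A: "assoc_algebra A" "assoc_algebra B" "assoc_algebra C" "assoc_algebra D"
    and hom: "f \<in> alg_hom A C" "g \<in> alg_hom B D"
  shows "tensor_map C D f g \<in> alg_hom (tensor A B) (tensor C D)"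
    and "\<lbrakk>x \<in> carrier A; y \<in> carrier B\<rbrakk> \<Longrightarrow> tensor_map C D f g (pure_tensor A B x y) = pure_tensor C D (f x) (g y)"
proof -
  interpret P: tensor_product A B by (intro tensor_product.intro A)
  interpret Q: tensor_product C D by (intro tensor_product.intro A)
  note H = alg_homD(2-6)[OF hom(1)] alg_homD(2-6)[OF hom(2)]
  have bil: "bilinear_map A B (tensor C D) (\<lambda>x y. pure_tensor C D (f x) (g y))"
    by (auto simp: bilinear_map_def H Q.pure_add_left Q.pure_add_right Q.pure_smult intro!: lin_mapI)
  show "tensor_map C D f g \<in> alg_hom (tensor A B) (tensor C D)"
    unfolding tensor_map_def
    by (rule P.tensor_lift_hom[OF Q.assoc_algebra_T bil]) (simp_all add: H Q.one_T Q.pure_mult)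
  show "\<lbrakk>x \<in> carrier A; y \<in> carrier B\<rbrakk> \<Longrightarrow> tensor_map C D f g (pure_tensor A B x y) = pure_tensor C D (f x) (g y)"
    unfolding tensor_map_def by (rule P.tensor_lift_pure[OF Q.assoc_algebra_T bil])
qed

lemma tensor_assoc_hom:
  assumes A: "assoc_algebra A" "assoc_algebra B" "assoc_algebra C"
  shows "tensor_assoc A B C \<in> alg_hom (tensor (tensor A B) C) (tensor A (tensor B C))"
    and "\<lbrakk>x \<in> carrier A; y \<in> carrier B; z \<in> carrier C\<rbrakk> \<Longrightarrow>
      tensor_assoc A B C (pure_tensor (tensor A B) C (pure_tensor A B x y) z) = pure_tensor A (tensor B C) x (pure_tensor B C y z)"
proof -
  interpret P: tensor_product A B by (intro tensor_product.intro A)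
  interpret Q: tensor_product B C by (intro tensor_product.intro A)
  interpret PC: tensor_product "tensor A B" C by (intro tensor_product.intro A P.assoc_algebra_T)
  interpret AQ: tensor_product A "tensor B C" by (intro tensor_product.intro A Q.assoc_algebra_T)
  let ?W = "tensor A (tensor B C)"
  let ?\<alpha> = "\<lambda>z. tensor_lift ?W (\<lambda>x y. pure_tensor A (tensor B C) x (pure_tensor B C y z))"
  have bil: "bilinear_map A B ?W (\<lambda>x y. pure_tensor A (tensor B C) x (pure_tensor B C y z))" if "z \<in> carrier C" for z
    using that by (auto simp: bilinear_map_def AQ.pure_add_left AQ.pure_add_right AQ.pure_smult
        Q.pure_add_left Q.pure_smult intro!: lin_mapI)
  note L = lin_mapD[OF P.tensor_lift_lin[OF AQ.assoc_algebra_T bil]]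
  note V = P.tensor_lift_pure[OF AQ.assoc_algebra_T bil]
  note Z = lin_map_zero[OF P.assoc_algebra_T AQ.assoc_algebra_T P.tensor_lift_lin[OF AQ.assoc_algebra_T bil]]
  have add: "?\<alpha> (z \<oplus>\<^bsub>C\<^esub> z') t = ?\<alpha> z t \<oplus>\<^bsub>?W\<^esub> ?\<alpha> z' t" if z: "z \<in> carrier C" "z' \<in> carrier C" and t: "t \<in> carrier (tensor A B)" for z z' t
    using t
  proof (induction t rule: P.tensor_induct)
    case (add x y t)
    then show ?case using z by (simp add: L V AQ.pure_add_right Q.pure_add_right AQ.T.a_ac)
  qed (use z in \<open>simp add: Z\<close>)
  have smult: "?\<alpha> (c \<odot>\<^bsub>C\<^esub> z) t = c \<odot>\<^bsub>?W\<^esub> ?\<alpha> z t" if z: "z \<in> carrier C" and t: "t \<in> carrier (tensor A B)" for c z t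
    using t
  proof (induction t rule: P.tensor_induct)
    case (add x y t)
    then show ?case using z by (simp add: L V AQ.pure_smult Q.pure_smult AQ.T.smult_add_r)
  qed (use z in \<open>simp add: Z\<close>)
  have bil2: "bilinear_map (tensor A B) C ?W (\<lambda>t z. ?\<alpha> z t)"
    by (auto simp: bilinear_map_def L add smult intro!: lin_mapI)
  have mult: "?\<alpha> (z \<otimes>\<^bsub>C\<^esub> z') (s \<otimes>\<^bsub>tensor A B\<^esub> t) = ?\<alpha> z s \<otimes>\<^bsub>?W\<^esub> ?\<alpha> z' t"
    if s: "s \<in> carrier (tensor A B)" and t: "t \<in> carrier (tensor A B)" and z: "z \<in> carrier C" "z' \<in> carrier C" for s t z z'
    using s
  proof (induction s rule: P.tensor_induct)
    case zero
    then show ?case using z t by (simp add: Z L)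
  next
    case (add x y s)
    have "?\<alpha> (z \<otimes>\<^bsub>C\<^esub> z') (pure_tensor A B x y \<otimes>\<^bsub>tensor A B\<^esub> t) = ?\<alpha> z (pure_tensor A B x y) \<otimes>\<^bsub>?W\<^esub> ?\<alpha> z' t"
      using t
    proof (induction t rule: P.tensor_induct)
      case zero
      then show ?case using z add by (simp add: Z L V)
    next
      case (add x' y' t)
      then show ?case using z \<open>x \<in> carrier A\<close> \<open>y \<in> carrier B\<close>
        by (simp add: L V P.T.r_distr AQ.T.r_distr P.pure_mult AQ.pure_mult Q.pure_mult)
    qed
    then show ?case using add z t by (simp add: L P.T.l_distr AQ.T.l_distr)
  qed
  show "tensor_assoc A B C \<in> alg_hom (tensor (tensor A B) C) (tensor A (tensor B C))"
    unfolding tensor_assoc_def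
    by (rule PC.tensor_lift_hom[OF AQ.assoc_algebra_T bil2]) (simp_all add: mult P.one_T AQ.one_T Q.one_T V)
  show "\<lbrakk>x \<in> carrier A; y \<in> carrier B; z \<in> carrier C\<rbrakk> \<Longrightarrow>
      tensor_assoc A B C (pure_tensor (tensor A B) C (pure_tensor A B x y) z) = pure_tensor A (tensor B C) x (pure_tensor B C y z)"
    unfolding tensor_assoc_def by (simp add: PC.tensor_lift_pure[OF AQ.assoc_algebra_T bil2] V)
qed

lemma tensor_counit_hom:
  assumes A: "assoc_algebra A" and \<epsilon>: "\<epsilon> \<in> alg_hom A scalars"
  shows "tensor_lift A (\<lambda>y z. \<epsilon> y \<odot>\<^bsub>A\<^esub> z) \<in> alg_hom (tensor A A) A"
    and "tensor_lift A (\<lambda>y z. \<epsilon> z \<odot>\<^bsub>A\<^esub> y) \<in> alg_hom (tensor A A) A"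
    and "\<lbrakk>x \<in> carrier A; y \<in> carrier A\<rbrakk> \<Longrightarrow> tensor_lift A (\<lambda>y z. \<epsilon> y \<odot>\<^bsub>A\<^esub> z) (pure_tensor A A x y) = \<epsilon> x \<odot>\<^bsub>A\<^esub> y"
    and "\<lbrakk>x \<in> carrier A; y \<in> carrier A\<rbrakk> \<Longrightarrow> tensor_lift A (\<lambda>y z. \<epsilon> z \<odot>\<^bsub>A\<^esub> y) (pure_tensor A A x y) = \<epsilon> y \<odot>\<^bsub>A\<^esub> x"
proof -
  interpret P: tensor_product A A by (intro tensor_product.intro A)
  note H = alg_homD(2)[OF \<epsilon>] alg_homD(4-6)[OF \<epsilon>]
  have c: "c \<odot>\<^bsub>A\<^esub> (d \<odot>\<^bsub>A\<^esub> x) = d \<odot>\<^bsub>A\<^esub> (c \<odot>\<^bsub>A\<^esub> x)" if "x \<in> carrier A" for c d x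
    using that by (metis P.A.smult_assoc mult.commute)
  have l: "bilinear_map A A A (\<lambda>y z. \<epsilon> y \<odot>\<^bsub>A\<^esub> z)" and r: "bilinear_map A A A (\<lambda>y z. \<epsilon> z \<odot>\<^bsub>A\<^esub> y)"
    by (auto simp: bilinear_map_def H P.A.smult_add_l P.A.smult_add_r P.A.smult_assoc intro!: lin_mapI c)
  show "tensor_lift A (\<lambda>y z. \<epsilon> y \<odot>\<^bsub>A\<^esub> z) \<in> alg_hom (tensor A A) A"
    by (rule P.tensor_lift_hom[OF A l]) (auto simp: H P.A.smult_assoc P.A.smult_mult_left P.A.smult_mult_right intro!: c)
  show "tensor_lift A (\<lambda>y z. \<epsilon> z \<odot>\<^bsub>A\<^esub> y) \<in> alg_hom (tensor A A) A"
    by (rule P.tensor_lift_hom[OF A r]) (auto simp: H P.A.smult_assoc P.A.smult_mult_left P.A.smult_mult_right intro!: c)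
  show "\<lbrakk>x \<in> carrier A; y \<in> carrier A\<rbrakk> \<Longrightarrow> tensor_lift A (\<lambda>y z. \<epsilon> y \<odot>\<^bsub>A\<^esub> z) (pure_tensor A A x y) = \<epsilon> x \<odot>\<^bsub>A\<^esub> y"
    by (rule P.tensor_lift_pure[OF A l])
  show "\<lbrakk>x \<in> carrier A; y \<in> carrier A\<rbrakk> \<Longrightarrow> tensor_lift A (\<lambda>y z. \<epsilon> z \<odot>\<^bsub>A\<^esub> y) (pure_tensor A A x y) = \<epsilon> y \<odot>\<^bsub>A\<^esub> x"
    by (rule P.tensor_lift_pure[OF A r])
qed

text \<open>These contractions are not multiplicative. As S reverses products, multiplying s on the
  right by y \<otimes> z turns \<phi> s into S y times \<phi> s times z, so a scalar \<phi> s can be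
  pulled out. This is what lets the antipode axioms pass from factors to products.\<close>

lemma tensor_antipode:
  assumes A: "assoc_algebra A" and S: "S \<in> alg_hom A (opposite A)"
  defines "\<phi> \<equiv> tensor_lift A (\<lambda>y z. S y \<otimes>\<^bsub>A\<^esub> z)" and "\<psi> \<equiv> tensor_lift A (\<lambda>y z. y \<otimes>\<^bsub>A\<^esub> S z)"
  shows "\<phi> \<in> lin_map (tensor A A) A" "\<psi> \<in> lin_map (tensor A A) A"
    and "\<And>x y. \<lbrakk>x \<in> carrier A; y \<in> carrier A\<rbrakk> \<Longrightarrow> \<phi> (pure_tensor A A x y) = S x \<otimes>\<^bsub>A\<^esub> y"
    and "\<And>x y. \<lbrakk>x \<in> carrier A; y \<in> carrier A\<rbrakk> \<Longrightarrow> \<psi> (pure_tensor A A x y) = x \<otimes>\<^bsub>A\<^esub> S y"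
    and "\<And>s t c. \<lbrakk>s \<in> carrier (tensor A A); t \<in> carrier (tensor A A); \<phi> s = c \<odot>\<^bsub>A\<^esub> \<one>\<^bsub>A\<^esub>\<rbrakk> \<Longrightarrow>
      \<phi> (s \<otimes>\<^bsub>tensor A A\<^esub> t) = c \<odot>\<^bsub>A\<^esub> \<phi> t"
    and "\<And>s t c. \<lbrakk>s \<in> carrier (tensor A A); t \<in> carrier (tensor A A); \<psi> t = c \<odot>\<^bsub>A\<^esub> \<one>\<^bsub>A\<^esub>\<rbrakk> \<Longrightarrow>
      \<psi> (s \<otimes>\<^bsub>tensor A A\<^esub> t) = c \<odot>\<^bsub>A\<^esub> \<psi> s"
proof -
  interpret P: tensor_product A A by (intro tensor_product.intro A)
  have H: "S x \<in> carrier A" "S (x \<oplus>\<^bsub>A\<^esub> y) = S x \<oplus>\<^bsub>A\<^esub> S y" "S (x \<otimes>\<^bsub>A\<^esub> y) = S y \<otimes>\<^bsub>A\<^esub> S x" "S (c \<odot>\<^bsub>A\<^esub> x) = c \<odot>\<^bsub>A\<^esub> S x"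
    if "x \<in> carrier A" "y \<in> carrier A" for x y c
    using that alg_homD(3-6)[OF S] by simp_all
  have l: "bilinear_map A A A (\<lambda>y z. S y \<otimes>\<^bsub>A\<^esub> z)" and r: "bilinear_map A A A (\<lambda>y z. y \<otimes>\<^bsub>A\<^esub> S z)"
    by (auto simp: bilinear_map_def H P.A.l_distr P.A.r_distr P.A.smult_mult_left P.A.smult_mult_right intro!: lin_mapI)
  show \<phi>: "\<phi> \<in> lin_map (tensor A A) A" unfolding \<phi>_def by (rule P.tensor_lift_lin[OF A l])
  show \<psi>: "\<psi> \<in> lin_map (tensor A A) A" unfolding \<psi>_def by (rule P.tensor_lift_lin[OF A r])
  show V: "\<phi> (pure_tensor A A x y) = S x \<otimes>\<^bsub>A\<^esub> y" if "x \<in> carrier A" "y \<in> carrier A" for x y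
    unfolding \<phi>_def by (rule P.tensor_lift_pure[OF A l that])
  show W: "\<psi> (pure_tensor A A x y) = x \<otimes>\<^bsub>A\<^esub> S y" if "x \<in> carrier A" "y \<in> carrier A" for x y
    unfolding \<psi>_def by (rule P.tensor_lift_pure[OF A r that])
  note L = lin_mapD[OF \<phi>] lin_mapD[OF \<psi>]
  note Z = lin_map_zero[OF P.assoc_algebra_T A \<phi>] lin_map_zero[OF P.assoc_algebra_T A \<psi>]
  have l1: "\<phi> (s \<otimes>\<^bsub>tensor A A\<^esub> pure_tensor A A y z) = S y \<otimes>\<^bsub>A\<^esub> \<phi> s \<otimes>\<^bsub>A\<^esub> z"
    if "s \<in> carrier (tensor A A)" and c: "y \<in> carrier A" "z \<in> carrier A" for s y z
    using that(1)
  proof (induction s rule: P.tensor_induct)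
    case (add x x' s)
    then show ?case using c by (simp add: P.T.l_distr P.A.l_distr P.A.r_distr P.pure_mult L V H P.A.m_assoc)
  qed (use c H in \<open>simp add: Z\<close>)
  have r1: "\<psi> (pure_tensor A A y z \<otimes>\<^bsub>tensor A A\<^esub> t) = y \<otimes>\<^bsub>A\<^esub> \<psi> t \<otimes>\<^bsub>A\<^esub> S z"
    if "t \<in> carrier (tensor A A)" and c: "y \<in> carrier A" "z \<in> carrier A" for t y z
    using that(1)
  proof (induction t rule: P.tensor_induct)
    case (add x x' t)
    then show ?case using c by (simp add: P.T.r_distr P.A.l_distr P.A.r_distr P.pure_mult L W H P.A.m_assoc)
  qed (use c H in \<open>simp add: Z\<close>)
  show "\<phi> (s \<otimes>\<^bsub>tensor A A\<^esub> t) = c \<odot>\<^bsub>A\<^esub> \<phi> t"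
    if s: "s \<in> carrier (tensor A A)" and t: "t \<in> carrier (tensor A A)" and c: "\<phi> s = c \<odot>\<^bsub>A\<^esub> \<one>\<^bsub>A\<^esub>" for s t c
    using t
  proof (induction t rule: P.tensor_induct)
    case (add x y t)
    then show ?case using s H
      by (simp add: P.T.r_distr L l1 c V P.A.smult_mult_left P.A.smult_mult_right P.A.smult_add_r)
  qed (use s in \<open>simp add: Z\<close>)
  show "\<psi> (s \<otimes>\<^bsub>tensor A A\<^esub> t) = c \<odot>\<^bsub>A\<^esub> \<psi> s"
    if s: "s \<in> carrier (tensor A A)" and t: "t \<in> carrier (tensor A A)" and c: "\<psi> t = c \<odot>\<^bsub>A\<^esub> \<one>\<^bsub>A\<^esub>" for s t c
    using s
  proof (induction s rule: P.tensor_induct)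
    case (add x y s)
    then show ?case using t H
      by (simp add: P.T.l_distr L r1 c W P.A.smult_mult_left P.A.smult_mult_right P.A.smult_add_r)
  qed (use t in \<open>simp add: Z\<close>)
qed

lemma hom_eq_on_generators:
  assumes "assoc_algebra A" "assoc_algebra V" "f \<in> alg_hom A V" "g \<in> alg_hom A V"
    and "\<And>x. v x \<in> carrier A" "\<And>x. f (v x) = g (v x)"
  shows "f (free_eval A v p) = g (free_eval A v p)"
proof -
  interpret A: assoc_algebra A by fact
  interpret V: assoc_algebra V by fact
  have F: "free_eval A v \<in> alg_hom free_algebra A" by (rule A.free_eval_hom[OF assms(5)])
  have c: "f (v x) \<in> carrier V" for x by (rule alg_homD(3)[OF assms(3) assms(5)])
  have "f (free_eval A v p) = free_eval V (\<lambda>x. f (v x)) p"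
    by (rule V.free_eval_unique[OF c alg_hom_comp[OF F assms(3)]]) (simp add: A.free_eval_gen[OF assms(5)])
  moreover have "g (free_eval A v p) = free_eval V (\<lambda>x. f (v x)) p"
    by (rule V.free_eval_unique[OF c alg_hom_comp[OF F assms(4)]]) (simp add: A.free_eval_gen[OF assms(5)] assms(6))
  ultimately show ?thesis by simp
qed

text \<open>Coassociativity and the counit laws equate algebra homomorphisms and so need checking on
  generators only. The antipode laws do not have this form and are proved by induction along words
  with \<open>tensor_antipode\<close>.\<close>

theorem hopf_algebra_generated:
  assumes A: "assoc_algebra A"
    and v: "\<And>x. v x \<in> carrier A" "\<And>x. x \<in> carrier A \<Longrightarrow> \<exists>p. x = free_eval A v p"
    and \<Delta>: "\<Delta> \<in> alg_hom A (tensor A A)" and \<epsilon>: "\<epsilon> \<in> alg_hom A scalars" and S: "S \<in> alg_hom A (opposite A)"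
    and coassoc: "\<And>x. tensor_assoc A A A (tensor_map (tensor A A) A \<Delta> (\<lambda>y. y) (\<Delta> (v x))) =
      tensor_map A (tensor A A) (\<lambda>y. y) \<Delta> (\<Delta> (v x))"
    and counit: "\<And>x. tensor_lift A (\<lambda>y z. \<epsilon> y \<odot>\<^bsub>A\<^esub> z) (\<Delta> (v x)) = v x"
      "\<And>x. tensor_lift A (\<lambda>y z. \<epsilon> z \<odot>\<^bsub>A\<^esub> y) (\<Delta> (v x)) = v x"
    and antipode: "\<And>x. tensor_lift A (\<lambda>y z. S y \<otimes>\<^bsub>A\<^esub> z) (\<Delta> (v x)) = \<epsilon> (v x) \<odot>\<^bsub>A\<^esub> \<one>\<^bsub>A\<^esub>"
      "\<And>x. tensor_lift A (\<lambda>y z. y \<otimes>\<^bsub>A\<^esub> S z) (\<Delta> (v x)) = \<epsilon> (v x) \<odot>\<^bsub>A\<^esub> \<one>\<^bsub>A\<^esub>"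
  shows "hopf_algebra A \<Delta> \<epsilon> S"
proof -
  interpret P: tensor_product A A by (intro tensor_product.intro A)
  have T: "assoc_algebra (tensor A A)" by (rule P.assoc_algebra_T)
  interpret AT: tensor_product A "tensor A A" by (intro tensor_product.intro A T)
  note eq = hom_eq_on_generators[OF A _ _ _ v(1)]
  note D = alg_homD(2-6)[OF \<Delta>] and e = alg_homD(2)[OF \<epsilon>] alg_homD(4-6)[OF \<epsilon>]
  note anti = tensor_antipode[OF A S]
  note F = P.A.free_eval_simps[OF v(1)] P.A.free_eval_smult[OF v(1)] P.A.free_eval_gen[OF v(1)] P.A.free_eval_closed[OF v(1)]
  have left: "tensor_lift A (\<lambda>y z. S y \<otimes>\<^bsub>A\<^esub> z) (\<Delta> (free_eval A v p)) = \<epsilon> (free_eval A v p) \<odot>\<^bsub>A\<^esub> \<one>\<^bsub>A\<^esub>" for p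
  proof (induction p rule: free_induct)
    case one
    show ?case using alg_homD(2)[OF S] by (simp add: F D e P.one_T anti(3))
  next
    case (add f g)
    then show ?case by (simp add: F D e lin_mapD(2)[OF anti(1)] P.A.smult_add_l)
  next
    case (smult c f)
    then show ?case by (simp add: F(7-9) D e lin_mapD(3)[OF anti(1)] P.A.smult_assoc)
  next
    case (gen_mult x f)
    then show ?case by (simp add: F D e v(1) anti(5)[OF _ _ antipode(1)] P.A.smult_assoc)
  qed
  have right: "tensor_lift A (\<lambda>y z. y \<otimes>\<^bsub>A\<^esub> S z) (\<Delta> (free_eval A v p)) = \<epsilon> (free_eval A v p) \<odot>\<^bsub>A\<^esub> \<one>\<^bsub>A\<^esub>" for p
  proof (induction p rule: free_induct)
    case one
    show ?case using alg_homD(2)[OF S] by (simp add: F D e P.one_T anti(4))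
  next
    case (add f g)
    then show ?case by (simp add: F D e lin_mapD(2)[OF anti(2)] P.A.smult_add_l)
  next
    case (smult c f)
    then show ?case by (simp add: F(7-9) D e lin_mapD(3)[OF anti(2)] P.A.smult_assoc)
  next
    \<comment> \<open>On this side the right factor has to contract to a scalar, so the induction
      hypothesis for f is applied first and the law for the generator second.\<close>
    case (gen_mult x f)
    have "tensor_lift A (\<lambda>y z. y \<otimes>\<^bsub>A\<^esub> S z) (\<Delta> (v x) \<otimes>\<^bsub>tensor A A\<^esub> \<Delta> (free_eval A v f)) =
      \<epsilon> (free_eval A v f) \<odot>\<^bsub>A\<^esub> (\<epsilon> (v x) \<odot>\<^bsub>A\<^esub> \<one>\<^bsub>A\<^esub>)"
      using anti(6)[OF _ _ gen_mult] antipode(2) by (simp add: D v(1) F)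
    then show ?case by (simp add: F D e v(1) mult.commute[of "\<epsilon> (v x)"] P.A.smult_assoc)
  qed
  show ?thesis
  proof (intro hopf_algebra.intro A hopf_algebra_axioms.intro \<Delta> \<epsilon>)
    fix x assume x: "x \<in> carrier A"
    then obtain p where p: "x = free_eval A v p" using v(2) by blast
    show "tensor_assoc A A A (tensor_map (tensor A A) A \<Delta> (\<lambda>y. y) (\<Delta> x)) = tensor_map A (tensor A A) (\<lambda>y. y) \<Delta> (\<Delta> x)"
      unfolding p
      by (rule eq[OF AT.assoc_algebra_T alg_hom_comp[OF alg_hom_comp[OF \<Delta> tensor_map_hom(1)[OF A A T A \<Delta> alg_hom_id]] tensor_assoc_hom(1)[OF A A A]]
          alg_hom_comp[OF \<Delta> tensor_map_hom(1)[OF A A A T alg_hom_id \<Delta>]] coassoc])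
    show "tensor_lift A (\<lambda>y z. \<epsilon> y \<odot>\<^bsub>A\<^esub> z) (\<Delta> x) = x"
      unfolding p by (rule eq[OF A alg_hom_comp[OF \<Delta> tensor_counit_hom(1)[OF A \<epsilon>]] alg_hom_id counit(1)])
    show "tensor_lift A (\<lambda>y z. \<epsilon> z \<odot>\<^bsub>A\<^esub> y) (\<Delta> x) = x"
      unfolding p by (rule eq[OF A alg_hom_comp[OF \<Delta> tensor_counit_hom(2)[OF A \<epsilon>]] alg_hom_id counit(2)])
    show "S x \<in> carrier A" "S (c \<odot>\<^bsub>A\<^esub> x) = c \<odot>\<^bsub>A\<^esub> S x" for c using alg_homD(3,6)[OF S] x by simp_all
    show "S (x \<oplus>\<^bsub>A\<^esub> y) = S x \<oplus>\<^bsub>A\<^esub> S y" if "y \<in> carrier A" for y using alg_homD(5)[OF S] x that by simp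
    show "tensor_lift A (\<lambda>y z. S y \<otimes>\<^bsub>A\<^esub> z) (\<Delta> x) = \<epsilon> x \<odot>\<^bsub>A\<^esub> \<one>\<^bsub>A\<^esub>"
      "tensor_lift A (\<lambda>y z. y \<otimes>\<^bsub>A\<^esub> S z) (\<Delta> x) = \<epsilon> x \<odot>\<^bsub>A\<^esub> \<one>\<^bsub>A\<^esub>"
      unfolding p by (rule left right)+
  qed
qed


section \<open>The Hopf algebra structure of the contraction\<close>

context
  fixes \<kappa> :: real
begin

section \<open>The counit of the limit\<close>

definition contraction_counit :: "contraction_carrier \<Rightarrow> complex" where
  "contraction_counit = coset_map (\<lambda>x. fls_nth (su2_counit \<kappa> x) 0)"

lemma su2_counit_gens:
  "su2_counit \<kappa> (cls \<kappa> (aF \<kappa>)) = 1" "su2_counit \<kappa> (cls \<kappa> (aF' \<kappa>)) = 1"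
  "su2_counit \<kappa> (cls \<kappa> (wF \<kappa>)) = 0" "su2_counit \<kappa> (cls \<kappa> (wF' \<kappa>)) = 0"
proof -
  have "su2_counit \<kappa> (cls \<kappa> (lc a b c d)) = a + b" for a b c d
    by (simp add: su2_counit_cls lc_def scal.free_eval_simps(2) scal.free_eval_smult)
  then show "su2_counit \<kappa> (cls \<kappa> (aF \<kappa>)) = 1" "su2_counit \<kappa> (cls \<kappa> (aF' \<kappa>)) = 1"
    "su2_counit \<kappa> (cls \<kappa> (wF \<kappa>)) = 0" "su2_counit \<kappa> (cls \<kappa> (wF' \<kappa>)) = 0"
    by (simp_all add: gF_defs)
qed

lemma su2_counit_limit:
  assumes "x \<in> lattice_carrier \<kappa>"
  shows "fls_limit (su2_counit \<kappa> x) (fls_nth (su2_counit \<kappa> x) 0)"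
proof -
  note H = alg_homD(2)[OF su2_counit_hom[of \<kappa>]] alg_homD(4-6)[OF su2_counit_hom[of \<kappa>]]
  from assms have "\<exists>l. fls_limit (su2_counit \<kappa> x) l"
  proof (induction x rule: lattice_induct)
    case (gen x)
    then show ?case using fls_limit_consts(1,2) by (cases x) (auto simp: su2_counit_gens)
  next
    case one
    then show ?case using fls_limit_consts(2) H(1) by auto
  next
    case (add x y)
    then show ?case using H(3)[of x y] by (auto simp: latD intro: fls_limit_add)
  next
    case (mult x y)
    then show ?case using H(2)[of x y] by (auto simp: latD intro: fls_limit_mult)
  next
    case (smult c x)
    then show ?case using H(4)[of x "fps_to_fls c"] by (auto simp: latD intro: fls_limit_mult fls_limit_consts(6))
  qed
  then show ?thesis using fls_limit_nth by blast
qed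

lemma contraction_counit:
  "contraction_counit \<in> alg_hom (contraction \<kappa>) scalars"
  "x \<in> lattice_carrier \<kappa> \<Longrightarrow> contraction_counit (limit_class \<kappa> x) = fls_nth (su2_counit \<kappa> x) 0"
proof -
  note H = alg_homD(2)[OF su2_counit_hom[of \<kappa>]] alg_homD(4-6)[OF su2_counit_hom[of \<kappa>]]
  have lin: "(\<lambda>x. fls_nth (su2_counit \<kappa> x) 0) \<in> alg_hom (latC \<kappa>) scalars"
  proof (intro alg_homI lin_mapI)
    fix x y assume "x \<in> carrier (latC \<kappa>)" "y \<in> carrier (latC \<kappa>)"
    then have xy: "x \<in> lattice_carrier \<kappa>" "y \<in> lattice_carrier \<kappa>" by simp_all
    show "fls_nth (su2_counit \<kappa> (x \<otimes>\<^bsub>latC \<kappa>\<^esub> y)) 0 = fls_nth (su2_counit \<kappa> x) 0 \<otimes>\<^bsub>scalars\<^esub> fls_nth (su2_counit \<kappa> y) 0"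
      using fls_limit_nth[OF fls_limit_mult[OF su2_counit_limit[OF xy(1)] su2_counit_limit[OF xy(2)]]] xy by (simp add: H latD)
  qed (simp_all add: H latD)
  have null: "fls_nth (su2_counit \<kappa> (fls_X \<odot>\<^bsub>su2 \<kappa>\<^esub> z)) 0 = \<zero>\<^bsub>scalars\<^esub>" if "z \<in> lattice_carrier \<kappa>" for z
    using fls_limit_nth[OF fls_limit_mult[OF fls_limit_consts(4) su2_counit_limit[OF that]]] that H(4)[of z fls_X]
    by (simp add: latD del: fls_times_both_shifted_simp)
  note I = contraction_induced[OF assoc_algebra_scalars alg_homD(1)[OF lin] null]
  show "contraction_counit \<in> alg_hom (contraction \<kappa>) scalars"
    unfolding contraction_counit_def by (rule I(3)[OF _ lin])
  show "x \<in> lattice_carrier \<kappa> \<Longrightarrow> contraction_counit (limit_class \<kappa> x) = fls_nth (su2_counit \<kappa> x) 0"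
    unfolding contraction_counit_def by (rule I(2))
qed

lemma contraction_counit_gens:
  "contraction_counit (e2_gen_value \<kappa> A0) = 1" "contraction_counit (e2_gen_value \<kappa> A0_star) = 1"
  "contraction_counit (e2_gen_value \<kappa> W0) = 0" "contraction_counit (e2_gen_value \<kappa> W0_star) = 0"
proof -
  have e: "contraction_counit (e2_gen_value \<kappa> x) = fls_nth (su2_counit \<kappa> (cls \<kappa> (e2F \<kappa> x))) 0" for x
    unfolding e2_gen_value_eq by (rule contraction_counit(2)[OF lattice_sub(3)])
  show "contraction_counit (e2_gen_value \<kappa> A0) = 1" "contraction_counit (e2_gen_value \<kappa> A0_star) = 1"
    "contraction_counit (e2_gen_value \<kappa> W0) = 0" "contraction_counit (e2_gen_value \<kappa> W0_star) = 0"
    unfolding e by (simp_all add: su2_counit_gens)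
qed

lemma contraction_counit_induced: "induced_counit \<kappa> contraction_counit"
  unfolding induced_counit_def
proof
  fix x assume x: "x \<in> lattice_carrier \<kappa>"
  then show "\<exists>c. su2_counit \<kappa> x = fps_to_fls c \<and> contraction_counit (limit_class \<kappa> x) = fps_nth c 0"
    using su2_counit_limit[OF x] by (auto simp: fls_limit_def contraction_counit(2))
qed

section \<open>The antipode of the limit\<close>

definition contraction_antipode :: "contraction_carrier \<Rightarrow> contraction_carrier" where
  "contraction_antipode = coset_map (\<lambda>x. limit_class \<kappa> (su2_antipode \<kappa> x))"

lemma su2_antipode_lc:
  "su2_antipode \<kappa> (cls \<kappa> (lc a b c d)) = cls \<kappa> (lc b a (- (mu \<kappa> * c)) (- (inverse (mu \<kappa>) * d)))"
  by (simp add: su2_antipode_cls lc_def opp.free_eval_simps(2) opp.free_eval_smult cst_hom)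
    (simp add: add.commute mult.assoc[symmetric] mult.commute flip: cst_hom)

abbreviation kC :: "e2_gen list \<Rightarrow>\<^sub>0 complex" where "kC \<equiv> cst (complex_of_real (1 / (2 * \<kappa>)))"

text \<open>S exchanges \<sigma> and \<sigma>* and multiplies \<rho>, \<rho>* by -\<mu>, -1/\<mu>,
  so it sends w to -w up to terms in \<rho> and \<rho>* with coefficients of order \<mu> - 1 divided
  by h. These produce the additional summand a - a* over 2\<kappa>, and likewise for w*.\<close>

lemma reduces_antipode_gens:
  "\<exists>X. su2_antipode \<kappa> (cls \<kappa> (aF \<kappa>)) = cls \<kappa> X \<and> reduces \<kappa> gb X"
  "\<exists>X. su2_antipode \<kappa> (cls \<kappa> (aF' \<kappa>)) = cls \<kappa> X \<and> reduces \<kappa> ga X"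
  "\<exists>X. su2_antipode \<kappa> (cls \<kappa> (wF \<kappa>)) = cls \<kappa> X \<and> reduces \<kappa> (kC * (ga - gb) - gw) X"
  "\<exists>X. su2_antipode \<kappa> (cls \<kappa> (wF' \<kappa>)) = cls \<kappa> X \<and> reduces \<kappa> (kC * (ga - gb) - gz) X"
proof -
  have mu0: "mu \<kappa> \<noteq> 0" by (simp add: mu_def)
  note C = fls_limit_consts(1,2,3,5)
  have half: "fls_limit (1/2) (1/2)" "fls_limit (mu \<kappa> / 2) (1/2)" "fls_limit (- (mu \<kappa> / 2)) (- (1/2))"
    "fls_limit (mu \<kappa> * mu \<kappa> / 2) (1 * 1/2)" "fls_limit (- (inverse (mu \<kappa>) / 2)) (- (inverse 1 / 2))"
    by (intro fls_limit_divide fls_limit_uminus fls_limit_mult fls_limit_inverse C; simp)+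
  note R = reduces_lc[where \<kappa> = \<kappa>]
  have "su2_antipode \<kappa> (cls \<kappa> (aF \<kappa>)) = cls \<kappa> (lc (1/2) (1/2) (- (mu \<kappa> / 2)) (1/2))"
    using mu0 by (simp add: aF_def su2_antipode_lc)
  moreover have "reduces \<kappa> gb (lc (1/2) (1/2) (- (mu \<kappa> / 2)) (1/2))"
    using R[OF half(1,1,3,1)] by simp
  ultimately show "\<exists>X. su2_antipode \<kappa> (cls \<kappa> (aF \<kappa>)) = cls \<kappa> X \<and> reduces \<kappa> gb X" by blast
  have "su2_antipode \<kappa> (cls \<kappa> (aF' \<kappa>)) = cls \<kappa> (lc (1/2) (1/2) (mu \<kappa> * mu \<kappa> / 2) (- (inverse (mu \<kappa>) / 2)))"
    by (simp add: aF'_def su2_antipode_lc)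
  moreover have "reduces \<kappa> ga (lc (1/2) (1/2) (mu \<kappa> * mu \<kappa> / 2) (- (inverse (mu \<kappa>) / 2)))"
    using R[OF half(1,1,4,5)] by simp
  ultimately show "\<exists>X. su2_antipode \<kappa> (cls \<kappa> (aF' \<kappa>)) = cls \<kappa> X \<and> reduces \<kappa> ga X" by blast
  let ?m = "(mu \<kappa> - 1) * hinv"
  have lim: "fls_limit (?m / 2) (complex_of_real (1 / \<kappa>) / 2)" "fls_limit (- (?m / 2)) (- (complex_of_real (1 / \<kappa>) / 2))"
    "fls_limit (mu \<kappa> * ?m / 2) (1 * complex_of_real (1 / \<kappa>) / 2)"
    "fls_limit (- (inverse (mu \<kappa>) * ?m / 2)) (- (inverse 1 * complex_of_real (1 / \<kappa>) / 2))"
    by (intro fls_limit_divide fls_limit_uminus fls_limit_mult fls_limit_inverse fls_limit_mu_diff C; simp)+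
  have k: "cst (complex_of_real (1 / \<kappa>) / 2) * ga + cst (- (complex_of_real (1 / \<kappa>) / 2)) * gb = kC * (ga - gb)"
  proof -
    have "complex_of_real (1 / \<kappa>) / 2 = complex_of_real (1 / (2 * \<kappa>))" by simp
    then show ?thesis by (simp only: cst_hom(4) right_diff_distrib mult_minus_left add_uminus_conv_diff)
  qed
  have r1: "reduces \<kappa> (kC * (ga - gb)) (lc 0 0 (?m / 2) (- (?m / 2)))"
    using R[OF C(1,1) lim(1,2)] k by simp
  have r2: "reduces \<kappa> (kC * (ga - gb)) (lc 0 0 (mu \<kappa> * ?m / 2) (- (inverse (mu \<kappa>) * ?m / 2)))"
    using R[OF C(1,1) lim(3,4)] k by simp
  have "su2_antipode \<kappa> (cls \<kappa> (wF \<kappa>)) = cls \<kappa> (lc 0 0 (?m / 2) (- (?m / 2)) - wF \<kappa>)"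
    using mu0 by (simp add: wF_def su2_antipode_lc lc_simps field_simps)
  with reduces_diff[OF r1 reduces_gens(3)] show "\<exists>X. su2_antipode \<kappa> (cls \<kappa> (wF \<kappa>)) = cls \<kappa> X \<and> reduces \<kappa> (kC * (ga - gb) - gw) X" by blast
  have "su2_antipode \<kappa> (cls \<kappa> (wF' \<kappa>)) = cls \<kappa> (lc 0 0 (mu \<kappa> * ?m / 2) (- (inverse (mu \<kappa>) * ?m / 2)) - wF' \<kappa>)"
    using mu0 by (simp add: wF'_def su2_antipode_lc lc_simps field_simps)
  with reduces_diff[OF r2 reduces_gens(4)] show "\<exists>X. su2_antipode \<kappa> (cls \<kappa> (wF' \<kappa>)) = cls \<kappa> X \<and> reduces \<kappa> (kC * (ga - gb) - gz) X" by blast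
qed

lemma su2_antipode_lattice:
  assumes "x \<in> lattice_carrier \<kappa>"
  shows "su2_antipode \<kappa> x \<in> lattice_carrier \<kappa>"
  using assms
proof (induction x rule: lattice_induct)
  case (gen x)
  then show ?case using reduces_antipode_gens by (cases x) (auto simp: reduces_def)
next
  case one
  then show ?case using alg_homD(2)[OF su2_antipode_hom[of \<kappa>]] by (simp add: lattice_closed)
next
  case (add x y)
  then show ?case using alg_homD(5)[OF su2_antipode_hom[of \<kappa>], of x y] by (simp add: latD lattice_closed)
next
  case (mult x y)
  then show ?case using alg_homD(4)[OF su2_antipode_hom[of \<kappa>], of x y] by (simp add: latD lattice_closed)
next
  case (smult c x)
  then show ?case using alg_homD(6)[OF su2_antipode_hom[of \<kappa>], of x "fps_to_fls c"] by (simp add: latD lattice_closed)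
qed

lemma contraction_antipode:
  "contraction_antipode \<in> alg_hom (contraction \<kappa>) (opposite (contraction \<kappa>))"
  "x \<in> lattice_carrier \<kappa> \<Longrightarrow> contraction_antipode (limit_class \<kappa> x) = limit_class \<kappa> (su2_antipode \<kappa> x)"
proof -
  note H = alg_homD(2)[OF su2_antipode_hom[of \<kappa>]] alg_homD(4-6)[OF su2_antipode_hom[of \<kappa>]]
  note M = su2_antipode_lattice
  have sm: "limit_class \<kappa> (fls_const c \<odot>\<^bsub>su2 \<kappa>\<^esub> y) = c \<odot>\<^bsub>contraction \<kappa>\<^esub> limit_class \<kappa> y"
    if "y \<in> lattice_carrier \<kappa>" for c y
    using limit_class_smult[OF that, of "fps_const c"] by simp
  have lin: "(\<lambda>x. limit_class \<kappa> (su2_antipode \<kappa> x)) \<in> alg_hom (latC \<kappa>) (opposite (contraction \<kappa>))"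
    by (intro alg_homI lin_mapI)
      (simp_all add: H M latD limit_class_simps sm limit_class_one)
  have null: "limit_class \<kappa> (su2_antipode \<kappa> (fls_X \<odot>\<^bsub>su2 \<kappa>\<^esub> z)) = \<zero>\<^bsub>opposite (contraction \<kappa>)\<^esub>" if "z \<in> lattice_carrier \<kappa>" for z
    using limit_class_h[OF M[OF that]] H(4)[OF latD[OF that], of fls_X] by simp
  note I = contraction_induced[OF assoc_algebra_opposite[OF E.is_assoc_algebra] alg_homD(1)[OF lin] null]
  show "contraction_antipode \<in> alg_hom (contraction \<kappa>) (opposite (contraction \<kappa>))"
    unfolding contraction_antipode_def by (rule I(3)[OF _ lin])
  show "x \<in> lattice_carrier \<kappa> \<Longrightarrow> contraction_antipode (limit_class \<kappa> x) = limit_class \<kappa> (su2_antipode \<kappa> x)"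
    unfolding contraction_antipode_def by (rule I(2))
qed

lemma contraction_antipode_induced: "induced_antipode \<kappa> contraction_antipode"
  unfolding induced_antipode_def using su2_antipode_lattice contraction_antipode(2) by blast

text \<open>Multiplying the commutation rule of a and w by a* from the left shows that w is a* w a
  plus (a - a* ) / (2\<kappa>); this brings the computed limit of S w into the form -a* w a, and
  similarly for w*.\<close>

lemma contraction_relations:
  "ga * gb - 1 \<in> ev_ker \<kappa>" "gb * ga - 1 \<in> ev_ker \<kappa>"
  "kC * (ga - gb) - gw + gb * gw * ga \<in> ev_ker \<kappa>"
  "kC * (ga - gb) - gz + ga * gz * gb \<in> ev_ker \<kappa>"
proof -
  note K = ev_ker_closed
  have r: "- (gb * gz - gz * gb) - kC * (gb * gb - 1) \<in> ev_ker \<kappa>" "ga * gw - gw * ga - kC * (ga * ga - 1) \<in> ev_ker \<kappa>"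
    "gb * ga - 1 \<in> ev_ker \<kappa>" "ga * gb - 1 \<in> ev_ker \<kappa>"
    using e2_relations_in_ker[of \<kappa>] unfolding e2_relations_def Let_def commutator_def free_algebra_simps a_minus_free a_inv_free
    by (simp_all only: insert_subset)
  then show ab: "ga * gb - 1 \<in> ev_ker \<kappa>" and ba: "gb * ga - 1 \<in> ev_ker \<kappa>" by simp_all
  have "kC * (ga - gb) - gw + gb * gw * ga =
      (gb * ga - 1) * gw - kC * ((gb * ga - 1) * ga) - gb * (ga * gw - gw * ga - kC * (ga * ga - 1))"
    by (simp add: algebra_simps cst_left_commute cst_commute)
  then show "kC * (ga - gb) - gw + gb * gw * ga \<in> ev_ker \<kappa>"
    using K(2)[OF K(2)[OF K(3)[OF ba, of gw] K(4)[OF K(3)[OF ba, of ga], of kC]] K(4)[OF r(2), of gb]] by simp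
  have "kC * (ga - gb) - gz + ga * gz * gb =
      ga * (- (gb * gz - gz * gb) - kC * (gb * gb - 1)) + (ga * gb - 1) * gz + kC * ((ga * gb - 1) * gb)"
    by (simp add: algebra_simps cst_left_commute cst_commute)
  then show "kC * (ga - gb) - gz + ga * gz * gb \<in> ev_ker \<kappa>"
    using K(1)[OF K(1)[OF K(4)[OF r(1), of ga] K(3)[OF ab, of gz]] K(4)[OF K(3)[OF ab, of gb], of kC]] by simp
qed

abbreviation eA where "eA \<equiv> e2_gen_value \<kappa> A0"
abbreviation eB where "eB \<equiv> e2_gen_value \<kappa> A0_star"
abbreviation eW where "eW \<equiv> e2_gen_value \<kappa> W0"
abbreviation eZ where "eZ \<equiv> e2_gen_value \<kappa> W0_star"

lemma ev_eqI: "f - g \<in> ev_ker \<kappa> \<Longrightarrow> ev \<kappa> f = ev \<kappa> g"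
  by (simp add: ev_ker_def ev_simps(3))

lemma e2_gen_inverse:
  "eA \<otimes>\<^bsub>contraction \<kappa>\<^esub> eB = \<one>\<^bsub>contraction \<kappa>\<^esub>" "eB \<otimes>\<^bsub>contraction \<kappa>\<^esub> eA = \<one>\<^bsub>contraction \<kappa>\<^esub>"
  using ev_eqI[OF contraction_relations(1)] ev_eqI[OF contraction_relations(2)] by (simp_all only: ev_simps)

lemma contraction_antipode_gens:
  "contraction_antipode eA = eB" "contraction_antipode eB = eA"
  "contraction_antipode eW = \<ominus>\<^bsub>contraction \<kappa>\<^esub> (eB \<otimes>\<^bsub>contraction \<kappa>\<^esub> eW \<otimes>\<^bsub>contraction \<kappa>\<^esub> eA)"
  "contraction_antipode eZ = \<ominus>\<^bsub>contraction \<kappa>\<^esub> (eA \<otimes>\<^bsub>contraction \<kappa>\<^esub> eZ \<otimes>\<^bsub>contraction \<kappa>\<^esub> eB)"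
proof -
  have S: "contraction_antipode (e2_gen_value \<kappa> x) = ev \<kappa> f"
    if "\<exists>X. su2_antipode \<kappa> (cls \<kappa> (e2F \<kappa> x)) = cls \<kappa> X \<and> reduces \<kappa> f X" for x f
    using that contraction_antipode(2)[OF lattice_sub(3)] by (auto simp only: e2_gen_value_eq reduces_def)
  note R = reduces_antipode_gens
  show "contraction_antipode eA = eB" "contraction_antipode eB = eA"
    using S[of A0] S[of A0_star] R(1,2) by (simp_all only: e2F_simps ev_simps)
  have "ev \<kappa> (kC * (ga - gb) - gw) = ev \<kappa> (- (gb * gw * ga))"
    by (rule ev_eqI) (use contraction_relations(3) in simp)
  then show "contraction_antipode eW = \<ominus>\<^bsub>contraction \<kappa>\<^esub> (eB \<otimes>\<^bsub>contraction \<kappa>\<^esub> eW \<otimes>\<^bsub>contraction \<kappa>\<^esub> eA)"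
    using S[of W0] R(3) by (simp only: e2F_simps) (simp only: ev_simps)
  have "ev \<kappa> (kC * (ga - gb) - gz) = ev \<kappa> (- (ga * gz * gb))"
    by (rule ev_eqI) (use contraction_relations(4) in simp)
  then show "contraction_antipode eZ = \<ominus>\<^bsub>contraction \<kappa>\<^esub> (eA \<otimes>\<^bsub>contraction \<kappa>\<^esub> eZ \<otimes>\<^bsub>contraction \<kappa>\<^esub> eB)"
    using S[of W0_star] R(4) by (simp only: e2F_simps) (simp only: ev_simps)
qed

section \<open>The Hopf algebra axioms on the generators of the limit\<close>

lemma contraction_hopf: "hopf_algebra (contraction \<kappa>) (contraction_coproduct \<kappa>) contraction_counit contraction_antipode"
proof -
  interpret ET: tensor_product "contraction \<kappa>" "contraction \<kappa>" by (rule tensor_product_E)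
  interpret L: tensor_product "E2T \<kappa>" "contraction \<kappa>" by (intro tensor_product.intro ET.assoc_algebra_T E.is_assoc_algebra)
  interpret R: tensor_product "contraction \<kappa>" "E2T \<kappa>" by (intro tensor_product.intro ET.assoc_algebra_T E.is_assoc_algebra)
  let ?E = "contraction \<kappa>" and ?\<Delta> = "contraction_coproduct \<kappa>"
  have cl: "eA \<in> carrier ?E" "eB \<in> carrier ?E" "eW \<in> carrier ?E" "eZ \<in> carrier ?E" by (rule e2_gen_value_closed)+
  note EA = E.is_assoc_algebra[of \<kappa>]
  note \<Delta> = contraction_coproduct(1)[of \<kappa>] and G = contraction_coproduct_gens[of \<kappa>]
  note m1 = tensor_map_hom[OF EA EA ET.assoc_algebra_T EA \<Delta> alg_hom_id]
  note m2 = tensor_map_hom[OF EA EA EA ET.assoc_algebra_T alg_hom_id \<Delta>]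
  note as = tensor_assoc_hom[OF EA EA EA]
  note cu = tensor_counit_hom[OF EA contraction_counit(1)]
  note an = tensor_antipode[OF EA contraction_antipode(1)]
  note simps = cl G contraction_counit_gens contraction_antipode_gens e2_gen_inverse
  show ?thesis
  proof (rule hopf_algebra_generated[OF EA e2_gen_value_closed _ \<Delta> contraction_counit(1) contraction_antipode(1)])
    show "\<exists>p. X = ev \<kappa> p" if "X \<in> carrier ?E" for X using ev_surj[OF that] by blast
    show "tensor_assoc ?E ?E ?E (tensor_map (E2T \<kappa>) ?E ?\<Delta> (\<lambda>y. y) (?\<Delta> (e2_gen_value \<kappa> x))) =
        tensor_map ?E (E2T \<kappa>) (\<lambda>y. y) ?\<Delta> (?\<Delta> (e2_gen_value \<kappa> x))" for x
      by (cases x) (simp_all add: simps m1(2) m2(2) as(2) alg_homD(5)[OF m1(1)] alg_homD(5)[OF m2(1)] alg_homD(5)[OF as(1)]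
        L.pure_add_left R.pure_add_right R.T.a_assoc del: e2_gen_value.simps)
    show "tensor_lift ?E (\<lambda>y z. contraction_counit y \<odot>\<^bsub>?E\<^esub> z) (?\<Delta> (e2_gen_value \<kappa> x)) = e2_gen_value \<kappa> x" for x
      by (cases x) (simp_all add: simps cu alg_homD(5)[OF cu(1)] del: e2_gen_value.simps)
    show "tensor_lift ?E (\<lambda>y z. contraction_counit z \<odot>\<^bsub>?E\<^esub> y) (?\<Delta> (e2_gen_value \<kappa> x)) = e2_gen_value \<kappa> x" for x
      by (cases x) (simp_all add: simps cu alg_homD(5)[OF cu(2)] del: e2_gen_value.simps)
    have inv: "eA \<otimes>\<^bsub>?E\<^esub> (eB \<otimes>\<^bsub>?E\<^esub> X) = X" "eB \<otimes>\<^bsub>?E\<^esub> (eA \<otimes>\<^bsub>?E\<^esub> X) = X" if "X \<in> carrier ?E" for X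
      using that cl E.m_assoc[of eA \<kappa> eB X] E.m_assoc[of eB \<kappa> eA X] by (simp_all add: e2_gen_inverse del: e2_gen_value.simps)
    show "tensor_lift ?E (\<lambda>y z. contraction_antipode y \<otimes>\<^bsub>?E\<^esub> z) (?\<Delta> (e2_gen_value \<kappa> x)) = contraction_counit (e2_gen_value \<kappa> x) \<odot>\<^bsub>?E\<^esub> \<one>\<^bsub>?E\<^esub>" for x
      by (cases x) (simp_all add: simps an(3) lin_mapD(2)[OF an(1)] E.l_minus E.m_assoc E.l_neg inv del: e2_gen_value.simps)
    show "tensor_lift ?E (\<lambda>y z. y \<otimes>\<^bsub>?E\<^esub> contraction_antipode z) (?\<Delta> (e2_gen_value \<kappa> x)) = contraction_counit (e2_gen_value \<kappa> x) \<odot>\<^bsub>?E\<^esub> \<one>\<^bsub>?E\<^esub>" for x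
      by (cases x) (simp_all add: simps an(4) lin_mapD(2)[OF an(2)] E.r_minus E.m_assoc E.r_neg inv del: e2_gen_value.simps)
  qed
qed

end

theorem theorem1:
  fixes \<kappa> :: real
  assumes "\<kappa> \<noteq> 0"
  shows "let E = contraction \<kappa>; tens = pure_tensor E E;
             a = limit_class \<kappa> (su2_a \<kappa>); a' = limit_class \<kappa> (su2_star (su2_a \<kappa>));
             w = limit_class \<kappa> (su2_w \<kappa>); w' = limit_class \<kappa> (su2_star (su2_w \<kappa>))
         in \<exists>\<Delta> \<epsilon> S.
           induced_coproduct \<kappa> \<Delta> \<and> induced_counit \<kappa> \<epsilon> \<and> induced_antipode \<kappa> S \<and>
           hopf_algebra E \<Delta> \<epsilon> S \<and>
           presented_by E (e2_gen_value \<kappa>) (e2_relations \<kappa>) \<and>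
           \<Delta> a = tens a a \<and> \<Delta> a' = tens a' a' \<and>
           \<Delta> w = tens w a' \<oplus>\<^bsub>tensor E E\<^esub> tens a w \<and>
           \<Delta> w' = tens w' a \<oplus>\<^bsub>tensor E E\<^esub> tens a' w' \<and>
           S a = a' \<and> S a' = a \<and>
           S w = \<ominus>\<^bsub>E\<^esub> (a' \<otimes>\<^bsub>E\<^esub> w \<otimes>\<^bsub>E\<^esub> a) \<and>
           S w' = \<ominus>\<^bsub>E\<^esub> (a \<otimes>\<^bsub>E\<^esub> w' \<otimes>\<^bsub>E\<^esub> a') \<and>
           \<epsilon> a = 1 \<and> \<epsilon> a' = 1 \<and> \<epsilon> w = 0 \<and> \<epsilon> w' = 0"
  unfolding Let_def e2_gen_value.simps[symmetric]
  by (intro exI[of _ "contraction_coproduct \<kappa>"] exI[of _ "contraction_counit \<kappa>"] exI[of _ "contraction_antipode \<kappa>"] conjI contraction_coproduct_induced contraction_counit_induced contraction_antipode_induced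
      contraction_hopf contraction_presented contraction_coproduct_gens contraction_antipode_gens contraction_counit_gens)

end
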